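(* Let $N\ge 3$, let $f\in C^2[0,\infty)$ with $f>0$ on $[0,\infty)$, and assume $$F(u):=\int_u^\infty\frac{ds}{f(s)}<\infty,\qquad q:=\lim_{u\to\infty}\frac{f'(u)^2}{f(u)f''(u)}<\frac{N+2}{4}\ \text{ (the limit exists)},$$ and, for some $0<k\le 2$ and $\gamma\in\mathbb{R}$, $$\bigl(F(u)f'(u)-q_{\mathrm{JL}}\bigr)(-\log F(u))^k\to\gamma\quad\text{as }u\to\infty,\qquad q_{\mathrm{JL}}:=\frac{N-2\sqrt{N-1}}{4}.$$ Then the problem $-\Delta u=\lambda f(u)$ in $B_1$, $u>0$ in $B_1$, $u=0$ on $\partial B_1$ has a unique radial singular solution $(\lambda_*,U_* )$. Moreover, $U_*\in H^1_0(B_1)$, $$\lambda(\alpha)\to\lambda_*\quad\text{and}\quad u(r,\alpha)\to U_*\ \text{ in } C^2_{\mathrm{loc}}(0,1]\quad\text{as }\alpha\to\infty,$$ $$\lambda_* f'(U_*(r))=\frac{(N-2)^2}{4r^2}+\frac{\gamma\sqrt{N-1}+o(1)}{2^{k-2}r^2(-\log r)^k}\quad\text{as } r\to 0,$$ and (i) $m(U_* )=\infty$ if either $0<k<2$ and $\gamma>0$, or $k=2$ and $\gamma>\frac{1}{4\sqrt{N-1}}$; (ii) $m(U_* )<\infty$ if either $0<k<2$ and $\gamma<0$, or $k=2$ and $\gamma<\frac{1}{4\sqrt{N-1}}$.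
   Context: $B_1\subset\mathbb{R}^N$ is the unit ball. For $f\in C^2[0,\infty)$, $f>0$, it is known that every (regular) solution of $-\Delta u=\lambda f(u)$ in $B_1$, $u>0$ in $B_1$, $u=0$ on $\partial B_1$ ($\lambda>0$) is radially symmetric and decreasing, and that the set of all solutions is an unbounded $C^2$ curve $\{(\lambda(\alpha),u(r,\alpha)):\alpha>0\}$ with $\|u(\cdot,\alpha)\|_{L^\infty(B_1)}=u(0,\alpha)=\alpha$. $(\lambda_*,U_* )$ is a radial singular solution if $U_*=U_*(r)\in C^2(0,1]$ (with $r=|x|$) is a regular (classical) solution of the problem in $(0,1]$ with $\lambda=\lambda_*>0$ (i.e. it satisfies the equation for $0<r<1$, is positive for $0<r<1$, and vanishes at $r=1$), and $U_*(r)\to\infty$ as $r\to 0$. For a solution $(\lambda,u)$ (regular or singular), the Morse index $m(u)$ is the maximal dimension of a subspace $X\subset C^1_{\mathrm{c}}(B_1)$ such that $$Q_u(\xi):=\int_{B_1}\left(|\nabla\xi|^2-\lambda f'(u)\xi^2\right)dx<0\quad\text{for all }\xi\in X\setminus\{0\}$$ ($m(u)=\infty$ if there are such subspaces of arbitrarily large dimension). *)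

theory Defs
  imports "HOL-Analysis.Analysis" "HOL-Library.Extended_Nat" "HOL-Library.Function_Algebras"
begin

section \<open>Functions of one real variable\<close>

text \<open>Derivatives are taken within \<open>S\<close>, so they are one-sided at end points belonging to \<open>S\<close>
  (\<open>0\<close> for \<open>S = {0..}\<close>, \<open>1\<close> for \<open>S = {0<..1}\<close>) and do not depend on values outside \<open>S\<close>.\<close>

definition deriv_on :: "real set \<Rightarrow> (real \<Rightarrow> real) \<Rightarrow> real \<Rightarrow> real" where
  "deriv_on S g x = vector_derivative g (at x within S)"

definition C2_on :: "real set \<Rightarrow> (real \<Rightarrow> real) \<Rightarrow> bool" where
  "C2_on S g \<longleftrightarrow>
     (\<forall>x\<in>S. g differentiable (at x within S)) \<and>
     (\<forall>x\<in>S. deriv_on S g differentiable (at x within S)) \<and>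
     continuous_on S (deriv_on S (deriv_on S g))"

definition C2_loc_convergent ::
    "real set \<Rightarrow> (real \<Rightarrow> real \<Rightarrow> real) \<Rightarrow> (real \<Rightarrow> real) \<Rightarrow> real filter \<Rightarrow> bool" where
  "C2_loc_convergent S g h A \<longleftrightarrow>
     (\<forall>\<^sub>F a in A. C2_on S (g a)) \<and> C2_on S h \<and>
     (\<forall>K. compact K \<and> K \<subseteq> S \<longrightarrow>
        uniform_limit K g h A \<and>
        uniform_limit K (\<lambda>a. deriv_on S (g a)) (deriv_on S h) A \<and>
        uniform_limit K (\<lambda>a. deriv_on S (deriv_on S (g a))) (deriv_on S (deriv_on S h)) A)"

definition F_tail :: "(real \<Rightarrow> real) \<Rightarrow> real \<Rightarrow> real" where
  "F_tail f u = (LINT s:{u..}|lebesgue. 1 / f s)"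

definition q_JL :: "nat \<Rightarrow> real" where
  "q_JL N = (real N - 2 * sqrt (real N - 1)) / 4"


section \<open>Functions on Euclidean space\<close>

definition pderiv_dir :: "'a::euclidean_space \<Rightarrow> ('a \<Rightarrow> real) \<Rightarrow> 'a \<Rightarrow> real" where
  "pderiv_dir i u x = frechet_derivative u (at x) i"

text \<open>Meant for open \<open>S\<close>.\<close>

fun Ck_on :: "nat \<Rightarrow> 'a::euclidean_space set \<Rightarrow> ('a \<Rightarrow> real) \<Rightarrow> bool" where
  "Ck_on 0 S u \<longleftrightarrow> continuous_on S u"
| "Ck_on (Suc k) S u \<longleftrightarrow>
     (\<forall>x\<in>S. u differentiable (at x)) \<and> (\<forall>i\<in>Basis. Ck_on k S (pderiv_dir i u))"

definition grad :: "('a::euclidean_space \<Rightarrow> real) \<Rightarrow> 'a \<Rightarrow> 'a" where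
  "grad u x = (\<Sum>i\<in>Basis. pderiv_dir i u x *\<^sub>R i)"

definition laplacian :: "('a::euclidean_space \<Rightarrow> real) \<Rightarrow> 'a \<Rightarrow> real" where
  "laplacian u x = (\<Sum>i\<in>Basis. pderiv_dir i (pderiv_dir i u) x)"

text \<open>Elements of \<open>C\<^sup>1\<^sub>c(\<Omega>)\<close> are represented by their extensions by zero to the whole space.\<close>

definition C1c :: "'a::euclidean_space set \<Rightarrow> ('a \<Rightarrow> real) set" where
  "C1c \<Omega> = {\<xi>. Ck_on 1 UNIV \<xi> \<and> compact (closure {x. \<xi> x \<noteq> 0}) \<and> closure {x. \<xi> x \<noteq> 0} \<subseteq> \<Omega>}"

definition L2_on :: "'a::euclidean_space set \<Rightarrow> ('a \<Rightarrow> 'b::euclidean_space) \<Rightarrow> bool" where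
  "L2_on \<Omega> g \<longleftrightarrow> set_borel_measurable lebesgue \<Omega> g \<and> set_integrable lebesgue \<Omega> (\<lambda>x. (norm (g x))\<^sup>2)"

definition weak_gradient :: "'a::euclidean_space set \<Rightarrow> ('a \<Rightarrow> real) \<Rightarrow> ('a \<Rightarrow> 'a) \<Rightarrow> bool" where
  "weak_gradient \<Omega> u G \<longleftrightarrow>
     (\<forall>\<phi>\<in>C1c \<Omega>. \<forall>i\<in>Basis.
        (LINT x:\<Omega>|lebesgue. u x * pderiv_dir i \<phi> x) = - (LINT x:\<Omega>|lebesgue. (G x \<bullet> i) * \<phi> x))"

text \<open>\<open>H\<^sup>1\<^sub>0(\<Omega>)\<close> is the closure of \<open>C\<^sup>1\<^sub>c(\<Omega>)\<close> in \<open>H\<^sup>1(\<Omega>)\<close> (the definition used by Brezis).\<close>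

definition H10 :: "'a::euclidean_space set \<Rightarrow> ('a \<Rightarrow> real) set" where
  "H10 \<Omega> = {u. \<exists>G \<phi>. L2_on \<Omega> u \<and> L2_on \<Omega> G \<and> weak_gradient \<Omega> u G \<and>
     (\<forall>n::nat. \<phi> n \<in> C1c \<Omega>) \<and>
     (\<lambda>n. LINT x:\<Omega>|lebesgue. (\<phi> n x - u x)\<^sup>2) \<longlonglongrightarrow> 0 \<and>
     (\<lambda>n. LINT x:\<Omega>|lebesgue. (norm (grad (\<phi> n) x - G x))\<^sup>2) \<longlonglongrightarrow> 0}"


section \<open>Solutions of the Dirichlet problem in the unit ball\<close>

definition regular_solution ::
    "(real \<Rightarrow> real) \<Rightarrow> real \<Rightarrow> ('a::euclidean_space \<Rightarrow> real) \<Rightarrow> bool" where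
  "regular_solution f l u \<longleftrightarrow> l > 0 \<and>
     Ck_on 2 (ball 0 1) u \<and> continuous_on (cball 0 1) u \<and>
     (\<forall>x\<in>ball 0 1. - laplacian u x = l * f (u x)) \<and>
     (\<forall>x\<in>ball 0 1. u x > 0) \<and> (\<forall>x\<in>sphere 0 1. u x = 0)"

text \<open>Radial functions are given by their profiles. As a profile does not determine the ambient
  space \<open>\<real>\<^sup>N\<close>, the latter is passed as a type argument.\<close>

definition radial :: "(real \<Rightarrow> real) \<Rightarrow> 'a::euclidean_space \<Rightarrow> real" where
  "radial U x = U (norm x)"

text \<open>The parametrisation of the solution set by \<open>\<alpha> = u(0,\<alpha>)\<close>, which determines
  \<open>\<lambda>(\<alpha>)\<close> and \<open>u(\<cdot>,\<alpha>)\<close> on \<open>[0,1]\<close> uniquely.\<close>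

definition solution_curve ::
    "'a::euclidean_space itself \<Rightarrow> (real \<Rightarrow> real) \<Rightarrow> (real \<Rightarrow> real) \<Rightarrow> (real \<Rightarrow> real \<Rightarrow> real) \<Rightarrow> bool" where
  "solution_curve _ f lam u \<longleftrightarrow>
     (\<forall>\<alpha>>0. regular_solution f (lam \<alpha>) (radial (u \<alpha>) :: 'a \<Rightarrow> real) \<and> u \<alpha> 0 = \<alpha>)"

definition radial_singular_solution ::
    "'a::euclidean_space itself \<Rightarrow> (real \<Rightarrow> real) \<Rightarrow> real \<Rightarrow> (real \<Rightarrow> real) \<Rightarrow> bool" where
  "radial_singular_solution _ f l U \<longleftrightarrow> l > 0 \<and>
     C2_on {0<..1} U \<and>
     (\<forall>x::'a. 0 < norm x \<and> norm x < 1 \<longrightarrow> - laplacian (radial U) x = l * f (radial U x)) \<and>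
     (\<forall>r. 0 < r \<and> r < 1 \<longrightarrow> U r > 0) \<and> U 1 = 0 \<and>
     filterlim U at_top (at_right 0)"


section \<open>Morse index\<close>

global_interpretation fun_space: vector_space "\<lambda>c (\<xi>::'a \<Rightarrow> real) x. c * \<xi> x"
  by unfold_locales (auto simp: fun_eq_iff algebra_simps)

definition Q_form ::
    "(real \<Rightarrow> real) \<Rightarrow> real \<Rightarrow> ('a::euclidean_space \<Rightarrow> real) \<Rightarrow> ('a \<Rightarrow> real) \<Rightarrow> real" where
  "Q_form f l u \<xi> =
     (LINT x:ball 0 1|lebesgue. (norm (grad \<xi> x))\<^sup>2 - l * deriv_on {0..} f (u x) * (\<xi> x)\<^sup>2)"

text \<open>Only finite-dimensional \<open>X\<close> need to be considered: an infinite-dimensional one contains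
  subspaces of every finite dimension.\<close>

definition morse_index ::
    "(real \<Rightarrow> real) \<Rightarrow> real \<Rightarrow> ('a::euclidean_space \<Rightarrow> real) \<Rightarrow> enat" where
  "morse_index f l u = Sup {enat n |n. \<exists>X B. fun_space.subspace X \<and> X \<subseteq> C1c (ball 0 1) \<and>
     finite B \<and> fun_space.independent B \<and> fun_space.span B = X \<and> card B = n \<and>
     (\<forall>\<xi>\<in>X - {0}. Q_form f l u \<xi> < 0)}"

end

theory Submission imports Defs begin

text \<open>In the variables \<open>t = ln s\<close>, \<open>y = s\<^sup>2 / F(u)\<close>, \<open>z = - s u' / (f(u) F(u))\<close> the radial equation becomes an
  autonomous quadratic system with the equilibrium \<open>(\<mu>\<^sup>2, 2)\<close>, \<open>\<mu> = 1 + sqrt (N - 1)\<close>, perturbed by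
  \<open>h = F f' - q\<^sub>J\<^sub>L\<close>, which is small for large \<open>u\<close>. At the critical exponent both eigenvalues are \<open>- \<mu>\<close>. Singular solutions
  are the orbits converging to the equilibrium as \<open>t\<close> tends to minus infinity. A contraction argument gives existence, and
  the difference of two orbits near the equilibrium decays forward in time, which gives uniqueness and, applied to a regular orbit that
  started early, convergence of regular solutions. The same Lyapunov function yields \<open>ln \<mu>\<^sup>2 - ln y \<sim> 4 h / \<mu>\<^sup>2\<close>, hence the
  expansion of \<open>f'(U)\<close>. The Morse index is then decided by the Hardy inequality with the sharp logarithmic
  remainder \<open>1 / (4 r\<^sup>2 (1 - ln r)\<^sup>2)\<close>.\<close>

text \<open>A dilation removes the parameter: profiles are studied with parameter 1 up to their
  first zero R, and R^2 is the parameter of the rescaled solution in the unit ball. Backwards in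
  time an orbit with bounded \<open>y\<close> can come from the equilibrium or from the origin of
  the phase plane, where the regular solutions start. The quantity that separates the two cases is
  ln w = 2*t - ln y = ln F(u), with derivative \<open>z\<close>: below the level y = mu^2/2 it
  drifts only by a bounded amount. Hence a singular orbit, on which ln w comes from minus infinity,
  never visits that region, and a regular orbit leaves it at a time that tends to minus infinity as
  u(0) grows. Along an orbit \<open>h\<close> is a function \<open>H\<close> of ln w. It is not
  enough that \<open>H\<close> tends to 0: the contraction and the comparison of two orbits need a
  small Lipschitz constant, and the existence of the limit q is what makes the derivative of
  \<open>H\<close> tend to 0. The constants of the phase-plane bounds depend on \<open>mu\<close>
  only, so they hold uniformly along the curve of regular solutions.\<close>

notation tendsto (infixr "--->" 55) and has_real_derivative (infix "hasD" 50)

section \<open>Differential inequalities\<close>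

lemma DERIV_max_zero_square:
 "((%x. (max x 0)^2) hasD 2*max x 0) (at (x::real))"
proof -
 consider "x > 0" | "x < 0" | "x = 0" by linarith
 then show ?thesis
 proof cases
  case 1
  have "((%x. x^2) hasD 2*x) (at x)" by (auto intro!: derivative_eq_intros)
  moreover have "\<forall>\<^sub>F y in nhds x. y^2 = (max y 0)^2"
   using eventually_nhds_in_open[of "{0<..}" x] 1 by (auto elim!: eventually_mono simp: max_def)
  ultimately show ?thesis using 1 by (simp add: DERIV_cong_ev max_def)
 next
  case 2
  have "((%x. 0) hasD 0) (at x)" by simp
  moreover have "\<forall>\<^sub>F y in nhds x. 0 = (max y 0)^2"
   using eventually_nhds_in_open[of "{..<0}" x] 2 by (auto elim!: eventually_mono simp: max_def)
  ultimately have "((%x. (max x 0)^2) hasD 0) (at x)"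
   using DERIV_cong_ev[of x x "%x. 0" "%x. (max x 0)^2" 0 0] by simp
  then show ?thesis using 2 by (simp add: max_def)
 next
  case 3
  have "abs ((max h 0)^2/h) <= abs h" for h :: real
   by (auto simp: max_def power2_eq_square)
  then have "\<forall>\<^sub>F h in at (0::real). norm ((max h 0)^2/h) <= abs h"
   by (simp only: real_norm_def) (rule always_eventually, blast)
  then have "((%h. (max h 0)^2/h) ---> 0) (at (0::real))"
   by (rule Lim_null_comparison) (rule tendsto_rabs_zero[OF tendsto_ident_at])
  then show ?thesis using 3 by (simp add: DERIV_def)
 qed
qed

text \<open>Gronwall: \<open>exp (- c*t)*m t\<close> is nonincreasing. The derivatives are one-sided
  at the end points, so that the lemma also serves solutions known only on a closed
  interval.\<close>

lemma DERIV_le_growth: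
 fixes m :: "real => real"
 assumes "a <= b" and d: "!!t. a <= t ==> t <= b ==> (m hasD m' t) (at t within {a..b})"
  and le: "!!t. a <= t ==> t <= b ==> m' t <= c*m t"
 shows "m b <= m a*exp (c*(b - a))"
proof -
 define P where "P t = exp (- c*t)*m t" for t
 have dP: "(P hasD exp (- c*t)*(m' t - c*m t)) (at t within {a..b})"
  if "a <= t" "t <= b" for t
  unfolding P_def using that
  by (auto intro!: derivative_eq_intros d simp: algebra_simps)
 have "P b <= P a"
 proof (rule DERIV_nonpos_imp_decreasing_open[OF \<open>a <= b\<close>])
  fix t assume t: "a < t" "t < b"
  then have "(P hasD exp (- c*t)*(m' t - c*m t)) (at t)"
   using dP[of t] by (metis at_within_Icc_at less_imp_le)
  moreover have "exp (- c*t)*(m' t - c*m t) <= 0"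
   using le[of t] t by (simp add: mult_le_0_iff)
  ultimately show "EX y. (P hasD y) (at t) & y <= 0" by blast
 next
  show "continuous_on {a..b} P"
   using dP by (meson atLeastAtMost_iff continuous_on_eq_continuous_within DERIV_continuous)
 qed
 then have "exp (c*b)*P b <= exp (c*b)*P a" by simp
 then show ?thesis
  unfolding P_def by (simp add: exp_minus exp_diff field_simps right_diff_distrib exp_add)
qed

text \<open>Apply \<open>DERIV_le_growth\<close> from \<open>s\<close> to \<open>t\<close> and let
  \<open>s\<close> tend to minus infinity: the factor \<open>exp (- c*(t - s))\<close> kills any
  bounded starting value. Boundedness in the past thus takes the place of an initial
  condition.\<close>

lemma DERIV_decay_imp_nonpos:
 fixes m :: "real => real"
 assumes "c > 0" and d: "!!t. t < T ==> (m hasD m' t) (at t)"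
  and le: "!!t. t < T ==> m' t <= - c*m t" and bd: "!!t. t < T ==> m t <= K"
  and "t < T"
 shows "m t <= 0"
proof -
 have "m t <= abs K*exp (- c*(t - s))" if "s < t" for s
 proof -
  have "m t <= m s*exp (- c*(t - s))"
  proof (rule DERIV_le_growth)
   show "s <= t" using that by simp
   show "(m hasD m' r) (at r within {s..t})" if "s <= r" "r <= t" for r
    using that \<open>t < T\<close> by (simp add: has_field_derivative_at_within[OF d])
  qed (use \<open>t < T\<close> le in auto)
  also have "... <= abs K*exp (- c*(t - s))"
   using bd[of s] that \<open>t < T\<close> by (intro mult_right_mono) auto
  finally show ?thesis .
 qed
 then have ev: "\<forall>\<^sub>F s in at_bot. m t <= abs K*exp (- c*(t - s))"
  using eventually_at_bot_dense by blast
 have "filterlim (%s. - c*(t - s)) at_bot at_bot"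
 proof -
  have "filterlim (%s. - (c*t) + c * s) at_bot at_bot"
   using \<open>c > 0\<close> by real_asymp
  then show ?thesis by (simp add: algebra_simps)
 qed
 then have "((%s. abs K*exp (- c*(t - s))) ---> abs K*0) at_bot"
  by (intro tendsto_mult tendsto_const filterlim_compose[OF exp_at_bot])
 then show ?thesis
  using ev tendsto_lowerbound trivial_limit_at_bot_linorder by (metis mult_zero_right)
qed

text \<open>The square of the positive part stays differentiable, so no case distinction on the sign of
 \<open>p\<close> is needed.\<close>

lemma DERIV_decay_positive_part:
 fixes p :: "real => real"
 assumes "c > 0" and d: "!!t. t < T ==> (p hasD p' t) (at t)"
  and le: "!!t. t < T ==> p t > 0 ==> p' t <= - c*p t" and bd: "!!t. t < T ==> p t <= K"
  and "t < T"
 shows "p t <= 0"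
proof -
 have "(max (p t) 0)^2 <= 0"
 proof (rule DERIV_decay_imp_nonpos[where m = "%t. (max (p t) 0)^2" and T = T and c = "2*c" and K = "(max K 0)^2"
    and m' = "%t. 2*max (p t) 0*p' t"])
  fix t assume t: "t < T"
  show "((%t. (max (p t) 0)^2) hasD 2*max (p t) 0*p' t) (at t)"
   using DERIV_chain2[OF DERIV_max_zero_square d[OF t]] by simp
  show "2*max (p t) 0*p' t <= - (2*c)*(max (p t) 0)^2"
   using le[OF t] mult_left_mono[OF le[OF t], of "2*p t"]
   by (auto simp: max_def power2_eq_square algebra_simps)
  show "(max (p t) 0)^2 <= (max K 0)^2"
   using bd[OF t] by (intro power_mono) auto
 qed (use assms in auto)
 then show ?thesis by (auto simp: max_def split: if_splits)
qed

text \<open>At the last time \<open>s\<close> with \<open>p s <= c\<close> the value is exactly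
  \<open>c\<close> by continuity, and there the strict sign of the derivative pushes
  \<open>p\<close> below \<open>c\<close> again, so \<open>s\<close> was not the last.\<close>

lemma DERIV_barrier_le:
 fixes p :: "real => real"
 assumes "a <= b" and d: "!!t. a <= t ==> t <= b ==> (p hasD p' t) (at t)"
  and neg: "!!t. a <= t ==> t < b ==> p t = c ==> p' t < 0" and "p a <= c"
 shows "p b <= c"
proof (rule ccontr)
 assume gt: "~ p b <= c"
 have cont: "continuous_on {a..b} p"
  using d by (meson atLeastAtMost_iff continuous_at_imp_continuous_on DERIV_isCont)
 define S where "S = {t \<in> {a..b}. p t <= c}"
 have "compact S"
 proof -
  have "closed S" unfolding S_def
   using continuous_closed_preimage[OF cont closed_atLeastAtMost, of "{..c}"]
   by (auto simp: vimage_def Int_def)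
  then show ?thesis unfolding S_def
   by (metis (no_types, lifting) bounded_closed_interval bounded_subset compact_eq_bounded_closed mem_Collect_eq subsetI)
 qed
 moreover have "S ~= {}" using assms by (auto simp: S_def)
 ultimately obtain s where s: "s \<in> S" "!!t. t \<in> S ==> t <= s"
  using compact_attains_sup by metis
 then have sb: "a <= s" "s < b" "p s <= c"
  using gt by (auto simp: S_def order_less_le)
 have after: "p t > c" if "s < t" "t <= b" for t
  using s(2)[of t] that sb by (force simp: S_def)
 have "p s = c"
 proof (rule ccontr)
  assume "p s ~= c"
  then have "p s < c" using sb by simp
  then obtain t where t: "s <= t" "t <= b" "p t = c"
   using IVT'[of p s c b] gt sb cont continuous_on_subset[OF cont, of "{s..b}"] by force
  then show False using after[of t] \<open>p s < c\<close> by (cases "s = t") auto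
 qed
 moreover obtain e where "e > 0" "!!h. h > 0 ==> h < e ==> p (s + h) < p s"
  using DERIV_neg_dec_right[OF d neg] sb \<open>p s = c\<close> by (metis less_imp_le)
 moreover define h where "h = min (e/2) (b - s)"
 ultimately have "p (s + h) < c" "s < s + h" "s + h <= b" using sb by (auto simp: h_def min_def)
 then show False using after by fastforce
qed

section \<open>The Emden system near its equilibrium\<close>

text \<open>With N = mu^2 - 2*mu + 2 the coefficients are mu*(mu - 4)/4 = q_JL - 1 and mu*(mu - 2) =
  N - 2. The perturbation \<open>h\<close> is a given function of time, although along a solution it
  depends on \<open>y\<close>; the a priori bounds then involve only its size.\<close>

definition emden_orbit :: "real => (real => real) => real => (real => real) => (real => real) => bool" where
 "emden_orbit mu h T y z \<longleftrightarrow> (ALL t<T. y t > 0 & z t > 0 &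
  (y hasD y t*(2 - z t)) (at t) &
  (z hasD (mu*(mu - 4)/4 + h t)*(z t)^2 - mu*(mu - 2)*z t + y t) (at t))"

lemma emden_orbitD:
 assumes "emden_orbit mu h T y z" "t < T"
 shows "y t > 0" "z t > 0" "(y hasD y t*(2 - z t)) (at t)"
  "(z hasD (mu*(mu - 4)/4 + h t)*(z t)^2 - mu*(mu - 2)*z t + y t) (at t)"
 using assms by (auto simp: emden_orbit_def)

lemma square_le_shift: "(z::real)^2 <= 2*(z - 2)^2 + 8"
proof -
 have "2*(z - 2)^2 + 8 - z^2 = (z - 4)^2" by (simp add: power2_eq_square algebra_simps)
 then show ?thesis by (metis diff_ge_0_iff_ge zero_le_power2)
qed

text \<open>The line z - 2 = y/mu - mu passes through the equilibrium in the eigendirection of the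
  linearization. The deviation v = z - 2 + mu - y/mu satisfies v' = - (mu - 2 + z)*v + q*(z - 2)^2 +
  h*z^2 with q = (mu - 2)^2/4; the square has the favourable sign, so \<open>v\<close> can be
  negative only by a multiple of \<open>et\<close>.\<close>

lemma emden_lower_line:
 assumes mu: "mu > 2" and orb: "emden_orbit mu h T y z" and h: "!!t. t < T ==> abs (h t) <= et"
  and eta: "2*et <= (mu - 2)^2/4" and bd: "!!t. t < T ==> y t <= K" and t: "t < T"
 shows "z t - 2 >= y t/mu - mu - 8/(mu - 2)*et"
proof -
 define C where "C = 8/(mu - 2)"
 define p where "p t = - (z t - 2 + mu - y t/mu + C*et)" for t
 define q where "q = (mu - 2)^2/4"
 have eta0: "et >= 0" using h[OF t] by linarith
 have "mu - 2 ~= 0" "C > 0" using mu by (auto simp: C_def)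
 moreover then have "C*(mu - 2) = 8" using nonzero_eq_divide_eq[of "mu - 2" C 8] C_def by blast
 ultimately have C: "C > 0" "C*(mu - 2) = 8" by blast+
 note o = emden_orbitD[OF orb]
 let ?z' = "%t. (mu*(mu - 4)/4 + h t)*(z t)^2 - mu*(mu - 2)*z t + y t"
 have "p t <= 0"
 proof (rule DERIV_decay_positive_part[where p = p and T = T and c = "mu - 2" and K = "K/mu"
    and p' = "%t. - (?z' t - y t*(2 - z t)/mu)"])
  fix t assume t: "t < T"
  show "(p hasD - (?z' t - y t*(2 - z t)/mu)) (at t)"
   unfolding p_def using o[OF t] mu by (auto intro!: derivative_eq_intros)
  have id: "?z' t - y t*(2 - z t)/mu =
    - (mu - 2 + z t)*(z t - 2 + mu - y t/mu) + q*(z t - 2)^2 + h t*(z t)^2"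
   using mu by (simp add: q_def power2_eq_square field_simps)
  have "h t*(z t)^2 >= - et*(z t)^2" using h[OF t] by (intro mult_right_mono) auto
  moreover have "et*(z t)^2 <= et*(2*(z t - 2)^2 + 8)"
   using square_le_shift eta0 by (intro mult_left_mono) auto
  \<comment> \<open>\<open>eta\<close> lets the favourable square absorb the quadratic part of
    et*z^2; what remains is 8*et, matched by C*(mu - 2) = 8.\<close>
  moreover have "2*et*(z t - 2)^2 <= q*(z t - 2)^2"
   using eta by (intro mult_right_mono) (auto simp: q_def)
  ultimately have "q*(z t - 2)^2 + h t*(z t)^2 >= - 8*et"
   by (simp add: algebra_simps)
  then have 1: "- (?z' t - y t*(2 - z t)/mu) <= - (mu - 2 + z t)*(p t + C*et) + 8*et"
   unfolding id p_def by (simp add: algebra_simps)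
  have 2: "(mu - 2 + z t)*(C*et) >= 8*et"
  proof -
   have "8*et = (mu - 2)*(C*et)" using C(2) by (simp add: mult_ac)
   also have "... <= (mu - 2 + z t)*(C*et)"
    using o(2)[OF t] C eta0 by (intro mult_right_mono) auto
   finally show ?thesis .
  qed
  assume pos: "p t > 0"
  have "(mu - 2 + z t)*p t >= (mu - 2)*p t" using pos o(2)[OF t] by (intro mult_right_mono) auto
  with 1 2 show "- (?z' t - y t*(2 - z t)/mu) <= - (mu - 2)*p t"
   by (simp add: algebra_simps)
 next
  fix t assume t: "t < T"
  have "y t/mu <= K/mu" using bd[OF t] mu by (intro divide_right_mono) auto
  moreover have "C*et >= 0" using C eta0 by simp
  ultimately show "p t <= K/mu" using o(2)[OF t] mu by (simp add: p_def)
 qed (use mu t in auto)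
 then show ?thesis by (simp add: p_def C_def)
qed

text \<open>Above the claimed level the lower line forces z > 2, and the excess \<open>p\<close>
  satisfies p' <= - mu*p. An excess that decays forward and is bounded in the past is
  absent.\<close>

lemma emden_y_upper:
 assumes mu: "mu > 2" and orb: "emden_orbit mu h T y z" and h: "!!t. t < T ==> abs (h t) <= et"
  and eta: "2*et <= (mu - 2)^2/4" and bd: "!!t. t < T ==> y t <= K" and t: "t < T"
 shows "y t <= mu^2 + mu*(8/(mu - 2))*et"
proof -
 define C where "C = 8/(mu - 2)"
 define p where "p t = y t - (mu^2 + mu*C*et)" for t
 have eta0: "et >= 0" using h[OF t] by linarith
 have C: "C > 0" using mu by (auto simp: C_def)
 note o = emden_orbitD[OF orb]
 have "p t <= 0"
 proof (rule DERIV_decay_positive_part[where p = p and T = T and c = mu and K = K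
    and p' = "%t. y t*(2 - z t)"])
  fix t assume t: "t < T"
  show "(p hasD y t*(2 - z t)) (at t)"
   unfolding p_def using o[OF t] mu by (auto intro!: derivative_eq_intros)
  assume pos: "p t > 0"
  have mc: "mu*C*et >= 0" using mu C eta0 by auto
  have yt: "y t >= mu*mu" using pos mc unfolding p_def power2_eq_square by linarith
  have "p t/mu = y t/mu - mu - C*et"
   unfolding p_def using mu by (simp add: field_simps power2_eq_square)
  then have "2 - z t <= - (p t/mu)"
   using emden_lower_line[OF mu orb h eta bd t] unfolding C_def by linarith
  then have "y t*(2 - z t) <= y t*(- (p t/mu))"
   using o(1)[OF t] by (intro mult_left_mono) auto
  also have "... <= (mu*mu)*(- (p t/mu))"
   using yt pos mu by (intro mult_right_mono_neg) auto
  also have "... = - mu*p t" using mu by simp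
  finally show "y t*(2 - z t) <= - mu*p t" .
 next
  fix t assume t: "t < T"
  have "mu^2 + mu*C*et >= 0" using mu C eta0 by simp
  then show "p t <= K" using bd[OF t] unfolding p_def by linarith
 qed (use mu t in auto)
 then show ?thesis by (simp add: p_def C_def)
qed

text \<open>If \<open>z\<close> exceeded 2 + c in the whole past, \<open>y\<close> would decay
  forward at rate \<open>c\<close> and, being bounded, could not be positive. This supplies the
  starting time of the barrier argument in \<open>emden_z_upper\<close>.\<close>

lemma emden_z_small_early:
 assumes orb: "emden_orbit mu h T y z" and bd: "!!t. t < T ==> y t <= K"
  and c: "c > 0" and t: "t < T"
 shows "EX s<t. z s - 2 <= c"
proof (rule ccontr)
 assume "~ ?thesis"
 then have big: "z s - 2 > c" if "s < t" for s using that by force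
 note o = emden_orbitD[OF orb]
 have "y (t - 1) <= 0"
 proof (rule DERIV_decay_imp_nonpos[where m = y and T = t and K = K and c = c and m' = "%s. y s*(2 - z s)"])
  fix s assume s: "s < t"
  then have sT: "s < T" using t by simp
  show "(y hasD y s*(2 - z s)) (at s)" using o sT by blast
  have "y s*(2 - z s) <= y s*(- c)"
   using big[OF s] o(1)[OF sT] by (intro mult_left_mono) auto
  then show "y s*(2 - z s) <= - c*y s" by (simp add: mult.commute)
  show "y s <= K" using bd sT by blast
 qed (use c in auto)
 then show False using o(1)[of "t - 1"] t by simp
qed

lemma emden_z_upper:
 assumes mu: "mu > 2" and orb: "emden_orbit mu h T y z" and h: "!!t. t < T ==> abs (h t) <= et"
  and eta: "2*et <= (mu - 2)^2/4" "et > 0"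
  and C2: "C2 = 8/(mu - 2) + 9" "C2*et*(1 + abs (mu*(mu - 4)/4)) <= 1"
  and bd: "!!t. t < T ==> y t <= K" and t: "t < T"
 shows "z t - 2 <= C2*et"
proof -
 define C where "C = 8/(mu - 2)"
 define a where "a = mu*(mu - 4)/4"
 define c where "c = C2*et"
 have C: "C > 0" using mu by (simp add: C_def)
 then have "C2 > 0" unfolding C2 C_def[symmetric] by linarith
 note C = \<open>C > 0\<close> this
 have c: "c > 0" using C eta by (simp add: c_def)
 have c1: "c <= 1" "abs a*c <= 1"
 proof -
  have "c*(1 + abs a) <= 1" using C2(2) by (simp add: c_def a_def)
  then have 1: "c + c*abs a <= 1" by (simp add: algebra_simps)
  have "c <= c + c*abs a" "c*abs a <= c + c*abs a" using c by auto
  then have "c <= 1 & abs a*c <= 1" using order_trans[OF _ 1] by (simp add: mult.commute)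
  then show "c <= 1" "abs a*c <= 1" by blast+
 qed
 note o = emden_orbitD[OF orb]
 obtain s where s: "s < t" "z s - 2 <= c" using emden_z_small_early[OF orb bd c t] by auto
 have "z t <= 2 + c"
 proof (rule DERIV_barrier_le[where a = s and b = t])
  fix r assume r: "s <= r" "r <= t"
  then have rT: "r < T" using t by simp
  show "(z hasD (a + h r)*(z r)^2 - mu*(mu - 2)*z r + y r) (at r)"
   using o(4)[OF rT] by (simp add: a_def)
 next
  fix r assume r: "s <= r" "r < t" and eq: "z r = 2 + c"
  then have rT: "r < T" using t by simp
  have y: "y r <= mu^2 + mu*C*et" using emden_y_upper[OF mu orb h eta(1) bd rT] by (simp add: C_def)
  have "a*c^2 <= c"
  proof -
   have "a*c^2 <= (abs a*c)*c" using c by (simp add: power2_eq_square mult_right_mono)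
   also have "... <= 1*c" using c1 c by (intro mult_right_mono) auto
   finally show ?thesis by simp
  qed
  moreover have "h r*(2 + c)^2 <= 9*et"
  proof -
   have "h r*(2 + c)^2 <= et*(2 + c)^2" using h[OF rT] by (intro mult_right_mono) auto
   also have "... <= et*3^2" using c c1 eta by (intro mult_left_mono power_mono) auto
   finally show ?thesis by simp
  qed
  moreover have "(a + h r)*(z r)^2 - mu*(mu - 2)*z r + y r =
   - 2*mu*c + (y r - mu^2) + a*c^2 + h r*(2 + c)^2"
   unfolding eq a_def by (simp add: power2_eq_square field_simps)
  \<comment> \<open>This sum fixes C2 = C + 9: it collapses to - et*(mu - 1)*(C + 18).\<close>
  moreover have "- 2*mu*c + mu*C*et + c + 9*et < 0"
  proof -
   have "- 2*mu*c + mu*C*et + c + 9*et = - et*((mu - 1)*(C + 18))"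
    unfolding c_def C2 C_def[symmetric] by (simp add: algebra_simps)
   moreover have "et*((mu - 1)*(C + 18)) > 0" using eta mu C by simp
   ultimately show ?thesis by linarith
  qed
  ultimately show "(a + h r)*(z r)^2 - mu*(mu - 2)*z r + y r < 0"
   using y by linarith
 qed (use s in auto)
 then show ?thesis by (simp add: c_def)
qed

text \<open>A second line through the equilibrium, meeting y = 0 at z = 1. It keeps \<open>z\<close>
  a fixed amount below 2 where y <= mu^2/2, and it makes 2 - z at least proportional to mu^2 - y,
  which is the source of attraction. The term (z - 2)*(q*(z - 2) + (mu - 1)^2) in the derivative is
  nonpositive for z < 2, and for z >= 2 it is small by \<open>emden_z_upper\<close>.\<close>

lemma emden_upper_line:
 assumes mu: "mu > 2" and orb: "emden_orbit mu h T y z" and h: "!!t. t < T ==> abs (h t) <= et"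
  and eta: "2*et <= (mu - 2)^2/4" "et > 0"
  and C2: "C2 = 8/(mu - 2) + 9" "C2*et*(1 + abs (mu*(mu - 4)/4)) <= 1"
  and C4: "C4 = C2*((mu - 2)^2/4 + (mu - 1)^2) + 9"
  and bd: "!!t. t < T ==> y t <= K" and t: "t < T"
 shows "z t - 2 <= y t/mu^2 - 1 + C4*et"
proof -
 define q where "q = (mu - 2)^2/4"
 define c where "c = C2*et"
 define p where "p t = z t - 1 - y t/mu^2 - C4*et" for t
 have "8/(mu - 2) > 0" using mu by simp
 then have "C2 > 0" using C2(1) by linarith
 moreover then have "C2*((mu - 2)^2/4 + (mu - 1)^2) >= 0" by simp
 ultimately have "C2 > 0 & C4 > 0" unfolding C4 by linarith
 then have C: "C2 > 0" "C4 > 0" by blast+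
 have c: "c > 0" using C eta by (simp add: c_def)
 have "c*1 <= c*(1 + abs (mu*(mu - 4)/4))" using c by (intro mult_left_mono) auto
 then have c1: "c <= 1" using C2(2) unfolding c_def by linarith
 have q: "q > 0" using mu by (simp add: q_def)
 have mu2: "mu^2 > 4" using mu power_strict_mono[of 2 mu 2] by simp
 note o = emden_orbitD[OF orb]
 let ?z' = "%t. (mu*(mu - 4)/4 + h t)*(z t)^2 - mu*(mu - 2)*z t + y t"
 have "p t <= 0"
 proof (rule DERIV_decay_positive_part[where p = p and T = T and c = 1 and K = 2
    and p' = "%t. ?z' t - y t*(2 - z t)/mu^2"])
  fix t assume t: "t < T"
  show "(p hasD ?z' t - y t*(2 - z t)/mu^2) (at t)"
   unfolding p_def by (rule DERIV_cdivide derivative_eq_intros o[OF t] refl)+ simp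
  have id: "?z' t - y t*(2 - z t)/mu^2 =
    - (mu^2 + z t - 2)*(z t - 1 - y t/mu^2) + (z t - 2)*(q*(z t - 2) + (mu - 1)^2) + h t*(z t)^2"
   using mu by (simp add: q_def power2_eq_square field_simps)
  have zu: "z t - 2 <= c" using emden_z_upper[OF mu orb h eta C2 bd t] by (simp add: c_def)
  have hz: "h t*(z t)^2 <= 9*et"
  proof -
   have "h t*(z t)^2 <= et*(z t)^2" using h[OF t] by (intro mult_right_mono) auto
   also have "... <= et*3^2" using zu c1 o(2)[OF t] eta by (intro mult_left_mono power_mono) auto
   finally show ?thesis by simp
  qed
  have "(z t - 2)*(q*(z t - 2) + (mu - 1)^2) <= c*(q + (mu - 1)^2)"
  proof (cases "z t >= 2")
   case True
   have "q*(z t - 2) <= q*1" using zu c1 q by (intro mult_left_mono) auto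
   then show ?thesis using True zu c q by (intro mult_mono) auto
  next
   case False
   have "q*(z t - 2) >= q*(- 2)" using o(2)[OF t] q by (intro mult_left_mono) auto
   moreover have "(mu - 1)^2 >= 2*q" unfolding q_def
   proof -
    have "(mu - 2)^2 <= (mu - 1)^2" using mu by (intro power_mono) auto
    then show "2*((mu - 2)^2/4) <= (mu - 1)^2"
     using zero_le_power2[of "mu - 2"] by linarith
   qed
   ultimately have "(z t - 2)*(q*(z t - 2) + (mu - 1)^2) <= 0"
    using False by (intro mult_nonpos_nonneg) auto
   also have "0 <= c*(q + (mu - 1)^2)" using c q by simp
   finally show ?thesis .
  qed
  then have 1: "?z' t - y t*(2 - z t)/mu^2 <= - (mu^2 + z t - 2)*(p t + C4*et) + C4*et"
   using hz unfolding id p_def C4 q_def[symmetric] c_def by (simp add: algebra_simps)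
  have g1: "mu^2 + z t - 2 >= 1" using o(2)[OF t] mu2 by simp
  have 2: "(mu^2 + z t - 2)*(C4*et) >= 1*(C4*et)"
   using C eta g1 by (intro mult_right_mono) auto
  assume pos: "p t > 0"
  have "(mu^2 + z t - 2)*p t >= 1*p t" using pos g1 by (intro mult_right_mono) auto
  with 1 2 show "?z' t - y t*(2 - z t)/mu^2 <= - 1*p t"
   by (simp add: algebra_simps)
 next
  fix t assume t: "t < T"
  have zu: "z t - 2 <= c" using emden_z_upper[OF mu orb h eta C2 bd t] by (simp add: c_def)
  have "y t/mu^2 >= 0" "C4*et >= 0" using o(1)[OF t] C eta by auto
  then show "p t <= 2" using zu c1 by (simp add: p_def)
 qed (use t in auto)
 then show ?thesis by (simp add: p_def)
qed


text \<open>One constant and one threshold, depending on \<open>mu\<close> only, for the four bounds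
  on all orbits: they are later applied to a whole family of regular orbits. The numerical clauses
  serve the estimates that follow; for example C*e <= 1/4 yields z <= 1 + 1/2 + 1/4 where y <=
  mu^2/2.\<close>

definition emden_const :: "real => real => real => bool" where
 "emden_const mu C e \<longleftrightarrow> C > 0 & e > 0 & C*e <= 1/4 & e <= 1 & 2*e <= mu - 2 &
  (ALL h T y z et K t. 0 < et --> et <= e --> emden_orbit mu h T y z --> (ALL t<T. abs (h t) <= et) -->
   (ALL t<T. y t <= K) --> t < T -->
   y t <= mu^2 + C*et & z t - 2 <= C*et &
   z t - 2 >= y t/mu - mu - C*et & z t - 2 <= y t/mu^2 - 1 + C*et)"

lemma emden_const_exists:
 assumes mu: "mu > 2"
 shows "EX C e. emden_const mu C e"
proof -
 define C1 where "C1 = 8/(mu - 2)"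
 define C2 where "C2 = C1 + 9"
 define C4 where "C4 = C2*((mu - 2)^2/4 + (mu - 1)^2) + 9"
 define C where "C = (mu + 1)*C1 + C2 + C4"
 define A where "A = 1 + abs (mu*(mu - 4)/4)"
 define e where "e = min (min ((mu - 2)^2/8) (1/(C2*A))) (min (min 1 ((mu - 2)/2)) (1/(4*C)))"
 have C1: "C1 > 0" using mu by (simp add: C1_def)
 then have C2: "C2 > 0" by (simp add: C2_def)
 then have "C2*((mu - 2)^2/4 + (mu - 1)^2) >= 0" by simp
 then have C4: "C4 > 0" unfolding C4_def by linarith
 have muC: "(mu + 1)*C1 > 0" using C1 mu by simp
 have C: "C > 0" using muC C2 C4 unfolding C_def by linarith
 have A: "A > 0" by (simp add: A_def add_pos_nonneg)
 have e: "e > 0" using mu C C2 A by (simp add: e_def)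
 have Ce: "C*e <= 1/4"
 proof -
  have "C*e <= C*(1/(4*C))" using C by (intro mult_left_mono) (auto simp: e_def)
  then show ?thesis using C by simp
 qed
 have main: "y t <= mu^2 + C*et & z t - 2 <= C*et &
   z t - 2 >= y t/mu - mu - C*et & z t - 2 <= y t/mu^2 - 1 + C*et"
  if eta: "0 < et" "et <= e" and orb: "emden_orbit mu h T y z" and h: "ALL t<T. abs (h t) <= et"
   and bd: "ALL t<T. y t <= K" and t: "t < T" for h T y z et K t
 proof -
  have "e <= (mu - 2)^2/8" by (simp add: e_def)
  then have 1: "2*et <= (mu - 2)^2/4" using eta by linarith
  have "et <= 1/(C2*A)" using eta by (simp add: e_def)
  then have 2: "C2*et*A <= 1" using C2 A by (simp add: field_simps)
  have c: "C1*et > 0" "C2*et > 0" "C4*et > 0" using C1 C2 C4 eta by auto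
  have m: "mu*C1*et > 0" using c mu by (simp add: mult.assoc)
  have Ceq: "C*et = mu*C1*et + C1*et + C2*et + C4*et" by (simp add: C_def algebra_simps)
  note h' = h[rule_format] and bd' = bd[rule_format]
  have "y t <= mu^2 + mu*C1*et" using emden_y_upper[OF mu orb h' 1 bd' t] by (simp add: C1_def)
  moreover have "z t - 2 <= C2*et"
   by (rule emden_z_upper[OF mu orb h' 1 eta(1) _ _ bd' t]) (use 2 in "simp_all add: A_def C2_def C1_def")
  moreover have "z t - 2 >= y t/mu - mu - C1*et"
   using emden_lower_line[OF mu orb h' 1 bd' t] by (simp add: C1_def)
  moreover have "z t - 2 <= y t/mu^2 - 1 + C4*et"
   by (rule emden_upper_line[OF mu orb h' 1 eta(1) _ _ C4_def bd' t])
    (use 2 in "simp_all add: A_def C2_def C1_def")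
  ultimately show ?thesis using c m unfolding Ceq by linarith
 qed
 have "e <= 1" "2*e <= mu - 2" by (auto simp: e_def min_def)
 then show ?thesis unfolding emden_const_def using C e Ce main by blast
qed

section \<open>Orbits below the level y = mu^2/2\<close>

lemma emden_early_z_le:
 assumes mu: "mu > 2" and orb: "emden_orbit mu h T y z" and h: "!!t. t < T ==> abs (h t) <= et"
  and eta: "2*et <= mu - 2"
  and bd: "!!t. t < T ==> y t <= K" and z2: "!!t. t < T ==> z t <= 2" and t: "t < T"
 shows "z t <= y t/(mu - 2)"
proof -
 define c where "c = mu - 2"
 define a where "a = mu*(mu - 4)/4"
 define p where "p t = z t - y t/c" for t
 have c: "c > 0" using mu by (simp add: c_def)
 note o = emden_orbitD[OF orb]
 let ?z' = "%t. (a + h t)*(z t)^2 - mu*(mu - 2)*z t + y t"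
 have "p t <= 0"
 proof (rule DERIV_decay_imp_nonpos[where m = p and T = T and c = c and K = 2
    and m' = "%t. ?z' t - y t*(2 - z t)/c"])
  fix t assume t: "t < T"
  show "(p hasD ?z' t - y t*(2 - z t)/c) (at t)"
   unfolding p_def a_def by (rule DERIV_cdivide derivative_eq_intros o[OF t] refl)+
  \<comment> \<open>With this the quadratic and linear terms of z' add up to at most - c*z, so
    \<open>z - y/c\<close> decays at rate \<open>c\<close>.\<close>
  have "(a + h t)*z t <= mu*(mu - 2) - c"
  proof -
   have "h t*z t <= et*2"
    using h[OF t] z2[OF t] o(2)[OF t] by (intro mult_mono) auto
   then have hz: "h t*z t <= mu - 2" using eta by simp
   show ?thesis
   proof (cases "a >= 0")
    case True
    then have "a*z t <= a*2" using z2[OF t] by (intro mult_left_mono) auto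
    moreover have "a*2 + 2*(mu - 2) <= mu*(mu - 2)"
    proof -
     have "mu*(mu - 2) - (a*2 + 2*(mu - 2)) = ((mu - 2)^2 + 4)/2"
      by (simp add: a_def power2_eq_square field_simps)
     moreover have "((mu - 2)^2 + 4)/2 >= 0" by simp
     ultimately show ?thesis by linarith
    qed
    ultimately show ?thesis using hz by (simp add: c_def algebra_simps)
   next
    case False
    then have "a*z t <= 0" using o(2)[OF t] by (simp add: mult_nonpos_nonneg)
    moreover have "2*(mu - 2) <= mu*(mu - 2)" using mu by (intro mult_right_mono) auto
    ultimately show ?thesis using hz by (simp add: c_def algebra_simps)
   qed
  qed
  then have "(a + h t)*z t*z t <= (mu*(mu - 2) - c)*z t"
   using o(2)[OF t] by (intro mult_right_mono) auto
  then have 1: "?z' t <= - c*z t + y t" by (simp add: power2_eq_square algebra_simps)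
  have "y t*(2 - z t)/c >= 0" using o(1)[OF t] z2[OF t] c by simp
  then show "?z' t - y t*(2 - z t)/c <= - c*p t" using 1 c unfolding p_def by (simp add: right_diff_distrib)
 next
  fix t assume t: "t < T"
  have "y t/c >= 0" using o(1)[OF t] c by simp
  then show "p t <= 2" using z2[OF t] unfolding p_def by simp
 qed (use t c in auto)
 then show ?thesis by (simp add: p_def c_def)
qed

lemma emden_orbit_mono: "emden_orbit mu h T y z ==> T' <= T ==> emden_orbit mu h T' y z"
 by (simp add: emden_orbit_def)

text \<open>The derivative of 2*t - ln y is \<open>z\<close>. While z <= 7/4 one has z <= y/(mu - 2)
  <= 4/(mu - 2)*y*(2 - z) = 4/(mu - 2)*y', so the variation of 2*t - ln y is controlled by that of
  \<open>y\<close>.\<close>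

lemma emden_early_log_w:
 assumes mu: "mu > 2" and orb: "emden_orbit mu h T y z" and h: "!!t. t < T ==> abs (h t) <= et"
  and eta: "2*et <= mu - 2"
  and bd: "!!t. t < T ==> y t <= K" and s: "s <= t" and t: "t < T"
  and z2: "!!r. r < t ==> z r <= 7/4"
 shows "2*t - ln (y t) - 4/(mu - 2)*y t <= 2 * s - ln (y s) - 4/(mu - 2)*y s"
proof -
 define L where "L t = 2*t - ln (y t) - 4/(mu - 2)*y t" for t
 have d: "(L hasD 2 - 1/y r*(y r*(2 - z r)) - 4/(mu - 2)*(y r*(2 - z r))) (at r)"
  if "r < T" for r unfolding L_def
  by (rule derivative_eq_intros DERIV_cmult emden_orbitD[OF orb that] refl | simp)+
 have "L t <= L s"
 proof (rule DERIV_nonpos_imp_decreasing_open[OF s])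
  fix r assume r: "s < r" "r < t"
  then have rT: "r < T" using t by simp
  note o = emden_orbitD[OF orb rT]
  have "z r <= y r/(mu - 2)"
   by (rule emden_early_z_le[OF mu emden_orbit_mono[OF orb, of t] h eta bd _ r(2)])
    (use z2 t in force)+
  also have "... <= y r/(mu - 2)*(4*(2 - z r))"
   using z2[OF r(2)] o(1) mu mult_left_mono[of 1 "4*(2 - z r)" "y r/(mu - 2)"] by simp
  finally have "2 - 1/y r*(y r*(2 - z r)) - 4/(mu - 2)*(y r*(2 - z r)) <= 0"
   using o(1) by (simp add: mult_ac)
  then show "EX y'. (L hasD y') (at r) & y' <= 0" using d[OF rT] by blast
 next
  show "continuous_on {s..t} L"
   using d t by (intro continuous_at_imp_continuous_on ballI) (meson DERIV_isCont atLeastAtMost_iff order_le_less_trans)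
 qed
 then show ?thesis by (simp add: L_def)
qed

lemma emden_half_barrier:
 assumes orb: "emden_orbit mu h T y z" and z2: "!!t. t < T ==> y t = c ==> z t < 2"
  and st: "s <= t" "t < T" "y s >= c"
 shows "y t >= c"
proof -
 note o = emden_orbitD[OF orb]
 have "- y t <= - c"
 proof (rule DERIV_barrier_le[OF st(1)])
  fix r assume r: "s <= r" "r <= t"
  then show "((%r. - y r) hasD - (y r*(2 - z r))) (at r)"
   using o(3)[of r] st by (auto intro!: derivative_intros)
 next
  fix r assume r: "s <= r" "r < t" "- y r = - c"
  then show "- (y r*(2 - z r)) < 0" using z2[of r] o(1)[of r] st by simp
 qed (use st in auto)
 then show ?thesis by simp
qed


section \<open>Attraction to the equilibrium\<close>

context
 fixes mu C e h T y z et K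
 assumes mu: "mu > 2" and const: "emden_const mu C e" and eta: "0 < et" "et <= e"
  and orb: "emden_orbit mu h T y z" and h: "ALL t<T. abs (h t) <= et"
  and bd: "ALL t<T. y t <= K"
begin

lemma emden_trapped:
 assumes "t < T"
 shows "y t <= mu^2 + C*et" "z t - 2 <= C*et" "z t - 2 >= y t/mu - mu - C*et"
  "z t - 2 <= y t/mu^2 - 1 + C*et"
 using const eta orb h bd assms unfolding emden_const_def by blast+

lemma emden_C_eta: "0 < C*et" "C*et <= 1/4" "2*et <= mu - 2"
proof -
 have c: "C > 0" "C*e <= 1/4" "2*e <= mu - 2" using const by (auto simp: emden_const_def)
 show "0 < C*et" using c eta by simp
 have "C*et <= C*e" using c eta by (intro mult_left_mono) auto
 then show "C*et <= 1/4" using c by linarith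
 show "2*et <= mu - 2" using c eta by linarith
qed

lemma emden_half_z:
 assumes "t < T" "y t <= mu^2/2"
 shows "z t <= 7/4"
proof -
 have "y t/mu^2 <= 1/2" using assms(2) mu by (simp add: field_simps)
 then show ?thesis using emden_trapped(4)[OF assms(1)] emden_C_eta by linarith
qed

lemma emden_half_mono: "s <= t ==> t < T ==> y s >= mu^2/2 ==> y t >= mu^2/2"
 by (rule emden_half_barrier[OF orb]) (use emden_half_z in force)+

text \<open>The drift of ln w = 2*t - ln y since any earlier time is at most 4/(mu - 2)*(mu^2/2).
  This tells singular orbits, on which ln w comes from minus infinity, from regular ones.\<close>

lemma emden_log_w_decreasing:
 assumes t: "t < T" "y t < mu^2/2" and s: "s <= t"
 shows "2*t - ln (y t) <= 2 * s - ln (y s) + 2*mu^2/(mu - 2)"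
proof -
 have "z r <= 7/4" if "r < t" for r
  using emden_half_mono[of r t] emden_half_z[of r] that t by force
 from emden_early_log_w[OF mu orb h[rule_format] emden_C_eta(3) bd[rule_format] s t(1) this]
 have 1: "2*t - ln (y t) - 4/(mu - 2)*y t <= 2 * s - ln (y s) - 4/(mu - 2)*y s" .
 have "4/(mu - 2)*y s >= 0" using emden_orbitD(1)[OF orb, of s] s t mu by simp
 moreover have "4/(mu - 2)*y t <= 4/(mu - 2)*(mu^2/2)"
  using t mu by (intro mult_left_mono) auto
 moreover have "4/(mu - 2)*(mu^2/2) = 2*mu^2/(mu - 2)" using mu by (simp add: divide_simps)
 ultimately show ?thesis using 1 by linarith
qed

text \<open>Where the deficit \<open>p\<close> is positive the upper line gives 2 - z >= p/mu^2, and
  y >= mu^2/2, which persists by \<open>emden_half_mono\<close>, turns this into y' >= p/2. Hence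
  the square of the positive part of \<open>p\<close> decays at rate 1.\<close>

lemma emden_attraction:
 assumes "y s >= mu^2/2" and st: "s <= t" "t < T"
 shows "y t >= mu^2*(1 - C*et) - mu^2*exp (- (t - s)/2)"
proof -
 define p where "p t = mu^2*(1 - C*et) - y t" for t
 have mu2: "mu^2 > 0" using mu by simp
 have "(max (p t) 0)^2 <= (max (p s) 0)^2*exp (- 1*(t - s))"
 proof (rule DERIV_le_growth[OF st(1)])
  fix r assume r: "s <= r" "r <= t"
  then have rT: "r < T" using st by simp
  note o = emden_orbitD[OF orb rT]
  have "(p hasD - (y r*(2 - z r))) (at r)"
   unfolding p_def by (rule derivative_eq_intros o refl | simp)+
  then show "((%r. (max (p r) 0)^2) hasD 2*max (p r) 0*- (y r*(2 - z r))) (at r within {s..t})"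
   by (rule has_field_derivative_at_within[OF DERIV_chain2[OF DERIV_max_zero_square]])
  have y: "y r >= mu^2/2" using emden_half_mono[OF r(1) rT] assms by simp
  show "2*max (p r) 0*- (y r*(2 - z r)) <= - 1*(max (p r) 0)^2"
  proof (cases "p r > 0")
   case True
   have "p r/mu^2 = 1 - C*et - y r/mu^2" unfolding p_def using mu2 by (simp add: field_simps)
   then have "p r/mu^2 <= 2 - z r" using emden_trapped(4)[OF rT] by linarith
   then have "y r*(2 - z r) >= (mu^2/2)*(p r/mu^2)"
    using y mu2 True o(1) by (intro mult_mono) auto
   then have "2*(y r*(2 - z r)) >= p r" using mu by simp
   then have "p r*(2*(y r*(2 - z r))) >= p r*p r" using True by (intro mult_left_mono) auto
   then show ?thesis using True by (simp add: power2_eq_square max_def mult_ac)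
  qed (simp add: max_def)
 qed
 also have "(max (p s) 0)^2*exp (- 1*(t - s)) <= (mu^2)^2*exp (- 1*(t - s))"
 proof (intro mult_right_mono power_mono)
  have "mu^2*(1 - C*et) <= mu^2*1" using emden_C_eta mu2 by (intro mult_left_mono) auto
  then have "p s <= mu^2" using assms(1) mu2 unfolding p_def by linarith
  then show "max (p s) 0 <= mu^2" by simp
 qed simp_all
 also have "(mu^2)^2*exp (- 1*(t - s)) = (mu^2*exp (- (t - s)/2))^2"
  by (simp add: power_mult_distrib power2_eq_square[of "exp _"] mult_exp_exp)
 finally have "(max (p t) 0)^2 <= (mu^2*exp (- (t - s)/2))^2" by simp
 then have "max (p t) 0 <= mu^2*exp (- (t - s)/2)"
  by (rule power2_le_imp_le) simp
 then show ?thesis by (simp add: p_def)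
qed

lemma emden_attraction_from_bot:
 assumes half: "!!s. s < T ==> y s >= mu^2/2" and t: "t < T"
 shows "y t >= mu^2*(1 - C*et)"
proof (rule tendsto_upperbound)
 have "((%s. mu^2*(1 - C*et) - mu^2*exp (- (t - s)/2)) ---> mu^2*(1 - C*et) - mu^2*0) at_bot"
  by (intro tendsto_intros) real_asymp
 then show "((%s. mu^2*(1 - C*et) - mu^2*exp (- (t - s)/2)) ---> mu^2*(1 - C*et)) at_bot"
  by simp
 show "\<forall>\<^sub>F s in at_bot. mu^2*(1 - C*et) - mu^2*exp (- (t - s)/2) <= y t"
  using eventually_le_at_bot[of t] by eventually_elim (rule emden_attraction, use half t in auto)
qed simp

end

text \<open>At an early time with y < mu^2/2 the drift bound would keep 2*t - ln y bounded below in
  the past. So the attraction can be started arbitrarily early, and letting \<open>et\<close> shrink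
  along the tail of \<open>h\<close> traps the orbit in ever smaller neighbourhoods of the
  equilibrium.\<close>

lemma emden_singular_limit:
 assumes mu: "mu > 2" and orb: "emden_orbit mu h T y z" and h: "(h ---> 0) at_bot"
  and bd: "!!t. t < T ==> y t <= K" and L: "filterlim (%t. 2*t - ln (y t)) at_bot at_bot"
 shows "(y ---> mu^2) at_bot" "(z ---> 2) at_bot"
proof -
 obtain C e where const: "emden_const mu C e" using emden_const_exists[OF mu] by blast
 then have Ce: "C > 0" "e > 0" by (auto simp: emden_const_def)
 have close: "\<forall>\<^sub>F t in at_bot. abs (y t - mu^2) <= (mu^2 + 1)*C*et & abs (z t - 2) <= (mu + 1)*C*et"
  if eta: "0 < et" "et <= e" for et
 proof -
  have "\<forall>\<^sub>F t in at_bot. abs (h t) < et" using h eta(1) unfolding tendsto_iff by (auto simp: dist_real_def)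
  then obtain T1 where T1: "!!t. t <= T1 ==> abs (h t) <= et"
   unfolding eventually_at_bot_linorder by (meson less_imp_le)
  define T' where "T' = min T T1"
  have orb': "emden_orbit mu h T' y z" using orb by (rule emden_orbit_mono) (simp add: T'_def)
  have h': "ALL t<T'. abs (h t) <= et" "ALL t<T'. y t <= K" using T1 bd by (auto simp: T'_def)
  note lem = emden_trapped[OF mu const eta orb' h'] emden_C_eta[OF mu const eta orb' h']
  have half: "y t >= mu^2/2" if t: "t < T'" for t
  proof (rule ccontr)
   assume "~ y t >= mu^2/2"
   then have y: "y t < mu^2/2" by simp
   have "\<forall>\<^sub>F s in at_bot. 2 * s - ln (y s) < 2*t - ln (y t) - 2*mu^2/(mu - 2)"
    using L unfolding filterlim_at_bot_dense by blast
   moreover have "\<forall>\<^sub>F s in at_bot. s <= t" by (rule eventually_le_at_bot)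
   ultimately have "\<forall>\<^sub>F s in at_bot. 2 * s - ln (y s) < 2*t - ln (y t) - 2*mu^2/(mu - 2) & s <= t"
    by (rule eventually_conj)
   then obtain s where "2 * s - ln (y s) < 2*t - ln (y t) - 2*mu^2/(mu - 2)" "s <= t"
    using eventually_happens'[OF trivial_limit_at_bot_linorder] by blast
   then show False using emden_log_w_decreasing[OF mu const eta orb' h' t y] by force
  qed
  have "\<forall>\<^sub>F t in at_bot. t < T'" by (rule eventually_gt_at_bot)
  then show ?thesis
  proof eventually_elim
   case (elim t)
   have c: "C*et > 0" using Ce eta by simp
   have lo: "y t >= mu^2*(1 - C*et)"
    by (rule emden_attraction_from_bot[OF mu const eta orb' h' half elim])
   have exp1: "(mu^2 + 1)*C*et = mu^2*(C*et) + C*et" "(mu + 1)*C*et = mu*(C*et) + C*et"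
    by (simp_all add: algebra_simps)
   have pos: "mu^2*(C*et) > 0" "mu*(C*et) > 0" using c mu by simp_all
   have "y t/mu >= mu^2*(1 - C*et)/mu" using lo mu by (intro divide_right_mono) auto
   also have "mu^2*(1 - C*et)/mu = mu - mu*(C*et)" using mu by (simp add: power2_eq_square field_simps)
   finally have yl: "y t/mu >= mu - mu*(C*et)" by simp
   have "abs (y t - mu^2) <= (mu^2 + 1)*C*et"
    using lo lem(1)[OF elim] c pos unfolding exp1 by (simp add: abs_le_iff right_diff_distrib)
   moreover have "abs (z t - 2) <= (mu + 1)*C*et"
    using yl lem(2,3)[OF elim] c pos unfolding exp1 by (simp add: abs_le_iff)
   ultimately show ?case by blast
  qed
 qed
 have lim: "(v ---> l) at_bot"
  if A: "A > 0" and v: "!!et. 0 < et ==> et <= e ==> \<forall>\<^sub>F t in at_bot. abs (v t - l) <= A*et" for v :: "real => real" and l A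
  unfolding tendsto_iff dist_real_def
 proof (intro allI impI)
  fix d :: real assume d: "d > 0"
  define et where "et = min e (d/(2*A))"
  have "0 < et" "et <= e" "A*et <= A*(d/(2*A))"
   using d A Ce unfolding et_def by (simp, simp, intro mult_left_mono, auto)
  moreover have "A*(d/(2*A)) < d" using A d by simp
  ultimately show "\<forall>\<^sub>F t in at_bot. abs (v t - l) < d"
   using v[of et] by (auto elim!: eventually_mono)
 qed
 have "(mu^2 + 1)*C > 0" "(mu + 1)*C > 0" using Ce mu by (simp_all add: add_nonneg_pos)
 note pos = this
 show "(y ---> mu^2) at_bot"
  by (rule lim[OF pos(1)]) (rule eventually_mono[OF close], auto)
 show "(z ---> 2) at_bot"
  by (rule lim[OF pos(2)]) (rule eventually_mono[OF close], auto)
qed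

text \<open>In the application \<open>l0\<close> is ln F(u(0)). After the time (l0 + K1)/2 the level
  y < mu^2/2 is excluded, because there 2*t - ln y would exceed the drift bound l0 + K0. For large
  u(0) this time is very early.\<close>

lemma emden_regular_orbit:
 assumes mu: "mu > 2" and const: "emden_const mu C e" and eta: "0 < et" "et <= e"
  and orb: "emden_orbit mu h T y z" and h: "ALL t<T. abs (h t) <= et"
  and bd: "ALL t<T. y t <= K" and L: "((%t. 2*t - ln (y t)) ---> l0) at_bot" and t: "t < T"
 defines "K0 \<equiv> 2*mu^2/(mu - 2)" and "K1 \<equiv> 2*mu^2/(mu - 2) + ln (mu^2/2)"
 shows "2*t - ln (y t) <= l0 + K0 | y t >= mu^2/2"
  and "2*t > l0 + K1 ==> y t >= mu^2*(1 - C*et) - mu^2*exp (- (t - (l0 + K1)/2)/2)"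
proof -
 note o = emden_orbitD[OF orb]
 have lo: "2*r - ln (y r) <= l0 + K0 | y r >= mu^2/2" if r: "r < T" for r
 proof (rule disjCI)
  assume "~ y r >= mu^2/2"
  then have y: "y r < mu^2/2" by simp
  have "((%s. 2 * s - ln (y s) + K0) ---> l0 + K0) at_bot" using L by (intro tendsto_intros)
  moreover have "\<forall>\<^sub>F s in at_bot. 2*r - ln (y r) <= 2 * s - ln (y s) + K0"
   using eventually_le_at_bot[of r]
   by eventually_elim (use emden_log_w_decreasing[OF mu const eta orb h bd r y] in "auto simp: K0_def")
  ultimately show "2*r - ln (y r) <= l0 + K0" by (rule tendsto_lowerbound) simp
 qed
 then show "2*t - ln (y t) <= l0 + K0 | y t >= mu^2/2" using t by blast
 have half: "y r >= mu^2/2" if r: "r < T" "2*r > l0 + K1" for r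
 proof (rule ccontr)
  assume "~ y r >= mu^2/2"
  then have "2*r - ln (y r) <= l0 + K0" "ln (y r) < ln (mu^2/2)"
   using lo[OF r(1)] o(1)[OF r(1)] ln_less_cancel_iff[of "y r" "mu^2/2"] mu by auto
  then show False using r by (simp add: K0_def K1_def)
 qed
 assume gt: "2*t > l0 + K1"
 \<comment> \<open>The lower level is known to be passed only strictly after \<open>s0\<close>, so
   attraction is started at s > s0 and then s tends to \<open>s0\<close>.\<close>
 define s0 where "s0 = (l0 + K1)/2"
 show "y t >= mu^2*(1 - C*et) - mu^2*exp (- (t - (l0 + K1)/2)/2)"
  unfolding s0_def[symmetric]
 proof (rule tendsto_upperbound)
  show "((%s. mu^2*(1 - C*et) - mu^2*exp (- (t - s)/2)) --->
    mu^2*(1 - C*et) - mu^2*exp (- (t - s0)/2)) (at_right s0)"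
   by (intro tendsto_intros) auto
  have "s0 < t" using gt by (simp add: s0_def)
  then have "\<forall>\<^sub>F s in at_right s0. s0 < s & s < t"
   unfolding eventually_at_right_field by blast
  then show "\<forall>\<^sub>F s in at_right s0. mu^2*(1 - C*et) - mu^2*exp (- (t - s)/2) <= y t"
  proof eventually_elim
   case (elim s)
   then have "y s >= mu^2/2" using half[of s] t by (simp add: s0_def)
   then show ?case using emden_attraction[OF mu const eta orb h bd, of s t] elim t by simp
  qed
 qed simp
qed

text \<open>For D = ln y2 - ln y1 and E = z1 - z2 + mu*D the linear part is the Jordan block D' = E
  - mu*D, E' = - mu*E. As mu > 2, the damping - 2*mu*V of V = D^2 + E^2 dominates both the coupling
  2*D*E and the remainder. The hypothesis on h1 - h2 is stated in terms of \<open>D\<close> because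
  in the application both are values of one function of 2*t - ln y, and these arguments differ by
  \<open>D\<close>.\<close>

lemma emden_two_orbits:
 assumes mu: "mu > 2"
 shows "EX rh>0. rh < mu^2 & (ALL h1 h2 T1 T2 y1 y2 z1 z2 t. emden_orbit mu h1 T1 y1 z1 --> emden_orbit mu h2 T2 y2 z2 -->
  t < T1 --> t < T2 --> abs (y1 t - mu^2) <= rh --> abs (y2 t - mu^2) <= rh --> abs (z1 t - 2) <= rh --> abs (z2 t - 2) <= rh -->
  \<bar>h2 t\<bar> <= rh --> abs (h1 t - h2 t) <= rh*abs (ln (y2 t) - ln (y1 t)) -->
  (EX V'. ((%t. (ln (y2 t) - ln (y1 t))^2 + (z1 t - z2 t + mu*(ln (y2 t) - ln (y1 t)))^2)
    hasD V') (at t) &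
   V' <= - ((ln (y2 t) - ln (y1 t))^2 + (z1 t - z2 t + mu*(ln (y2 t) - ln (y1 t)))^2)))"
proof -
 define a where "a = mu*(mu - 4)/4"
 define A where "A = 2*abs a + 6"
 define B where "B = 10 + (2*abs a + 6)*mu"
 \<comment> \<open>\<open>A\<close> and \<open>B\<close> collect the coefficients of |E| and |D| in
   the remainder \<open>R\<close>; the choice makes 2*E*R <= V.\<close>
 define rh where "rh = min 1 (1/(2*(A + B)))"
 have AB: "A > 0" "B > 0" using mu by (auto simp: A_def B_def add_nonneg_pos add_pos_nonneg)
 then have rho: "rh > 0" "rh <= 1" by (auto simp: rh_def)
 have "rh <= 1/(2*(A + B))" by (simp add: rh_def)
 then have rAB: "rh*(2*(A + B)) <= 1" using AB by (simp add: field_simps)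
 have mu4: "mu^2 > 4" using mu power_strict_mono[of 2 mu 2] by simp
 have "EX V'. ((%t. (ln (y2 t) - ln (y1 t))^2 + (z1 t - z2 t + mu*(ln (y2 t) - ln (y1 t)))^2)
    hasD V') (at t) &
   V' <= - ((ln (y2 t) - ln (y1 t))^2 + (z1 t - z2 t + mu*(ln (y2 t) - ln (y1 t)))^2)"
  if orb1: "emden_orbit mu h1 T1 y1 z1" and orb2: "emden_orbit mu h2 T2 y2 z2"
   and t: "t < T1" "t < T2" and y: "abs (y1 t - mu^2) <= rh" "abs (y2 t - mu^2) <= rh"
   and z: "abs (z1 t - 2) <= rh" "abs (z2 t - 2) <= rh" and h: "abs (h2 t) <= rh" "abs (h1 t - h2 t) <= rh*abs (ln (y2 t) - ln (y1 t))"
  for h1 h2 T1 T2 y1 y2 z1 z2 t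
 proof -
  note o = emden_orbitD[OF orb1 t(1)] emden_orbitD[OF orb2 t(2)]
  define D where "D t = ln (y2 t) - ln (y1 t)" for t
  define E where "E t = z1 t - z2 t + mu*D t" for t
  define R where "R = a*(z1 t - z2 t)*((z1 t - 2) + (z2 t - 2)) + (h1 t - h2 t)*(z1 t)^2 +
   h2 t*(z1 t - z2 t)*(z1 t + z2 t) + (y1 t - y2 t + mu^2*D t)"
  have dD: "(D hasD E t - mu*D t) (at t)"
  proof -
   have "(D hasD 1/y2 t*(y2 t*(2 - z2 t)) - 1/y1 t*(y1 t*(2 - z1 t))) (at t)"
    unfolding D_def by (rule derivative_eq_intros o refl)+
   then show ?thesis using o(1,5) by (simp add: E_def)
  qed
  have dE: "(E hasD - mu*E t + R) (at t)"
  proof -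
   have "(E hasD ((a + h1 t)*(z1 t)^2 - mu*(mu - 2)*z1 t + y1 t) -
    ((a + h2 t)*(z2 t)^2 - mu*(mu - 2)*z2 t + y2 t) + mu*(E t - mu*D t)) (at t)"
    unfolding E_def[abs_def] a_def
    using DERIV_add[OF DERIV_diff[OF o(4) o(8)] DERIV_cmult[OF dD, of mu]] by (simp add: E_def)
   moreover have "((a + h1 t)*(z1 t)^2 - mu*(mu - 2)*z1 t + y1 t) -
    ((a + h2 t)*(z2 t)^2 - mu*(mu - 2)*z2 t + y2 t) + mu*(E t - mu*D t) = - mu*E t + R"
    unfolding E_def R_def a_def by (simp add: power2_eq_square field_simps)
   ultimately show ?thesis by simp
  qed
  \<comment> \<open>Mean value theorem for ln: y2 - y1 = xi*D with \<open>xi\<close> within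
    \<open>rh\<close> of mu^2.\<close>
  have ln: "abs (y1 t - y2 t + mu^2*D t) <= rh*abs (D t)"
  proof -
   have *: "EX xi. abs (xi - mu^2) <= rh & y2 t - y1 t = xi*D t"
   proof -
    have "EX xi. abs (xi - mu^2) <= rh & v - u = xi*(ln v - ln u)"
     if "0 < u" "u < v" "abs (u - mu^2) <= rh" "abs (v - mu^2) <= rh" for u v :: real
    proof -
     obtain xi where x: "u < xi" "xi < v" "ln v - ln u = (v - u)*inverse xi"
     proof -
      have "(ln hasD inverse x) (at x)" if "u <= x" for x
      using that \<open>0 < u\<close> by (intro DERIV_ln) simp
      from MVT2[OF \<open>u < v\<close> this] show ?thesis using that by blast
     qed
     then show ?thesis using that by (intro exI[of _ xi]) (auto simp: abs_le_iff field_simps)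
    qed
    note mvt = this
    consider "y1 t < y2 t" | "y2 t < y1 t" | "y1 t = y2 t" by linarith
    then show ?thesis
    proof cases
     case 1 then show ?thesis using mvt[of "y1 t" "y2 t"] o y by (simp add: D_def)
    next
     case 2
     then obtain xi where "abs (xi - mu^2) <= rh" "y1 t - y2 t = xi*(ln (y1 t) - ln (y2 t))"
      using mvt[of "y2 t" "y1 t"] o y by auto
     then show ?thesis by (intro exI[of _ xi]) (simp add: D_def algebra_simps)
    next
     case 3 then show ?thesis using rho by (intro exI[of _ "mu^2"]) (simp add: D_def)
    qed
   qed
   then obtain xi where x: "abs (xi - mu^2) <= rh" "y2 t - y1 t = xi*D t" by blast
   have "y1 t - y2 t + mu^2*D t = - (xi - mu^2)*D t" using x(2) by (simp add: algebra_simps)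
   then show ?thesis using x(1) by (simp add: abs_mult mult_right_mono)
  qed
  define D' where "D' = abs (z1 t - z2 t)"
  have D': "D' <= abs (E t) + mu*abs (D t)" "D' >= 0"
  proof -
   have "z1 t - z2 t = E t - mu*D t" by (simp add: E_def)
   then have "D' <= abs (E t) + abs (mu*D t)" unfolding D'_def by linarith
   then show "D' <= abs (E t) + mu*abs (D t)" using mu by (simp add: abs_mult)
  qed (simp add: D'_def)
  have R: "abs R <= rh*(A*abs (E t) + B*abs (D t))"
  proof -
   have "abs (a*(z1 t - z2 t)*((z1 t - 2) + (z2 t - 2))) <= abs a*D'*(2*rh)"
    unfolding abs_mult D'_def using z by (intro mult_mono) auto
   moreover have "abs ((h1 t - h2 t)*(z1 t)^2) <= (rh*abs (D t))*9"
   proof -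
    have "abs (z1 t)^2 <= 3^2" using z rho by (intro power_mono) auto
    then show ?thesis unfolding abs_mult using h(2) rho by (intro mult_mono) (auto simp: D_def)
   qed
   moreover have "abs (h2 t*(z1 t - z2 t)*(z1 t + z2 t)) <= rh*D'*6"
    unfolding abs_mult D'_def using z rho h by (intro mult_mono) auto
   ultimately have "abs R <= abs a*D'*(2*rh) + rh*abs (D t)*9 + rh*D'*6 + rh*abs (D t)"
    unfolding R_def by (intro order_trans[OF abs_triangle_ineq] add_mono ln)
   also have "... = rh*(A*D' + 10*abs (D t))" by (simp add: A_def algebra_simps)
   also have "... <= rh*(A*(abs (E t) + mu*abs (D t)) + 10*abs (D t))"
    using D' AB rho by (intro mult_left_mono add_right_mono) auto
   also have "... = rh*(A*abs (E t) + B*abs (D t))" by (simp add: A_def B_def algebra_simps)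
   finally show ?thesis .
  qed
  have "((%t. (D t)^2 + (E t)^2) hasD 2*D t*(E t - mu*D t) + 2*E t*(- mu*E t + R)) (at t)"
   by (rule derivative_eq_intros dD dE refl | simp)+
  moreover have "2*D t*(E t - mu*D t) + 2*E t*(- mu*E t + R) <= - ((D t)^2 + (E t)^2)"
  proof -
   define V where "V = (D t)^2 + (E t)^2"
   have DE: "2*abs (D t)*abs (E t) <= V"
    using sum_squares_bound[of "abs (D t)" "abs (E t)"] by (simp add: V_def)
   have "abs (E t*R) <= abs (E t)*(rh*(A*abs (E t) + B*abs (D t)))"
    unfolding abs_mult using R by (intro mult_left_mono) auto
   also have "... = rh*(A*(E t)^2 + B*(abs (D t)*abs (E t)))" by (simp add: power2_eq_square algebra_simps)
   also have "... <= rh*(A*V + B*V)"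
   proof -
    have "(E t)^2 <= V" by (simp add: V_def)
    moreover have "1*(abs (D t)*abs (E t)) <= 2*(abs (D t)*abs (E t))"
     by (intro mult_right_mono) auto
    then have "abs (D t)*abs (E t) <= V" using DE by (simp only: mult.assoc)
    ultimately show ?thesis using rho AB by (intro mult_left_mono add_mono) auto
   qed
   also have "... = rh*(2*(A + B))*(V/2)" by (simp add: algebra_simps)
   also have "... <= 1*(V/2)" using rAB by (intro mult_right_mono) (auto simp: V_def)
   finally have ER: "2*(E t*R) <= V" by linarith
   have "D t*E t <= abs (D t)*abs (E t)" by (metis abs_ge_self abs_mult)
   then have DE': "2*(D t*E t) <= V" using DE by linarith
   have "2*mu*V >= 4*V" using mu by (intro mult_right_mono) (auto simp: V_def)
   moreover have "V >= 0" by (simp add: V_def)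
   moreover have "2*D t*(E t - mu*D t) + 2*E t*(- mu*E t + R) = 2*(D t*E t) + 2*(E t*R) - 2*mu*V"
    by (simp add: V_def power2_eq_square algebra_simps)
   ultimately show ?thesis unfolding V_def[symmetric] using ER DE' by linarith
  qed
  ultimately show ?thesis unfolding E_def D_def by blast
 qed
 moreover have "rh < mu^2" using rho mu4 by simp
 ultimately show ?thesis using rho(1) by blast
qed

section \<open>Singular orbits of the Emden system\<close>

lemma Bcontfun_apply:
 "continuous_on UNIV f ==> (!!x. norm (f x) <= M) ==> apply_bcontfun (Bcontfun f) = f"
 by (intro Bcontfun_inverse) (auto simp: bcontfun_def intro!: boundedI[of _ M])

lemma norm_bcontfun_le: "(!!x. norm (apply_bcontfun v x) <= M) ==> norm v <= M"
 by (simp add: norm_bound)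

text \<open>Picard iteration in the weighted unknown exp (- K*t)*x. The weight K = 2*L + 1 makes the
  integral operator a contraction with factor L/K <= 1/2 on an interval of any length. Clamping time
  by \<open>cl\<close> turns functions on {a..b} into bounded continuous functions on the line,
  where Banach's theorem is applied.\<close>

lemma lipschitz_ode_solution:
 fixes G :: "real => 'b::banach => 'b"
 assumes ab: "a <= b" and cont: "continuous_on ({a..b} \<times> UNIV) (%(t, x). G t x)"
  and lip: "!!t x y. a <= t ==> t <= b ==> norm (G t x - G t y) <= L*norm (x - y)" and L: "L >= 0"
 shows "EX x. x a = x0 & (\<forall>t\<in>{a..b}. (x has_vector_derivative G t (x t)) (at t within {a..b}))"
proof -
 define K where "K = 2*L + 1"
 have K: "K > 0" "L <= K/2" using L by (auto simp: K_def)
 define g where "g v s = G s (exp (K * s) *\<^sub>R v s)" for v :: "real => 'b" and s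
 define cl where "cl t = min b (max a t)" for t :: real
 have cl: "cl t \<in> {a..b}" for t using ab by (auto simp: cl_def)
 have cl_id: "cl t = t" if "t \<in> {a..b}" for t using that by (auto simp: cl_def)
 define Ph where "Ph v t = exp (- K*cl t) *\<^sub>R (x0 + integral {a..cl t} (g v))" for v t
 have gc: "continuous_on {a..b} (g v)" if "continuous_on UNIV v" for v
 proof -
  have "continuous_on {a..b} (%s. (s, exp (K * s) *\<^sub>R v s))"
   by (intro continuous_intros continuous_on_subset[OF that]) auto
  moreover have "(%s. (s, exp (K * s) *\<^sub>R v s)) ` {a..b} \<subseteq> {a..b} \<times> UNIV" by auto
  ultimately show ?thesis
   using continuous_on_compose2[OF cont, of "{a..b}" "%s. (s, exp (K * s) *\<^sub>R v s)"]
   by (simp add: g_def[abs_def])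
 qed
 have gi: "g v integrable_on {a..t}" if "continuous_on UNIV v" "t \<in> {a..b}" for v t
  using gc[OF that(1)] that(2) by (intro integrable_continuous_real continuous_on_subset[OF gc[OF that(1)]]) auto
 have Phi_cont: "continuous_on UNIV (Ph v)" if v: "continuous_on UNIV v" for v
 proof -
  have "continuous_on {a..b} (%t. integral {a..t} (g v))"
   using gc[OF v] by (intro indefinite_integral_continuous_1 integrable_continuous_real)
  then have "continuous_on UNIV (%t. integral {a..cl t} (g v))"
   by (rule continuous_on_compose2[of _ _ UNIV cl])
    (use cl in "auto simp: cl_def[abs_def] intro!: continuous_intros")
  then show ?thesis unfolding Ph_def cl_def[abs_def] by (intro continuous_intros)
 qed
 have Phi_bd: "EX M. ALL t. norm (Ph v t) <= M" if v: "continuous_on UNIV v" for v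
 proof -
  have "compact (Ph v ` {a..b})"
   using Phi_cont[OF v] by (intro compact_continuous_image) (auto intro: continuous_on_subset)
  then obtain M where M: "!!t. t \<in> {a..b} ==> norm (Ph v t) <= M"
   using compact_imp_bounded bounded_iff by (metis imageI)
  have "Ph v t = Ph v (cl t)" for t unfolding Ph_def using cl_id[OF cl] by simp
  then show ?thesis using M[OF cl] by metis
 qed
 define Ps :: "(real \<Rightarrow>\<^sub>C 'b) => (real \<Rightarrow>\<^sub>C 'b)" where "Ps v = Bcontfun (Ph (apply_bcontfun v))" for v
 have bc: "continuous_on UNIV (apply_bcontfun v)" for v :: "real \<Rightarrow>\<^sub>C 'b"
  using apply_bcontfun[of v] by (simp add: bcontfun_def)
 have Psi: "apply_bcontfun (Ps v) = Ph (apply_bcontfun v)" for v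
 proof -
  obtain M where "!!t. norm (Ph (apply_bcontfun v) t) <= M" using Phi_bd[OF bc] by blast
  then show ?thesis unfolding Ps_def by (intro Bcontfun_apply Phi_cont bc)
 qed
 have "dist (Ps v) (Ps w) <= 1/2*dist v w" for v w
 proof (rule dist_bound)
  fix t
  let ?d = "dist v w"
  define v' w' where "v' = apply_bcontfun v" and "w' = apply_bcontfun w"
  have c: "continuous_on UNIV v'" "continuous_on UNIV w'" by (simp_all add: v'_def w'_def bc)
  have dvw: "norm (v' s - w' s) <= ?d" for s unfolding v'_def w'_def
   using dist_fun_lt_imp_dist_val_lt dist_bounded[of v s w] by (simp add: dist_norm)
  have "dist (Ph v' t) (Ph w' t) = exp (- K*cl t)*norm (integral {a..cl t} (g v') - integral {a..cl t} (g w'))"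
   by (simp add: Ph_def dist_norm scaleR_diff_right[symmetric])
  also have "integral {a..cl t} (g v') - integral {a..cl t} (g w') = integral {a..cl t} (%s. g v' s - g w' s)"
   using gi c cl by (intro integral_diff[symmetric]) auto
  also have "norm (integral {a..cl t} (%s. g v' s - g w' s)) <= integral {a..cl t} (%s. L*?d*exp (K * s))"
  proof (rule integral_norm_bound_integral)
   show "(%s. g v' s - g w' s) integrable_on {a..cl t}" using gi c cl by (intro integrable_diff) auto
   show "(%s. L*?d*exp (K * s)) integrable_on {a..cl t}"
    by (intro integrable_continuous_real continuous_intros)
   fix s assume "s \<in> {a..cl t}"
   then have s: "a <= s" "s <= b" using cl[of t] by auto
   have "norm (g v' s - g w' s) <= L*norm (exp (K * s) *\<^sub>R v' s - exp (K * s) *\<^sub>R w' s)"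
    unfolding g_def by (rule lip[OF s])
   also have "... = L*exp (K * s)*norm (v' s - w' s)"
    by (simp add: scaleR_diff_right[symmetric])
   also have "... <= L*exp (K * s)*?d" using dvw L by (intro mult_left_mono) auto
   finally show "norm (g v' s - g w' s) <= L*?d*exp (K * s)" by (simp add: mult_ac)
  qed
  also have "integral {a..cl t} (%s. L*?d*exp (K * s)) = L*?d/K*exp (K*cl t) - L*?d/K*exp (K*a)"
  proof (intro integral_unique fundamental_theorem_of_calculus)
   show "a <= cl t" using cl[of t] by simp
   show "((%s. L*?d/K*exp (K * s)) has_vector_derivative L*?d*exp (K * s)) (at s within {a..cl t})" for s
    using K unfolding has_real_derivative_iff_has_vector_derivative[symmetric]
    by (auto intro!: derivative_eq_intros)
  qed
  also have "... <= L*?d/K*exp (K*cl t)" using L K by simp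
  also have "exp (- K*cl t)*(L*?d/K*exp (K*cl t)) = L/K*?d"
   by (simp add: mult_exp_exp)
  also have "... <= 1/2*?d" using K by (intro mult_right_mono) (auto simp: field_simps)
  finally show "dist (apply_bcontfun (Ps v) t) (apply_bcontfun (Ps w) t) <= 1/2*dist v w"
   unfolding Psi v'_def w'_def by (simp add: mult_left_mono)
 qed
 then obtain v where v: "Ps v = v" using banach_fix_type[of "1/2" Ps] by auto
 define x where "x t = exp (K*t) *\<^sub>R apply_bcontfun v t" for t
 have x_eq: "x t = x0 + integral {a..t} (%s. G s (x s))" if t: "t \<in> {a..b}" for t
 proof -
  have "apply_bcontfun v t = Ph (apply_bcontfun v) t" using Psi[of v] v by simp
  then show ?thesis
   using cl_id[OF t] by (simp add: x_def Ph_def g_def[abs_def] exp_minus)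
 qed
 have cx: "continuous_on {a..b} (%s. G s (x s))" using gc[OF bc[of v]] by (simp add: g_def[abs_def] x_def[abs_def])
 have "(x has_vector_derivative G t (x t)) (at t within {a..b})" if t: "t \<in> {a..b}" for t
 proof -
  have "((%t. x0 + integral {a..t} (%s. G s (x s))) has_vector_derivative 0 + G t (x t)) (at t within {a..b})"
   by (intro has_vector_derivative_add has_vector_derivative_const integral_has_vector_derivative[OF cx t])
  then show ?thesis
   by (intro has_vector_derivative_transform[OF t x_eq]) simp_all
 qed
 moreover have "x a = x0" using x_eq[of a] ab by simp
 ultimately show ?thesis by blast
qed

text \<open>The bounded solution of Y' = mu*Y - h: integrating from infinity removes the growing
  mode. In the reversed time - t the equilibrium is repelling, and this operator takes the place of
  an initial value problem.\<close>

definition resolvent :: "real => (real => real) => real => real" where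
 "resolvent mu h ta = exp (mu*ta)*integral {ta..} (%s. exp (- mu * s)*h s)"

context
 fixes mu :: real
 assumes mu: "mu > 0"
begin

lemma resolvent_integrable:
 assumes "continuous_on UNIV h" "!!s. abs (h s) <= M"
 shows "(%s. exp (- mu * s)*h s) integrable_on {ta..}"
proof -
 have "(%s. exp (- mu * s)*h s) absolutely_integrable_on {ta..}"
 proof (rule measurable_bounded_by_integrable_imp_absolutely_integrable)
  show "(%s. exp (- mu * s)*h s) \<in> borel_measurable (lebesgue_on {ta..})"
   by (intro continuous_imp_measurable_on_sets_lebesgue continuous_intros continuous_on_subset[OF assms(1)]) auto
  show "(%s. M*exp (- mu * s)) integrable_on {ta..}"
   using integrable_on_cmult_left[OF has_integral_integrable[OF has_integral_exp_minus_to_infinity[OF mu]], of M]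
   by simp
  show "norm (exp (- mu * s)*h s) <= M*exp (- mu * s)" for s
   using assms(2)[of s] by (simp add: abs_mult mult.commute mult_right_mono)
 qed simp
 then show ?thesis by (rule set_lebesgue_integral_eq_integral)
qed

lemma resolvent_bound:
 assumes "continuous_on UNIV h" "!!s. abs (h s) <= M"
 shows "abs (resolvent mu h ta) <= M/mu"
proof -
 have "norm (integral {ta..} (%s. exp (- mu * s)*h s)) <= integral {ta..} (%s. M*exp (- mu * s))"
 proof (rule integral_norm_bound_integral[OF resolvent_integrable[OF assms]])
  show "(%s. M*exp (- mu * s)) integrable_on {ta..}"
   using integrable_on_cmult_left[OF has_integral_integrable[OF has_integral_exp_minus_to_infinity[OF mu]], of M]
   by simp
  show "norm (exp (- mu * s)*h s) <= M*exp (- mu * s)" for s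
   using assms(2)[of s] by (simp add: abs_mult mult.commute mult_right_mono)
 qed
 also have "... = M*(exp (- mu*ta)/mu)"
  using has_integral_exp_minus_to_infinity[OF mu, of ta] by (simp add: integral_unique)
 finally have "exp (mu*ta)*norm (integral {ta..} (%s. exp (- mu * s)*h s)) <=
   exp (mu*ta)*(M*(exp (- mu*ta)/mu))"
  by (rule mult_left_mono) simp
 also have "... = M/mu" by (simp add: exp_minus)
 finally show ?thesis unfolding resolvent_def abs_mult by simp
qed

lemma resolvent_DERIV:
 assumes h: "continuous_on UNIV h" "!!s. abs (h s) <= M"
 shows "(resolvent mu h hasD mu*resolvent mu h ta - h ta) (at ta)"
proof -
 let ?g = "%s. exp (- mu * s)*h s"
 \<comment> \<open>Splitting off a fixed improper integral leaves an integral over a compact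
   interval to differentiate.\<close>
 define I where "I = integral {ta - 1..} ?g"
 have gi: "?g integrable_on {a..b}" for a b
  by (intro integrable_continuous_real continuous_intros continuous_on_subset[OF h(1)]) auto
 have split: "integral {t..} ?g = I - integral {ta - 1..t} ?g" if "t >= ta - 1" for t
 proof -
  have "(?g has_integral (integral {ta - 1..t} ?g + integral {t..} ?g)) ({ta - 1..t} \<union> {t..})"
   using gi resolvent_integrable[OF h]
   by (intro has_integral_Un integrable_integral) (auto intro: negligible_subset[of "{t}"])
  moreover have "{ta - 1..t} \<union> {t..} = {ta - 1..}" using that by auto
  ultimately show ?thesis by (simp add: I_def integral_unique)
 qed
 have "((%t. integral {ta - 1..t} ?g) has_vector_derivative ?g ta) (at ta within {ta - 1..ta + 1})"
  by (intro integral_has_vector_derivative continuous_intros continuous_on_subset[OF h(1)]) auto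
 then have "((%t. integral {ta - 1..t} ?g) hasD ?g ta) (at ta)"
  by (simp add: has_real_derivative_iff_has_vector_derivative at_within_Icc_at)
 then have "((%t. exp (mu*t)*(I - integral {ta - 1..t} ?g)) hasD
   exp (mu*ta)*mu*(I - integral {ta - 1..ta} ?g) + exp (mu*ta)*(0 - ?g ta)) (at ta)"
  by (auto intro!: derivative_eq_intros)
 moreover have "exp (mu*ta)*mu*(I - integral {ta - 1..ta} ?g) + exp (mu*ta)*(0 - ?g ta) =
   mu*resolvent mu h ta - h ta"
 proof -
  have "exp (mu*ta)*exp (- mu*ta) = 1" by (simp add: mult_exp_exp)
  moreover have "integral {ta..} ?g = I - integral {ta - 1..ta} ?g" by (rule split) simp
  ultimately show ?thesis unfolding resolvent_def by (simp only: mult.assoc[symmetric] right_diff_distrib) (simp add: algebra_simps)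
 qed
 ultimately have "((%t. exp (mu*t)*(I - integral {ta - 1..t} ?g)) hasD
   mu*resolvent mu h ta - h ta) (at ta)" by simp
 then show ?thesis
  by (rule has_field_derivative_transform_within_open[of _ _ _ "{ta - 1<..}"])
   (use split in "auto simp: resolvent_def")
qed

lemma resolvent_continuous:
 assumes "continuous_on UNIV h" "!!s. abs (h s) <= M"
 shows "continuous_on UNIV (resolvent mu h)"
 using resolvent_DERIV[OF assms] by (meson DERIV_isCont continuous_at_imp_continuous_on)

lemma resolvent_diff:
 assumes "continuous_on UNIV h" "!!s. abs (h s) <= M" "continuous_on UNIV h'" "!!s. abs (h' s) <= M'"
 shows "resolvent mu h ta - resolvent mu h' ta = resolvent mu (%s. h s - h' s) ta"
proof -
 have "integral {ta..} (%s. exp (- mu * s)*(h s - h' s)) =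
   integral {ta..} (%s. exp (- mu * s)*h s - exp (- mu * s)*h' s)"
  by (simp add: right_diff_distrib)
 also have "... = integral {ta..} (%s. exp (- mu * s)*h s) - integral {ta..} (%s. exp (- mu * s)*h' s)"
  by (rule integral_diff[OF resolvent_integrable[OF assms(1,2)] resolvent_integrable[OF assms(3,4)]])
 finally show ?thesis unfolding resolvent_def by (simp only: right_diff_distrib)
qed

end

lemma abs_one_minus_exp_le:
 assumes "abs x <= 1/2"
 shows "abs (1 - exp (- x)) <= 2*abs (x::real)"
proof -
 have "exp (- x) >= 1 - x" "exp (- x) <= 1 + 2*abs x"
  using exp_ge_add_one_self[of "- x"] exp_bound_lemma[of "- x"] assms by auto
 then show ?thesis by linarith
qed

text \<open>The bounds for Z are twice those for X because Z = Y - mu*X, where both terms are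
  controlled by the same number. The quadratic terms have Lipschitz constants proportional to
  \<open>r\<close>; the terms with \<open>h\<close> contribute 21 = 9 + 12 times
  \<open>rh\<close>.\<close>

lemma emden_nonlinearity_lipschitz:
 fixes X1 X2 Z1 Z2 h1 h2 a m r rh d :: real
 assumes r: "0 <= r" "r <= 1/2" "abs X1 <= r" "abs X2 <= r" "abs Z1 <= 2*r" "abs Z2 <= 2*r"
  and d: "abs (X1 - X2) <= d" "abs (Z1 - Z2) <= 2*d" and h: "abs h2 <= rh" "abs (h1 - h2) <= rh*abs (X1 - X2)" and m: "m >= 0"
 shows "abs ((m*(exp (- X1) - 1 + X1) + a*Z1^2 + h1*(2 + Z1)^2) -
   (m*(exp (- X2) - 1 + X2) + a*Z2^2 + h2*(2 + Z2)^2)) <= (2*m*r + 8*abs a*r + 21*rh)*d"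
proof -
 have d0: "d >= 0" "rh >= 0" using d h by linarith+
 have "norm ((exp (- X1) - 1 + X1) - (exp (- X2) - 1 + X2)) <= (2*r)*norm (X1 - X2)"
 proof (rule field_differentiable_bound[of "{-r..r}" _ "%x. 1 - exp (- x)"])
  fix x assume x: "x \<in> {-r..r}"
  show "((%x. exp (- x) - 1 + x) hasD 1 - exp (- x)) (at x within {-r..r})"
   by (auto intro!: derivative_eq_intros)
  have "abs (1 - exp (- x)) <= 2*abs x" using x r by (intro abs_one_minus_exp_le) auto
  also have "... <= 2*r" using x by auto
  finally show "norm (1 - exp (- x)) <= 2*r" by simp
 qed (use r in auto)
 also have "... <= 2*r*d" using d r by (intro mult_left_mono) auto
 finally have 1: "abs (m*((exp (- X1) - 1 + X1) - (exp (- X2) - 1 + X2))) <= m*(2*r*d)"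
  unfolding abs_mult using m by (intro mult_mono) auto
 have 2: "abs (a*((Z1 - Z2)*(Z1 + Z2))) <= abs a*((2*d)*(4*r))"
 proof -
  have "abs (Z1 + Z2) <= 4*r" using r by (simp add: abs_le_iff)
  then show ?thesis unfolding abs_mult using d(2) d0 by (intro mult_mono) auto
 qed
 have 3: "abs ((h1 - h2)*(2 + Z1)^2) <= (rh*d)*9"
 proof -
  have "abs (2 + Z1)^2 <= 3^2" using r by (intro power_mono) auto
  moreover have "rh*abs (X1 - X2) <= rh*d" using d d0 by (intro mult_left_mono) auto
  ultimately show ?thesis unfolding abs_mult using h d0 by (intro mult_mono) auto
 qed
 have 4: "abs (h2*((Z1 - Z2)*(4 + Z1 + Z2))) <= rh*((2*d)*6)"
 proof -
  have "abs (4 + Z1 + Z2) <= 6" using r by (simp add: abs_le_iff)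
  then show ?thesis unfolding abs_mult using d(2) d0 h(1) by (intro mult_mono) auto
 qed
 have "(m*(exp (- X1) - 1 + X1) + a*Z1^2 + h1*(2 + Z1)^2) -
   (m*(exp (- X2) - 1 + X2) + a*Z2^2 + h2*(2 + Z2)^2) =
   m*((exp (- X1) - 1 + X1) - (exp (- X2) - 1 + X2)) + a*((Z1 - Z2)*(Z1 + Z2)) +
   (h1 - h2)*(2 + Z1)^2 + h2*((Z1 - Z2)*(4 + Z1 + Z2))"
  by (simp add: power2_eq_square algebra_simps)
 also have "abs ... <= m*(2*r*d) + abs a*((2*d)*(4*r)) + (rh*d)*9 + rh*((2*d)*6)"
  by (intro order_trans[OF abs_triangle_ineq] add_mono 1 2 3 4)
 also have "... = (2*m*r + 8*abs a*r + 21*rh)*d" by (simp add: algebra_simps)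
 finally show ?thesis .
qed

text \<open>Here ta = - t, X = ln mu^2 - ln y and Z = z - 2. Because the eigenvalues coincide, the
  system becomes two copies of one scalar equation: X' = mu*X - Y for Y = Z + mu*X, and Y' = mu*Y -
  R with the nonlinear part \<open>R\<close>. So X is the resolvent of Y, and Y is a fixed point of
  the resolvent applied to \<open>R\<close>. As \<open>R\<close> has Lipschitz constant 1 in Y, the
  factor 1/mu < 1/2 of the resolvent gives the contraction.\<close>

lemma emden_fixed_point:
 assumes mu: "mu > 2" and r: "0 < r" "r <= 1/2" "2*mu^2*r + 8*abs a*r + 21*rh <= 1" "4*rh <= r"
  and H: "!!s. abs (H s) <= rh" "!!s s'. abs (H s - H s') <= rh*abs (s - s')"
 shows "EX X Z. (ALL ta. abs (X ta) <= r & abs (Z ta) <= 2*r) &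
  (ALL ta>ta0. (X hasD - Z ta) (at ta) &
   (Z hasD - (mu^2*(exp (- X ta) - 1) + a*(Z ta)^2 +
    H (X ta - 2*ta - ln (mu^2))*(2 + Z ta)^2 - 2*mu*Z ta)) (at ta))"
proof -
 have mu0: "mu > 0" using mu by simp
 have rho: "rh >= 0" using H(1)[of 0] by linarith
 have Hc: "continuous_on UNIV H"
 proof (rule continuous_on_iff[THEN iffD2], intro ballI allI impI)
  fix x e :: real assume e: "e > 0"
  show "EX d>0. \<forall>x'\<in>UNIV. dist x' x < d --> dist (H x') (H x) < e"
  proof (intro exI[of _ "e/(rh + 1)"] conjI ballI impI)
   show "e/(rh + 1) > 0" using e rho by simp
   fix x' assume "dist x' x < e/(rh + 1)"
   then have "(rh + 1)*abs (x' - x) < e" using rho by (simp add: dist_real_def field_simps)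
   then have "rh*abs (x' - x) < e" by (simp add: algebra_simps)
   then show "dist (H x') (H x) < e" using H(2)[of x' x] by (simp add: dist_real_def)
  qed
 qed
 have bc: "continuous_on UNIV (apply_bcontfun v)" for v :: "real \<Rightarrow>\<^sub>C real"
  using apply_bcontfun[of v] by (simp add: bcontfun_def)
 define c where "c ta = max ta ta0" for ta
 define X where "X Y = resolvent mu Y" for Y :: "real => real"
 define Z where "Z Y ta = Y ta - mu*X Y ta" for Y ta
 define N where "N x z h = mu^2*(exp (- x) - 1 + x) + a*z^2 + h*(2 + z)^2" for x z h
 define h where "h Y ta = H (X Y ta - 2*ta - ln (mu^2))" for Y ta
 define R where "R Y ta = N (X Y (c ta)) (Z Y (c ta)) (h Y (c ta))" for Y ta
 define S :: "(real => real) set" where "S = {Y. continuous_on UNIV Y & (ALL s. abs (Y s) <= r)}"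
 have XS: "abs (X Y ta) <= r" "abs (mu*X Y ta) <= r" "abs (Z Y ta) <= 2*r" if "Y \<in> S" for Y :: "real => real" and ta
 proof -
  have 1: "abs (X Y ta) <= r/mu" unfolding X_def by (rule resolvent_bound[OF mu0]) (use that in "auto simp: S_def")
  also have "... <= r" using r mu by (simp add: divide_le_eq)
  finally show "abs (X Y ta) <= r" .
  show 2: "abs (mu*X Y ta) <= r" using 1 mu by (simp add: abs_mult field_simps)
  have "abs (Y ta) <= r" using that by (simp add: S_def)
  with 2 show "abs (Z Y ta) <= 2*r" unfolding Z_def by linarith
 qed
 have Xc: "continuous_on A (X Y)" if "Y \<in> S" for Y :: "real => real" and A unfolding X_def
  by (rule continuous_on_subset[OF resolvent_continuous[OF mu0]]) (use that in "auto simp: S_def")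
 have cc: "continuous_on UNIV c" unfolding c_def[abs_def] by (intro continuous_intros)
 have Rc: "continuous_on UNIV (R Y)" if Y: "Y \<in> S" for Y
 proof -
  have Yc: "continuous_on A Y" for A using Y by (auto simp: S_def intro: continuous_on_subset)
  have 1: "continuous_on UNIV (%ta. X Y (c ta))"
   by (rule continuous_on_compose2[OF Xc[OF Y, of UNIV] cc]) simp
  have 2: "continuous_on UNIV (%ta. Z Y (c ta))" unfolding Z_def
   by (intro continuous_intros 1 continuous_on_compose2[OF Yc[of UNIV] cc]) simp
  have 3: "continuous_on UNIV (%ta. h Y (c ta))" unfolding h_def
   by (rule continuous_on_compose2[OF Hc]) (intro continuous_intros 1 cc, simp)
  show ?thesis unfolding R_def[abs_def] N_def by (intro continuous_intros 1 2 3)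
 qed
 have Rdiff: "abs (R Y ta - R Y' ta) <= d" if Y: "Y \<in> S" "Y' \<in> S" and d: "!!s. abs (Y s - Y' s) <= d" for Y Y' d ta
 proof -
  have d0: "d >= 0" using d[of 0] by linarith
  have Xd: "abs (X Y s - X Y' s) <= d/mu" for s
  proof -
   have "X Y s - X Y' s = resolvent mu (%s. Y s - Y' s) s" unfolding X_def
    by (rule resolvent_diff[OF mu0, of _ r _ r]) (use Y in "auto simp: S_def")
   then show ?thesis
    using resolvent_bound[OF mu0, of "%s. Y s - Y' s" d s] d Y by (simp add: S_def continuous_on_diff)
  qed
  also have "d/mu <= d/1" using mu d0 by (intro divide_left_mono) auto
  finally have Xd1: "abs (X Y s - X Y' s) <= d" for s by simp
  have Zd: "abs (Z Y s - Z Y' s) <= 2*d" for s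
  proof -
   have "abs (mu*(X Y s - X Y' s)) = mu*abs (X Y s - X Y' s)" using mu by (simp only: abs_mult)
   also have "... <= mu*(d/mu)" using Xd[of s] mu by (intro mult_left_mono) auto
   finally have "abs (mu*(X Y s - X Y' s)) <= d" using mu by simp
   moreover have "Z Y s - Z Y' s = (Y s - Y' s) - mu*(X Y s - X Y' s)" by (simp add: Z_def algebra_simps)
   ultimately show ?thesis using d[of s] by linarith
  qed
  have "abs (R Y ta - R Y' ta) <= (2*mu^2*r + 8*abs a*r + 21*rh)*d"
   unfolding R_def N_def
  proof (rule emden_nonlinearity_lipschitz)
   show "abs (h Y' (c ta)) <= rh" using H(1) by (simp add: h_def)
   show "abs (h Y (c ta) - h Y' (c ta)) <= rh*abs (X Y (c ta) - X Y' (c ta))"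
    unfolding h_def by (rule order_trans[OF H(2)]) simp
  qed (use r XS Y Xd1 Zd in auto)
  also have "... <= 1*d" using r(3) d0 by (rule mult_right_mono)
  finally show ?thesis by simp
 qed
 have zS: "(%_. 0) \<in> S" using r by (simp add: S_def)
 have R0: "abs (R (%_. 0) ta) <= r" for ta
 proof -
  have "X (%_. 0) s = 0" for s unfolding X_def resolvent_def by simp
  then have "abs (R (%_. 0) ta) = abs (h (%_. 0) (c ta))*4" by (simp add: R_def N_def Z_def abs_mult)
  also have "... <= rh*4" using H(1) by (intro mult_right_mono) (auto simp: h_def)
  finally show ?thesis using r by simp
 qed
 have Rb: "abs (R Y ta) <= 2*r" if "Y \<in> S" for Y :: "real => real" and ta
 proof -
  have "abs (R Y ta - R (%_. 0) ta) <= r" by (rule Rdiff[OF that zS]) (use that in "simp add: S_def")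
  then show ?thesis using R0[of ta] by linarith
 qed
 define Ps :: "(real \<Rightarrow>\<^sub>C real) => (real \<Rightarrow>\<^sub>C real)" where "Ps v = Bcontfun (resolvent mu (R (apply_bcontfun v)))" for v
 have Sv: "apply_bcontfun v \<in> S" if "v \<in> cball 0 r" for v :: "real \<Rightarrow>\<^sub>C real"
 proof -
  have "abs (apply_bcontfun v s) <= r" for s using order_trans[OF norm_bounded[of v s], of r] that by simp
  then show ?thesis using bc[of v] by (simp add: S_def)
 qed
 have Psi: "apply_bcontfun (Ps v) = resolvent mu (R (apply_bcontfun v))" "!!s. abs (resolvent mu (R (apply_bcontfun v)) s) <= r"
  if v: "v \<in> cball 0 r" for v :: "real \<Rightarrow>\<^sub>C real"
 proof -
  have "abs (resolvent mu (R (apply_bcontfun v)) s) <= 2*r/mu" for s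
   by (rule resolvent_bound[OF mu0 Rc Rb]) (use Sv[OF v] in auto)
  also have "2*r/mu <= r" using mu r by (simp add: divide_le_eq)
  finally show b: "abs (resolvent mu (R (apply_bcontfun v)) s) <= r" for s .
  then show "apply_bcontfun (Ps v) = resolvent mu (R (apply_bcontfun v))"
   unfolding Ps_def by (intro Bcontfun_apply[of _ r] resolvent_continuous[OF mu0 Rc Rb]) (use Sv[OF v] in auto)
 qed
 have "\<exists>!v\<in>cball 0 r. Ps v = v"
 proof (rule Banach_fix[of _ "1/2"])
  show "complete (cball (0 :: real \<Rightarrow>\<^sub>C real) r)" by (simp add: complete_eq_closed)
  show "cball (0 :: real \<Rightarrow>\<^sub>C real) r ~= {}" using r by simp
  show "Ps ` cball 0 r \<subseteq> cball 0 r"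
   using Psi by (auto intro!: norm_bcontfun_le)
  fix v w :: "real \<Rightarrow>\<^sub>C real" assume vw: "v \<in> cball 0 r" "w \<in> cball 0 r"
  show "dist (Ps v) (Ps w) <= 1/2*dist v w"
  proof (rule dist_bound)
   fix t
   let ?Rv = "R (apply_bcontfun v)" and ?Rw = "R (apply_bcontfun w)"
   have d: "abs (apply_bcontfun v s - apply_bcontfun w s) <= dist v w" for s
    using dist_bounded[of v s w] by (simp add: dist_real_def)
   have "resolvent mu ?Rv t - resolvent mu ?Rw t = resolvent mu (%s. ?Rv s - ?Rw s) t"
    by (rule resolvent_diff[OF mu0 Rc Rb Rc Rb]) (use Sv vw in auto)
   moreover have "abs (resolvent mu (%s. ?Rv s - ?Rw s) t) <= dist v w/mu"
    by (rule resolvent_bound[OF mu0]) (use Sv vw Rc Rdiff d in "auto intro!: continuous_on_diff")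
   moreover have "dist v w/mu <= dist v w/2" using mu by (intro divide_left_mono) auto
   ultimately show "dist (apply_bcontfun (Ps v) t) (apply_bcontfun (Ps w) t) <= 1/2*dist v w"
    unfolding Psi(1)[OF vw(1)] Psi(1)[OF vw(2)] dist_real_def by linarith
  qed
 qed auto
 then obtain v where v: "v \<in> cball 0 r" "Ps v = v" by auto
 define Y where "Y = apply_bcontfun v"
 have YS: "Y \<in> S" using Sv[OF v(1)] by (simp add: Y_def)
 have YR: "Y = resolvent mu (R Y)" using Psi(1)[OF v(1)] v(2) by (simp add: Y_def)
 have dX: "(X Y hasD - Z Y ta) (at ta)" for ta
  using resolvent_DERIV[OF mu0, of Y r ta] YS by (simp add: X_def Z_def S_def)
 have dY: "(Y hasD mu*Y ta - R Y ta) (at ta)" for ta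
  using resolvent_DERIV[OF mu0 Rc[OF YS] Rb[OF YS], of ta] YR by simp
 have dZ: "(Z Y hasD - (mu^2*(exp (- X Y ta) - 1) + a*(Z Y ta)^2 +
    H (X Y ta - 2*ta - ln (mu^2))*(2 + Z Y ta)^2 - 2*mu*Z Y ta)) (at ta)" if "ta > ta0" for ta
 proof -
  have "(Z Y hasD (mu*Y ta - R Y ta) - mu*- Z Y ta) (at ta)"
   unfolding Z_def[abs_def] by (intro DERIV_diff DERIV_cmult dX[unfolded Z_def] dY)
  moreover have "(mu*Y ta - R Y ta) - mu*- Z Y ta = - (mu^2*(exp (- X Y ta) - 1) + a*(Z Y ta)^2 +
    H (X Y ta - 2*ta - ln (mu^2))*(2 + Z Y ta)^2 - 2*mu*Z Y ta)"
  proof -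
   have "Y ta = Z Y ta + mu*X Y ta" by (simp add: Z_def)
   then show ?thesis using that
    by (simp only: R_def N_def c_def h_def max_absorb1 less_imp_le) (simp add: power2_eq_square algebra_simps)
  qed
  ultimately show ?thesis by (rule DERIV_cong)
 qed
 show ?thesis
  by (rule exI[of _ "X Y"], rule exI[of _ "Z Y"]) (use XS[OF YS] dX dZ in blast)
qed

lemma emden_singular_orbit_exists:
 assumes mu: "mu > 2"
 shows "EX rh>0. ALL H sg0. (ALL s<=sg0. abs (H s) <= rh) --> (ALL s<=sg0. ALL s'<=sg0. abs (H s - H s') <= rh*abs (s - s')) -->
  (EX T y z. emden_orbit mu (%t. H (2*t - ln (y t))) T y z & (ALL t<T. mu^2/2 <= y t & y t <= 2*mu^2))"
proof -
 define a where "a = mu*(mu - 4)/4"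
 \<comment> \<open>6 exceeds 21/4, the contribution of rh = r/4, so A*r = 1 yields the smallness
   condition of \<open>emden_fixed_point\<close>.\<close>
 define A where "A = 2*mu^2 + 8*abs a + 6"
 define r where "r = 1/A"
 define rh where "rh = r/4"
 have "A >= 6" by (simp add: A_def)
 then have r: "r > 0" "r <= 1/2" "A*r = 1" by (auto simp: r_def field_simps)
 then have rho: "rh > 0" "4*rh <= r" "2*mu^2*r + 8*abs a*r + 21*rh <= 1"
  by (auto simp: rh_def A_def algebra_simps)
 have mu4: "mu^2 > 0" using mu by simp
 have "EX T y z. emden_orbit mu (%t. H (2*t - ln (y t))) T y z & (ALL t<T. mu^2/2 <= y t & y t <= 2*mu^2)"
  if H: "ALL s<=sg0. abs (H s) <= rh" "ALL s<=sg0. ALL s'<=sg0. abs (H s - H s') <= rh*abs (s - s')" for H sg0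
 proof -
  define Hc where "Hc s = H (min s sg0)" for s
  \<comment> \<open>For ta > ta0 and |X| <= 1/2 the argument X - 2*ta - ln mu^2 stays below
    \<open>sg0\<close>, so the truncation \<open>Hc\<close> agrees with \<open>H\<close>.\<close>
  define ta0 where "ta0 = (1 - ln (mu^2) - sg0)/2"
  have "abs (Hc s - Hc s') <= rh*abs (s - s')" for s s'
  proof -
   have "abs (Hc s - Hc s') <= rh*abs (min s sg0 - min s' sg0)" unfolding Hc_def using H(2) by simp
   also have "... <= rh*abs (s - s')" using rho by (intro mult_left_mono) auto
   finally show ?thesis .
  qed
  then obtain X Z where XZ: "!!ta. abs (X ta) <= r & abs (Z ta) <= 2*r"
   and dX: "!!ta. ta > ta0 ==> (X hasD - Z ta) (at ta)"
   and dZ: "!!ta. ta > ta0 ==> (Z hasD - (mu^2*(exp (- X ta) - 1) + a*(Z ta)^2 +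
    Hc (X ta - 2*ta - ln (mu^2))*(2 + Z ta)^2 - 2*mu*Z ta)) (at ta)"
  proof -
   have "abs (Hc s) <= rh" for s using H(1) by (simp add: Hc_def)
   from emden_fixed_point[OF mu r(1,2) rho(3,2) this \<open>!!s s'. \<bar>Hc s - Hc s'\<bar> <= rh * \<bar>s - s'\<bar>\<close>, of ta0]
   show ?thesis using that by blast
  qed
  define y where "y t = mu^2*exp (- X (- t))" for t
  define z where "z t = 2 + Z (- t)" for t
  have lny: "2*t - ln (y t) = X (- t) - 2*(- t) - ln (mu^2)" for t
   using mu4 by (simp add: y_def ln_mult)
  have "emden_orbit mu (%t. H (2*t - ln (y t))) (- ta0) y z"
   unfolding emden_orbit_def
  proof (intro allI impI conjI)
   fix t assume t: "t < - ta0"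
   show "y t > 0" using mu4 by (simp add: y_def)
   show "z t > 0" using XZ[of "- t"] r by (auto simp: z_def abs_le_iff rh_def) 
   have dX': "((%t. X (- t)) hasD - Z (- t)*- 1) (at t)"
    using t by (intro DERIV_chain2[OF dX]) (auto intro!: derivative_eq_intros)
   then have "(y hasD mu^2*(exp (- X (- t))*- (- Z (- t)*- 1))) (at t)"
    unfolding y_def by (intro DERIV_cmult DERIV_fun_exp DERIV_minus)
   then show "(y hasD y t*(2 - z t)) (at t)" by (simp add: y_def z_def mult_ac)
   have Heq: "Hc (X (- t) - 2*(- t) - ln (mu^2)) = H (2*t - ln (y t))"
   proof -
    have "X (- t) - 2*(- t) - ln (mu^2) <= sg0"
     using XZ[of "- t"] r(2) t abs_ge_self[of "X (- t)"] unfolding ta0_def by argo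
    then show ?thesis by (simp add: Hc_def lny)
   qed
   have "((%t. Z (- t)) hasD - (mu^2*(exp (- X (- t)) - 1) + a*(Z (- t))^2 +
    Hc (X (- t) - 2*(- t) - ln (mu^2))*(2 + Z (- t))^2 - 2*mu*Z (- t))*- 1) (at t)"
    using t by (intro DERIV_chain2[OF dZ]) (auto intro!: derivative_eq_intros)
   then have "(z hasD 0 + - (mu^2*(exp (- X (- t)) - 1) + a*(Z (- t))^2 +
    Hc (X (- t) - 2*(- t) - ln (mu^2))*(2 + Z (- t))^2 - 2*mu*Z (- t))*- 1) (at t)"
    unfolding z_def by (intro DERIV_add DERIV_const)
   then show "(z hasD (mu*(mu - 4)/4 + H (2*t - ln (y t)))*(z t)^2 - mu*(mu - 2)*z t + y t) (at t)"
    unfolding Heq by (rule DERIV_cong) (simp add: z_def y_def a_def power2_eq_square field_simps)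
  qed
  moreover have "mu^2/2 <= y t & y t <= 2*mu^2" for t
  proof -
   have "exp (- X (- t)) >= 1/2" using exp_ge_add_one_self[of "- X (- t)"] XZ[of "- t"] r(2) by (simp add: abs_le_iff)
   then have "mu^2*(1/2) <= y t" unfolding y_def using mu4 by (intro mult_left_mono) auto
   moreover have "exp (- X (- t)) <= 2" using exp_bound_half[of "- X (- t)"] XZ[of "- t"] r(2) by simp
   then have "y t <= mu^2*2" unfolding y_def using mu4 by (intro mult_left_mono) auto
   ultimately show ?thesis by simp
  qed
  ultimately show ?thesis by blast
 qed
 then show ?thesis using rho by blast
qed

section \<open>The nonlinearity\<close>

locale jl_nonlinearity =
 fixes f f1 f2 :: "real => real" and mu k \<gamma> q' :: real
 assumes mu: "mu > 2"
  and f_deriv: "!!u. u >= 0 ==> (f hasD f1 u) (at u within {0..})"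
  and f1_deriv: "!!u. u >= 0 ==> (f1 hasD f2 u) (at u within {0..})"
  and f2_cont: "continuous_on {0..} f2"
  and f_pos: "!!u. u >= 0 ==> f u > 0"
  and F_finite: "set_integrable lebesgue {0..} (%s. 1/f s)"
  and f2_nonzero: "\<forall>\<^sub>F u in at_top. f2 u ~= 0"
  and q_lim: "((%u. (f1 u)^2/(f u*f2 u)) ---> q') at_top"
  and k: "0 < k" "k <= 2"
  and \<gamma>_lim: "((%u. (F_tail f u*f1 u - (mu - 2)^2/4)*(- ln (F_tail f u)) powr k) ---> \<gamma>) at_top"
begin

section \<open>The tail integral and its inverse\<close>

abbreviation "F \<equiv> F_tail f"

lemma f_cont: "continuous_on {0..} f" and f1_cont: "continuous_on {0..} f1"
 using f_deriv f1_deriv by (meson atLeast_iff continuous_on_eq_continuous_within DERIV_continuous)+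

lemma inv_f_cont: "continuous_on {0..} (%s. 1/f s)"
 by (intro continuous_intros f_cont) (use f_pos in fastforce)

text \<open>Trading the Lebesgue integral over a half-line for an integral over {0..u} makes the
  fundamental theorem of calculus available.\<close>

lemma F_eq: "u >= 0 ==> F u = F 0 - integral {0..u} (%s. 1/f s)"
proof -
 assume u: "u >= 0"
 have si: "set_integrable lebesgue {u..} (%s. 1/f s)"
  using F_finite by (rule set_integrable_subset) (use u in auto)
 have "((%s. 1/f s) has_integral integral {0..u} (%s. 1/f s) + integral {u..} (%s. 1/f s)) ({0..u} \<union> {u..})"
  using set_lebesgue_integral_eq_integral(1)[OF si] u
  by (intro has_integral_Un integrable_integral integrable_continuous_real continuous_on_subset[OF inv_f_cont])
   (auto intro: negligible_subset[of "{u}"])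
 moreover have "{0..u} \<union> {u..} = {0..}" using u by auto
 ultimately show ?thesis unfolding F_tail_def
  using set_lebesgue_integral_eq_integral(2)[OF si] set_lebesgue_integral_eq_integral(2)[OF F_finite]
  by (simp add: integral_unique)
qed

lemma F_deriv_within: "u >= 0 ==> (F hasD - (1/f u)) (at u within {0..})"
proof -
 assume u: "u >= 0"
 have "((%u. integral {0..u} (%s. 1/f s)) has_vector_derivative 1/f u) (at u within {0..u + 1})"
  by (intro integral_has_vector_derivative continuous_on_subset[OF inv_f_cont]) (use u in auto)
 then have "((%u. integral {0..u} (%s. 1/f s)) hasD 1/f u) (at u within {0..u + 1})"
  by (simp add: has_real_derivative_iff_has_vector_derivative)
 moreover have "at u within {0..u + 1} = at u within {0..}"
  by (rule at_within_nhd[of u "{u - 1<..<u + 1}"]) auto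
 ultimately have "((%u. F 0 - integral {0..u} (%s. 1/f s)) hasD 0 - 1/f u) (at u within {0..})"
  by (intro DERIV_diff DERIV_const) simp
 then have "((%u. F 0 - integral {0..u} (%s. 1/f s)) hasD - (1/f u)) (at u within {0..})" by simp
 then show ?thesis
  by (rule has_field_derivative_transform_within[where d = 1]) (use u F_eq in "simp_all only: atLeast_iff F_eq[symmetric] zero_less_one")
qed

lemma at_within_pos: "u > 0 ==> at u within {0..} = at (u::real)"
 by (rule at_within_interior) simp

lemma F_deriv: "u > 0 ==> (F hasD - (1/f u)) (at u)"
 using F_deriv_within[of u] at_within_pos by simp

lemma F_cont: "continuous_on {0..} F"
 using F_deriv_within by (meson atLeast_iff continuous_on_eq_continuous_within DERIV_continuous)

lemma F_strict:
 assumes "0 <= u" "u < v"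
 shows "F v < F u"
proof (rule DERIV_neg_imp_decreasing_open[OF assms(2)])
 fix x assume "u < x" "x < v"
 then show "EX y. (F hasD y) (at x) & y < 0"
  using F_deriv[of x] f_pos[of x] assms by (intro exI[of _ "- (1/f x)"]) auto
qed (use assms in "auto intro: continuous_on_subset[OF F_cont]")

lemma F_pos: "u >= 0 ==> F u > 0"
proof -
 assume u: "u >= 0"
 have "F (u + 1) >= 0" unfolding F_tail_def set_lebesgue_integral_def
  using u by (intro integral_nonneg_AE AE_I2) (simp add: indicator_def f_pos less_imp_le)
 then show ?thesis using F_strict[of u "u + 1"] u by simp
qed

lemma F_tendsto_0: "(F ---> 0) at_top"
proof -
 have F: "set_integrable lborel {0..} (%s. 1/f s)"
  unfolding set_integrable_def
 proof (rule integrable_completion[THEN iffD1])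
  show "(%x. indicat_real {0..} x *\<^sub>R (1/f x)) \<in> borel_measurable lborel"
   using borel_measurable_continuous_on_indicator[OF _ inv_f_cont] by simp
 qed (use F_finite in "simp add: set_integrable_def")
 have "((%t. LINT x:{0..t}|lborel. 1/f x) ---> (LINT x:{0..}|lborel. 1/f x)) at_top"
  by (rule tendsto_set_lebesgue_integral_at_top[OF _ F]) auto
 moreover have "(LINT x:{0..}|lborel. 1/f x) = F 0"
  unfolding F_tail_def set_lebesgue_integral_def
  by (rule integral_completion[symmetric]) (use borel_measurable_continuous_on_indicator[OF _ inv_f_cont] in simp)
 moreover have "(LINT x:{0..t}|lborel. 1/f x) = integral {0..t} (%s. 1/f s)" for t
  by (rule set_borel_integral_eq_integral(2), rule set_integrable_subset[OF F]) auto
 ultimately have "((%t. F 0 - integral {0..t} (%s. 1/f s)) ---> F 0 - F 0) at_top"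
  by (intro tendsto_intros) simp
 moreover have "\<forall>\<^sub>F t in at_top. F t = F 0 - integral {0..t} (%s. 1/f s)"
  using eventually_ge_at_top[of 0] by eventually_elim (rule F_eq)
 ultimately show ?thesis by (simp add: tendsto_cong)
qed

definition "Finv w = inv_into {0..} F w"

lemma F_inj: "inj_on F {0..}"
 by (rule inj_onI) (metis F_strict atLeast_iff less_irrefl linorder_neqE)

lemma Finv_F [simp]: "u >= 0 ==> Finv (F u) = u"
 unfolding Finv_def by (rule inv_into_f_f[OF F_inj]) simp

lemma F_surj:
 assumes "0 < w" "w <= F 0"
 shows "EX u>=0. F u = w"
proof -
 have "\<forall>\<^sub>F u in at_top. F u < w" using F_tendsto_0 assms(1) by (simp add: order_tendsto_iff)
 then obtain v where v: "v >= 0" "F v < w"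
  by (meson eventually_at_top_linorder max.cobounded1 max.cobounded2)
 then obtain u where "0 <= u" "F u = w"
  using IVT2'[of F v w 0] assms continuous_on_subset[OF F_cont, of "{0..v}"] by auto
 then show ?thesis by blast
qed

lemma Finv:
 assumes "0 < w" "w <= F 0"
 shows "Finv w >= 0" "F (Finv w) = w"
 using F_surj[OF assms] Finv_F by auto

lemma Finv_pos: "0 < w ==> w < F 0 ==> Finv w > 0"
 using Finv[of w] by (cases "Finv w = 0") auto

lemma Finv_ge: "0 < w ==> w <= F 0 ==> w <= F u ==> 0 <= u ==> u <= Finv w"
 using F_strict[of "Finv w" u] Finv[of w] by force

lemma Finv_deriv:
 assumes "0 < w" "w < F 0"
 shows "(Finv hasD - f (Finv w)) (at w)"
proof -
 define u where "u = Finv w"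
 have u: "u > 0" "F u = w" using Finv_pos[OF assms] Finv(2)[of w] assms by (auto simp: u_def)
 have "isCont Finv w"
 proof -
  have "isCont Finv (F u)"
  proof (rule isCont_inverse_function[where f = F and x = u and d = "u/2"])
   show "Finv (F z) = z" if "abs (z - u) <= u/2" for z
    by (rule Finv_F) (use that u in linarith)
   show "isCont F z" if "abs (z - u) <= u/2" for z
    by (rule DERIV_isCont[OF F_deriv]) (use that u in linarith)
  qed (use u in simp)
  then show ?thesis using u by simp
 qed
 then have "(Finv hasD inverse (- (1/f u))) (at w)"
  by (intro DERIV_inverse_function[where f = F and g = Finv and x = w and a = 0 and b = "F 0"])
   (use F_deriv[OF u(1)] f_pos[of u] u assms Finv(2) in "auto simp: u_def[symmetric]")
 then show ?thesis by (simp add: u_def)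
qed

lemma Finv_at_top: "filterlim Finv at_top (at_right 0)"
proof (rule filterlim_at_top[THEN iffD2], rule allI)
 fix Z :: real
 define u where "u = max Z 0"
 have "\<forall>\<^sub>F w in at_right 0. 0 < w & w < min (F u) (F 0)"
  unfolding eventually_at_right_field using F_pos[of u] F_pos[of 0] by (intro exI[of _ "min (F u) (F 0)"]) (auto simp: u_def)
 then show "\<forall>\<^sub>F w in at_right 0. Z <= Finv w"
 proof eventually_elim
  case (elim w)
  then have "u <= Finv w" by (intro Finv_ge) (auto simp: u_def)
  then show ?case by (simp add: u_def)
 qed
qed

text \<open>\<open>H\<close> is \<open>F f' - q\<close> as a function of \<open>ln F\<close>.\<close>

definition "u_of sg = Finv (exp sg)"
definition "H sg = exp sg*f1 (u_of sg) - (mu - 2)^2/4"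

lemma u_of: "sg <= ln (F 0) ==> u_of sg >= 0" "sg <= ln (F 0) ==> F (u_of sg) = exp sg"
 unfolding u_of_def using Finv[of "exp sg"] F_pos[of 0] by (simp_all add: ln_ge_iff)

lemma less_ln_iff: "0 < x ==> sg < ln x \<longleftrightarrow> exp sg < (x::real)"
 by (metis exp_less_cancel_iff exp_ln)

lemma u_of_pos: "sg < ln (F 0) ==> u_of sg > 0"
 unfolding u_of_def using Finv_pos[of "exp sg"] F_pos[of 0] by (simp add: less_ln_iff)

lemma u_of_F: "u >= 0 ==> u_of (ln (F u)) = u"
 using F_pos[of u] by (simp add: u_of_def)

lemma u_of_at_top: "filterlim u_of at_top at_bot"
proof -
 have "filterlim (exp :: real => real) (at_right 0) at_bot" by real_asymp
 then show ?thesis unfolding u_of_def[abs_def] by (rule filterlim_compose[OF Finv_at_top])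
qed

lemma u_of_deriv: "sg < ln (F 0) ==> (u_of hasD - f (u_of sg)*exp sg) (at sg)"
 unfolding u_of_def[abs_def]
 using DERIV_chain2[OF Finv_deriv[of "exp sg"] DERIV_exp] F_pos[of 0] by (simp add: less_ln_iff)

text \<open>Divide the hypothesis on \<open>\<gamma>\<close> by (- ln F)^k, which tends to infinity:
  it contains the convergence of F*f' to q_JL.\<close>

lemma F_u_of_lim: "((%u. F u*f1 u) ---> (mu - 2)^2/4) at_top"
proof -
 let ?G = "%u. F u*f1 u - (mu - 2)^2/4"
 have "\<forall>\<^sub>F u in at_top. F u \<in> {0<..} & F u ~= 0"
  using eventually_ge_at_top[of "0::real"] by eventually_elim (use F_pos in force)
 then have "filterlim F (at_right 0) at_top" using F_tendsto_0 by (simp add: filterlim_at)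
 then have "filterlim (%u. - ln (F u)) at_top at_top"
  by (intro filterlim_compose[OF filterlim_uminus_at_top_at_bot] filterlim_compose[OF ln_at_0])
 then have "filterlim (%u. (- ln (F u)) powr k) at_top at_top"
  by (rule filterlim_compose[rotated]) (use k in real_asymp)
 then have inf: "filterlim (%u. (- ln (F u)) powr k) at_infinity at_top"
  by (rule filterlim_at_top_imp_at_infinity)
 have "((%u. ?G u*(- ln (F u)) powr k/(- ln (F u)) powr k) ---> 0) at_top"
  by (rule tendsto_divide_0[OF \<gamma>_lim inf])
 moreover have "\<forall>\<^sub>F u in at_top. (- ln (F u)) powr k > 0"
  using \<open>filterlim (%u. (- ln (F u)) powr k) at_top at_top\<close> unfolding filterlim_at_top_dense by blast
 ultimately have "(?G ---> 0) at_top"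
  by (elim Lim_transform_eventually) (auto elim!: eventually_mono)
 then show ?thesis by (simp add: LIM_zero_iff)
qed

lemma H_lim: "(H ---> 0) at_bot"
proof -
 have "((%sg. F (u_of sg)*f1 (u_of sg) - (mu - 2)^2/4) ---> (mu - 2)^2/4 - (mu - 2)^2/4) at_bot"
  by (intro tendsto_diff tendsto_const filterlim_compose[OF F_u_of_lim u_of_at_top])
 then have "((%sg. F (u_of sg)*f1 (u_of sg) - (mu - 2)^2/4) ---> 0) at_bot" by simp
 then show ?thesis
 proof (rule Lim_transform_eventually)
  show "\<forall>\<^sub>F sg in at_bot. F (u_of sg)*f1 (u_of sg) - (mu - 2)^2/4 = H sg"
   using eventually_le_at_bot[of "ln (F 0)"] by eventually_elim (simp add: H_def u_of(2))
 qed
qed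

lemma H_gamma: "((%sg. H sg*(- sg) powr k) ---> \<gamma>) at_bot"
 using filterlim_compose[OF \<gamma>_lim u_of_at_top]
proof (rule Lim_transform_eventually)
 show "\<forall>\<^sub>F sg in at_bot. (F (u_of sg)*f1 (u_of sg) - (mu - 2)^2/4)*(- ln (F (u_of sg))) powr k = H sg*(- sg) powr k"
  using eventually_le_at_bot[of "ln (F 0)"] by eventually_elim (simp add: H_def u_of(2))
qed

text \<open>The derivative of \<open>H\<close>, as u_of' = - f*F. Where f' and f'' do not vanish it
  equals P - P^2/Q with P = F*f' and Q = f'^2/(f*f'').\<close>

definition "H1 sg = exp sg*f1 (u_of sg) - (exp sg)^2*(f (u_of sg)*f2 (u_of sg))"

lemma H_deriv: "sg < ln (F 0) ==> (H hasD H1 sg) (at sg)"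
proof -
 assume s: "sg < ln (F 0)"
 have "(f1 hasD f2 (u_of sg)) (at (u_of sg))"
  using f1_deriv[of "u_of sg"] u_of_pos[OF s] at_within_pos by simp
 from DERIV_chain2[OF this u_of_deriv[OF s]]
 have "((%sg. f1 (u_of sg)) hasD f2 (u_of sg)*(- f (u_of sg)*exp sg)) (at sg)" .
 from DERIV_diff[OF DERIV_mult[OF DERIV_exp this] DERIV_const]
 show ?thesis unfolding H_def[abs_def] H1_def by (rule DERIV_cong) (simp add: power2_eq_square algebra_simps)
qed

text \<open>The limit of Q enters here. \<open>H\<close> converges, so by the mean value theorem on
  [s - 1, s] its derivative is small at points tending to minus infinity. If Q has a nonzero limit,
  \<open>H1\<close> converges and its limit must be 0; if Q tends to 0, P^2/Q is unbounded and
  \<open>H1\<close> stays away from 0, which those points exclude.\<close>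

lemma H1_lim: "(H1 ---> 0) at_bot"
proof -
 define q where "q = (mu - 2)^2/4"
 have q: "q > 0" using mu by (simp add: q_def)
 define P where "P sg = exp sg*f1 (u_of sg)" for sg
 define Q where "Q u = (f1 u)^2/(f u*f2 u)" for u
 have P: "(P ---> q) at_bot"
  using tendsto_add[OF H_lim tendsto_const[of q]] by (simp add: H_def[abs_def] P_def[abs_def] q_def)
 have Q: "((%sg. Q (u_of sg)) ---> q') at_bot"
  using filterlim_compose[OF q_lim u_of_at_top] by (simp add: Q_def)
 have Ppos: "\<forall>\<^sub>F sg in at_bot. P sg > q/2" using order_tendstoD(1)[OF P, of "q/2"] q by simp
 have f2n: "\<forall>\<^sub>F sg in at_bot. f2 (u_of sg) ~= 0"
  using u_of_at_top f2_nonzero unfolding filterlim_iff by blast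
 have "\<forall>\<^sub>F sg in at_bot. Q (u_of sg) ~= 0 & H1 sg = P sg - (P sg)^2/Q (u_of sg)"
  using Ppos f2n eventually_le_at_bot[of "ln (F 0)"]
 proof eventually_elim
  case (elim sg)
  have "f1 (u_of sg) ~= 0" using elim(1) q by (auto simp: P_def)
  moreover have "f (u_of sg) > 0" using f_pos u_of elim(3) by simp
  ultimately show ?case using elim(2) by (simp add: Q_def P_def H1_def power_mult_distrib)
 qed
 note H1_eq = this
 have mvt: "EX xi<s. H (s) - H (s - 1) = H1 xi" if "s < ln (F 0)" for s
  using MVT2[of "s - 1" s H H1] H_deriv that by force
 have Hdiff: "((%s. H s - H (s - 1)) ---> 0 - 0) at_bot"
 proof (intro tendsto_diff H_lim filterlim_compose[OF H_lim])
  show "filterlim (%s. s - 1 :: real) at_bot at_bot" by real_asymp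
 qed
 have freq: "~ (\<forall>\<^sub>F sg in at_bot. abs (H1 sg) >= c)" if c: "c > 0" for c
 proof
  assume "\<forall>\<^sub>F sg in at_bot. abs (H1 sg) >= c"
  then obtain N where N: "!!sg. sg <= N ==> abs (H1 sg) >= c" by (auto simp: eventually_at_bot_linorder)
  have "\<forall>\<^sub>F s in at_bot. abs (H s - H (s - 1)) < c"
   using tendstoD[OF Hdiff c] by (simp add: dist_real_def)
  moreover have "\<forall>\<^sub>F s in at_bot. s < ln (F 0)" "\<forall>\<^sub>F s in at_bot. s < N" by (rule eventually_gt_at_bot)+
  ultimately have "\<forall>\<^sub>F s in at_bot. abs (H s - H (s - 1)) < c & s < ln (F 0) & s < N"
   by eventually_elim simp
  then obtain s where s: "abs (H s - H (s - 1)) < c" "s < ln (F 0)" "s < N"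
   using eventually_happens'[OF trivial_limit_at_bot_linorder] by blast
  then obtain xi where "xi < s" "H s - H (s - 1) = H1 xi" using mvt by blast
  then show False using N[of xi] s by simp
 qed
 show ?thesis
 proof (cases "q' = 0")
  case True
  have "\<forall>\<^sub>F sg in at_bot. abs (Q (u_of sg)) < min 1 (q^2/(4*(2*q + 1)))"
   using tendstoD[OF Q, of "min 1 (q^2/(4*(2*q + 1)))"] True q by simp
  moreover have "\<forall>\<^sub>F sg in at_bot. P sg < 2*q" using order_tendstoD(2)[OF P, of "2*q"] q by simp
  ultimately have "\<forall>\<^sub>F sg in at_bot. abs (H1 sg) >= 1" using H1_eq Ppos
  proof eventually_elim
   case (elim sg)
   \<comment> \<open>P > q/2 and the bound on |Q| give P^2/|Q| >= 2*q + 1, while P < 2*q; hence |H1|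
     >= 1.\<close>
   have "2*q + 1 <= (q/2)^2/abs (Q (u_of sg))"
    using elim q by (simp add: field_simps power2_eq_square)
   also have "... <= (P sg)^2/abs (Q (u_of sg))"
    using elim q by (intro divide_right_mono power_mono) auto
   also have "... = abs ((P sg)^2/Q (u_of sg))" by simp
   finally show ?case using elim q by linarith
  qed
  then show ?thesis using freq[of 1] by simp
 next
  case False
  have "((%sg. P sg - (P sg)^2/Q (u_of sg)) ---> q - q^2/q') at_bot"
   by (intro tendsto_intros P Q False)
  then have L: "(H1 ---> q - q^2/q') at_bot"
   by (rule Lim_transform_eventually) (use H1_eq in "auto elim!: eventually_mono")
  have "q - q^2/q' = 0"
  proof (rule ccontr)
   assume n: "q - q^2/q' ~= 0"
   define l where "l = q - q^2/q'"
   have "\<forall>\<^sub>F sg in at_bot. abs (H1 sg - l) < abs l/2"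
    using tendstoD[OF L, of "abs l/2"] n by (simp add: dist_real_def l_def)
   then have "\<forall>\<^sub>F sg in at_bot. abs (H1 sg) >= abs l/2" by eventually_elim linarith
   then show False using freq[of "abs l/2"] n by (simp add: l_def)
  qed
  then show ?thesis using L by simp
 qed
qed

lemma H_small:
 assumes "rh > 0"
 shows "EX sg0<ln (F 0). (ALL s<=sg0. abs (H s) <= rh) & (ALL s<=sg0. ALL s'<=sg0. abs (H s - H s') <= rh*abs (s - s'))"
proof -
 have "\<forall>\<^sub>F s in at_bot. abs (H s) < rh & abs (H1 s) < rh & s < ln (F 0)"
  using tendstoD[OF H_lim assms] tendstoD[OF H1_lim assms] eventually_gt_at_bot[of "ln (F 0)"]
  by eventually_elim simp
 then obtain sg0 where s0: "!!s. s <= sg0 ==> abs (H s) < rh & abs (H1 s) < rh & s < ln (F 0)"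
  by (auto simp: eventually_at_bot_linorder)
 have "abs (H s - H s') <= rh*abs (s - s')" if "s <= sg0" "s' <= sg0" for s s'
  using field_differentiable_bound[of "{..sg0}" H H1 rh s s'] s0 that
  by (force intro: has_field_derivative_at_within[OF H_deriv] less_imp_le)
 then show ?thesis using s0 by (intro exI[of _ sg0]) (auto intro: less_imp_le)
qed

end

section \<open>Radial functions\<close>

definition radial_ode :: "(real => real) => real => real => (real => real) => (real => real) => real => real => bool" where
 "radial_ode f N l u u1 a b \<longleftrightarrow> (ALL r. a < r & r < b --> (u hasD u1 r) (at r) &
  (u1 hasD - (N - 1)/r*u1 r - l*f (u r)) (at r))"

lemma pderiv_dir_eq: "(u has_derivative D) (at x) ==> pderiv_dir i u x = D i"
 unfolding pderiv_dir_def using frechet_derivative_at by metis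

lemma has_derivative_norm':
 "x ~= 0 ==> (norm has_derivative (%h. (x \<bullet> h)/norm x)) (at (x::'a::euclidean_space))"
proof -
 assume "x ~= 0"
 moreover have "(%h. h \<bullet> sgn x) = (%h. (x \<bullet> h)/norm x)"
  by (intro ext) (simp add: sgn_div_norm inner_commute[of x] divide_inverse mult.commute)
 ultimately show ?thesis using has_derivative_norm[of x] by simp
qed

lemma radial_has_derivative:
 assumes "(U hasD U1) (at (norm x))" "x ~= (0::'a::euclidean_space)"
 shows "(radial U has_derivative (%h. U1*((x \<bullet> h)/norm x))) (at x)"
proof -
 have eq: "radial U = (%x::'a. U (norm x))" by (rule ext) (simp add: radial_def)
 show ?thesis unfolding eq
  using has_derivative_compose[OF has_derivative_norm'[OF assms(2)], of U "%h. U1*h"] assms(1)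
  by (simp add: has_field_derivative_def)
qed

lemma radial_pderiv:
 assumes "(U hasD U1) (at (norm x))" "x ~= (0::'a::euclidean_space)"
 shows "pderiv_dir i (radial U) x = U1*((x \<bullet> i)/norm x)"
 using pderiv_dir_eq[OF radial_has_derivative[OF assms]] .

lemma radial_pderiv2:
 fixes x :: "'a::euclidean_space"
 assumes U: "!!r. a < r ==> r < b ==> (U hasD U1 r) (at r)"
  and U1: "(U1 hasD U2) (at (norm x))" and x: "0 <= a" "a < norm x" "norm x < b"
 shows "(pderiv_dir i (radial U) has_derivative (%h. U2*((x \<bullet> h)/norm x)*((x \<bullet> i)/norm x) +
   U1 (norm x)*((h \<bullet> i)/norm x - (x \<bullet> i)*(x \<bullet> h)/norm x^3))) (at x)"
proof (rule has_derivative_transform_within_open)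
 let ?A = "{y::'a. a < norm y & norm y < b}"
 show "open ?A" by (intro open_Collect_conj open_Collect_less continuous_intros)
 show "x \<in> ?A" using x by simp
 show "radial U1 y*((y \<bullet> i)/norm y) = pderiv_dir i (radial U) y" if "y \<in> ?A" for y
  using radial_pderiv[OF U[of "norm y"], of i] that x by (force simp: radial_def)
 have x0: "x ~= 0" "norm x > 0" using x by auto
 note n = has_derivative_norm'[OF x0(1)]
 have "((%y. (y \<bullet> i)/norm y) has_derivative
   (%h. ((h \<bullet> i)*norm x - (x \<bullet> i)*((x \<bullet> h)/norm x))/(norm x*norm x))) (at x)"
  using x0 by (intro has_derivative_divide' has_derivative_inner_left has_derivative_ident n) auto
 from has_derivative_mult[OF radial_has_derivative[OF U1 x0(1)] this]
 have "((%y. radial U1 y*((y \<bullet> i)/norm y)) has_derivative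
   (%h. radial U1 x*(((h \<bullet> i)*norm x - (x \<bullet> i)*((x \<bullet> h)/norm x))/(norm x*norm x)) +
   U2*((x \<bullet> h)/norm x)*((x \<bullet> i)/norm x))) (at x)" .
 moreover have "(%h. radial U1 x*(((h \<bullet> i)*norm x - (x \<bullet> i)*((x \<bullet> h)/norm x))/(norm x*norm x)) +
   U2*((x \<bullet> h)/norm x)*((x \<bullet> i)/norm x)) =
  (%h. U2*((x \<bullet> h)/norm x)*((x \<bullet> i)/norm x) +
   U1 (norm x)*((h \<bullet> i)/norm x - (x \<bullet> i)*(x \<bullet> h)/norm x^3))"
  using x0(2) by (intro ext) (simp add: radial_def field_simps power3_eq_cube)
 ultimately show "((%y. radial U1 y*((y \<bullet> i)/norm y)) has_derivative
  (%h. U2*((x \<bullet> h)/norm x)*((x \<bullet> i)/norm x) +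
   U1 (norm x)*((h \<bullet> i)/norm x - (x \<bullet> i)*(x \<bullet> h)/norm x^3))) (at x)" by simp
qed

lemma radial_laplacian:
 fixes x :: "'a::euclidean_space"
 assumes U: "!!r. a < r ==> r < b ==> (U hasD U1 r) (at r)"
  and U1: "(U1 hasD U2) (at (norm x))" and x: "0 <= a" "a < norm x" "norm x < b"
 shows "laplacian (radial U) x = U2 + (real DIM('a) - 1)/norm x*U1 (norm x)"
proof -
 have r: "norm x > 0" using x by auto
 have "pderiv_dir i (pderiv_dir i (radial U)) x =
   (x \<bullet> i)^2*(U2/(norm x)^2 - U1 (norm x)/norm x^3) + U1 (norm x)/norm x" if "i \<in> Basis" for i
 proof -
  have alg: "v * (c/n)*(c/n) + w*(1/n - c*c/n^3) = c^2*(v/n^2 - w/n^3) + w/n"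
   if "n > 0" for v w c n :: real
   using that by (simp add: power2_eq_square power3_eq_cube divide_simps) (simp add: algebra_simps)
  have "(pderiv_dir i (radial U) has_derivative (%h. U2*((x \<bullet> h)/norm x)*((x \<bullet> i)/norm x) +
   U1 (norm x)*((h \<bullet> i)/norm x - (x \<bullet> i)*(x \<bullet> h)/norm x^3))) (at x)"
   by (rule radial_pderiv2[OF U U1 x])
  from pderiv_dir_eq[OF this, of i] show ?thesis using that alg[OF r] by simp
 qed
 then have "laplacian (radial U) x = (\<Sum>i\<in>Basis. (x \<bullet> i)^2)*(U2/(norm x)^2 - U1 (norm x)/norm x^3) +
   real DIM('a)*(U1 (norm x)/norm x)"
  by (simp add: laplacian_def sum.distrib sum_distrib_right)
 also have "(\<Sum>i\<in>Basis. (x \<bullet> i)^2) = (norm x)^2"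
  by (simp only: power2_norm_eq_inner euclidean_inner[of x x]) (simp add: power2_eq_square)
 finally show ?thesis using r by (simp add: field_simps power2_eq_square power3_eq_cube)
qed

lemma line_derivative:
 fixes v :: "'a::euclidean_space => real"
 assumes "v differentiable (at (r *\<^sub>R e))"
 shows "((%r. v (r *\<^sub>R e)) hasD pderiv_dir e v (r *\<^sub>R e)) (at r)"
proof -
 have D: "(v has_derivative frechet_derivative v (at (r *\<^sub>R e))) (at (r *\<^sub>R e))"
  using assms frechet_derivative_works by blast
 have "((%r. v (r *\<^sub>R e)) has_derivative (%h. frechet_derivative v (at (r *\<^sub>R e)) (h *\<^sub>R e))) (at r)"
  by (rule has_derivative_compose[of "%r. r *\<^sub>R e" "%h. h *\<^sub>R e", OF _ D])
   (auto intro!: derivative_eq_intros)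
 moreover have "(%h. frechet_derivative v (at (r *\<^sub>R e)) (h *\<^sub>R e)) = (*) (pderiv_dir e v (r *\<^sub>R e))"
  using linear_scale[OF has_derivative_linear[OF D]] by (auto simp: pderiv_dir_def mult.commute)
 ultimately show ?thesis by (simp add: has_field_derivative_def)
qed

text \<open>Restriction to a ray through a basis vector turns partial derivatives into ordinary
  ones. Of the smoothness at the origin only the bound on \<open>u1\<close> is kept; it makes the
  flux r^(N - 1)*u1 vanish there.\<close>

lemma regular_solution_profile:
 assumes reg: "regular_solution f l (radial u :: 'a::euclidean_space => real)"
 shows "EX u1. radial_ode f (real DIM('a)) l u u1 0 1 & continuous_on {0..1} u & u 1 = 0 &
  (ALL r. 0 <= r & r < 1 --> u r > 0) & (EX M. ALL r. 0 < r & r < 1/2 --> abs (u1 r) <= M) & l > 0"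
proof -
 obtain e :: 'a where e: "e \<in> Basis" using nonempty_Basis by blast
 then have ne: "norm e = 1" by simp
 let ?v = "radial u :: 'a => real"
 define u1 where "u1 r = pderiv_dir e ?v (r *\<^sub>R e)" for r
 define u2 where "u2 r = pderiv_dir e (pderiv_dir e ?v) (r *\<^sub>R e)" for r
 have Ck: "Ck_on 2 (ball 0 1) ?v" and cont: "continuous_on (cball 0 1) ?v"
  and eq: "!!x. x \<in> ball 0 1 ==> - laplacian ?v x = l*f (?v x)"
  and pos: "!!x. x \<in> ball 0 1 ==> ?v x > 0" and bd: "!!x. x \<in> sphere 0 1 ==> ?v x = 0" and l: "l > 0"
  using reg unfolding regular_solution_def by auto
 have diff: "?v differentiable (at x)" "pderiv_dir e ?v differentiable (at x)" if "x \<in> ball 0 1" for x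
  using Ck that e by (auto simp: numeral_2_eq_2)
 have v_eq: "?v (r *\<^sub>R e) = u r" if "r >= 0" for r using that ne by (simp add: radial_def)
 have b: "r *\<^sub>R e \<in> ball 0 1" if "0 < r" "r < 1" for r using that ne by simp
 have d1: "(u hasD u1 r) (at r)" if r: "0 < r" "r < 1" for r
  unfolding u1_def using line_derivative[OF diff(1)[OF b[OF r]]]
  by (rule has_field_derivative_transform_within_open[of _ _ _ "{0<..}"]) (use r v_eq in auto)
 have d2: "(u1 hasD u2 r) (at r)" if r: "0 < r" "r < 1" for r
  unfolding u1_def u2_def using line_derivative[OF diff(2)[OF b[OF r]]] .
 have ode: "u2 r = - (real DIM('a) - 1)/r*u1 r - l*f (u r)" if r: "0 < r" "r < 1" for r
 proof -
  have n: "norm (r *\<^sub>R e) = r" using r ne by simp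
  have "laplacian ?v (r *\<^sub>R e) = u2 r + (real DIM('a) - 1)/r*u1 r"
   using radial_laplacian[of 0 1 u u1 "u2 r" "r *\<^sub>R e"] d1 d2[OF r] r n by simp
  moreover have "- laplacian ?v (r *\<^sub>R e) = l*f (u r)" using eq[OF b[OF r]] v_eq r by simp
  moreover have "- (real DIM('a) - 1)/r*u1 r = - ((real DIM('a) - 1)/r*u1 r)"
   by (simp only: minus_divide_left[symmetric] mult_minus_left)
  ultimately show ?thesis by linarith
 qed
 have "continuous_on (ball 0 1) (pderiv_dir e ?v)"
  using diff(2) by (intro continuous_at_imp_continuous_on ballI differentiable_imp_continuous_within) auto
 then have "continuous_on (cball 0 (1/2)) (pderiv_dir e ?v)" by (rule continuous_on_subset) auto
 then have "compact (pderiv_dir e ?v ` cball 0 (1/2))" by (rule compact_continuous_image) simp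
 then obtain M where M: "!!x. x \<in> cball 0 (1/2) ==> abs (pderiv_dir e ?v x) <= M"
  using compact_imp_bounded bounded_iff by (metis imageI real_norm_def)
 have "abs (u1 r) <= M" if "0 < r" "r < 1/2" for r unfolding u1_def using that ne by (intro M) simp
 moreover have "continuous_on {0..1} u"
 proof -
  have "continuous_on {0..1} (%r. ?v (r *\<^sub>R e))"
   by (rule continuous_on_compose2[OF cont]) (use ne in "auto intro!: continuous_intros")
  then show ?thesis by (rule continuous_on_cong[THEN iffD1, rotated -1]) (use v_eq in auto)
 qed
 moreover have "u 1 = 0" using bd[of e] ne by (simp add: radial_def)
 moreover have "u r > 0" if "0 <= r" "r < 1" for r
  using pos[of "r *\<^sub>R e"] v_eq[OF that(1)] that ne by simp
 moreover have "radial_ode f (real DIM('a)) l u u1 0 1" unfolding radial_ode_def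
  using d1 d2 ode by force
 ultimately show ?thesis using l by blast
qed

section \<open>One-sided derivatives, singular profiles and scaling\<close>

lemma deriv_on_eq:
 assumes "(g hasD D) (at x within S)" "at x within S ~= bot"
 shows "deriv_on S g x = D"
 unfolding deriv_on_def using assms vector_derivative_within
 by (metis has_real_derivative_iff_has_vector_derivative)

lemma deriv_on_works:
 "g differentiable (at x within S) ==> (g hasD deriv_on S g x) (at x within S)"
 unfolding deriv_on_def has_real_derivative_iff_has_vector_derivative
 using vector_derivative_works by blast

lemma at_within_Ioc_bot: "x \<in> {0<..1} ==> at (x::real) within {0<..1} ~= bot"
 and at_within_atLeast_bot: "x \<in> {0..} ==> at (x::real) within {0..} ~= bot"
proof -
 assume x: "x \<in> {0<..1}"
 have "x islimpt {0<..1}"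
  by (rule islimpt_subset[of x "{0<..<x}"]) (use x islimpt_greaterThanLessThan2[of 0 x] in auto)
 then show "at x within {0<..1} ~= bot" by (simp add: trivial_limit_within)
next
 assume x: "x \<in> {0..}"
 have "x islimpt {0..}"
  by (rule islimpt_subset[of x "{x<..<x+1}"]) (use x islimpt_greaterThanLessThan1[of x "x+1"] in auto)
 then show "at x within {0..} ~= bot" by (simp add: trivial_limit_within)
qed

lemma singular_solution_profile:
 assumes sing: "radial_singular_solution TYPE('a::euclidean_space) f l U"
 shows "radial_ode f (real DIM('a)) l U (deriv_on {0<..1} U) 0 1"
  "!!r. 0 < r ==> r <= 1 ==> (U hasD deriv_on {0<..1} U r) (at r within {0<..1})"
  "continuous_on {0<..1} (deriv_on {0<..1} U)"
proof -
 let ?U1 = "deriv_on {0<..1} U"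
 have C2: "C2_on {0<..1} U" and eq: "!!x::'a. 0 < norm x ==> norm x < 1 ==> - laplacian (radial U) x = l*f (radial U x)"
  using sing unfolding radial_singular_solution_def by auto
 show d: "(U hasD ?U1 r) (at r within {0<..1})" if "0 < r" "r <= 1" for r
  using C2 that unfolding C2_on_def by (intro deriv_on_works) auto
 have dd: "(?U1 hasD deriv_on {0<..1} ?U1 r) (at r within {0<..1})" if "0 < r" "r <= 1" for r
  using C2 that unfolding C2_on_def by (intro deriv_on_works) auto
 show "continuous_on {0<..1} ?U1"
  using dd by (meson DERIV_continuous continuous_on_eq_continuous_within greaterThanAtMost_iff)
 have at: "at r within {0<..1} = at r" if "0 < r" "r < 1" for r :: real
  by (rule at_within_open_subset[of r "{0<..<1}"]) (use that in auto)
 show "radial_ode f (real DIM('a)) l U ?U1 0 1" unfolding radial_ode_def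
 proof (intro allI impI conjI; elim conjE)
  fix r :: real assume r: "0 < r" "r < 1"
  show 1: "(U hasD ?U1 r) (at r)" using d[of r] at[OF r] r by simp
  obtain e :: 'a where e: "e \<in> Basis" using nonempty_Basis by blast
  then have n: "norm (r *\<^sub>R e) = r" using r by simp
  have d1: "(U hasD ?U1 r) (at r)" if "0 < r" "r < 1" for r
   using d[of r] at[of r] that by simp
  have d2: "(?U1 hasD deriv_on {0<..1} ?U1 r) (at r)" using dd[of r] at[OF r] r by simp
  have "laplacian (radial U) (r *\<^sub>R e) = deriv_on {0<..1} ?U1 r + (real DIM('a) - 1)/r*?U1 r"
   using radial_laplacian[of 0 1 U ?U1 "deriv_on {0<..1} ?U1 r" "r *\<^sub>R e"] d1 d2 r n by simp
  moreover have "- laplacian (radial U) (r *\<^sub>R e) = l*f (U r)" using eq[of "r *\<^sub>R e"] n r by (simp add: radial_def)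
  moreover have "- (real DIM('a) - 1)/r*?U1 r = - ((real DIM('a) - 1)/r*?U1 r)"
   by (simp only: minus_divide_left[symmetric] mult_minus_left)
  ultimately have "deriv_on {0<..1} ?U1 r = - (real DIM('a) - 1)/r*?U1 r - l*f (U r)" by linarith
  then show "(?U1 hasD - (real DIM('a) - 1)/r*?U1 r - l*f (U r)) (at r)" using d2 by simp
 qed
qed

text \<open>With s = sqrt l*r the parameter disappears, and the boundary point r = 1 becomes the
  zero R = sqrt l of the profile.\<close>

lemma radial_ode_scale:
 assumes "radial_ode f N l u u1 0 b" "l > 0" "R = sqrt l"
 shows "radial_ode f N 1 (%s. u (s/R)) (%s. u1 (s/R)/R) 0 (b*R)"
 unfolding radial_ode_def
proof (intro allI impI conjI; elim conjE)
 fix s assume s: "0 < s" "s < b*R"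
 have R: "R > 0" "R*R = l" using assms by auto
 then have r: "0 < s/R" "s/R < b" using s by (auto simp: field_simps)
 have c: "((%s. s/R) hasD 1/R) (at s)" using R by (auto intro!: derivative_eq_intros)
 have d: "(u hasD u1 (s/R)) (at (s/R))"
  "(u1 hasD - (N - 1)/(s/R)*u1 (s/R) - l*f (u (s/R))) (at (s/R))"
  using assms(1) r unfolding radial_ode_def by blast+
 show "((%s. u (s/R)) hasD u1 (s/R)/R) (at s)"
  using DERIV_chain2[OF d(1) c] by simp
 show "((%s. u1 (s/R)/R) hasD - (N - 1)/s*(u1 (s/R)/R) - 1*f (u (s/R))) (at s)"
  using DERIV_cdivide[OF DERIV_chain2[OF d(2) c], of R] 
  by (rule DERIV_cong) (use R s in "simp add: field_simps")
qed

section \<open>Solutions and orbits\<close>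

context jl_nonlinearity
begin

text \<open>The space dimension N expressed by mu = 1 + sqrt (N - 1).\<close>

definition "dimN = mu^2 - 2*mu + 2"

definition "emden_y U t = (exp t)^2/F (U (exp t))"
definition "emden_z U U1 t = - exp t*U1 (exp t)/(f (U (exp t))*F (U (exp t)))"

lemma emden_ln_w: "U (exp t) >= 0 ==> 2*t - ln (emden_y U t) = ln (F (U (exp t)))"
 using F_pos[of "U (exp t)"] by (simp add: emden_y_def ln_div ln_realpow)

lemma emden_orbit_of_ode:
 assumes ode: "radial_ode f dimN 1 U U1 0 R" and R: "R > 0"
  and U: "!!s. 0 < s ==> s < R ==> U s > 0" and U1: "!!s. 0 < s ==> s < R ==> U1 s < 0"
 shows "emden_orbit mu (%t. H (2*t - ln (emden_y U t))) (ln R) (emden_y U) (emden_z U U1)"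
 unfolding emden_orbit_def
proof (intro allI impI conjI)
 fix t assume t: "t < ln R"
 define s where "s = exp t"
 have s: "0 < s" "s < R" using t R by (auto simp: s_def less_ln_iff)
 define u where "u = U s"
 have u: "u > 0" using U s by (simp add: u_def)
 have fp: "f u > 0" "F u > 0" using f_pos F_pos u by auto
 have d: "(U hasD U1 s) (at s)" "(U1 hasD - (dimN - 1)/s*U1 s - 1*f u) (at s)"
  using ode s by (auto simp: radial_ode_def u_def)
 have dt: "(exp hasD s) (at t)" unfolding s_def by (rule DERIV_exp)
 have dU: "((%t. U (exp t)) hasD U1 s * s) (at t)"
  using DERIV_chain2[OF d(1)[unfolded s_def] DERIV_exp] by (simp add: s_def)
 have dU1: "((%t. U1 (exp t)) hasD (- (dimN - 1)/s*U1 s - f u) * s) (at t)"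
  using DERIV_chain2[OF d(2)[unfolded s_def] DERIV_exp] by (simp add: s_def)
 have "(f hasD f1 u) (at (U (exp t)))" using f_deriv[of u] at_within_pos[OF u] u by (simp add: u_def s_def)
 from DERIV_chain2[OF this dU] have df: "((%t. f (U (exp t))) hasD f1 u*(U1 s * s)) (at t)" .
 have "(F hasD - (1/f u)) (at (U (exp t)))" using F_deriv[OF u] by (simp add: u_def s_def)
 from DERIV_chain2[OF this dU] have dF: "((%t. F (U (exp t))) hasD - (1/f u)*(U1 s * s)) (at t)" .
 have us: "exp t = s" "U s = u" by (simp_all add: u_def s_def)
 show "emden_y U t > 0" using fp s by (simp add: emden_y_def us)
 show "emden_z U U1 t > 0" using fp s U1[OF s] by (simp add: emden_z_def us divide_neg_pos mult_pos_neg)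
 have "(emden_y U hasD ((2 * s * s)*F u - s^2*(- (1/f u)*(U1 s * s)))/(F u*F u)) (at t)"
  unfolding emden_y_def[abs_def] using dF dt fp
  by (auto intro!: derivative_eq_intros simp: us power2_eq_square)
 then show "(emden_y U hasD emden_y U t*(2 - emden_z U U1 t)) (at t)"
  by (rule DERIV_cong) (use fp in "simp add: emden_y_def emden_z_def us field_simps power2_eq_square")
 have "(emden_z U U1 hasD (- (s*U1 s + s*((- (dimN - 1)/s*U1 s - f u) * s))*(f u*F u) -
   (- (s*U1 s))*(f1 u*(U1 s * s)*F u + f u*(- (1/f u)*(U1 s * s))))/((f u*F u)*(f u*F u))) (at t)"
  unfolding emden_z_def[abs_def]
 proof -
  have "((%t. - (exp t*U1 (exp t))) hasD - (s*U1 s + s*((- (dimN - 1)/s*U1 s - f u) * s))) (at t)"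
   using DERIV_minus[OF DERIV_mult[OF dt dU1]] by (simp add: us algebra_simps)
  moreover have "((%t. f (U (exp t))*F (U (exp t))) hasD
    f1 u*(U1 s * s)*F u + f u*(- (1/f u)*(U1 s * s))) (at t)"
   using DERIV_mult[OF df dF] by (simp add: us algebra_simps)
  moreover have "f (U (exp t))*F (U (exp t)) ~= 0" using fp by (simp add: us)
  ultimately have "((%t. - (exp t*U1 (exp t))/(f (U (exp t))*F (U (exp t)))) hasD
   (- (s*U1 s + s*((- (dimN - 1)/s*U1 s - f u) * s))*(f (U (exp t))*F (U (exp t))) -
   (- (exp t*U1 (exp t)))*(f1 u*(U1 s * s)*F u + f u*(- (1/f u)*(U1 s * s)))) /
   (f (U (exp t))*F (U (exp t))*(f (U (exp t))*F (U (exp t))))) (at t)"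
   by (rule DERIV_divide)
  then show "((%t. - exp t*U1 (exp t)/(f (U (exp t))*F (U (exp t)))) hasD
   (- (s*U1 s + s*((- (dimN - 1)/s*U1 s - f u) * s))*(f u*F u) -
   (- (s*U1 s))*(f1 u*(U1 s * s)*F u + f u*(- (1/f u)*(U1 s * s))))/((f u*F u)*(f u*F u))) (at t)"
   by (simp add: us)
 qed
 note dz = this
 have Heq: "H (2*t - ln (emden_y U t)) = F u*f1 u - (mu - 2)^2/4"
  using u fp by (simp add: emden_ln_w us H_def u_of_F)
 show "(emden_z U U1 hasD (mu*(mu - 4)/4 + H (2*t - ln (emden_y U t))) *
   (emden_z U U1 t)^2 - mu*(mu - 2)*emden_z U U1 t + emden_y U t) (at t)"
  unfolding Heq by (rule DERIV_cong[OF dz])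
   (use fp s in "simp add: emden_y_def emden_z_def us dimN_def field_simps power2_eq_square")
qed

text \<open>Inverse of the passage to \<open>emden_y\<close>: w = F(u) is recovered as r^2/y, and u'
  = - f(u)*w' with w' = z*r/y.\<close>

definition "of_orbit y r = Finv (r^2/y (ln r))"
definition "of_orbit1 y z r = - f (of_orbit y r)*(z (ln r)*r/y (ln r))"

lemma ode_of_orbit:
 assumes orb: "emden_orbit mu (%t. H (2*t - ln (y t))) T y z"
  and small: "!!t. t < T ==> 2*t - ln (y t) < ln (F 0)"
 shows "radial_ode f dimN 1 (of_orbit y) (of_orbit1 y z) 0 (exp T)"
  "!!r. 0 < r ==> r < exp T ==> of_orbit y r > 0"
  "!!r. 0 < r ==> r < exp T ==> F (of_orbit y r) = r^2/y (ln r)"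
proof -
 have w: "0 < r^2/y (ln r)" "r^2/y (ln r) < F 0" if r: "0 < r" "r < exp T" for r
 proof -
  have t: "ln r < T" using r by (metis exp_ln exp_less_cancel_iff)
  have y: "y (ln r) > 0" using emden_orbitD(1)[OF orb t] .
  then show "0 < r^2/y (ln r)" using r by simp
  have "ln (r^2/y (ln r)) < ln (F 0)" using small[OF t] r y by (simp add: ln_div ln_realpow)
  then show "r^2/y (ln r) < F 0" using F_pos[of 0] y r by (subst (asm) ln_less_cancel_iff) auto
 qed
 show pos: "of_orbit y r > 0" if r: "0 < r" "r < exp T" for r
  unfolding of_orbit_def using Finv_pos w[OF r] by blast
 show Fo: "F (of_orbit y r) = r^2/y (ln r)" if r: "0 < r" "r < exp T" for r
  unfolding of_orbit_def using Finv(2) w[OF r] by simp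
 show "radial_ode f dimN 1 (of_orbit y) (of_orbit1 y z) 0 (exp T)"
  unfolding radial_ode_def
 proof (intro allI impI conjI; elim conjE)
  fix r assume r: "0 < r" "r < exp T"
  have t: "ln r < T" using r by (metis exp_ln exp_less_cancel_iff)
  define Y Z where "Y = y (ln r)" and "Z = z (ln r)"
  note o = emden_orbitD[OF orb t, folded Y_def Z_def]
  have dl: "(ln hasD 1/r) (at r)" using r by (intro DERIV_ln_divide) simp
  have dy: "((%r. y (ln r)) hasD Y*(2 - Z)*(1/r)) (at r)"
   by (rule DERIV_chain2[OF o(3) dl])
  have dz: "((%r. z (ln r)) hasD
    ((mu*(mu - 4)/4 + H (2*ln r - ln Y))*Z^2 - mu*(mu - 2)*Z + Y)*(1/r)) (at r)"
   by (rule DERIV_chain2[OF o(4) dl])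
  have "((%r. r^2/y (ln r)) hasD (2*r*Y - r^2*(Y*(2 - Z)*(1/r)))/(Y*Y)) (at r)"
   using dy o(1) by (auto intro!: derivative_eq_intros simp: Y_def)
  then have dw: "((%r. r^2/y (ln r)) hasD Z*r/Y) (at r)"
   by (rule DERIV_cong) (use r o(1) in "simp add: field_simps power2_eq_square")
  have "(Finv hasD - f (of_orbit y r)) (at (r^2/y (ln r)))"
   using Finv_deriv[OF w[OF r]] by (simp add: of_orbit_def)
  from DERIV_chain2[OF this dw]
  show du: "(of_orbit y hasD of_orbit1 y z r) (at r)"
   by (simp add: of_orbit_def[abs_def] of_orbit1_def Y_def Z_def)
  define u where "u = of_orbit y r"
  have u: "u > 0" "f u > 0" using pos[OF r] f_pos by (auto simp: u_def)
  have "(f hasD f1 u) (at (of_orbit y r))"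
   using f_deriv[of u] at_within_pos[OF u(1)] u by (simp add: u_def)
  from DERIV_chain2[OF this du] have df: "((%r. f (of_orbit y r)) hasD f1 u * of_orbit1 y z r) (at r)" .
  define h where "h = H (2*ln r - ln Y)"
  have h: "h = r^2/Y*f1 u - (mu - 2)^2/4"
  proof -
   have "2*ln r - ln Y = ln (F u)" using Fo[OF r] r o(1) by (simp add: u_def Y_def ln_div ln_realpow)
   then have "h = F u*f1 u - (mu - 2)^2/4" using u F_pos[of u] by (simp add: h_def H_def u_of_F)
   then show ?thesis using Fo[OF r] by (simp add: u_def Y_def)
  qed
  have "((%r. z (ln r)*r/y (ln r)) hasD
   (((((mu*(mu - 4)/4 + h)*Z^2 - mu*(mu - 2)*Z + Y)*(1/r))*r + 1*Z)*Y - (Z*r)*(Y*(2 - Z)*(1/r)))/(Y*Y)) (at r)"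
  proof -
   have 1: "((%r. z (ln r)*r) hasD
    (((mu*(mu - 4)/4 + h)*Z^2 - mu*(mu - 2)*Z + Y)*(1/r))*r + 1*Z) (at r)"
    using DERIV_mult[OF dz DERIV_ident] by (simp add: h_def Z_def)
   have "y (ln r) ~= 0" using o(1) by (simp add: Y_def)
   from DERIV_divide[OF 1 dy this] show ?thesis by (simp add: Y_def Z_def)
  qed
  from DERIV_mult[OF DERIV_minus[OF df] this]
  have "(of_orbit1 y z hasD - (f1 u * of_orbit1 y z r)*(Z*r/Y) +
   (((((mu*(mu - 4)/4 + h)*Z^2 - mu*(mu - 2)*Z + Y)*(1/r))*r + 1*Z)*Y - (Z*r)*(Y*(2 - Z)*(1/r)))/(Y*Y)*- f u) (at r)"
   by (simp add: of_orbit1_def[abs_def] u_def Y_def Z_def)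
  then show "(of_orbit1 y z hasD - (dimN - 1)/r * of_orbit1 y z r - 1*f (of_orbit y r)) (at r)"
   unfolding h
   by (rule DERIV_cong) (use r o(1) in "simp add: of_orbit1_def u_def[symmetric] Y_def[symmetric] Z_def[symmetric] dimN_def field_simps power2_eq_square")
 qed
qed


lemma dimN_gt: "dimN > 2" "dimN > 1"
proof -
 have "mu*(mu - 2) > 0" using mu by simp
 then show "dimN > 2" by (simp add: dimN_def power2_eq_square algebra_simps)
 then show "dimN > 1" by simp
qed

end

section \<open>Monotonicity of profiles from the radial flux\<close>

lemma radial_flux_deriv:
 assumes "radial_ode f N l u u1 a b" "0 <= a" "a < r" "r < b"
 shows "((%r. r powr (N - 1)*u1 r) hasD - (l*r powr (N - 1)*f (u r))) (at r)"
proof -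
 have r: "r > 0" using assms by simp
 have "(u1 hasD - (N - 1)/r*u1 r - l*f (u r)) (at r)"
  using assms by (simp add: radial_ode_def)
 moreover have "((%r. r powr (N - 1)) hasD (N - 1)*r powr (N - 1 - 1)) (at r)"
  using has_real_derivative_powr[OF r] .
 ultimately have "((%r. r powr (N - 1)*u1 r) hasD
  (N - 1)*r powr (N - 1 - 1)*u1 r + (- (N - 1)/r*u1 r - l*f (u r))*r powr (N - 1)) (at r)"
  by (intro DERIV_mult)
 note d = this
 have eq: "r powr (N - 1 - 1) = r powr (N - 1)/r" using powr_diff[of r "N - 1" 1] r by simp
 show ?thesis by (rule DERIV_cong[OF d[unfolded eq]]) (use r in "simp add: field_simps")
qed

lemma radial_flux_decreasing:
 assumes ode: "radial_ode f N l u u1 a b" "0 <= a" and f: "!!r. a < r ==> r < b ==> l*f (u r) > 0"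
  and r: "a < r" "r < s" "s < b"
 shows "s powr (N - 1)*u1 s < r powr (N - 1)*u1 r"
proof (rule DERIV_neg_imp_decreasing[OF r(2)])
 fix x assume x: "r <= x" "x <= s"
 then have "l*f (u x)*x powr (N - 1) > 0" using f[of x] r ode(2) by simp
 then show "EX y. ((%a. a powr (N - 1)*u1 a) hasD y) (at x) & y < 0"
  using radial_flux_deriv[OF ode, of x] x r by (intro exI conjI) (auto simp: mult_ac)
qed

lemma radial_ode_mono: "radial_ode f N l u u1 a b ==> a <= a' ==> b' <= b ==> radial_ode f N l u u1 a' b'"
 by (auto simp: radial_ode_def)

text \<open>Boundedness of \<open>u1\<close> gives the flux the limit 0 at the origin, and from
  there it decreases strictly.\<close>

lemma radial_decreasing_regular:
 assumes ode: "radial_ode f N l u u1 0 b" and N: "N > 1"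
  and f: "!!r. 0 < r ==> r < b ==> l*f (u r) > 0"
  and bd: "!!r. 0 < r ==> r < c ==> abs (u1 r) <= M" "c > 0" and r: "0 < r" "r < b"
 shows "u1 r < 0"
proof -
 have lim: "((%s. s powr (N - 1)*u1 s) ---> 0) (at_right 0)"
 proof (rule Lim_null_comparison)
  have "((%s. s powr (N - 1)) ---> 0) (at_right 0)" using N by real_asymp
  from tendsto_mult_right[OF this, of M]
  show "((%s. s powr (N - 1)*M) ---> 0) (at_right 0)" by simp
  show "\<forall>\<^sub>F s in at_right 0. norm (s powr (N - 1)*u1 s) <= s powr (N - 1)*M"
   unfolding eventually_at_right_field using bd by (intro exI[of _ c]) (auto simp: abs_mult intro!: mult_left_mono)
 qed
 have "(r/2) powr (N - 1)*u1 (r/2) <= 0"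
 proof (rule tendsto_lowerbound[OF lim])
  show "\<forall>\<^sub>F s in at_right 0. (r/2) powr (N - 1)*u1 (r/2) <= s powr (N - 1)*u1 s"
   unfolding eventually_at_right_field
   using radial_flux_decreasing[OF ode order_refl f, of _ "r/2"] r by (intro exI[of _ "r/2"]) (auto intro: less_imp_le)
 qed simp
 then have "r powr (N - 1)*u1 r < 0"
  using radial_flux_decreasing[OF ode order_refl f, of "r/2" r] r by simp
 then show ?thesis using r by (simp add: mult_less_0_iff)
qed

text \<open>No value of the flux at 0 is known. But if u1 >= 0 at some r, the flux is positive
  before r, so \<open>u\<close> increases there and stays below u (r/2), against u tending to
  infinity.\<close>

lemma radial_decreasing_singular:
 assumes ode: "radial_ode f N l u u1 0 b"
  and f: "!!r. 0 < r ==> r < b ==> l*f (u r) > 0"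
  and sing: "filterlim u at_top (at_right 0)" and r: "0 < r" "r < b"
 shows "u1 r < 0"
proof (rule ccontr)
 assume "~ u1 r < 0"
 then have "r powr (N - 1)*u1 r >= 0" by simp
 then have "s powr (N - 1)*u1 s > 0" if "0 < s" "s < r" for s
  using radial_flux_decreasing[OF ode order_refl f, of s r] that r by simp
 then have pos: "u1 s > 0" if "0 < s" "s < r" for s using that by (simp add: zero_less_mult_iff)
 have mono: "u s <= u (r/2)" if "0 < s" "s < r/2" for s
 proof (rule DERIV_nonneg_imp_nondecreasing[where f = u])
  show "s <= r/2" using that by simp
  show "EX y. (u hasD y) (at x) & 0 <= y" if "s <= x" "x <= r/2" for x
   using pos[of x] ode that \<open>0 < s\<close> r by (intro exI[of _ "u1 x"]) (auto simp: radial_ode_def)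
 qed
 have "\<forall>\<^sub>F s in at_right 0. u s > u (r/2)" using sing by (simp add: filterlim_at_top_dense)
 moreover have "\<forall>\<^sub>F s in at_right 0. 0 < s & s < r/2"
  unfolding eventually_at_right_field using r by (intro exI[of _ "r/2"]) auto
 ultimately have "\<forall>\<^sub>F s in at_right (0::real). False" by eventually_elim (use mono in force)
 then show False by simp
qed

context jl_nonlinearity
begin

lemma f1_pos_eventually: "EX u0>0. ALL u>=u0. f1 u > 0"
proof -
 have "\<forall>\<^sub>F u in at_top. F u*f1 u > 0"
  using order_tendstoD(1)[OF F_u_of_lim, of 0] mu by simp
 moreover have "\<forall>\<^sub>F u in at_top. u > (0::real)" by (rule eventually_gt_at_top)
 ultimately have "\<forall>\<^sub>F u in at_top. f1 u > 0"
  by eventually_elim (use F_pos zero_less_mult_pos less_imp_le in blast)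
 then obtain a where "!!u. u >= a ==> f1 u > 0" by (auto simp: eventually_at_top_linorder)
 then show ?thesis by (intro exI[of _ "max a 1"]) auto
qed

lemma f_mono_eventually: "EX u0>0. ALL u>=u0. ALL v>=u. f u <= f v"
proof -
 obtain u0 where u0: "u0 > 0" "!!u. u >= u0 ==> f1 u > 0" using f1_pos_eventually by blast
 have "f u <= f v" if "u0 <= u" "u <= v" for u v
 proof (rule DERIV_nonneg_imp_nondecreasing[OF that(2)])
  fix x assume "u <= x"
  then have "x >= u0" using that by simp
  then show "EX y. (f hasD y) (at x) & 0 <= y"
   using f_deriv[of x] at_within_pos[of x] u0 by (intro exI[of _ "f1 x"]) (auto simp: less_imp_le)
 qed
 then show ?thesis using u0(1) by blast
qed

text \<open>Near 0 the profile is large and decreasing and f is increasing, so f(U x) >= f(U r) for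
  x <= r. Integrating the flux gives - U' >= f(U)*r/N, that is (F(U))' >= r/N. This is the bound y
  <= 2*N, the entry ticket to the phase-plane analysis.\<close>

lemma singular_w_lower:
 assumes ode: "radial_ode f dimN 1 U U1 0 R" and R: "R > 0"
  and U: "!!s. 0 < s ==> s < R ==> U s > 0" and sing: "filterlim U at_top (at_right 0)"
 shows "EX r1>0. r1 <= R & (ALL r. 0 < r & r < r1 --> F (U r) >= r^2/(2*dimN))"
proof -
 have N: "dimN > 1" "dimN > 0" using dimN_gt by auto
 obtain u0 where u0: "u0 > 0" "!!u v. u0 <= u ==> u <= v ==> f u <= f v" using f_mono_eventually by blast
 have "\<forall>\<^sub>F s in at_right 0. U s > u0" using sing by (simp add: filterlim_at_top_dense)
 then obtain b where b: "b > 0" "!!s. 0 < s ==> s < b ==> U s > u0" by (auto simp: eventually_at_right_field)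
 define r1 where "r1 = min b R"
 have r1: "r1 > 0" "r1 <= R" "r1 <= b" using b R by (auto simp: r1_def)
 have fpos: "0 < s ==> s < R ==> 1*f (U s) > 0" for s using f_pos U by (simp add: less_imp_le)
 have U1: "U1 s < 0" if "0 < s" "s < R" for s
  by (rule radial_decreasing_singular[OF ode fpos sing that])
 have Umono: "U s <= U r" if "0 < r" "r <= s" "s < R" for r s
 proof (rule DERIV_nonpos_imp_nonincreasing[where f = U, OF that(2)])
  show "EX y. (U hasD y) (at x) & y <= 0" if "r <= x" "x <= s" for x
   using U1[of x] ode that \<open>0 < r\<close> \<open>s < R\<close> by (intro exI[of _ "U1 x"]) (auto simp: radial_ode_def)
 qed
 have key: "- U1 r/f (U r) >= r/dimN" if r: "0 < r" "r < r1" for r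
 proof -
  define c where "c = f (U r)"
  \<comment> \<open>Compares the flux with the one produced by the constant source \<open>c\<close>.
    An upper bound of \<open>g\<close> near 0 suffices, and it holds because the flux is
    negative.\<close>
  define g where "g s = s powr (dimN - 1)*U1 s + c * s powr dimN/dimN" for s
  have c: "c > 0" using f_pos U r r1 by (simp add: c_def less_imp_le)
  have "g r <= g s" if s: "0 < s" "s < r" for s
  proof (rule DERIV_nonpos_imp_nonincreasing[where f = g])
   show "s <= r" using s by simp
   fix x assume x: "s <= x" "x <= r"
   then have x': "0 < x" "x < R" using s r r1 by auto
   have "(g hasD - (1*x powr (dimN - 1)*f (U x)) + c*(dimN*x powr (dimN - 1))/dimN) (at x)"
    unfolding g_def[abs_def]
    by (intro DERIV_add radial_flux_deriv[OF ode] DERIV_cdivide DERIV_cmult has_real_derivative_powr) (use x' in auto)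
   moreover have "- (1*x powr (dimN - 1)*f (U x)) + c*(dimN*x powr (dimN - 1))/dimN = x powr (dimN - 1)*(c - f (U x))"
    using N by (simp add: algebra_simps)
   moreover have "c <= f (U x)" unfolding c_def
    using u0(2)[of "U r" "U x"] Umono[of x r] b(2)[of r] x x' r r1 by (simp add: less_imp_le)
   ultimately show "EX y. (g hasD y) (at x) & y <= 0"
    by (intro exI[of _ "x powr (dimN - 1)*(c - f (U x))"]) (simp add: mult_nonneg_nonpos)
  qed
  moreover have "g s <= c * s powr dimN/dimN" if "0 < s" "s < r" for s
   using U1[of s] that r r1 by (simp add: g_def mult_nonneg_nonpos less_imp_le)
  ultimately have ge: "g r <= c * s powr dimN/dimN" if "0 < s" "s < r" for s using that by (meson order_trans)
  have "((%s. s powr dimN) ---> 0) (at_right 0)" using N by real_asymp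
  from tendsto_divide[OF tendsto_mult_left[OF this, of c] tendsto_const[of dimN]]
  have "((%s. c * s powr dimN/dimN) ---> 0) (at_right 0)" using N by simp
  moreover have "\<forall>\<^sub>F s in at_right 0. g r <= c * s powr dimN/dimN"
   unfolding eventually_at_right_field using r ge by (intro exI[of _ r]) auto
  ultimately have "g r <= 0" by (rule tendsto_lowerbound) simp
  moreover have "g r = r powr (dimN - 1)*(U1 r + c*r/dimN)"
   using r by (simp add: g_def powr_diff field_simps)
  ultimately have "U1 r + c*r/dimN <= 0" using r by (simp add: mult_le_0_iff)
  then show ?thesis using c N by (simp add: c_def[symmetric] field_simps)
 qed
 have "F (U r) >= r^2/(2*dimN)" if r: "0 < r" "r < r1" for r
 proof -
  define g where "g s = F (U s) - s^2/(2*dimN)" for s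
  have "g s <= g r" if s: "0 < s" "s < r" for s
  proof (rule DERIV_nonneg_imp_nondecreasing[where f = g])
   show "s <= r" using s by simp
   fix x assume x: "s <= x" "x <= r"
   then have x': "0 < x" "x < R" "x < r1" using s r r1 by auto
   have dU: "(U hasD U1 x) (at x)" using ode x' by (simp add: radial_ode_def)
   have "(g hasD - (1/f (U x))*U1 x - (2*x)/(2*dimN)) (at x)"
    unfolding g_def[abs_def]
    by (intro DERIV_diff DERIV_chain2[OF F_deriv dU] DERIV_cdivide)
     (use U x' in "auto intro!: derivative_eq_intros")
   moreover have "- (1/f (U x))*U1 x - (2*x)/(2*dimN) >= 0" using key[of x] x' by simp
   ultimately show "EX y. (g hasD y) (at x) & 0 <= y" by blast
  qed
  moreover have "- (s^2/(2*dimN)) <= g s" if "0 < s" "s < r" for s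
   using F_pos[of "U s"] U[of s] that r r1 by (simp add: g_def)
  ultimately have ge: "- (s^2/(2*dimN)) <= g r" if "0 < s" "s < r" for s using that by (meson order_trans)
  have "((%s. s^2) ---> 0) (at_right (0::real))" by real_asymp
  from tendsto_minus[OF tendsto_divide[OF this tendsto_const[of "2*dimN"]]]
  have "((%s. - (s^2/(2*dimN))) ---> 0) (at_right 0)" using N by simp
  moreover have "\<forall>\<^sub>F s in at_right 0. - (s^2/(2*dimN)) <= g r"
   unfolding eventually_at_right_field using r ge by (intro exI[of _ r]) auto
  ultimately have "g r >= 0" by (rule tendsto_upperbound) simp
  then show ?thesis by (simp add: g_def)
 qed
 then show ?thesis using r1 by blast
qed

end

section \<open>The singular profile\<close>

text \<open>The friction term (N - 1)/r damps the difference of the derivatives and is dropped,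
  which leaves the growth rate 1 + L.\<close>

lemma radial_ode_gronwall:
 assumes ab: "0 < a" "a <= b" and N: "N >= 1" and L: "L >= 0"
  and u: "!!r. a <= r ==> r <= b ==> (u hasD u1 r) (at r within {a..b})"
   "!!r. a <= r ==> r <= b ==> (u1 hasD - (N - 1)/r*u1 r - g r) (at r within {a..b})"
  and v: "!!r. a <= r ==> r <= b ==> (v hasD v1 r) (at r within {a..b})"
   "!!r. a <= r ==> r <= b ==> (v1 hasD - (N - 1)/r * v1 r - h r) (at r within {a..b})"
  and lip: "!!r. a <= r ==> r <= b ==> abs (g r - h r) <= L*abs (u r - v r)"
 shows "(u b - v b)^2 + (u1 b - v1 b)^2 <= ((u a - v a)^2 + (u1 a - v1 a)^2)*exp ((1 + L)*(b - a))"
proof (rule DERIV_le_growth[OF ab(2), where m = "%r. (u r - v r)^2 + (u1 r - v1 r)^2"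
   and m' = "%r. 2*(u r - v r)*(u1 r - v1 r) +
    2*(u1 r - v1 r)*((- (N - 1)/r*u1 r - g r) - (- (N - 1)/r * v1 r - h r))"])
 fix r assume r: "a <= r" "r <= b"
 have alg: "real 2*(y*x^(2 - Suc 0)) + real 2*(z*y^(2 - Suc 0)) = 2*x*y + 2*y*z" for x y z :: real
  by (simp add: algebra_simps)
 show "((%r. (u r - v r)^2 + (u1 r - v1 r)^2) hasD 2*(u r - v r)*(u1 r - v1 r) +
    2*(u1 r - v1 r)*((- (N - 1)/r*u1 r - g r) - (- (N - 1)/r * v1 r - h r))) (at r within {a..b})"
  using DERIV_add[OF DERIV_power[OF DERIV_diff[OF u(1)[OF r] v(1)[OF r]], of 2] DERIV_power[OF DERIV_diff[OF u(2)[OF r] v(2)[OF r]], of 2]]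
  by (rule DERIV_cong) (rule alg)
 define d d1 c where "d = u r - v r" and "d1 = u1 r - v1 r" and "c = (N - 1)/r"
 have c: "- (N - 1)/r = - c" unfolding c_def by (rule minus_divide_left[symmetric])
 have "2*d*d1 <= d^2 + d1^2" using sum_squares_bound[of d d1] by simp
 moreover have "- (2*d1*(g r - h r)) <= L*(d^2 + d1^2)"
 proof -
  have "- (2*d1*(g r - h r)) <= 2*abs d1*abs (g r - h r)"
   by (metis abs_ge_minus_self abs_mult abs_numeral)
  also have "... <= 2*abs d1*(L*abs d)" using lip[OF r] by (intro mult_left_mono) (auto simp: d_def)
  also have "... = L*(2*abs d*abs d1)" by (simp add: mult_ac)
  also have "... <= L*(d^2 + d1^2)" using sum_squares_bound[of "abs d" "abs d1"] L by (intro mult_left_mono) auto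
  finally show ?thesis .
 qed
 moreover have "c*d1^2 >= 0" using N r ab by (simp add: c_def)
 moreover have "2*d*d1 + 2*d1*((- c*u1 r - g r) - (- c * v1 r - h r)) =
   2*d*d1 - 2*(c*d1^2) + - (2*d1*(g r - h r))"
  by (simp add: d1_def power2_eq_square algebra_simps)
 moreover have "(1 + L)*(d^2 + d1^2) = (d^2 + d1^2) + L*(d^2 + d1^2)" by (simp add: algebra_simps)
 ultimately show "2*(u r - v r)*(u1 r - v1 r) +
    2*(u1 r - v1 r)*((- (N - 1)/r*u1 r - g r) - (- (N - 1)/r * v1 r - h r)) <=
   (1 + L)*((u r - v r)^2 + (u1 r - v1 r)^2)"
  unfolding d_def[symmetric] d1_def[symmetric] c by linarith
qed

definition emden_contractive :: "real => real => bool" where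
 "emden_contractive mu rh \<longleftrightarrow> (ALL h1 h2 T1 T2 y1 y2 z1 z2 t. emden_orbit mu h1 T1 y1 z1 --> emden_orbit mu h2 T2 y2 z2 -->
  t < T1 --> t < T2 --> abs (y1 t - mu^2) <= rh --> abs (y2 t - mu^2) <= rh --> abs (z1 t - 2) <= rh --> abs (z2 t - 2) <= rh -->
  \<bar>h2 t\<bar> <= rh --> abs (h1 t - h2 t) <= rh*abs (ln (y2 t) - ln (y1 t)) -->
  (EX V'. ((%t. (ln (y2 t) - ln (y1 t))^2 + (z1 t - z2 t + mu*(ln (y2 t) - ln (y1 t)))^2)
    hasD V') (at t) &
   V' <= - ((ln (y2 t) - ln (y1 t))^2 + (z1 t - z2 t + mu*(ln (y2 t) - ln (y1 t)))^2)))"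

lemma emden_contractive_exists: "mu > 2 ==> EX rh>0. rh < mu^2 & emden_contractive mu rh"
 unfolding emden_contractive_def by (rule emden_two_orbits)

section \<open>Existence, continuation and uniqueness of the singular profile\<close>

context jl_nonlinearity
begin

text \<open>Constant extension of f below 0: positive and Lipschitz on every half-line {..M}. A
  profile can then be continued with negative derivative beyond its first zero, which provides
  derivatives at the boundary point and lets zeros of nearby profiles be compared.\<close>

definition "fp u = f (max u 0)"

lemma fp_pos: "fp u > 0" by (simp add: fp_def f_pos)

lemma fp_eq: "u >= 0 ==> fp u = f u" by (simp add: fp_def)

lemma fp_cont: "continuous_on A fp"
 unfolding fp_def[abs_def] by (rule continuous_on_compose2[OF f_cont]) (auto intro!: continuous_intros)

lemma fp_lipschitz: "EX L>=0. ALL u v. u <= M --> v <= M --> abs (fp u - fp v) <= L*abs (u - v)"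
proof -
 have "compact (f1 ` {0..max M 0})"
  by (intro compact_continuous_image continuous_on_subset[OF f1_cont]) auto
 then obtain L where L: "!!x. x \<in> {0..max M 0} ==> abs (f1 x) <= L"
  using compact_imp_bounded bounded_iff by (metis imageI real_norm_def)
 have L0: "L >= 0" using L[of 0] by (simp add: order_trans[OF abs_ge_zero])
 have "abs (fp u - fp v) <= L*abs (u - v)" if "u <= M" "v <= M" for u v
 proof -
  have "norm (f (max u 0) - f (max v 0)) <= L*norm (max u 0 - max v 0)"
  proof (rule field_differentiable_bound[of "{0..max M 0}"])
   fix z assume z: "z \<in> {0..max M 0}"
   then show "(f hasD f1 z) (at z within {0..max M 0})"
    using f_deriv[of z] by (auto intro: has_field_derivative_subset)
   show "norm (f1 z) <= L" using L[OF z] by simp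
  qed (use that in auto)
  also have "... <= L*abs (u - v)" using L0 by (intro mult_left_mono) auto
  finally show ?thesis by (simp add: fp_def)
 qed
 then show ?thesis using L0 by blast
qed

definition "singular_profile U U1 R \<longleftrightarrow> R > 0 & radial_ode f dimN 1 U U1 0 R &
 (ALL s. 0 < s & s < R --> U s > 0) & filterlim U at_top (at_right 0)"

lemma singular_profile_decreasing:
 assumes "singular_profile U U1 R" "0 < s" "s < R"
 shows "U1 s < 0"
 by (rule radial_decreasing_singular[of f dimN 1 U U1 R]) (use assms f_pos in "auto simp: singular_profile_def less_imp_le")

text \<open>\<open>singular_w_lower\<close> bounds \<open>y\<close>, and F(U) tending to 0 sends 2*t
  - ln y to minus infinity; together these select the equilibrium in
  \<open>emden_singular_limit\<close>.\<close>

lemma singular_orbit: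
 assumes "singular_profile U U1 R"
 shows "EX T<=ln R. emden_orbit mu (%t. H (2*t - ln (emden_y U t))) T (emden_y U) (emden_z U U1)"
  "filterlim (%t. 2*t - ln (emden_y U t)) at_bot at_bot"
  "(emden_y U ---> mu^2) at_bot" "(emden_z U U1 ---> 2) at_bot"
proof -
 have R: "R > 0" and ode: "radial_ode f dimN 1 U U1 0 R" and U: "!!s. 0 < s ==> s < R ==> U s > 0"
  and sing: "filterlim U at_top (at_right 0)" using assms by (auto simp: singular_profile_def)
 obtain r1 where r1: "r1 > 0" "r1 <= R" "!!r. 0 < r ==> r < r1 ==> F (U r) >= r^2/(2*dimN)"
  using singular_w_lower[OF ode R U sing] by blast
 have orb: "emden_orbit mu (%t. H (2*t - ln (emden_y U t))) (ln R) (emden_y U) (emden_z U U1)"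
  by (rule emden_orbit_of_ode[OF ode R U singular_profile_decreasing[OF assms]])
 then show ex: "EX T<=ln R. emden_orbit mu (%t. H (2*t - ln (emden_y U t))) T (emden_y U) (emden_z U U1)"
  by blast
 have exp0: "filterlim (exp :: real => real) (at_right 0) at_bot" by real_asymp
 have Uexp: "filterlim (%t. U (exp t)) at_top at_bot" by (rule filterlim_compose[OF sing exp0])
 have evR: "\<forall>\<^sub>F t in at_bot. t < ln r1" by (rule eventually_gt_at_bot)
 have tl: "0 < exp t" "exp t < r1" if "t < ln r1" for t :: real
  using that r1 by (auto simp: less_ln_iff)
 have F0: "filterlim (%t. F (U (exp t))) (at_right 0) at_bot"
  unfolding filterlim_at
 proof
  show "((%t. F (U (exp t))) ---> 0) at_bot" by (rule filterlim_compose[OF F_tendsto_0 Uexp])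
  show "\<forall>\<^sub>F t in at_bot. F (U (exp t)) \<in> {0<..} & F (U (exp t)) ~= 0"
   using evR
  proof eventually_elim
   case (elim t)
   then show ?case using F_pos[of "U (exp t)"] U[of "exp t"] tl[of t] r1 by simp
  qed
 qed
 have "filterlim (%t. ln (F (U (exp t)))) at_bot at_bot" by (rule filterlim_compose[OF ln_at_0 F0])
 moreover have "\<forall>\<^sub>F t in at_bot. ln (F (U (exp t))) = 2*t - ln (emden_y U t)"
  using evR
 proof eventually_elim
  case (elim t)
  then show ?case using emden_ln_w[of U t] U[of "exp t"] tl[of t] r1 by simp
 qed
 ultimately show L: "filterlim (%t. 2*t - ln (emden_y U t)) at_bot at_bot"
  by (simp add: filterlim_cong)
 have y: "emden_y U t <= 2*dimN" if "t < ln r1" for t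
 proof -
  have "F (U (exp t)) >= (exp t)^2/(2*dimN)" by (rule r1(3)) (use tl that in auto)
  moreover have "F (U (exp t)) > 0" using F_pos[of "U (exp t)"] U[of "exp t"] tl[of t] that r1 by simp
  ultimately show ?thesis using dimN_gt by (simp add: emden_y_def field_simps)
 qed
 have orb': "emden_orbit mu (%t. H (2*t - ln (emden_y U t))) (ln r1) (emden_y U) (emden_z U U1)"
  using orb by (rule emden_orbit_mono) (use r1 in simp)
 have hl: "((%t. H (2*t - ln (emden_y U t))) ---> 0) at_bot" by (rule filterlim_compose[OF H_lim L])
 show "(emden_y U ---> mu^2) at_bot" "(emden_z U U1 ---> 2) at_bot"
  by (rule emden_singular_limit[OF mu orb' hl _ L]; use y in blast)+
qed

lemma eventually_near:
 assumes "(v ---> (l::real)) G" "rh > 0"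
 shows "\<forall>\<^sub>F t in G. abs (v t - l) <= rh"
 using tendstoD[OF assms] by (auto simp: dist_real_def elim!: eventually_mono)

text \<open>Both orbits tend to the equilibrium in the past, so the Lyapunov function
  \<open>m\<close> of their difference is bounded there. As it decays forward at rate 1,
  \<open>DERIV_decay_imp_nonpos\<close> makes it vanish.\<close>

lemma singular_local_unique:
 assumes U: "singular_profile U U1 R" and V: "singular_profile V V1 R'"
 shows "EX r0>0. r0 <= R & r0 <= R' & (ALL r. 0 < r & r < r0 --> U r = V r & U1 r = V1 r)"
proof -
 obtain rh where rho: "rh > 0" and con: "emden_contractive mu rh"
  using emden_contractive_exists[OF mu] by blast
 note two = con[unfolded emden_contractive_def, rule_format]
 define y1 z1 y2 z2 where "y1 = emden_y U" and "z1 = emden_z U U1" and "y2 = emden_y V" and "z2 = emden_z V V1"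
 define h1 h2 where "h1 t = H (2*t - ln (y1 t))" and "h2 t = H (2*t - ln (y2 t))" for t
 obtain T1 where T1: "T1 <= ln R" "emden_orbit mu h1 T1 y1 z1"
  using singular_orbit(1)[OF U] by (auto simp: y1_def z1_def h1_def[abs_def])
 obtain T2 where T2: "T2 <= ln R'" "emden_orbit mu h2 T2 y2 z2"
  using singular_orbit(1)[OF V] by (auto simp: y2_def z2_def h2_def[abs_def])
 obtain sg0 where s0: "sg0 < ln (F 0)" "!!s. s <= sg0 ==> abs (H s) <= rh"
  "!!s s'. s <= sg0 ==> s' <= sg0 ==> abs (H s - H s') <= rh*abs (s - s')"
  using H_small[OF rho] by blast
 note l1 = singular_orbit(2-4)[OF U, folded y1_def z1_def] and l2 = singular_orbit(2-4)[OF V, folded y2_def z2_def]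
 define m where "m t = (ln (y2 t) - ln (y1 t))^2 + (z1 t - z2 t + mu*(ln (y2 t) - ln (y1 t)))^2" for t
 have mlim: "(m ---> (ln (mu^2) - ln (mu^2))^2 + (2 - 2 + mu*(ln (mu^2) - ln (mu^2)))^2) at_bot"
  unfolding m_def[abs_def] using mu by (intro tendsto_intros l1 l2) auto
 have "\<forall>\<^sub>F t in at_bot. abs (y1 t - mu^2) <= rh & abs (y2 t - mu^2) <= rh & abs (z1 t - 2) <= rh & abs (z2 t - 2) <= rh &
   2*t - ln (y1 t) <= sg0 & 2*t - ln (y2 t) <= sg0 & t < T1 & t < T2 & m t < 1"
  using eventually_near[OF l1(2) rho] eventually_near[OF l2(2) rho] eventually_near[OF l1(3) rho]
   eventually_near[OF l2(3) rho] l1(1)[unfolded filterlim_at_bot, rule_format, of sg0]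
   l2(1)[unfolded filterlim_at_bot, rule_format, of sg0] eventually_gt_at_bot[of T1] eventually_gt_at_bot[of T2]
   order_tendstoD(2)[OF mlim, of 1, simplified]
  by eventually_elim simp
 then obtain T where T: "!!t. t <= T ==> abs (y1 t - mu^2) <= rh & abs (y2 t - mu^2) <= rh & abs (z1 t - 2) <= rh & abs (z2 t - 2) <= rh &
   2*t - ln (y1 t) <= sg0 & 2*t - ln (y2 t) <= sg0 & t < T1 & t < T2 & m t < 1"
  by (auto simp: eventually_at_bot_linorder)
 have "EX V'. (m hasD V') (at t) & V' <= - m t" if t: "t < T" for t
 proof -
  note TT = T[OF less_imp_le[OF t]]
  have "abs (h1 t - h2 t) <= rh*abs ((2*t - ln (y1 t)) - (2*t - ln (y2 t)))"
   unfolding h1_def h2_def using TT by (intro s0(3)) auto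
  then have "abs (h1 t - h2 t) <= rh*abs (ln (y2 t) - ln (y1 t))" by simp
  then show ?thesis unfolding m_def[abs_def]
   by (intro two[OF T1(2) T2(2)]) (use TT s0(2) in "auto simp: h2_def")
 qed
 then obtain m' where m': "!!t. t < T ==> (m hasD m' t) (at t)" "!!t. t < T ==> m' t <= - m t"
  by metis
 have m0: "m t = 0" if t: "t < T" for t
 proof -
  have "m t <= 0"
   by (rule DERIV_decay_imp_nonpos[of 1 T m m' 1 t]) (use m' T t in "auto intro: less_imp_le")
  moreover have "m t >= 0" by (simp add: m_def)
  ultimately show ?thesis by simp
 qed
 define r0 where "r0 = min (exp T) (min R R')"
 have R: "R > 0" "R' > 0" using U V by (auto simp: singular_profile_def)
 have "U r = V r & U1 r = V1 r" if r: "0 < r" "r < r0" for r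
 proof -
  define t where "t = ln r"
  have t: "t < T" "exp t = r" using r unfolding t_def r0_def
   by (metis exp_ln exp_less_cancel_iff min_less_iff_conj, simp)
  have rR: "r < R" "r < R'" using r by (auto simp: r0_def)
  have "ln (y2 t) = ln (y1 t)" "z1 t - z2 t + mu*(ln (y2 t) - ln (y1 t)) = 0"
   using m0[OF t(1)] by (auto simp: m_def sum_power2_eq_zero_iff)
  then have eq: "ln (y2 t) = ln (y1 t)" "z1 t = z2 t" by auto
  have "y1 t > 0" "y2 t > 0" using emden_orbitD(1)[OF T1(2)] emden_orbitD(1)[OF T2(2)] T[of t] t by auto
  then have "y1 t = y2 t" using eq by simp
  have up: "U r > 0" "V r > 0" using U V rR r by (auto simp: singular_profile_def)
  then have Fp: "F (U r) > 0" "F (V r) > 0" "f (U r) > 0" using F_pos f_pos by auto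
  have "F (U r) = F (V r)" using \<open>y1 t = y2 t\<close> Fp r by (simp add: y1_def y2_def emden_y_def t field_simps)
  then have UV: "U r = V r" using Finv_F up by (metis less_imp_le)
  then show ?thesis using eq(2) Fp r by (simp add: z1_def z2_def emden_z_def t)
 qed
 then show ?thesis using R by (intro exI[of _ r0]) (auto simp: r0_def)
qed

lemma singular_profile_exists: "EX U U1 R. singular_profile U U1 R"
proof -
 obtain rh where rho: "rh > 0" and ex: "ALL H sg0. (ALL s<=sg0. abs (H s) <= rh) --> (ALL s<=sg0. ALL s'<=sg0. abs (H s - H s') <= rh*abs (s - s')) -->
  (EX T y z. emden_orbit mu (%t. H (2*t - ln (y t))) T y z & (ALL t<T. mu^2/2 <= y t & y t <= 2*mu^2))"
  using emden_singular_orbit_exists[OF mu] by (elim exE conjE) (rule that)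
 obtain sg0 where s0: "sg0 < ln (F 0)" "ALL s<=sg0. abs (H s) <= rh" "ALL s<=sg0. ALL s'<=sg0. abs (H s - H s') <= rh*abs (s - s')"
  using H_small[OF rho] by blast
 obtain T0 y z where T0: "emden_orbit mu (%t. H (2*t - ln (y t))) T0 y z" "!!t. t < T0 ==> mu^2/2 <= y t & y t <= 2*mu^2"
  using ex[THEN spec, THEN spec, THEN mp, THEN mp, OF s0(2,3)] by blast
 \<comment> \<open>The second bound keeps ln w below ln (F 0), so that \<open>Finv\<close> returns a
   positive value.\<close>
 define T where "T = min T0 ((ln (F 0) + ln (mu^2/2))/2)"
 have mu2: "mu^2/2 > 0" using mu by simp
 have orb: "emden_orbit mu (%t. H (2*t - ln (y t))) T y z" using T0(1) by (rule emden_orbit_mono) (simp add: T_def)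
 have small: "2*t - ln (y t) < ln (F 0)" if "t < T" for t
 proof -
  have "ln (mu^2/2) <= ln (y t)" using T0(2)[of t] that mu2 by (intro ln_mono) (auto simp: T_def)
  then show ?thesis using that by (simp add: T_def min_def split: if_splits)
 qed
 note ode = ode_of_orbit[OF orb small]
 have "filterlim (%r. r^2/y (ln r)) (at_right 0) (at_right 0)"
  unfolding filterlim_at
 proof
  have ev: "\<forall>\<^sub>F r in at_right 0. 0 < r & r < exp T" unfolding eventually_at_right_field by (intro exI[of _ "exp T"]) auto
  have yl: "y (ln r) >= mu^2/2" if "0 < r" "r < exp T" for r
  proof -
   have "ln r < T" using that by (metis exp_ln exp_less_cancel_iff)
   then show ?thesis using T0(2) by (simp add: T_def)
  qed
  show "((%r. r^2/y (ln r)) ---> 0) (at_right 0)"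
  proof (rule Lim_null_comparison)
   show "((%r. r^2/(mu^2/2)) ---> 0) (at_right 0)" using mu by real_asymp
   show "\<forall>\<^sub>F r in at_right 0. norm (r^2/y (ln r)) <= r^2/(mu^2/2)"
    using ev
   proof eventually_elim
    case (elim r)
    then have y: "y (ln r) >= mu^2/2" using yl by blast
    then have "r^2/y (ln r) <= r^2/(mu^2/2)" using mu2 by (intro frac_le) auto
    moreover have "r^2/y (ln r) >= 0" using y mu2 by (intro divide_nonneg_nonneg) (simp, linarith)
    ultimately show ?case unfolding real_norm_def by linarith
   qed
  qed
  show "\<forall>\<^sub>F r in at_right 0. r^2/y (ln r) \<in> {0<..} & r^2/y (ln r) ~= 0"
   using ev
  proof eventually_elim
   case (elim r)
   then have "y (ln r) > 0" using yl[of r] mu2 by linarith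
   then show ?case using elim by simp
  qed
 qed
 from filterlim_compose[OF Finv_at_top this]
 have "filterlim (of_orbit y) at_top (at_right 0)" by (simp add: of_orbit_def[abs_def])
 then have "singular_profile (of_orbit y) (of_orbit1 y z) (exp T)"
  unfolding singular_profile_def using ode by auto
 then show ?thesis by blast
qed

text \<open>A source bounded below by m > 0 pulls \<open>u\<close> under a parabola; multiplying by
  s^(N - 1) absorbs the friction. This forces a zero at a computable radius.\<close>

lemma radial_linear_descent:
 assumes p: "!!s. a < s ==> s < b ==> (p hasD - (N - 1)/s*p s - g s) (at s)"
  and u: "!!s. a < s ==> s < b ==> (u hasD p s) (at s)"
  and N: "N >= 1" and a: "0 <= a" and g: "!!s. a < s ==> s < b ==> g s >= m" and m: "m > 0"
  and c: "a < c" "p c <= 0" and s: "c <= s" "s < b"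
 shows "p s <= - (m/N)*(s - c)" "u s <= u c - m/(2*N)*(s - c)^2"
proof -
 have p_le: "p s <= - (m/N)*(s - c)" if s: "c <= s" "s < b" for s
 proof -
  define G where "G s = s powr (N - 1)*(p s + m/N*(s - c))" for s
  have "G s <= G c"
  proof (rule DERIV_nonpos_imp_nonincreasing[where f = G, OF s(1)])
   fix x assume x: "c <= x" "x <= s"
   then have x': "a < x" "x < b" "0 < x" using c s a by auto
   define A where "A = x powr (N - 1)"
   have A: "A > 0" "x powr (N - 1 - 1) = A/x" using x' powr_diff[of x "N - 1" 1] by (auto simp: A_def)
   have "((%s. s powr (N - 1)) hasD (N - 1)*x powr (N - 1 - 1)) (at x)"
    using has_real_derivative_powr[OF x'(3)] .
   then have dA: "((%s. s powr (N - 1)) hasD (N - 1)*(A/x)) (at x)" unfolding A(2) .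
   have "((%s. p s + m/N*(s - c)) hasD (- (N - 1)/x*p x - g x) + m/N*(1 - 0)) (at x)"
    by (intro DERIV_add p DERIV_cmult DERIV_diff DERIV_ident DERIV_const x')
   from DERIV_mult[OF dA this]
   have "(G hasD (N - 1)*(A/x)*(p x + m/N*(x - c)) +
    ((- (N - 1)/x*p x - g x) + m/N*(1 - 0))*A) (at x)" by (simp add: G_def[abs_def] A_def)
   moreover have "(N - 1)*(A/x)*(p x + m/N*(x - c)) + ((- (N - 1)/x*p x - g x) + m/N*(1 - 0))*A =
    A*((m - g x) - m/N*(N - 1)*(c/x))"
    using x' N by (simp add: field_simps)
   moreover have "A*((m - g x) - m/N*(N - 1)*(c/x)) <= 0"
   proof (rule mult_nonneg_nonpos)
    have "m/N*(N - 1)*(c/x) >= 0" using m N x' c a by simp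
    then show "(m - g x) - m/N*(N - 1)*(c/x) <= 0" using g[OF x'(1,2)] by linarith
   qed (use A in simp)
   ultimately show "EX y. (G hasD y) (at x) & y <= 0" by metis
  qed
  also have "G c <= 0" using c by (simp add: G_def mult_nonneg_nonpos)
  finally have "p s + m/N*(s - c) <= 0" using s c a by (auto simp: G_def mult_le_0_iff)
  then show ?thesis by simp
 qed
 then show "p s <= - (m/N)*(s - c)" using s by blast
 have "u s + m/(2*N)*(s - c)^2 <= u c + m/(2*N)*(c - c)^2"
 proof (rule DERIV_nonpos_imp_nonincreasing[where f = "%s. u s + m/(2*N)*(s - c)^2", OF s(1)])
  fix x assume x: "c <= x" "x <= s"
  then have x': "a < x" "x < b" using c s by auto
  have "((%s. u s + m/(2*N)*(s - c)^2) hasD p x + m/(2*N)*(2*(x - c))) (at x)"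
   by (rule derivative_eq_intros u[OF x'] refl | simp)+
  moreover have "p x + m/(2*N)*(2*(x - c)) <= 0" using p_le[of x] x s N by (simp add: field_simps)
  ultimately show "EX y. ((%s. u s + m/(2*N)*(s - c)^2) hasD y) (at x) & y <= 0" by blast
 qed
 then show "u s <= u c - m/(2*N)*(s - c)^2" by simp
qed


text \<open>The solutions agree on the overlap (b, c), so every point has a neighbourhood on which
  the glued function coincides with one of them and the switch at \<open>m\<close> is
  invisible.\<close>

lemma radial_ode_pasted:
 assumes u: "radial_ode g N 1 u u1 a c" and v: "radial_ode g N 1 v v1 b d"
  and ord: "b < c" and m: "b < m" "m < c" and eq: "!!r. b < r ==> r < c ==> u r = v r & u1 r = v1 r"
 shows "radial_ode g N 1 (%r. if r < m then u r else v r) (%r. if r < m then u1 r else v1 r) a d"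
 unfolding radial_ode_def
proof (intro allI impI; elim conjE)
 fix r assume r: "a < r" "r < d"
 let ?w = "%r. if r < m then u r else v r" and ?w1 = "%r. if r < m then u1 r else v1 r"
 show "(?w hasD ?w1 r) (at r) & (?w1 hasD - (N - 1)/r*?w1 r - 1*g (?w r)) (at r)"
 proof (cases "r < c")
  case True
  have e: "u s = ?w s" "u1 s = ?w1 s" if "s < c" for s using eq[of s] that m by auto
  have d: "(u hasD u1 r) (at r)" "(u1 hasD - (N - 1)/r*u1 r - 1*g (u r)) (at r)"
   using u r True by (auto simp: radial_ode_def)
  have "(?w hasD u1 r) (at r)"
   by (rule has_field_derivative_transform_within_open[OF d(1) open_lessThan _ e(1)]) (use True in auto)
  moreover have "(?w1 hasD - (N - 1)/r*u1 r - 1*g (u r)) (at r)"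
   by (rule has_field_derivative_transform_within_open[OF d(2) open_lessThan _ e(2)]) (use True in auto)
  ultimately show ?thesis using e[OF True] by simp
 next
  case False
  then have r': "b < r" using ord by simp
  have e: "v s = ?w s" "v1 s = ?w1 s" if "s > b" for s using eq[of s] that m by auto
  have d: "(v hasD v1 r) (at r)" "(v1 hasD - (N - 1)/r * v1 r - 1*g (v r)) (at r)"
   using v r r' by (auto simp: radial_ode_def)
  have "(?w hasD v1 r) (at r)"
   by (rule has_field_derivative_transform_within_open[OF d(1) open_greaterThan _ e(1)]) (use r' in auto)
  moreover have "(?w1 hasD - (N - 1)/r * v1 r - 1*g (v r)) (at r)"
   by (rule has_field_derivative_transform_within_open[OF d(2) open_greaterThan _ e(2)]) (use r' in auto)
  ultimately show ?thesis using e[OF r'] by simp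
 qed
qed

lemma radial_ode_cong:
 "radial_ode g N l u u1 a b ==> (!!r. a < r ==> r < b ==> g (u r) = h (u r)) ==> radial_ode h N l u u1 a b"
 by (auto simp: radial_ode_def)

lemma radial_ivp:
 fixes g :: "real => real"
 assumes g: "continuous_on UNIV g" "!!x y. abs (g x - g y) <= L*abs (x - y)" "L >= 0" and ab: "0 < a" "a <= b" and N: "N >= 1"
 shows "EX u u1. u a = al & u1 a = be & (\<forall>s\<in>{a..b}. (u hasD u1 s) (at s within {a..b}) &
  (u1 hasD - (N - 1)/s*u1 s - g (u s)) (at s within {a..b}))"
proof -
 define G :: "real => real \<times> real => real \<times> real" where
  "G s x = (snd x, - (N - 1)/s * snd x - g (fst x))" for s x
 have "EX x. x a = (al, be) & (\<forall>t\<in>{a..b}. (x has_vector_derivative G t (x t)) (at t within {a..b}))"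
 proof (rule lipschitz_ode_solution[where L = "1 + (N - 1)/a + L", OF ab(2)])
  show "continuous_on ({a..b} \<times> UNIV) (%(t, x). G t x)"
   unfolding G_def case_prod_unfold
   by (intro continuous_intros continuous_on_compose2[OF g(1)]) (use ab in auto)
  show "0 <= 1 + (N - 1)/a + L" using N ab g(3) by (intro add_nonneg_nonneg divide_nonneg_nonneg) auto
  fix t and x y :: "real \<times> real" assume t: "a <= t" "t <= b"
  define d1 d2 n where "d1 = fst x - fst y" and "d2 = snd x - snd y" and "n = norm (x - y)"
  have n: "abs d1 <= n" "abs d2 <= n" "n >= 0"
   using norm_fst_le[of d1 d2] norm_snd_le[of d2 d1]
   by (simp_all add: d1_def d2_def n_def minus_prod_def)
  have "norm (G t x - G t y) <= norm (snd x - snd y) +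
    norm ((- (N - 1)/t * snd x - g (fst x)) - (- (N - 1)/t * snd y - g (fst y)))"
   unfolding G_def diff_Pair by (rule norm_Pair_le)
  also have "(- (N - 1)/t * snd x - g (fst x)) - (- (N - 1)/t * snd y - g (fst y)) =
    - (N - 1)/t*d2 - (g (fst x) - g (fst y))" by (simp add: d2_def right_diff_distrib)
  also have "norm (- (N - 1)/t*d2 - (g (fst x) - g (fst y))) <= (N - 1)/a*n + L*n"
  proof -
   have "abs (- (N - 1)/t*d2) = (N - 1)/t*abs d2" using N t ab by (simp add: abs_mult)
   also have "... <= (N - 1)/a*n" using N t ab n by (intro mult_mono divide_left_mono) auto
   finally have "abs (- (N - 1)/t*d2) <= (N - 1)/a*n" .
   moreover have "abs (g (fst x) - g (fst y)) <= L*n"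
    using g(2)[of "fst x" "fst y"] mult_left_mono[OF n(1) g(3)] unfolding d1_def by linarith
   ultimately show ?thesis unfolding real_norm_def by linarith
  qed
  finally show "norm (G t x - G t y) <= (1 + (N - 1)/a + L)*norm (x - y)"
   using n unfolding n_def[symmetric] d2_def[symmetric] by (simp add: algebra_simps)
 qed
 then obtain x where x: "x a = (al, be)" "!!t. t \<in> {a..b} ==> (x has_vector_derivative G t (x t)) (at t within {a..b})"
  by blast
 have "((%s. fst (x s)) hasD snd (x s)) (at s within {a..b}) &
  ((%s. snd (x s)) hasD - (N - 1)/s * snd (x s) - g (fst (x s))) (at s within {a..b})"
  if s: "s \<in> {a..b}" for s
  using bounded_linear.has_vector_derivative[OF bounded_linear_fst x(2)[OF s]]
   bounded_linear.has_vector_derivative[OF bounded_linear_snd x(2)[OF s]]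
  by (simp add: G_def has_real_derivative_iff_has_vector_derivative)
 then show ?thesis using x(1) by (intro exI[of _ "%s. fst (x s)"] exI[of _ "%s. snd (x s)"]) simp
qed

text \<open>From a = R0/2 on the equation is regular and a decreasing solution stays below M = V a,
  so \<open>fp\<close> may be truncated above M and becomes globally Lipschitz. Gronwall identifies
  the new solution with V on the overlap, the flux keeps it decreasing beyond \<open>R0\<close>, and
  so the truncation was never active.\<close>

lemma radial_extend:
 assumes R0: "R0 > 0" and Vode: "radial_ode f dimN 1 V V1 0 R0" and Vpos: "!!s. 0 < s ==> s < R0 ==> V s > 0"
  and V1: "!!s. 0 < s ==> s < R0 ==> V1 s < 0" and b: "R0 < b"
 shows "EX U U1. radial_ode fp dimN 1 U U1 0 b & (ALL r. 0 < r & r < R0 --> U r = V r & U1 r = V1 r) &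
  (ALL s. 0 < s & s < b --> U1 s < 0)"
proof -
 have N: "dimN >= 1" "dimN > 0" using dimN_gt by auto
 define a where "a = R0/2"
 define c where "c = 3/4*R0"
 have a: "0 < a" "a < c" "c < R0" "a <= b" "c < b" using R0 b by (auto simp: a_def c_def)
 define M where "M = V a"
 have M: "M > 0" using Vpos a by (simp add: M_def)
 define fc where "fc u = fp (min u M)" for u
 have fc_pos: "fc u > 0" for u by (simp add: fc_def fp_pos)
 obtain L where L: "L >= 0" "!!u v. u <= M ==> v <= M ==> abs (fp u - fp v) <= L*abs (u - v)"
  using fp_lipschitz[of M] by blast
 have fc_lip: "abs (fc u - fc v) <= L*abs (u - v)" for u v
 proof -
  have "abs (fc u - fc v) <= L*abs (min u M - min v M)" unfolding fc_def by (intro L) auto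
  also have "... <= L*abs (u - v)" using L by (intro mult_left_mono) auto
  finally show ?thesis .
 qed
 have fc_cont: "continuous_on UNIV fc"
  unfolding fc_def[abs_def] by (rule continuous_on_compose2[OF fp_cont[of UNIV]]) (auto intro!: continuous_intros)
 obtain u u1 where ua: "u a = V a" "u1 a = V1 a" and
  ud: "!!s. s \<in> {a..b} ==> (u hasD u1 s) (at s within {a..b})"
   "!!s. s \<in> {a..b} ==> (u1 hasD - (dimN - 1)/s*u1 s - fc (u s)) (at s within {a..b})"
  using radial_ivp[OF fc_cont fc_lip L(1) a(1) a(4) N(1), of "V a" "V1 a"] by blast
 have at: "at s within {a..b} = at s" if "a < s" "s < b" for s using that by (simp add: at_within_Icc_at)
 have uode: "radial_ode fc dimN 1 u u1 a b" unfolding radial_ode_def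
  using ud at by (metis atLeastAtMost_iff less_imp_le mult_1)
 have Vmono: "V s <= M" if "a <= s" "s < R0" for s unfolding M_def
 proof (rule DERIV_nonpos_imp_nonincreasing[where f = V, OF that(1)])
  show "EX y. (V hasD y) (at x) & y <= 0" if "a <= x" "x <= s" for x
   using V1[of x] Vode that a \<open>s < R0\<close> by (intro exI[of _ "V1 x"]) (auto simp: radial_ode_def)
 qed
 have fcV: "fc (V s) = f (V s)" if "a <= s" "s < R0" for s
  using Vmono[OF that] Vpos[of s] that a by (simp add: fc_def fp_def)
 have uV: "u s = V s & u1 s = V1 s" if s: "a < s" "s < R0" for s
 proof -
  have sub: "{a..s} \<subseteq> {a..b}" using s b by auto
  have "(u s - V s)^2 + (u1 s - V1 s)^2 <= ((u a - V a)^2 + (u1 a - V1 a)^2)*exp ((1 + L)*(s - a))"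
  proof (rule radial_ode_gronwall[OF a(1) _ N(1) L(1), where g = "%r. fc (u r)" and h = "%r. fc (V r)"])
   fix r assume r: "a <= r" "r <= s"
   show "(u hasD u1 r) (at r within {a..s})"
    "(u1 hasD - (dimN - 1)/r*u1 r - fc (u r)) (at r within {a..s})"
    using ud[of r] r s b by (auto intro: has_field_derivative_subset[OF _ sub])
   have "(V hasD V1 r) (at r)" "(V1 hasD - (dimN - 1)/r*V1 r - 1*f (V r)) (at r)"
    using Vode r s a by (auto simp: radial_ode_def)
   then show "(V hasD V1 r) (at r within {a..s})"
    "(V1 hasD - (dimN - 1)/r*V1 r - fc (V r)) (at r within {a..s})"
    using fcV[of r] r s by (auto intro: has_field_derivative_at_within)
   show "abs (fc (u r) - fc (V r)) <= L*abs (u r - V r)" by (rule fc_lip)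
  qed (use s in simp)
  then have "(u s - V s)^2 + (u1 s - V1 s)^2 <= 0" using ua by simp
  then have "(u s - V s)^2 + (u1 s - V1 s)^2 = 0" by (intro antisym) auto
  then show ?thesis by (simp add: sum_power2_eq_zero_iff)
 qed
 have u1neg: "u1 s < 0" if s: "a < s" "s < b" for s
 proof (cases "s < R0")
  case True then show ?thesis using uV[of s] V1[of s] s a by simp
 next
  case False
  have "s powr (dimN - 1)*u1 s < c powr (dimN - 1)*u1 c"
   by (rule radial_flux_decreasing[OF uode]) (use False a s fc_pos in auto)
  also have "... < 0" using uV[of c] V1[of c] a by (simp add: mult_pos_neg)
  finally show ?thesis using s a by (simp add: mult_less_0_iff)
 qed
 have u_le: "u s <= M" if s: "a < s" "s < b" for s
 proof (cases "s < R0")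
  case True then show ?thesis using uV[of s] Vmono[of s] s by simp
 next
  case False
  have "u s <= u c"
  proof (rule DERIV_nonpos_imp_nonincreasing[where f = u])
   show "EX y. (u hasD y) (at x) & y <= 0" if "c <= x" "x <= s" for x
    using uode u1neg[of x] that a s by (intro exI[of _ "u1 x"]) (auto simp: radial_ode_def)
  qed (use False a in simp)
  also have "... <= M" using uV[of c] Vmono[of c] a by simp
  finally show ?thesis .
 qed
 have uode': "radial_ode fp dimN 1 u u1 a b"
  by (rule radial_ode_cong[OF uode]) (use u_le in "auto simp: fc_def min_def")
 have Vode': "radial_ode fp dimN 1 V V1 0 R0"
  by (rule radial_ode_cong[OF Vode]) (use Vpos in "auto simp: fp_eq less_imp_le")
 define U U1 where "U r = (if r < c then V r else u r)" and "U1 r = (if r < c then V1 r else u1 r)" for r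
 have "radial_ode fp dimN 1 U U1 0 b" unfolding U_def[abs_def] U1_def[abs_def]
  by (rule radial_ode_pasted[OF Vode' uode']) (use a uV in auto)
 moreover have "U r = V r & U1 r = V1 r" if "0 < r" "r < R0" for r
  using uV[of r] that a by (auto simp: U_def U1_def)
 moreover have "U1 s < 0" if "0 < s" "s < b" for s
  using u1neg[of s] V1[of s] that a by (auto simp: U1_def)
 ultimately show ?thesis by blast
qed

definition "extended_profile U U1 R S \<longleftrightarrow> 0 < R & R < S & singular_profile U U1 R &
 radial_ode fp dimN 1 U U1 0 S & (ALL s. 0 < s & s < S --> U1 s < 0) & U R = 0"

lemma extended_profile_exists: "EX U U1 R S. extended_profile U U1 R S"
proof -
 obtain V V1 R0 where V: "singular_profile V V1 R0" using singular_profile_exists by blast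
 then have R0: "R0 > 0" and Vode: "radial_ode f dimN 1 V V1 0 R0" and Vpos: "!!s. 0 < s ==> s < R0 ==> V s > 0"
  and Vsing: "filterlim V at_top (at_right 0)" by (auto simp: singular_profile_def)
 have N: "dimN >= 1" "dimN > 0" using dimN_gt by auto
 have V1: "V1 s < 0" if "0 < s" "s < R0" for s by (rule singular_profile_decreasing[OF V that])
 define c where "c = R0/2"
 define a where "a = R0/4"
 have c: "0 < a" "a < c" "c < R0" using R0 by (auto simp: a_def c_def)
 define M where "M = V a"
 have M: "M > 0" using Vpos c by (simp add: M_def)
 have "\<exists>x\<in>{0..M}. \<forall>y\<in>{0..M}. fp x <= fp y"
  by (rule continuous_attains_inf) (use M fp_cont in auto)
 then obtain x0 where x0: "x0 \<in> {0..M}" "!!y. y \<in> {0..M} ==> fp x0 <= fp y" by blast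
 define m where "m = fp x0"
 have m: "m > 0" by (simp add: m_def fp_pos)
 have fp_m: "fp u >= m" if "u <= M" for u
 proof -
  have "fp u = fp (max u 0)" by (simp add: fp_def)
  then show ?thesis unfolding m_def using x0(2)[of "max u 0"] M that by simp
 qed
 \<comment> \<open>Solves m/(2*N)*(B - c)^2 > M: at \<open>B\<close> the parabola of
   \<open>radial_linear_descent\<close>, starting below M at \<open>c\<close>, is negative.\<close>
 define B where "B = R0 + sqrt (2*dimN*M/m) + 1"
 define b where "b = B + 1"
 have B: "c < B" "B < b" "R0 < b" "m/(2*dimN)*(B - c)^2 > M"
 proof -
  define q where "q = 2*dimN*M/m"
  have q: "q > 0" "m/(2*dimN)*q = M" using N M m by (auto simp: q_def)
  have sq: "sqrt q >= 0" using q by simp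
  then have "c < B & B < b & R0 < b" using c unfolding B_def b_def q_def[symmetric] by linarith
  then show "c < B" "B < b" "R0 < b" by blast+
  have "(B - c)^2 > (sqrt q)^2" unfolding B_def q_def[symmetric] using sq c by (intro power_strict_mono) auto
  then have "(B - c)^2 > q" using q by simp
  then have "m/(2*dimN)*(B - c)^2 > m/(2*dimN)*q" using m N by (intro mult_strict_left_mono) auto
  then show "m/(2*dimN)*(B - c)^2 > M" using q by simp
 qed
 obtain U U1 where ode: "radial_ode fp dimN 1 U U1 0 b" and UV: "!!r. 0 < r ==> r < R0 ==> U r = V r & U1 r = V1 r"
  and U1neg: "!!s. 0 < s ==> s < b ==> U1 s < 0"
  using radial_extend[OF R0 Vode Vpos V1 B(3)] by blast
 have Udec: "U r <= U s" if "0 < s" "s <= r" "r < b" for r s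
 proof (rule DERIV_nonpos_imp_nonincreasing[where f = U, OF that(2)])
  show "EX y. (U hasD y) (at x) & y <= 0" if "s <= x" "x <= r" for x
   using U1neg[of x] ode that \<open>0 < s\<close> \<open>r < b\<close> by (intro exI[of _ "U1 x"]) (auto simp: radial_ode_def)
 qed
 have "\<forall>\<^sub>F r in at_right 0. V r = U r"
  unfolding eventually_at_right_field using c UV by (intro exI[of _ c]) auto
 then have Using: "filterlim U at_top (at_right 0)" using Vsing by (rule filterlim_cong[OF refl refl, THEN iffD1])
 have d: "(U1 hasD - (dimN - 1)/s*U1 s - fp (U s)) (at s)" "(U hasD U1 s) (at s)"
  if "a < s" "s < b" for s using ode that c by (simp_all add: radial_ode_def)
 have fU: "m <= fp (U s)" if "a < s" "s < b" for s
  using fp_m[of "U s"] Udec[of a s] UV[of a] c that by (simp add: M_def)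
 have Uc: "U c <= M" "U c > 0" using Udec[of a c] UV[of a] UV[of c] Vpos[of c] c B by (auto simp: M_def)
 have "U B <= U c - m/(2*dimN)*(B - c)^2"
  by (rule radial_linear_descent(2)[of a b U1 dimN "%s. fp (U s)" U m c B, OF d N(1) less_imp_le[OF c(1)] fU m c(2)])
   (use U1neg[of c] c B in auto)
 then have UB: "U B <= 0" using Uc B(4) by simp
 have "continuous_on {c..B} U"
 proof (intro continuous_at_imp_continuous_on ballI)
  fix x assume "x \<in> {c..B}"
  then have "(U hasD U1 x) (at x)" using ode c B by (simp add: radial_ode_def)
  then show "isCont U x" by (rule DERIV_isCont)
 qed
 then obtain R where R: "c <= R" "R <= B" "U R = 0"
  using IVT2'[of U B 0 c] UB Uc B by auto
 have Rb: "0 < R" "R < b" using R B c by auto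
 have Upos: "U s > 0" if s: "0 < s" "s < R" for s
 proof -
  have "U R < U s"
  proof (rule DERIV_neg_imp_decreasing[OF s(2)])
   show "EX y. (U hasD y) (at x) & y < 0" if "s <= x" "x <= R" for x
    using ode U1neg[of x] that s Rb by (intro exI[of _ "U1 x"]) (auto simp: radial_ode_def)
  qed
  then show ?thesis using R by simp
 qed
 have "radial_ode f dimN 1 U U1 0 R"
  by (rule radial_ode_cong[OF radial_ode_mono[OF ode]]) (use Upos Rb in "auto simp: fp_eq less_imp_le")
 then have "singular_profile U U1 R" unfolding singular_profile_def using Rb Upos Using by blast
 then show ?thesis unfolding extended_profile_def using Rb R ode U1neg by blast
qed

text \<open>Local uniqueness at 0 is carried by Gronwall to all radii below both R' and S. As V is
  positive before R', that radius cannot pass the zero R of U.\<close>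

lemma singular_profile_unique:
 assumes U: "extended_profile U U1 R S" and V: "singular_profile V V1 R'"
 shows "R' <= R" "!!r. 0 < r ==> r < R' ==> V r = U r & V1 r = U1 r"
proof -
 have US: "0 < R" "R < S" "singular_profile U U1 R" and ode: "radial_ode fp dimN 1 U U1 0 S"
  and UR: "U R = 0" using U by (auto simp: extended_profile_def)
 have V': "R' > 0" "radial_ode f dimN 1 V V1 0 R'" "!!s. 0 < s ==> s < R' ==> V s > 0"
  using V by (auto simp: singular_profile_def)
 have N: "dimN >= 1" using dimN_gt by simp
 obtain r0 where r0: "r0 > 0" "r0 <= R" "r0 <= R'" "!!r. 0 < r ==> r < r0 ==> U r = V r & U1 r = V1 r"
  using singular_local_unique[OF US(3) V] by blast
 have eq: "V r = U r & V1 r = U1 r" if r: "0 < r" "r < min R' S" for r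
 proof (cases "r < r0")
  case True then show ?thesis using r0 r by simp
 next
  case False
  define a where "a = r0/2"
  have a: "0 < a" "a < r" "a < r0" using r0 False by (auto simp: a_def)
  have d: "(U hasD U1 s) (at s)" "(U1 hasD - (dimN - 1)/s*U1 s - 1*fp (U s)) (at s)"
   "(V hasD V1 s) (at s)" "(V1 hasD - (dimN - 1)/s*V1 s - 1*f (V s)) (at s)"
   if "a <= s" "s <= r" for s using ode V'(2) that r a by (auto simp: radial_ode_def)
  have bd: "compact (U ` {a..r})" "compact (V ` {a..r})"
   using d(1,3) by (auto intro!: compact_continuous_image continuous_at_imp_continuous_on DERIV_isCont)
  obtain M1 where M1: "!!s. s \<in> {a..r} ==> abs (U s) <= M1"
   using compact_imp_bounded[OF bd(1)] bounded_iff by (metis imageI real_norm_def)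
  obtain M2 where M2: "!!s. s \<in> {a..r} ==> abs (V s) <= M2"
   using compact_imp_bounded[OF bd(2)] bounded_iff by (metis imageI real_norm_def)
  obtain L where L: "L >= 0" "!!u v. u <= max M1 M2 ==> v <= max M1 M2 ==> abs (fp u - fp v) <= L*abs (u - v)"
   using fp_lipschitz[of "max M1 M2"] by blast
  have "(V r - U r)^2 + (V1 r - U1 r)^2 <= ((V a - U a)^2 + (V1 a - U1 a)^2)*exp ((1 + L)*(r - a))"
  proof (rule radial_ode_gronwall[OF a(1) _ N L(1), where g = "%r. fp (V r)" and h = "%r. fp (U r)"])
   fix s assume s: "a <= s" "s <= r"
   then have "V s > 0" using V'(3)[of s] a r by simp
   then have "f (V s) = fp (V s)" by (simp add: fp_eq)
   then show "(V hasD V1 s) (at s within {a..r})"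
    "(V1 hasD - (dimN - 1)/s*V1 s - fp (V s)) (at s within {a..r})"
    "(U hasD U1 s) (at s within {a..r})"
    "(U1 hasD - (dimN - 1)/s*U1 s - fp (U s)) (at s within {a..r})"
    using d[OF s] by (auto intro: has_field_derivative_at_within)
   show "abs (fp (V s) - fp (U s)) <= L*abs (V s - U s)"
    using M1[of s] M2[of s] s by (intro L(2)) auto
  qed (use a in simp)
  also have "... = 0" using r0(4)[of a] a by simp
  finally have "(V r - U r)^2 + (V1 r - U1 r)^2 = 0" by (intro antisym) auto
  then show ?thesis by (simp add: sum_power2_eq_zero_iff)
 qed
 show le: "R' <= R"
 proof (rule ccontr)
  assume "~ R' <= R"
  then have "V R = U R" "V R > 0" using eq[of R] US V'(3)[of R] by auto
  then show False using UR by simp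
 qed
 show "V r = U r & V1 r = U1 r" if "0 < r" "r < R'" for r
  using eq[OF that(1)] that le US by simp
qed

end

section \<open>Regular profiles\<close>

context jl_nonlinearity
begin

text \<open>\<open>rh\<close> is the first zero, so rh^2 is the parameter after rescaling to the
  unit ball. The bound on \<open>V1\<close> near 0 is what remains of smoothness at the
  origin.\<close>

definition "regular_profile V V1 rh al \<longleftrightarrow> rh > 0 & radial_ode f dimN 1 V V1 0 rh & continuous_on {0..rh} V &
 V 0 = al & V rh = 0 & (ALL s. 0 <= s & s < rh --> V s > 0) & (EX M c. c > 0 & (ALL s. 0 < s & s < c --> abs (V1 s) <= M))"

lemma regular_profile_decreasing:
 assumes V: "regular_profile V V1 rh al"
 shows "!!s. 0 < s ==> s < rh ==> V1 s < 0" "!!s. 0 <= s ==> s < rh ==> V s <= al"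
proof -
 have ode: "radial_ode f dimN 1 V V1 0 rh" and cont: "continuous_on {0..rh} V" and V0: "V 0 = al"
  and pos: "!!s. 0 <= s ==> s < rh ==> V s > 0" using V by (auto simp: regular_profile_def)
 obtain M c where Mc: "c > 0" "!!s. 0 < s ==> s < c ==> abs (V1 s) <= M" using V by (auto simp: regular_profile_def)
 show d: "V1 s < 0" if "0 < s" "s < rh" for s
  by (rule radial_decreasing_regular[OF ode dimN_gt(2) _ Mc(2,1) that]) (use pos f_pos in "auto simp: less_imp_le")
 show "V s <= al" if s: "0 <= s" "s < rh" for s
  unfolding V0[symmetric]
 proof (rule DERIV_nonpos_imp_decreasing_open[OF s(1)])
  show "EX y. (V hasD y) (at x) & y <= 0" if "0 < x" "x < s" for x
   using ode d[of x] that s by (intro exI[of _ "V1 x"]) (auto simp: radial_ode_def)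
  show "continuous_on {0..s} V" by (rule continuous_on_subset[OF cont]) (use s in auto)
 qed
qed

lemma regular_orbit:
 assumes V: "regular_profile V V1 rh al"
 shows "emden_orbit mu (%t. H (2*t - ln (emden_y V t))) (ln rh) (emden_y V) (emden_z V V1)"
  "EX K. ALL t<ln rh. emden_y V t <= K" "((%t. 2*t - ln (emden_y V t)) ---> ln (F al)) at_bot"
  "((%t. 2*t - ln (emden_y V t)) ---> ln (F 0)) (at_left (ln rh))"
proof -
 have rho: "rh > 0" and ode: "radial_ode f dimN 1 V V1 0 rh" and cont: "continuous_on {0..rh} V"
  and V0: "V 0 = al" "V rh = 0" and pos: "!!s. 0 <= s ==> s < rh ==> V s > 0" using V by (auto simp: regular_profile_def)
 note dec = regular_profile_decreasing[OF V]
 have al: "al > 0" using pos[of 0] V0 rho by simp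
 show "emden_orbit mu (%t. H (2*t - ln (emden_y V t))) (ln rh) (emden_y V) (emden_z V V1)"
  by (rule emden_orbit_of_ode[OF ode rho]) (use pos dec in auto)
 have tl: "exp t < rh" if "t < ln rh" for t using that rho by (simp add: less_ln_iff)
 have FV: "F (V (exp t)) >= F al" if "t < ln rh" for t
  using F_strict[of "V (exp t)" al] dec(2)[of "exp t"] pos[of "exp t"] tl[OF that] by (cases "V (exp t) = al") auto
 have "emden_y V t <= rh^2/F al" if "t < ln rh" for t
  unfolding emden_y_def using tl[OF that] FV[OF that] F_pos[of al] al by (intro frac_le power_mono) auto
 then show "EX K. ALL t<ln rh. emden_y V t <= K" by blast
 have L: "2*t - ln (emden_y V t) = ln (F (V (exp t)))" if "t < ln rh" for t
  using emden_ln_w[of V t] pos[of "exp t"] tl[OF that] by (simp add: less_imp_le)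
 have c0: "continuous (at s within {0..rh}) (%s. ln (F (V s)))" if "s \<in> {0..rh}" for s
 proof -
  have Vnn: "V r >= 0" if "r \<in> {0..rh}" for r using pos[of r] V0 that by (cases "r = rh") (auto simp: less_imp_le)
  have "continuous_on {0..rh} (%s. ln (F (V s)))"
  proof (intro continuous_on_ln continuous_on_compose2[OF F_cont cont] ballI)
   show "F (V s) ~= 0" if "s \<in> {0..rh}" for s using F_pos[OF Vnn[OF that]] by simp
  qed (use Vnn in auto)
  then show ?thesis using that by (simp add: continuous_on_eq_continuous_within)
 qed
 have "((%t. ln (F (V (exp t)))) ---> ln (F (V 0))) at_bot"
 proof (rule filterlim_compose[of "%s. ln (F (V s))" _ "at 0 within {0..rh}"])
  show "((%s. ln (F (V s))) ---> ln (F (V 0))) (at 0 within {0..rh})"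
   using c0[of 0] rho by (simp add: continuous_within)
  show "filterlim exp (at 0 within {0..rh}) at_bot" unfolding filterlim_at
  proof
   show "(exp ---> (0::real)) at_bot" by (rule exp_at_bot)
   show "\<forall>\<^sub>F x in at_bot. exp x \<in> {0..rh} & exp x ~= 0"
    using eventually_gt_at_bot[of "ln rh"] by eventually_elim (use tl in "auto simp: less_imp_le")
  qed
 qed
 moreover have "\<forall>\<^sub>F t in at_bot. ln (F (V (exp t))) = 2*t - ln (emden_y V t)"
  using eventually_gt_at_bot[of "ln rh"] by eventually_elim (simp add: L)
 ultimately show "((%t. 2*t - ln (emden_y V t)) ---> ln (F al)) at_bot"
  using V0(1) by (simp add: tendsto_cong)
 have "((%t. ln (F (V (exp t)))) ---> ln (F (V rh))) (at_left (ln rh))"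
 proof (rule filterlim_compose[of "%s. ln (F (V s))" _ "at rh within {0..rh}"])
  show "((%s. ln (F (V s))) ---> ln (F (V rh))) (at rh within {0..rh})"
   using c0[of rh] rho by (simp add: continuous_within)
  show "filterlim exp (at rh within {0..rh}) (at_left (ln rh))" unfolding filterlim_at
  proof
   have "(exp ---> exp (ln rh)) (at_left (ln rh))" by (intro tendsto_intros)
   then show "(exp ---> rh) (at_left (ln rh))" using rho by simp
   have "\<forall>\<^sub>F x in at_left (ln rh). x < ln rh" by (simp add: eventually_at_filter)
   then show "\<forall>\<^sub>F x in at_left (ln rh). exp x \<in> {0..rh} & exp x ~= rh"
   proof eventually_elim
    case (elim x) then show ?case using tl[of x] by (simp add: less_imp_le)
   qed
  qed
 qed
 moreover have "\<forall>\<^sub>F t in at_left (ln rh). ln (F (V (exp t))) = 2*t - ln (emden_y V t)"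
 proof -
  have "\<forall>\<^sub>F x in at_left (ln rh). x < ln rh" by (simp add: eventually_at_filter)
  then show ?thesis by eventually_elim (simp add: L)
 qed
 ultimately show "((%t. 2*t - ln (emden_y V t)) ---> ln (F 0)) (at_left (ln rh))"
  using V0(2) by (simp add: tendsto_cong)
qed

text \<open>Bootstrapping the smallness of \<open>w\<close>: until \<open>ln w\<close> reaches \<open>sg0\<close> the orbit obeys the bounds
 that keep \<open>ln w\<close> below \<open>sg0 - 1\<close> up to the time \<open>T1\<close>, which does not depend on \<open>al\<close>.\<close>

lemma regular_orbit_small:
 assumes V: "regular_profile V V1 rh al" and const: "emden_const mu C e" and eta: "0 < et" "et <= e"
  and s0: "sg0 < ln (F 0)" "!!s. s <= sg0 ==> abs (H s) <= et"
  and T1: "2*T1 <= sg0 + ln (mu^2/2) - 2" and l0: "ln (F al) + 2*mu^2/(mu - 2) <= sg0 - 1"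
 shows "T1 <= ln rh" "!!t. t < T1 ==> 2*t - ln (emden_y V t) <= sg0"
proof -
 let ?y = "emden_y V" and ?z = "emden_z V V1"
 define L where "L t = 2*t - ln (?y t)" for t
 note orb = regular_orbit[OF V]
 obtain K where K: "!!t. t < ln rh ==> ?y t <= K" using orb(2) by blast
 have dL: "(L hasD ?z t) (at t)" "?z t > 0" if "t < ln rh" for t
 proof -
  note o = emden_orbitD[OF orb(1) that]
  have "(L hasD 2 - 1/?y t*(?y t*(2 - ?z t))) (at t)"
   unfolding L_def[abs_def] by (rule derivative_eq_intros o refl | simp)+
  then show "(L hasD ?z t) (at t)" using o(1) by simp
  show "?z t > 0" using o(2) .
 qed
 have Llim: "(L ---> ln (F al)) at_bot" using orb(3) by (simp add: L_def[abs_def])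
 \<comment> \<open>\<open>hyp\<close> makes \<open>h\<close> small up to T, hence the dichotomy of
   \<open>emden_regular_orbit\<close> holds; either alternative improves \<open>sg0\<close> to
   \<open>sg0 - 1\<close>, one by \<open>l0\<close>, the other by the choice of
   \<open>T1\<close>.\<close>
 have bound: "L t <= sg0 - 1" if T: "T <= ln rh" "T <= T1" and hyp: "!!t. t < T ==> L t <= sg0" and t: "t < T" for T t
 proof -
  have orbT: "emden_orbit mu (%t. H (L t)) T ?y ?z"
   using emden_orbit_mono[OF orb(1) T(1)] by (simp add: L_def)
  have hT: "ALL t<T. abs (H (L t)) <= et" using hyp s0(2) by blast
  have KT: "ALL t<T. ?y t <= K" using K T by simp
  have "L t <= ln (F al) + 2*mu^2/(mu - 2) | ?y t >= mu^2/2"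
   using emden_regular_orbit(1)[OF mu const eta orbT hT KT orb(3) t] by (simp add: L_def)
  then show ?thesis
  proof
   assume "?y t >= mu^2/2"
   then have "ln (?y t) >= ln (mu^2/2)" using mu by (intro ln_mono) auto
   then show ?thesis using T1 T t by (simp add: L_def)
  qed (use l0 in linarith)
 qed
 have main: "L t <= sg0" if t: "t < T1" "t < ln rh" for t
 proof (rule ccontr)
  assume "~ L t <= sg0"
  have "mu - 2 > 0" using mu by simp
  then have "2*mu^2/(mu - 2) >= 0" by simp
  then have "ln (F al) < sg0" using l0 by linarith
  then have "\<forall>\<^sub>F s in at_bot. L s < sg0 & s < t"
   using order_tendstoD(2)[OF Llim] eventually_gt_at_bot[of t] by (simp add: eventually_conj)
  then obtain s where s: "L s < sg0" "s < t" using eventually_happens'[OF trivial_limit_at_bot_linorder] by blast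
  have "continuous_on {s..t} L"
   using dL(1) t by (intro continuous_at_imp_continuous_on ballI) (meson DERIV_isCont atLeastAtMost_iff order_le_less_trans)
  then obtain T where T: "s <= T" "T <= t" "L T = sg0"
   using IVT'[of L s sg0 t] s \<open>~ L t <= sg0\<close> by auto
  have less: "L r < sg0" if "r < T" for r
  proof -
   have "L r < L T"
   proof (rule DERIV_pos_imp_increasing[OF that])
    show "EX y. (L hasD y) (at x) & y > 0" if "r <= x" "x <= T" for x
     using dL[of x] that T t by (intro exI[of _ "?z x"]) auto
   qed
   then show ?thesis using T by simp
  qed
  have "L r <= sg0 - 1" if "r < T" for r
   by (rule bound[of T]) (use T t less that in "auto intro: less_imp_le")
  moreover have "(L ---> L T) (at_left T)"
   using DERIV_isCont[OF dL(1)[of T]] T t by (auto simp: isCont_def intro: filterlim_mono[OF _ order_refl at_le])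
  moreover have "\<forall>\<^sub>F r in at_left T. r < T" by (simp add: eventually_at_filter)
  ultimately have "L T <= sg0 - 1"
   by (intro tendsto_upperbound[of L _ "at_left T"]) (auto elim!: eventually_mono)
  then show False using T by simp
 qed
 \<comment> \<open>At the zero \<open>rh\<close> the value of ln w is ln (F 0) > sg0, so this zero
   is not reached before \<open>T1\<close>.\<close>
 show T1r: "T1 <= ln rh"
 proof (rule ccontr)
  assume n: "~ T1 <= ln rh"
  have "L t <= sg0" if "t < ln rh" for t using main that n by simp
  moreover have "\<forall>\<^sub>F r in at_left (ln rh). r < ln rh" by (simp add: eventually_at_filter)
  moreover have "(L ---> ln (F 0)) (at_left (ln rh))" using orb(4) by (simp add: L_def[abs_def])
  ultimately have "ln (F 0) <= sg0"
   by (intro tendsto_upperbound[of L _ "at_left (ln rh)"]) (auto elim!: eventually_mono)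
  then show False using s0(1) by simp
 qed
 show "2*t - ln (?y t) <= sg0" if "t < T1" for t using main[of t] that T1r by (simp add: L_def)
qed

text \<open>From the time \<open>t0 al\<close> on the regular orbit is within \<open>r\<close> of
  the equilibrium, where it can be compared with the singular orbit. The Lyapunov function is at
  most \<open>Mc\<close> at that time and decays afterwards. Since \<open>t0 al\<close> tends to
  minus infinity with \<open>al\<close>, it tends to 0 at each fixed time, and u and u' are
  recovered from y and z.\<close>

lemma regular_near_zero:
 assumes U: "singular_profile U U1 R" and V: "!!al. al > 0 ==> regular_profile (V al) (V1 al) (rh al) al"
 shows "EX s0>0. s0 <= R & (ALL s. 0 < s & s < s0 --> (\<forall>\<^sub>F al in at_top. s < rh al) &
  ((%al. V al s) ---> U s) at_top & ((%al. V1 al s) ---> U1 s) at_top)"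
proof -
 obtain r where r: "r > 0" "r < mu^2" and con: "emden_contractive mu r"
  using emden_contractive_exists[OF mu] by blast
 note two = con[unfolded emden_contractive_def, rule_format]
 obtain C e where const: "emden_const mu C e" using emden_const_exists[OF mu] by blast
 then have C: "C > 0" "e > 0" by (auto simp: emden_const_def)
 define B where "B = mu^2 + mu + 1"
 have B: "B > 0" using mu by (auto simp: B_def add_pos_pos)
 \<comment> \<open>The error budget \<open>r\<close> is split: the phase-plane bounds, of total
   weight B*C*et, use one half, and the transient mu^2*exp (- ta/2) the other.\<close>
 define et where "et = min (min e r) (r/(2*B*C))"
 have eta: "0 < et" "et <= e" "et <= r" using C r B by (auto simp: et_def)
 have "et <= r/(2*B*C)" by (simp add: et_def)
 then have BC: "B*(C*et) <= r/2" using B C by (simp add: field_simps)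
 have Ceta: "C*et > 0" using C eta by simp
 obtain sg0 where s0: "sg0 < ln (F 0)" "!!s. s <= sg0 ==> abs (H s) <= et"
  "!!s s'. s <= sg0 ==> s' <= sg0 ==> abs (H s - H s') <= et*abs (s - s')"
  using H_small[OF eta(1)] by blast
 define y z where "y = emden_y U" and "z = emden_z U U1"
 obtain Ts where Ts: "Ts <= ln R" "emden_orbit mu (%t. H (2*t - ln (y t))) Ts y z"
  using singular_orbit(1)[OF U] by (auto simp: y_def z_def)
 note l1 = singular_orbit(2-4)[OF U, folded y_def z_def]
 have "\<forall>\<^sub>F t in at_bot. abs (y t - mu^2) <= r & abs (z t - 2) <= r & 2*t - ln (y t) <= sg0 & t < Ts"
  using eventually_near[OF l1(2) r(1)] eventually_near[OF l1(3) r(1)]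
   l1(1)[unfolded filterlim_at_bot, rule_format, of sg0] eventually_gt_at_bot[of Ts]
  by eventually_elim simp
 then obtain T2 where T2: "!!t. t <= T2 ==> abs (y t - mu^2) <= r & abs (z t - 2) <= r & 2*t - ln (y t) <= sg0 & t < Ts"
  by (auto simp: eventually_at_bot_linorder)
 define T1 where "T1 = (sg0 + ln (mu^2/2) - 2)/2"
 define T3 where "T3 = min T1 T2"
 define K1 where "K1 = 2*mu^2/(mu - 2) + ln (mu^2/2)"
 define ta where "ta = - 2*ln (r/(2*mu^2))"
 have mu2: "mu^2 > 0" using mu by simp
 have tau: "ta > 0" "mu^2*exp (- ta/2) = r/2"
 proof -
  have "0 < r/(2*mu^2)" "r/(2*mu^2) < 1" using r mu2 by (auto simp: field_simps)
  then show "ta > 0" "mu^2*exp (- ta/2) = r/2" unfolding ta_def using mu2 by auto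
 qed
 define t0 where "t0 al = (ln (F al) + K1)/2 + ta" for al
 have lnF: "filterlim (%al. ln (F al)) at_bot at_top"
 proof (rule filterlim_compose[OF ln_at_0])
  have "\<forall>\<^sub>F u in at_top. F u \<in> {0<..} & F u ~= 0"
   using eventually_ge_at_top[of "0::real"] by eventually_elim (use F_pos in force)
  then show "filterlim F (at_right 0) at_top" using F_tendsto_0 by (simp add: filterlim_at)
 qed
 have t0lim: "filterlim t0 at_bot at_top"
 proof -
  have "filterlim (%x::real. (x + K1)/2 + ta) at_bot at_bot" by real_asymp
  from filterlim_compose[OF this lnF] show ?thesis by (simp add: t0_def[abs_def])
 qed
 define ya za where "ya al = emden_y (V al)" and "za al = emden_z (V al) (V1 al)" for al
 define m where "m al t = (ln (ya al t) - ln (y t))^2 + (z t - za al t + mu*(ln (ya al t) - ln (y t)))^2" for al t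
 define \<Lambda> where "\<Lambda> = ln (mu^2 + r) - ln (mu^2 - r)"
 define Mc where "Mc = \<Lambda>^2 + (2*r + mu*\<Lambda>)^2"
 have ev0: "\<forall>\<^sub>F al in at_top. al > 0 & ln (F al) + 2*mu^2/(mu - 2) <= sg0 - 1"
  using eventually_gt_at_top[of "0::real"] lnF[unfolded filterlim_at_bot, rule_format, of "sg0 - 1 - 2*mu^2/(mu - 2)"]
  by eventually_elim simp
 have close: "T1 <= ln (rh al) & (ALL t. t0 al <= t & t < T3 --> m al t <= Mc*exp (- (t - t0 al)))"
  if al: "al > 0 & ln (F al) + 2*mu^2/(mu - 2) <= sg0 - 1" for al
 proof -
  have reg: "regular_profile (V al) (V1 al) (rh al) al" using V al by blast
  note orb = regular_orbit[OF reg, folded ya_def za_def]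
  have sm: "T1 <= ln (rh al)" "!!t. t < T1 ==> 2*t - ln (ya al t) <= sg0"
   unfolding ya_def using regular_orbit_small[OF reg const eta(1,2) s0(1,2), of T1] al by (simp_all add: T1_def)
  obtain K where K: "ALL t<ln (rh al). ya al t <= K" using orb(2) by blast
  have orbT: "emden_orbit mu (%t. H (2*t - ln (ya al t))) T1 (ya al) (za al)"
   using orb(1) by (rule emden_orbit_mono) (rule sm)
  have hT: "ALL t<T1. abs (H (2*t - ln (ya al t))) <= et" using sm s0 by blast
  have KT: "ALL t<T1. ya al t <= K" using K sm by simp
  have near: "abs (ya al t - mu^2) <= r & abs (za al t - 2) <= r" if t: "t0 al <= t" "t < T1" for t
  proof -
   have gt: "2*t > ln (F al) + (2*mu^2/(mu - 2) + ln (mu^2/2))" using t(1) tau(1) unfolding t0_def K1_def by argo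
   have "ya al t >= mu^2*(1 - C*et) - mu^2*exp (- (t - (ln (F al) + K1)/2)/2)"
    using emden_regular_orbit(2)[OF mu const eta(1,2) orbT hT KT orb(3) t(2) gt] by (simp add: K1_def)
   moreover have "mu^2*exp (- (t - (ln (F al) + K1)/2)/2) <= mu^2*exp (- ta/2)"
    using t mu2 by (intro mult_left_mono) (auto simp: t0_def)
   ultimately have lo: "ya al t >= mu^2 - mu^2*(C*et) - r/2" using tau by (simp add: algebra_simps)
   note tr = emden_trapped[OF mu const eta(1,2) orbT hT KT t(2)]
   have Bc: "B*(C*et) = mu^2*(C*et) + mu*(C*et) + C*et" by (simp add: B_def algebra_simps)
   have p: "mu^2*(C*et) > 0" "mu*(C*et) > 0" using Ceta mu by auto
   have "ya al t/mu >= (mu^2 - mu^2*(C*et) - r/2)/mu" using lo mu by (intro divide_right_mono) auto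
   moreover have "(mu^2 - mu^2*(C*et) - r/2)/mu = mu - mu*(C*et) - r/2/mu"
    using mu by (simp add: field_simps power2_eq_square)
   moreover have "r/2/mu <= r/2/1" using mu r by (intro divide_left_mono) auto
   ultimately have yl: "ya al t/mu >= mu - mu*(C*et) - r/2" by simp
   have "abs (ya al t - mu^2) <= r" using lo tr(1) p Ceta BC Bc r by (intro abs_leI) linarith+
   moreover have "abs (za al t - 2) <= r" using yl tr(2,3) p Ceta BC Bc r by (intro abs_leI) linarith+
   ultimately show ?thesis by blast
  qed
  have md: "EX m'. (m al hasD m') (at t) & m' <= - m al t" if t: "t0 al <= t" "t < T3" for t
  proof -
   have tT: "t < T1" "t <= T2" using t by (auto simp: T3_def)
   note n = near[OF t(1) tT(1)] and n2 = T2[OF tT(2)]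
   have "abs (H (2*t - ln (y t)) - H (2*t - ln (ya al t))) <= et*abs ((2*t - ln (y t)) - (2*t - ln (ya al t)))"
    using n2 sm(2)[OF tT(1)] by (intro s0(3)) auto
   also have "... <= r*abs (ln (ya al t) - ln (y t))" using eta by (intro mult_mono) auto
   finally show ?thesis unfolding m_def
    by (intro two[OF Ts(2) orbT]) (use n n2 tT hT eta in "auto intro: order_trans")
  qed
  have "m al t <= Mc*exp (- (t - t0 al))" if t: "t0 al <= t" "t < T3" for t
  proof -
   obtain m' where m': "!!s. t0 al <= s ==> s < T3 ==> (m al hasD m' s) (at s) & m' s <= - m al s"
    using md by metis
   have "m al t <= m al (t0 al)*exp (- 1*(t - t0 al))"
    by (rule DERIV_le_growth[OF t(1), of _ m']) (use m' t in "auto intro: has_field_derivative_at_within")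
   moreover have "m al (t0 al) <= Mc"
   proof -
    have tT: "t0 al < T1" "t0 al <= T2" using t by (auto simp: T3_def)
    note n = near[OF order_refl tT(1)] and n2 = T2[OF tT(2)]
    have b: "mu^2 - r > 0" using r by simp
    have lnb: "ln (mu^2 - r) <= ln x & ln x <= ln (mu^2 + r)" if "abs (x - mu^2) <= r" for x
     using that b by (intro conjI ln_mono) (auto simp: abs_le_iff)
    have D: "abs (ln (ya al (t0 al)) - ln (y (t0 al))) <= \<Lambda>"
     using lnb[of "ya al (t0 al)"] lnb[of "y (t0 al)"] n n2 unfolding \<Lambda>_def by (intro abs_leI) linarith+
    have "abs (z (t0 al) - za al (t0 al) + mu*(ln (ya al (t0 al)) - ln (y (t0 al)))) <= 2*r + mu*\<Lambda>"
    proof -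
     have "abs (mu*(ln (ya al (t0 al)) - ln (y (t0 al)))) <= mu*\<Lambda>"
      using D mu by (simp add: abs_mult mult_left_mono)
     moreover have "abs (z (t0 al) - za al (t0 al)) <= 2*r" using n n2 by linarith
     ultimately show ?thesis by linarith
    qed
    then show ?thesis unfolding m_def Mc_def
     using D by (intro add_mono) (auto simp: abs_le_square_iff[symmetric] intro: order_trans[OF _ abs_ge_self])
   qed
   ultimately show ?thesis
    using order_trans[OF _ mult_right_mono[of "m al (t0 al)" Mc "exp (- (t - t0 al))"]] by simp
  qed
  then show ?thesis using sm(1) by blast
 qed
 have R: "R > 0" using U by (simp add: singular_profile_def)
 have T3R: "T3 < ln R" using T2[of T3] Ts by (simp add: T3_def)
 show ?thesis
 proof (intro exI[of _ "exp T3"] conjI allI impI; (elim conjE)?)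
  show "exp T3 > 0" by simp
  show "exp T3 <= R" using T3R R by (simp add: less_ln_iff less_imp_le)
  fix s assume s: "0 < s" "s < exp T3"
  define t where "t = ln s"
  have t: "t < T3" "exp t = s" using s unfolding t_def by (metis exp_ln exp_less_cancel_iff, simp)
  show ev1: "\<forall>\<^sub>F al in at_top. s < rh al"
   using ev0
  proof eventually_elim
   case (elim al)
   have "t < ln (rh al)" using close[OF elim] t by (simp add: T3_def)
   moreover have "rh al > 0" using V[of al] elim by (simp add: regular_profile_def)
   ultimately show ?case using t by (simp add: less_ln_iff)
  qed
  have mlim: "((%al. m al t) ---> 0) at_top"
  proof (rule tendsto_sandwich)
   show "\<forall>\<^sub>F al in at_top. 0 <= m al t" by (simp add: m_def)
   show "\<forall>\<^sub>F al in at_top. m al t <= Mc*exp (- (t - t0 al))"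
    using ev0 t0lim[unfolded filterlim_at_bot, rule_format, of t]
    by eventually_elim (use close t in blast)
   have "((%x::real. Mc*exp (- (t - x))) ---> 0) at_bot" by real_asymp
   from filterlim_compose[OF this t0lim] show "((%al. Mc*exp (- (t - t0 al))) ---> 0) at_top" .
  qed simp
  have sq: "(g ---> 0) at_top" if "!!al. (g al)^2 <= m al t" for g :: "real => real"
  proof -
   have "((%al. (g al)^2) ---> 0) at_top"
    by (rule tendsto_sandwich[OF _ _ tendsto_const mlim]) (use that in auto)
   then show ?thesis by (simp add: tendsto_null_power)
  qed
  have l1: "((%al. ln (ya al t) - ln (y t)) ---> 0) at_top" by (rule sq) (simp add: m_def)
  have l2: "((%al. z t - za al t + mu*(ln (ya al t) - ln (y t))) ---> 0) at_top" by (rule sq) (simp add: m_def)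
  from tendsto_diff[OF l2 tendsto_mult_left[OF l1, of mu]]
  have "((%al. z t - za al t) ---> 0) at_top" by simp
  from tendsto_diff[OF tendsto_const[of "z t"] this] have zl: "((%al. za al t) ---> z t) at_top" by simp
  have sR: "s < R" using s T3R R by (metis exp_less_cancel_iff exp_ln less_trans)
  have Us: "U s > 0" using U s sR by (simp add: singular_profile_def)
  have Fs: "F (U s) > 0" "F (U s) < F 0" "f (U s) > 0" using F_pos[of "U s"] F_strict[of 0 "U s"] f_pos[of "U s"] Us by auto
  have yt: "y t > 0" using Fs s by (simp add: y_def emden_y_def t)
  have evV: "\<forall>\<^sub>F al in at_top. V al s > 0 & ya al t > 0 & F (V al s) = s^2/ya al t & V1 al s = - za al t*f (V al s)*F (V al s)/s"
   using ev0 ev1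
  proof eventually_elim
   case (elim al)
   have Vs: "V al s > 0" using V[of al] elim s by (simp add: regular_profile_def)
   then have "F (V al s) > 0" "f (V al s) > 0" using F_pos f_pos by auto
   then show ?case using s Vs by (simp add: ya_def za_def emden_y_def emden_z_def t)
  qed
  have "((%al. ln (ya al t)) ---> ln (y t)) at_top" using l1 by (simp add: LIM_zero_iff)
  then have "((%al. exp (ln (ya al t))) ---> exp (ln (y t))) at_top" by (rule tendsto_exp)
  moreover have "\<forall>\<^sub>F al in at_top. exp (ln (ya al t)) = ya al t" using evV by eventually_elim simp
  ultimately have "((%al. ya al t) ---> y t) at_top" using yt by (simp add: tendsto_cong)
  then have "((%al. s^2/ya al t) ---> s^2/y t) at_top" using yt by (intro tendsto_intros) auto
  moreover have "s^2/y t = F (U s)" using Fs s by (simp add: y_def emden_y_def t)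
  moreover have "\<forall>\<^sub>F al in at_top. s^2/ya al t = F (V al s)" using evV by eventually_elim simp
  ultimately have Fl: "((%al. F (V al s)) ---> F (U s)) at_top" by (simp add: tendsto_cong)
  have "isCont Finv (F (U s))" using Finv_deriv[OF Fs(1,2)] by (rule DERIV_isCont)
  from isCont_tendsto_compose[OF this Fl] have "((%al. Finv (F (V al s))) ---> U s) at_top" using Us by simp
  moreover have "\<forall>\<^sub>F al in at_top. Finv (F (V al s)) = V al s" using evV
   by eventually_elim (intro Finv_F less_imp_le, blast)
  ultimately show Vl: "((%al. V al s) ---> U s) at_top" by (simp add: tendsto_cong)
  have "isCont f (U s)" using f_deriv[of "U s"] at_within_pos[OF Us] Us by (auto intro: DERIV_isCont)
  from isCont_tendsto_compose[OF this Vl] have fl: "((%al. f (V al s)) ---> f (U s)) at_top" .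
  have "((%al. - za al t*f (V al s)*F (V al s)/s) ---> - z t*f (U s)*F (U s)/s) at_top"
   using s by (intro tendsto_intros zl fl Fl) auto
  moreover have "- z t*f (U s)*F (U s)/s = U1 s" using Fs s by (simp add: z_def emden_z_def t)
  moreover have "\<forall>\<^sub>F al in at_top. - za al t*f (V al s)*F (V al s)/s = V1 al s" using evV by eventually_elim simp
  ultimately show "((%al. V1 al s) ---> U1 s) at_top" by (simp add: tendsto_cong)
 qed
qed

end

text \<open>The functions \<open>G n\<close> are controlled only up to their own end points
  \<open>rh n\<close>, which may lie beyond R. Comparing first with g (rh n*r) and then using
  uniform continuity of \<open>g\<close> up to b > R covers both sides.\<close>

lemma uniform_limit_dilation:
 fixes G :: "'b => real => real"
 assumes R: "a < r1*R" "R < b" "0 < r1" and cont: "continuous_on {a..b} g"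
  and G: "!!e. e > 0 ==> \<forall>\<^sub>F n in A. ALL s. a <= s & s <= b & s <= rh n --> abs (G n s - g s) < e"
  and rho: "(rh ---> R) A" "\<forall>\<^sub>F n in A. rh n > 0"
  and r1: "r1 <= 1" and Rpos: "R > 0"
 shows "uniform_limit {r1..1} (%n r. G n (rh n*r)) (%r. g (R*r)) A"
 unfolding uniform_limit_iff
proof (intro allI impI)
 fix e :: real assume e: "e > 0"
 have "uniformly_continuous_on {a..b} g" by (rule compact_uniformly_continuous[OF cont]) simp
 then obtain d where d: "d > 0" "!!x y. x \<in> {a..b} ==> y \<in> {a..b} ==> abs (x - y) < d ==> abs (g x - g y) < e/2"
  using e unfolding uniformly_continuous_on_def dist_real_def by (metis half_gt_zero)
 have "\<forall>\<^sub>F n in A. a < r1*rh n" by (rule order_tendstoD(1)[OF tendsto_mult_left[OF rho(1)] R(1)])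
 moreover have "\<forall>\<^sub>F n in A. rh n < b" by (rule order_tendstoD(2)[OF rho(1) R(2)])
 moreover have "\<forall>\<^sub>F n in A. abs (rh n - R) < d" using tendstoD[OF rho(1) d(1)] by (simp add: dist_real_def)
 moreover have "\<forall>\<^sub>F n in A. ALL s. a <= s & s <= b & s <= rh n --> abs (G n s - g s) < e/2" using G[of "e/2"] e by simp
 ultimately show "\<forall>\<^sub>F n in A. \<forall>r\<in>{r1..1}. dist (G n (rh n*r)) (g (R*r)) < e"
  using rho(2)
 proof eventually_elim
  case (elim n)
  show ?case
  proof
   fix r assume r: "r \<in> {r1..1}"
   have s: "r1*rh n <= rh n*r" "rh n*r <= rh n" "r1*R <= R*r" "R*r <= R"
    using r elim(5) Rpos by (auto simp: mult.commute)
   have "abs (rh n*r - R*r) = abs (rh n - R)*r" using r R(3) by (simp add: left_diff_distrib[symmetric] abs_mult)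
   also have "... <= abs (rh n - R)*1" using r by (intro mult_left_mono) auto
   finally have "abs (rh n*r - R*r) < d" using elim(3) by simp
   then have "abs (g (rh n*r) - g (R*r)) < e/2" using s elim(1,2) R by (intro d(2)) auto
   moreover have "abs (G n (rh n*r) - g (rh n*r)) < e/2" using s elim(1,2,4) by simp
   ultimately show "dist (G n (rh n*r)) (g (R*r)) < e" unfolding dist_real_def by linarith
  qed
 qed
qed

lemma uniform_limit_fixed_factor:
 fixes X :: "'b => real => real"
 assumes X: "uniform_limit K X x A" and c: "!!r. r \<in> K ==> abs (c r) <= M"
 shows "uniform_limit K (%n r. c r*X n r) (%r. c r*x r) A"
 unfolding uniform_limit_iff
proof (intro allI impI)
 fix e :: real assume e: "e > 0"
 have "\<forall>\<^sub>F n in A. \<forall>r\<in>K. dist (X n r) (x r) < e/(abs M + 1)"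
  using X e unfolding uniform_limit_iff by (simp add: add_nonneg_pos)
 then show "\<forall>\<^sub>F n in A. \<forall>r\<in>K. dist (c r*X n r) (c r*x r) < e"
 proof (eventually_elim, intro ballI)
  fix n r assume *: "\<forall>r\<in>K. dist (X n r) (x r) < e/(abs M + 1)" and r: "r \<in> K"
  have "dist (c r*X n r) (c r*x r) = abs (c r)*dist (X n r) (x r)"
   by (simp add: dist_real_def right_diff_distrib[symmetric] abs_mult)
  also have "... <= abs M*dist (X n r) (x r)" using c[OF r] by (intro mult_right_mono) auto
  also have "... <= (abs M + 1)*dist (X n r) (x r)" by (intro mult_right_mono) auto
  also have "... < e" using * r by (simp add: field_simps add_nonneg_pos)
  finally show "dist (c r*X n r) (c r*x r) < e" .
 qed
qed

section \<open>Convergence of the rescaled regular solutions\<close>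

context jl_nonlinearity
begin

text \<open>Derivatives are written as a fixed power of r times a function of rh*r; in this form
  \<open>uniform_limit_dilation\<close> and \<open>uniform_limit_fixed_factor\<close> pass to the
  limit.\<close>

lemma ode_imp_C2_on:
 assumes ode: "radial_ode fp dimN 1 W W1 0 b" and rho: "0 < rh" "rh < b" and u: "!!r. 0 < r ==> r <= 1 ==> u r = W (rh*r)"
 shows "C2_on {0<..1} u" "!!r. 0 < r ==> r <= 1 ==> deriv_on {0<..1} u r = 1/r*(rh*r*W1 (rh*r))"
  "!!r. 0 < r ==> r <= 1 ==> deriv_on {0<..1} (deriv_on {0<..1} u) r =
   1/r^2*((rh*r)^2*(- (dimN - 1)/(rh*r)*W1 (rh*r) - fp (W (rh*r))))"
  "!!r. 0 < r ==> r <= 1 ==> (u hasD 1/r*(rh*r*W1 (rh*r))) (at r within {0<..1})"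
proof -
 let ?S = "{0<..1::real}"
 have in_b: "0 < rh*r" "rh*r < b" if "0 < r" "r <= 1" for r
  using that rho by (auto intro: le_less_trans[OF mult_left_mono[of r 1 rh]])
 have d: "(W hasD W1 (rh*r)) (at (rh*r))"
  "(W1 hasD - (dimN - 1)/(rh*r)*W1 (rh*r) - 1*fp (W (rh*r))) (at (rh*r))"
  if "0 < r" "r <= 1" for r using ode in_b[OF that] by (auto simp: radial_ode_def)
 have m: "((%r. rh*r) hasD rh) (at r within ?S)" for r
  by (auto intro!: derivative_eq_intros)
 have du: "(u hasD rh*W1 (rh*r)) (at r within ?S)" if r: "0 < r" "r <= 1" for r
 proof (rule has_field_derivative_transform_within[where d = 1])
  show "((%r. W (rh*r)) hasD rh*W1 (rh*r)) (at r within ?S)"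
   using DERIV_chain2[OF d(1)[OF r] m] by (simp add: mult.commute)
 qed (use r u in auto)
 show "(u hasD 1/r*(rh*r*W1 (rh*r))) (at r within ?S)" if r: "0 < r" "r <= 1" for r
  using du[OF r] r by simp
 have deq: "deriv_on ?S u r = rh*W1 (rh*r)" if "0 < r" "r <= 1" for r
  using deriv_on_eq[OF du[OF that] at_within_Ioc_bot] that by simp
 then show "deriv_on ?S u r = 1/r*(rh*r*W1 (rh*r))" if "0 < r" "r <= 1" for r using that by simp
 define u2 where "u2 r = rh^2*(- (dimN - 1)/(rh*r)*W1 (rh*r) - fp (W (rh*r)))" for r
 have ddu: "(deriv_on ?S u hasD u2 r) (at r within ?S)" if r: "0 < r" "r <= 1" for r
 proof (rule has_field_derivative_transform_within[where d = 1])
  show "((%r. rh*W1 (rh*r)) hasD u2 r) (at r within ?S)"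
   using DERIV_cmult[OF DERIV_chain2[OF d(2)[OF r] m], of rh]
   by (rule DERIV_cong) (simp add: u2_def power2_eq_square)
 qed (use r deq in auto)
 have ddeq: "deriv_on ?S (deriv_on ?S u) r = u2 r" if "0 < r" "r <= 1" for r
  using deriv_on_eq[OF ddu[OF that] at_within_Ioc_bot] that by simp
 then show "deriv_on ?S (deriv_on ?S u) r =
   1/r^2*((rh*r)^2*(- (dimN - 1)/(rh*r)*W1 (rh*r) - fp (W (rh*r))))" if "0 < r" "r <= 1" for r
  using that by (simp add: u2_def power_mult_distrib)
 have "continuous_on ?S u2"
 proof -
  have cW: "continuous_on ?S (%r. W (rh*r))" "continuous_on ?S (%r. W1 (rh*r))"
   using DERIV_chain2[OF d(1) m] DERIV_chain2[OF d(2) m]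
   by (auto simp: continuous_on_eq_continuous_within intro!: DERIV_continuous)
  show ?thesis unfolding u2_def[abs_def]
   by (intro continuous_intros cW continuous_on_compose2[OF fp_cont[of UNIV]]) (use rho in auto)
 qed
 then have "continuous_on ?S (deriv_on ?S (deriv_on ?S u))"
  by (rule continuous_on_cong[THEN iffD1, rotated -1]) (use ddeq in auto)
 moreover have "\<forall>x\<in>?S. u differentiable at x within ?S" "\<forall>x\<in>?S. deriv_on ?S u differentiable at x within ?S"
  unfolding real_differentiable_def using du ddu greaterThanAtMost_iff by blast+
 ultimately show "C2_on ?S u" unfolding C2_on_def by blast
qed

lemma extended_profile_bounds:
 assumes "extended_profile U U1 R S"
 shows "!!s r. 0 < s ==> s < r ==> r < S ==> U r < U s" "!!s. 0 < s ==> s < R ==> U s > 0" "!!s. R < s ==> s < S ==> U s < 0"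
proof -
 show dec: "U r < U s" if "0 < s" "s < r" "r < S" for s r
 proof (rule DERIV_neg_imp_decreasing[OF that(2)])
  show "EX y. (U hasD y) (at x) & y < 0" if "s <= x" "x <= r" for x
   using assms that \<open>0 < s\<close> \<open>r < S\<close> unfolding extended_profile_def radial_ode_def
   by (intro exI[of _ "U1 x"]) auto
 qed
 show "U s > 0" if "0 < s" "s < R" for s using dec[of s R] that assms by (auto simp: extended_profile_def)
 show "U s < 0" if "R < s" "s < S" for s using dec[of R s] that assms by (auto simp: extended_profile_def)
qed

text \<open>Gronwall carries convergence at one radius a < s0 to all radii below S that the profiles
  reach. U changes sign strictly at R, so its values at R - de and R + de trap the zeros
  \<open>rh al\<close>.\<close>

lemma profiles_converge:
 assumes U: "extended_profile U U1 R S"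
  and W: "!!al::real. al > 0 ==> rh al > 0 & radial_ode fp dimN 1 (W al) (W1 al) 0 (rh al + 1) & W al (rh al) = 0 &
   (ALL s. 0 < s & s < rh al --> W al s > 0) & (ALL s. 0 < s & s < rh al + 1 --> W1 al s < 0)"
  and s0: "s0 > 0" "!!s. 0 < s ==> s < s0 ==> (\<forall>\<^sub>F al in at_top. s < rh al) &
   ((%al. W al s) ---> U s) at_top & ((%al. W1 al s) ---> U1 s) at_top"
 shows "(rh ---> R) at_top"
  "!!a e. 0 < a ==> a < s0 ==> e > 0 ==> \<forall>\<^sub>F al in at_top. a < rh al & (ALL s. a <= s & s < S & s < rh al + 1 -->
   \<bar>W al s - U s\<bar> < e & abs (W1 al s - U1 s) < e)"
proof -
 have US: "0 < R" "R < S" and ode: "radial_ode fp dimN 1 U U1 0 S" and UR: "U R = 0"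
  using U by (auto simp: extended_profile_def)
 note Ub = extended_profile_bounds[OF U]
 have N: "dimN >= 1" using dimN_gt by simp
 show close: "\<forall>\<^sub>F al in at_top. a < rh al & (ALL s. a <= s & s < S & s < rh al + 1 -->
   \<bar>W al s - U s\<bar> < e & abs (W1 al s - U1 s) < e)" if a: "0 < a" "a < s0" and e: "e > 0" for a e
 proof -
  define M where "M = U a + 1"
  obtain L where L: "L >= 0" "!!u v. u <= M ==> v <= M ==> abs (fp u - fp v) <= L*abs (u - v)"
   using fp_lipschitz[of M] by blast
  define E where "E = exp ((1 + L)*abs (S - a))"
  have "((%al. ((W al a - U a)^2 + (W1 al a - U1 a)^2)*E) ---> ((U a - U a)^2 + (U1 a - U1 a)^2)*E) at_top"
   using s0(2)[OF a] by (intro tendsto_intros) auto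
  then have "\<forall>\<^sub>F al in at_top. ((W al a - U a)^2 + (W1 al a - U1 a)^2)*E < e^2"
   using e by (intro order_tendstoD(2)) auto
  moreover have "\<forall>\<^sub>F al in at_top. W al a < M" using s0(2)[OF a] by (intro order_tendstoD(2)[of _ "U a"]) (auto simp: M_def)
  moreover have "\<forall>\<^sub>F al in at_top. a < rh al" using s0(2)[OF a] by blast
  ultimately show ?thesis using eventually_gt_at_top[of "0::real"]
  proof eventually_elim
   case (elim al)
   note Wa = W[OF elim(4)]
   have "abs (W al s - U s) < e & abs (W1 al s - U1 s) < e" if s: "a <= s" "s < S" "s < rh al + 1" for s
   proof -
    have d: "(W al hasD W1 al r) (at r)" "(W1 al hasD - (dimN - 1)/r*W1 al r - 1*fp (W al r)) (at r)"
     "(U hasD U1 r) (at r)" "(U1 hasD - (dimN - 1)/r*U1 r - 1*fp (U r)) (at r)"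
     if "a <= r" "r <= s" for r using Wa ode that s a by (auto simp: radial_ode_def)
    have WM: "W al r <= M" if r: "a <= r" "r <= s" for r
    proof -
     have "W al r <= W al a"
     proof (rule DERIV_nonpos_imp_nonincreasing[where f = "W al", OF r(1)])
      show "EX y. (W al hasD y) (at x) & y <= 0" if "a <= x" "x <= r" for x
      using d(1)[of x] Wa that r s a by (intro exI[of _ "W1 al x"]) (auto intro: less_imp_le)
     qed
     then show ?thesis using elim(2) by simp
    qed
    have UM: "U r <= M" if "a <= r" "r <= s" for r
     using Ub(1)[of a r] that s a by (cases "r = a") (auto simp: M_def)
    have "(W al s - U s)^2 + (W1 al s - U1 s)^2 <= ((W al a - U a)^2 + (W1 al a - U1 a)^2)*exp ((1 + L)*(s - a))"
     by (rule radial_ode_gronwall[OF a(1) s(1) N L(1), where g = "%r. fp (W al r)" and h = "%r. fp (U r)"])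
      (use d[THEN has_field_derivative_at_within] WM UM L(2) in auto)
    also have "... <= ((W al a - U a)^2 + (W1 al a - U1 a)^2)*E"
     unfolding E_def using s L(1) by (intro mult_left_mono) auto
    also have "... < e^2" by (rule elim(1))
    finally have le: "(W al s - U s)^2 + (W1 al s - U1 s)^2 < e^2" .
    have "(W al s - U s)^2 < e^2" "(W1 al s - U1 s)^2 < e^2"
     using le zero_le_power2[of "W al s - U s"] zero_le_power2[of "W1 al s - U1 s"] by linarith+
    then show ?thesis
     using power2_less_imp_less[of "abs (W al s - U s)" e] power2_less_imp_less[of "abs (W1 al s - U1 s)" e] e by simp
   qed
   then show ?case using elim(3) by blast
  qed
 qed
 show "(rh ---> R) at_top"
  unfolding tendsto_iff dist_real_def
 proof (intro allI impI)
  fix d :: real assume d: "d > 0"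
  define a where "a = min (s0/2) (R/2)"
  define de where "de = min (min (d/2) (R/4)) ((S - R)/2)"
  have a: "0 < a" "a < s0" "a <= R/2" using s0 US by (auto simp: a_def)
  have "de > 0" "de <= d/2" "de <= R/4" using d US by (simp_all add: de_def)
  moreover have "de <= (S - R)/2" unfolding de_def by (rule min.cobounded2)
  then have "R + de < S" using US by (simp add: field_simps)
  ultimately have dl: "0 < de" "de <= d/2" "de <= R/4" "R + de < S" by blast+
  define e where "e = min (U (R - de)) (- U (R + de))"
  have e: "e > 0" using Ub(2)[of "R - de"] Ub(3)[of "R + de"] dl US by (simp add: e_def)
  have e2: "e <= U (R - de)" "e <= - U (R + de)" by (simp_all add: e_def)
  show "\<forall>\<^sub>F al in at_top. abs (rh al - R) < d"
   using close[OF a(1,2) e] eventually_gt_at_top[of "0::real"]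
  proof eventually_elim
   case (elim al)
   note Wa = W[OF elim(2)]
   have "R - de < rh al"
   proof (rule ccontr)
    assume "~ R - de < rh al"
    then have le: "rh al <= R - de" by simp
    then have "abs (W al (rh al) - U (rh al)) < e" using elim(1) dl US by auto
    moreover have "U (rh al) >= U (R - de)"
     using Ub(1)[of "rh al" "R - de"] le Wa dl US by (cases "rh al = R - de") auto
    moreover have "W al (rh al) = 0" using Wa by blast
    ultimately show False using e2(1) by linarith
   qed
   moreover have "rh al <= R + de"
   proof (rule ccontr)
    assume n: "~ rh al <= R + de"
    then have "abs (W al (R + de) - U (R + de)) < e" using elim(1) dl US a by auto
    moreover have "W al (R + de) > 0" using Wa n dl US by auto
    ultimately show False using e2(2) by linarith
   qed
   ultimately show "abs (rh al - R) < d" using dl d by linarith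
  qed
 qed
qed

lemma rescaled_profiles_converge:
 assumes U: "extended_profile U U1 R S"
  and V: "!!al. al > 0 ==> regular_profile (V al) (V1 al) (rh al) al"
  and u: "!!al r. al > 0 ==> 0 < r ==> r <= 1 ==> u al r = V al (rh al*r)"
 shows "(rh ---> R) at_top" "C2_loc_convergent {0<..1} u (%r. U (R*r)) at_top"
proof -
 have US: "0 < R" "R < S" and sing: "singular_profile U U1 R" and ode: "radial_ode fp dimN 1 U U1 0 S"
  using U by (auto simp: extended_profile_def)
 have Vp: "rh al > 0" "radial_ode f dimN 1 (V al) (V1 al) 0 (rh al)" "continuous_on {0..rh al} (V al)" "V al (rh al) = 0"
  "!!s. 0 < s ==> s < rh al ==> V al s > 0" "!!s. 0 < s ==> s < rh al ==> V1 al s < 0" if "al > 0" for al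
  using V[OF that] regular_profile_decreasing(1)[OF V[OF that]] by (auto simp: regular_profile_def)
 \<comment> \<open>All regular profiles are continued by one unit past their zeros, so that they can
   be compared with U on both sides of R.\<close>
 have "EX W W1. radial_ode fp dimN 1 W W1 0 (rh al + 1) & (ALL r. 0 < r & r < rh al --> W r = V al r & W1 r = V1 al r) &
  (ALL s. 0 < s & s < rh al + 1 --> W1 s < 0)" if "al > 0" for al
  by (rule radial_extend[OF Vp(1,2,5,6)]) (use that in auto)
 then obtain W W1 where W: "!!al. al > 0 ==> radial_ode fp dimN 1 (W al) (W1 al) 0 (rh al + 1)"
  "!!al r. al > 0 ==> 0 < r ==> r < rh al ==> W al r = V al r & W1 al r = V1 al r"
  "!!al s. al > 0 ==> 0 < s ==> s < rh al + 1 ==> W1 al s < 0" by metis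
 have Wrho: "W al (rh al) = 0" if al: "al > 0" for al
 proof -
  have "(W al hasD W1 al (rh al)) (at (rh al))"
   using W(1)[OF al] Vp(1)[OF al] by (simp add: radial_ode_def)
  then have "isCont (W al) (rh al)" by (rule DERIV_isCont)
  then have 1: "(W al ---> W al (rh al)) (at_left (rh al))" by (auto simp: isCont_def intro: filterlim_mono[OF _ order_refl at_le])
  have "(V al ---> V al (rh al)) (at_left (rh al))"
   using continuous_on_Icc_at_leftD[OF Vp(3)[OF al] Vp(1)[OF al]] .
  moreover have "\<forall>\<^sub>F r in at_left (rh al). V al r = W al r"
   unfolding eventually_at_left_field using W(2)[OF al] Vp(1)[OF al] by (intro exI[of _ 0]) auto
  ultimately have "(W al ---> V al (rh al)) (at_left (rh al))" by (rule Lim_transform_eventually)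
  then show ?thesis using tendsto_unique[OF _ 1] Vp(4)[OF al] by fastforce
 qed
 obtain s0 where s0: "s0 > 0" "!!s. 0 < s ==> s < s0 ==> (\<forall>\<^sub>F al in at_top. s < rh al) &
  ((%al. V al s) ---> U s) at_top & ((%al. V1 al s) ---> U1 s) at_top"
  using regular_near_zero[OF sing V] by blast
 have s0': "(\<forall>\<^sub>F al in at_top. s < rh al) &
  ((%al. W al s) ---> U s) at_top & ((%al. W1 al s) ---> U1 s) at_top" if s: "0 < s" "s < s0" for s
 proof -
  note V' = s0(2)[OF s]
  have "\<forall>\<^sub>F al in at_top. V al s = W al s & V1 al s = W1 al s"
   using V'[THEN conjunct1] eventually_gt_at_top[of "0::real"]
   by eventually_elim (use W(2) s in auto)
  then have "\<forall>\<^sub>F al in at_top. V al s = W al s" "\<forall>\<^sub>F al in at_top. V1 al s = W1 al s"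
   by (auto elim: eventually_mono)
  then show ?thesis using V' by (auto intro: Lim_transform_eventually)
 qed
 have Wall: "rh al > 0 & radial_ode fp dimN 1 (W al) (W1 al) 0 (rh al + 1) & W al (rh al) = 0 &
   (ALL s. 0 < s & s < rh al --> W al s > 0) & (ALL s. 0 < s & s < rh al + 1 --> W1 al s < 0)" if "al > 0" for al
  using Vp(1,5)[OF that] W[OF that] Wrho[OF that] by simp
 show rho: "(rh ---> R) at_top" by (rule profiles_converge(1)[OF U Wall s0(1) s0'])
 have conv: "\<forall>\<^sub>F al in at_top. a < rh al & (ALL s. a <= s & s < S & s < rh al + 1 -->
   \<bar>W al s - U s\<bar> < e & abs (W1 al s - U1 s) < e)" if "0 < a" "a < s0" "e > 0" for a e
  by (rule profiles_converge(2)[OF U Wall s0(1) s0']) (use that in auto)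
 have rho0: "\<forall>\<^sub>F al in at_top. rh al > 0" using eventually_gt_at_top[of "0::real"] by eventually_elim (use Vp in auto)
 have uW: "u al r = W al (rh al*r)" if "al > 0" "0 < r" "r <= 1" for al r
 proof (cases "r = 1")
  case True then show ?thesis using u[of al r] that Vp(4) Wrho by simp
 next
  case False
  then show ?thesis using u[OF that] W(2)[OF that(1), of "rh al*r"] Vp(1)[OF that(1)] that by simp
 qed
 have C2a: "C2_on {0<..1} (u al)"
  "!!r. 0 < r ==> r <= 1 ==> deriv_on {0<..1} (u al) r = 1/r*(rh al*r*W1 al (rh al*r))"
  "!!r. 0 < r ==> r <= 1 ==> deriv_on {0<..1} (deriv_on {0<..1} (u al)) r = 1/r^2*((rh al*r)^2 *
   (- (dimN - 1)/(rh al*r)*W1 al (rh al*r) - fp (W al (rh al*r))))" if al: "al > 0" for al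
 proof -
  have lt: "rh al < rh al + 1" by simp
  note C = ode_imp_C2_on[OF W(1)[OF al] Vp(1)[OF al] lt, of "u al", OF uW[OF al]]
  show "C2_on {0<..1} (u al)" by (rule C(1))
  show "deriv_on {0<..1} (u al) r = 1/r*(rh al*r*W1 al (rh al*r))" if "0 < r" "r <= 1" for r
   by (rule C(2)) (use that in auto)
  show "deriv_on {0<..1} (deriv_on {0<..1} (u al)) r = 1/r^2*((rh al*r)^2 *
   (- (dimN - 1)/(rh al*r)*W1 al (rh al*r) - fp (W al (rh al*r))))" if "0 < r" "r <= 1" for r
   by (rule C(3)) (use that in auto)
 qed
 note C2U = ode_imp_C2_on[OF ode US, of "%r. U (R*r)"]
 have "uniform_limit K u (%r. U (R*r)) at_top &
   uniform_limit K (%al. deriv_on {0<..1} (u al)) (deriv_on {0<..1} (%r. U (R*r))) at_top &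
   uniform_limit K (%al. deriv_on {0<..1} (deriv_on {0<..1} (u al))) (deriv_on {0<..1} (deriv_on {0<..1} (%r. U (R*r)))) at_top"
  if K: "compact K" "K \<subseteq> {0<..1}" for K
 proof -
  have "EX r1. 0 < r1 & r1 <= 1 & K \<subseteq> {r1..1}"
  proof (cases "K = {}")
   case False
   then obtain m where "m \<in> K" "!!x. x \<in> K ==> m <= x" using compact_attains_inf[OF K(1)] by blast
   then show ?thesis using K(2) by (intro exI[of _ m]) auto
  qed (auto intro: exI[of _ 1])
  then obtain r1 where r1: "0 < r1" "r1 <= 1" "K \<subseteq> {r1..1}" by blast
  define a where "a = min (s0/2) (r1*R/2)"
  have a: "0 < a" "a < s0" "a < r1*R" using s0(1) r1 US by (auto simp: a_def min_def)
  define b where "b = (R + S)/2"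
  have b: "R < b" "b < S" using US by (auto simp: b_def)
  have dU: "(U hasD U1 s) (at s)" "(U1 hasD - (dimN - 1)/s*U1 s - 1*fp (U s)) (at s)"
   if "a <= s" "s <= b" for s using ode that a b by (auto simp: radial_ode_def)
  have cU: "continuous_on {a..b} U" "continuous_on {a..b} U1"
   using dU by (auto intro!: continuous_at_imp_continuous_on DERIV_isCont)
  have cl: "\<forall>\<^sub>F al in at_top. ALL s. a <= s & s <= b & s <= rh al --> abs (W al s - U s) < e & abs (W1 al s - U1 s) < e" if "e > 0" for e
   using conv[OF a(1,2) that] by eventually_elim (use b in auto)
  have l0: "uniform_limit {r1..1} (%al r. W al (rh al*r)) (%r. U (R*r)) at_top"
  proof (rule uniform_limit_dilation[OF a(3) b(1) r1(1) cU(1) _ rho rho0 r1(2) US(1)])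
   show "\<forall>\<^sub>F al in at_top. ALL s. a <= s & s <= b & s <= rh al --> abs (W al s - U s) < e" if "e > 0" for e
    using cl[OF that] by eventually_elim blast
  qed
  have l1: "uniform_limit {r1..1} (%al r. rh al*r*W1 al (rh al*r)) (%r. R*r*U1 (R*r)) at_top"
  proof (rule uniform_limit_dilation[where G = "%al s. s*W1 al s" and g = "%s. s*U1 s", OF a(3) b(1) r1(1) _ _ rho rho0 r1(2) US(1)])
   show "continuous_on {a..b} (%s. s*U1 s)" by (intro continuous_intros cU)
   fix e :: real assume e: "e > 0"
   have "e/b > 0" using e b US by simp
   from cl[OF this] show "\<forall>\<^sub>F al in at_top. ALL s. a <= s & s <= b & s <= rh al --> abs (s*W1 al s - s*U1 s) < e"
   proof (eventually_elim, intro allI impI)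
    fix al s assume *: "ALL s. a <= s & s <= b & s <= rh al --> abs (W al s - U s) < e/b & abs (W1 al s - U1 s) < e/b"
     and s: "a <= s & s <= b & s <= rh al"
    have "abs (s*W1 al s - s*U1 s) = s*abs (W1 al s - U1 s)" using s a by (simp add: right_diff_distrib[symmetric] abs_mult)
    also have "... < s*(e/b)" using * s a by (intro mult_strict_left_mono) auto
    also have "... <= b*(e/b)" using s e b US by (intro mult_right_mono) auto
    finally show "abs (s*W1 al s - s*U1 s) < e" using b US by simp
   qed
  qed
  define G2 where "G2 w w1 s = s^2*(- (dimN - 1)/s*w1 s - fp (w s))" for w w1 :: "real => real" and s
  have l2: "uniform_limit {r1..1} (%al r. G2 (W al) (W1 al) (rh al*r)) (%r. G2 U U1 (R*r)) at_top"
  proof (rule uniform_limit_dilation[OF a(3) b(1) r1(1) _ _ rho rho0 r1(2) US(1)])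
   show "continuous_on {a..b} (G2 U U1)" unfolding G2_def[abs_def]
    by (intro continuous_intros cU continuous_on_compose2[OF fp_cont[of UNIV]]) (use a in auto)
   fix e :: real assume e: "e > 0"
   define M where "M = U a + 1"
   obtain L where L: "L >= 0" "!!u v. u <= M ==> v <= M ==> abs (fp u - fp v) <= L*abs (u - v)"
    using fp_lipschitz[of M] by blast
   \<comment> \<open>Lipschitz constant of \<open>G2\<close> in the pair (w, w1) on {a..b}, plus 1
     to obtain a strict inequality.\<close>
   define B where "B = b*(dimN - 1) + b^2*L + 1"
   have B: "B > 0" using b US dimN_gt L by (auto simp: B_def intro!: add_nonneg_pos add_nonneg_nonneg mult_nonneg_nonneg)
   define e' where "e' = min 1 (e/B)"
   have e': "e' > 0" "e' <= 1" "B*e' <= e" using e B by (auto simp: e'_def min_def field_simps)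
   from cl[OF e'(1)] show "\<forall>\<^sub>F al in at_top. ALL s. a <= s & s <= b & s <= rh al --> abs (G2 (W al) (W1 al) s - G2 U U1 s) < e"
   proof (eventually_elim, intro allI impI)
    fix al s assume *: "ALL s. a <= s & s <= b & s <= rh al --> abs (W al s - U s) < e' & abs (W1 al s - U1 s) < e'"
     and s: "a <= s & s <= b & s <= rh al"
    then have ws: "abs (W al s - U s) < e'" "abs (W1 al s - U1 s) < e'" by auto
    have s0: "s > 0" using s a by simp
    have Ua: "U s <= U a" using extended_profile_bounds(1)[OF U, of a s] s a b by (cases "s = a") auto
    have fl: "abs (fp (W al s) - fp (U s)) <= L*e'"
    proof -
     have "abs (fp (W al s) - fp (U s)) <= L*abs (W al s - U s)"
      using ws Ua e' by (intro L(2)) (auto simp: M_def)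
     also have "... <= L*e'" using ws L by (intro mult_left_mono) auto
     finally show ?thesis .
    qed
    have "G2 (W al) (W1 al) s - G2 U U1 s = - ((dimN - 1) * s*(W1 al s - U1 s)) + - (s^2*(fp (W al s) - fp (U s)))"
     using s0 by (simp add: G2_def power2_eq_square field_simps)
    then have "abs (G2 (W al) (W1 al) s - G2 U U1 s) <= abs ((dimN - 1) * s*(W1 al s - U1 s)) + abs (s^2*(fp (W al s) - fp (U s)))"
     by linarith
    also have "abs ((dimN - 1) * s*(W1 al s - U1 s)) <= (dimN - 1)*b*e'"
     unfolding abs_mult using s s0 ws dimN_gt by (intro mult_mono) auto
    also have "abs (s^2*(fp (W al s) - fp (U s))) <= b^2*(L*e')"
     unfolding abs_mult using fl s s0 by (intro mult_mono) (auto intro: power_mono)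
    also have "(dimN - 1)*b*e' + b^2*(L*e') < B*e'"
     using e'(1) by (simp add: B_def algebra_simps)
    also have "... <= e" by (rule e')
    finally show "abs (G2 (W al) (W1 al) s - G2 U U1 s) < e" by simp
   qed
  qed
  have c: "abs (1/r) <= 1/r1" "abs (1/r^2) <= 1/r1^2" if "r \<in> {r1..1}" for r
   using that r1 by (auto simp: abs_of_pos intro!: divide_left_mono power_mono mult_pos_pos)
  note l1' = uniform_limit_fixed_factor[where c = "%r. 1/r", OF l1 c(1)]
   and l2' = uniform_limit_fixed_factor[where c = "%r. 1/r^2", OF l2 c(2)]
  have ev: "\<forall>\<^sub>F al in at_top. al > (0::real)" by (rule eventually_gt_at_top)
  have "uniform_limit {r1..1} u (%r. U (R*r)) at_top"
   by (rule uniform_limit_cong[THEN iffD1, OF _ _ l0], rule eventually_mono[OF ev])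
    (use r1 in "simp_all add: uW")
  moreover have "uniform_limit {r1..1} (%al. deriv_on {0<..1} (u al)) (deriv_on {0<..1} (%r. U (R*r))) at_top"
   by (rule uniform_limit_cong[THEN iffD1, OF _ _ l1'], rule eventually_mono[OF ev])
    (use r1 in "simp_all add: C2a(2) C2U(2)")
  moreover have "uniform_limit {r1..1} (%al. deriv_on {0<..1} (deriv_on {0<..1} (u al))) (deriv_on {0<..1} (deriv_on {0<..1} (%r. U (R*r)))) at_top"
   by (rule uniform_limit_cong[THEN iffD1, OF _ _ l2'], rule eventually_mono[OF ev])
    (use r1 in "simp_all add: C2a(3) C2U(3) G2_def")
  ultimately show ?thesis using uniform_limit_on_subset[OF _ r1(3)] by blast
 qed
 moreover have "\<forall>\<^sub>F al in at_top. C2_on {0<..1} (u al)"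
  using eventually_gt_at_top[of "0::real"] by eventually_elim (rule C2a(1))
 moreover have "C2_on {0<..1} (%r. U (R*r))" by (rule C2U(1)) simp
 ultimately show "C2_loc_convergent {0<..1} u (%r. U (R*r)) at_top"
  unfolding C2_loc_convergent_def by blast
qed

end

section \<open>Asymptotics at the origin\<close>

lemma abs_exp_minus_taylor_le: "abs x <= 1/2 ==> abs (exp (- x) - 1 + x) <= 2*abs x*abs (x::real)"
proof -
 assume x: "abs x <= 1/2"
 have "norm ((exp (- x) - 1 + x) - (exp (- 0) - 1 + 0)) <= (2*abs x)*norm (x - 0)"
 proof (rule field_differentiable_bound[of "{-\<bar>x\<bar>..\<bar>x\<bar>}" _ "%x. 1 - exp (- x)"])
  fix y assume y: "y \<in> {-\<bar>x\<bar>..\<bar>x\<bar>}"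
  show "((%x. exp (- x) - 1 + x) hasD 1 - exp (- y)) (at y within {-\<bar>x\<bar>..\<bar>x\<bar>})"
   by (auto intro!: derivative_eq_intros)
  have "abs (1 - exp (- y)) <= 2*abs y" using x y by (intro abs_one_minus_exp_le) auto
  also have "... <= 2*abs x" using y by auto
  finally show "norm (1 - exp (- y)) <= 2*abs x" by simp
 qed auto
 then show ?thesis by simp
qed

text \<open>Lyapunov estimate with forcing \<open>p\<close>. Of the damping 2*mu the coupling 2*D*E
  takes 1, and the condition on \<open>ep\<close> lets the remainder take at most 2*mu - 2, so that
  1 is left.\<close>

lemma emden_comparison_step:
 fixes D E R ep p mu :: real
 assumes mu: "mu > 2" and e: "ep >= 0" "ep*(5 + 2*mu) <= 2*mu - 2"
  and R: "abs R <= ep*(abs E + (1 + mu)*abs D + p)" and p: "p >= 0"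
 shows "2*D*(E - mu*D) + 2*E*(- mu*E + R) <= - (D^2 + E^2) + ep*p^2"
proof -
 define V where "V = D^2 + E^2"
 have V: "V >= 0" "E^2 <= V" by (auto simp: V_def)
 have DE: "2*(abs D*abs E) <= V"
  using sum_squares_bound[of "abs D" "abs E"] by (simp add: V_def)
 have DE': "2*(D*E) <= V" using sum_squares_bound[of D E] by (simp add: V_def)
 have pE: "2*(abs E*p) <= V + p^2" using sum_squares_bound[of "abs E" p] V by simp
 have "2*(E*R) <= 2*(abs E*abs R)" by (metis abs_ge_self abs_mult mult_left_mono zero_le_numeral)
 also have "... <= 2*(abs E*(ep*(abs E + (1 + mu)*abs D + p)))"
  using R by (intro mult_left_mono) auto
 also have "... = ep*(2*E^2 + (1 + mu)*(2*(abs D*abs E)) + 2*(abs E*p))"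
  by (simp add: power2_eq_square algebra_simps)
 also have "... <= ep*(2*V + (1 + mu)*V + (V + p^2))"
  using V DE pE mu e by (intro mult_left_mono add_mono) auto
 also have "... = ep*(4 + mu)*V + ep*p^2" by (simp add: algebra_simps)
 also have "ep*(4 + mu)*V <= (2*mu - 2)*V"
 proof (rule mult_right_mono[OF _ V(1)])
  have "ep*(4 + mu) <= ep*(5 + 2*mu)" using mu e by (intro mult_left_mono) auto
  then show "ep*(4 + mu) <= 2*mu - 2" using e by simp
 qed
 finally have "2*(E*R) <= (2*mu - 2)*V + ep*p^2" by simp
 moreover have "2*D*(E - mu*D) + 2*E*(- mu*E + R) = 2*(D*E) - 2*mu*V + 2*(E*R)"
  by (simp add: V_def power2_eq_square algebra_simps)
 moreover have "(2*mu - 2)*V = 2*mu*V - 2*V" by (simp add: algebra_simps)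
 ultimately show ?thesis unfolding V_def[symmetric] using DE' by linarith
qed

text \<open>X = ln mu^2 - ln y is driven by h*z^2, about 4*c*p with p = (- t) powr (- k). The
  forcing varies so slowly that X follows the balance mu^2*X = 4*c*p. D and E measure the deviation
  from A*p and its derivative; the rest \<open>R\<close> is a small multiple of |D|, |E| and p, so
  D^2 + E^2 - ep*p^2 is nonpositive near minus infinity for every small \<open>ep\<close>.\<close>

lemma emden_asymptotics:
 assumes mu: "mu > 2" and orb: "emden_orbit mu h T y z" and k: "k > 0"
  and hl: "((%t. h t*(- t) powr k) ---> c) at_bot"
  and yl: "(y ---> mu^2) at_bot" and zl: "(z ---> 2) at_bot"
 shows "((%t. (ln (mu^2) - ln (y t))*(- t) powr k) ---> 4*c/mu^2) at_bot"
proof -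
 define a where "a = mu*(mu - 4)/4"
 define A where "A = 4*c/mu^2"
 define p where "p t = (- t) powr (- k)" for t :: real
 define X where "X t = ln (mu^2) - ln (y t)" for t
 define p1 where "p1 t = k*(- t) powr (- k - 1)" for t :: real
 define p2 where "p2 t = k*(k + 1)*(- t) powr (- k - 2)" for t :: real
 have mu2: "mu^2 > 0" using mu by simp
 have dp: "(p hasD p1 t) (at t)" "(p1 hasD p2 t) (at t)" if t: "t < 0" for t
 proof -
  have m: "((%t. - t) hasD - 1) (at t)" by (auto intro!: derivative_eq_intros)
  have pw: "((%t. (- t) powr b) hasD b*(- t) powr (b - 1)*- 1) (at t)" for b
   by (rule DERIV_chain2[OF has_real_derivative_powr m]) (use t in simp)
  show "(p hasD p1 t) (at t)" using pw[of "- k"] by (simp add: p_def[abs_def] p1_def)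
  show "(p1 hasD p2 t) (at t)"
   unfolding p1_def[abs_def] using DERIV_cmult[OF pw[of "- k - 1"], of k] by (rule DERIV_cong) (simp add: p2_def algebra_simps)
 qed
 have ppos: "p t > 0" "p t*(- t) powr k = 1" if "t < 0" for t using that by (auto simp: p_def powr_add[symmetric])
 have Xl: "(X ---> 0) at_bot"
  unfolding X_def[abs_def] using tendsto_diff[OF tendsto_const tendsto_ln[OF yl], of "ln (mu^2)"] mu2 by simp
 define D where "D t = X t - A*p t" for t
 define E where "E t = z t - 2 - A*p1 t + mu*D t" for t
 define R where "R t = a*(z t - 2)^2 + h t*(z t)^2 + (y t - mu^2 + mu^2*X t) - A*(p2 t + 2*mu*p1 t + mu^2*p t)" for t
 have dD: "(D hasD E t - mu*D t) (at t)" and dE: "(E hasD - mu*E t + R t) (at t)"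
  if t: "t < T" "t < 0" for t
 proof -
  note o = emden_orbitD[OF orb t(1)]
  have "(D hasD 0 - 1/y t*(y t*(2 - z t)) - A*p1 t) (at t)"
   unfolding D_def[abs_def] X_def by (rule derivative_eq_intros DERIV_cmult o dp[OF t(2)] refl | simp)+
  then show dD: "(D hasD E t - mu*D t) (at t)" using o(1) by (simp add: E_def)
  have "(E hasD ((a + h t)*(z t)^2 - mu*(mu - 2)*z t + y t) - 0 - A*p2 t + mu*(E t - mu*D t)) (at t)"
   unfolding E_def[abs_def] a_def
   by (rule DERIV_add DERIV_diff DERIV_cmult DERIV_const o dp[OF t(2)] dD[unfolded E_def a_def])+
  then show "(E hasD - mu*E t + R t) (at t)"
   by (rule DERIV_cong) (simp add: E_def R_def D_def a_def power2_eq_square field_simps)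
 qed
 have hp: "((%t. (4*h t - mu^2*A*p t)*(- t) powr k) ---> 0) at_bot"
 proof -
  have "((%t. 4*(h t*(- t) powr k) - mu^2*A) ---> 4*c - mu^2*A) at_bot" by (intro tendsto_intros hl)
  moreover have "4*c - mu^2*A = 0" using mu2 by (simp add: A_def)
  moreover have "\<forall>\<^sub>F t in at_bot. 4*(h t*(- t) powr k) - mu^2*A = (4*h t - mu^2*A*p t)*(- t) powr k"
   using eventually_gt_at_bot[of "0::real"]
  proof eventually_elim
   case (elim t) then show ?case using ppos(2)[of t] by (simp add: algebra_simps)
  qed
  ultimately show ?thesis by (simp add: tendsto_cong)
 qed
 have hz: "((%t. h t*((z t)^2 - 4)*(- t) powr k) ---> 0) at_bot"
 proof -
  have "((%t. (h t*(- t) powr k)*((z t)^2 - 4)) ---> c*(2^2 - 4)) at_bot" by (intro tendsto_intros hl zl)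
  then show ?thesis by (simp add: mult_ac)
 qed
 have p1l: "((%t. p1 t*(- t) powr k) ---> 0) at_bot" "((%t. p2 t*(- t) powr k) ---> 0) at_bot"
 proof -
  have "((%t::real. k*(- t) powr (- 1)) ---> 0) at_bot" "((%t::real. k*(k + 1)*(- t) powr (- 2)) ---> 0) at_bot" by real_asymp+
  moreover have "\<forall>\<^sub>F t in at_bot. k*(- t) powr (- 1) = p1 t*(- t) powr k"
   using eventually_gt_at_bot[of "0::real"] 
  proof eventually_elim
   case (elim t)
   show ?case using powr_add[of "- t" "- k - 1" k] by (simp only: p1_def mult.assoc) simp
  qed
  moreover have "\<forall>\<^sub>F t in at_bot. k*(k + 1)*(- t) powr (- 2) = p2 t*(- t) powr k"
   using eventually_gt_at_bot[of "0::real"] 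
  proof eventually_elim
   case (elim t)
   show ?case using powr_add[of "- t" "- k - 2" k] by (simp only: p2_def mult.assoc) simp
  qed
  ultimately show "((%t. p1 t*(- t) powr k) ---> 0) at_bot" "((%t. p2 t*(- t) powr k) ---> 0) at_bot"
   by (simp_all add: tendsto_cong)
 qed
 have small: "\<forall>\<^sub>F t in at_bot. abs (v t) <= de*p t" if v: "((%t. v t*(- t) powr k) ---> 0) at_bot" and d: "de > 0" for v de
  using tendstoD[OF v d] eventually_gt_at_bot[of "0::real"]
 proof eventually_elim
  case (elim t)
  have "abs (v t) = abs (v t*(- t) powr k)*p t" using ppos[OF elim(2)] by (simp add: abs_mult mult_ac)
  also have "... <= de*p t" using elim ppos(1)[OF elim(2)] by (intro mult_right_mono) auto
  finally show ?case .
 qed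
 have V_small: "\<forall>\<^sub>F t in at_bot. (D t)^2 <= ep*(p t)^2" if eps: "0 < ep" "ep*(5 + 2*mu) <= 2*mu - 2" for ep
 proof -
  define B where "B = 1 + abs a + 2*mu^2 + abs A"
  \<comment> \<open>\<open>de\<close> bounds X, z - 2 and the ratios of the error terms to p; the
    divisor dominates the sum of all coefficients in \<open>R\<close>.\<close>
  define de where "de = ep/(B*(4 + abs A + 2*mu))"
  have B: "B > 0" by (simp add: B_def add_pos_nonneg add_nonneg_pos)
  have B4: "4 + abs A + 2*mu > 0" using mu by simp
  have dl: "de > 0" "de*(B*(4 + abs A + 2*mu)) = ep" using eps B B4 by (auto simp: de_def)
  have zl': "((%t. z t - 2) ---> 0) at_bot" using zl by (simp add: LIM_zero_iff)
  have ev: "\<forall>\<^sub>F t in at_bot. abs (4*h t - mu^2*A*p t) <= de*p t & abs (h t*((z t)^2 - 4)) <= de*p t & abs (p1 t) <= de*p t &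
    \<bar>p2 t\<bar> <= de*p t & abs (X t) <= min de (1/2) & abs (z t - 2) <= de & t < T & t < 0 & D t <= 1 & - D t <= 1 & E t <= 1 & - E t <= 1"
  proof -
   have pl: "(p ---> 0) at_bot" "(p1 ---> 0) at_bot" unfolding p_def[abs_def] p1_def[abs_def] using k by real_asymp+
   have Dl: "(D ---> 0 - A*0) at_bot" unfolding D_def[abs_def] by (intro tendsto_intros Xl pl)
   then have El: "(E ---> 2 - 2 - A*0 + mu*(0 - A*0)) at_bot" unfolding E_def[abs_def] by (intro tendsto_intros zl pl)
   have "\<forall>\<^sub>F t in at_bot. abs (D t) < 1" "\<forall>\<^sub>F t in at_bot. abs (E t) < 1" "\<forall>\<^sub>F t in at_bot. abs (X t) < min de (1/2)" "\<forall>\<^sub>F t in at_bot. abs (z t - 2) < de"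
    using tendstoD[OF Dl, of 1] tendstoD[OF El, of 1] tendstoD[OF Xl, of "min de (1/2)"] tendstoD[OF zl', of de] dl by simp_all
   then show ?thesis
    using small[OF hp dl(1)] small[OF hz dl(1)] small[OF p1l(1) dl(1)] small[OF p1l(2) dl(1)]
     eventually_gt_at_bot[of T] eventually_gt_at_bot[of "0::real"]
    by eventually_elim (auto simp: abs_less_iff)
  qed
  then obtain T' where T': "!!t. t <= T' ==> abs (4*h t - mu^2*A*p t) <= de*p t & abs (h t*((z t)^2 - 4)) <= de*p t & abs (p1 t) <= de*p t &
    \<bar>p2 t\<bar> <= de*p t & abs (X t) <= min de (1/2) & abs (z t - 2) <= de & t < T & t < 0 & D t <= 1 & - D t <= 1 & E t <= 1 & - E t <= 1"
   by (auto simp: eventually_at_bot_linorder)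
  have Rb: "abs (R t) <= ep*(abs (E t) + (1 + mu)*abs (D t) + p t)" if t: "t <= T'" for t
  proof -
   note tt = T'[OF t]
   have t0: "t < 0" "t < T" using tt by auto
   have p: "p t > 0" using ppos t0 by blast
   define Q where "Q = abs (E t) + (1 + mu)*abs (D t) + p t"
   have Q: "abs (E t) + mu*abs (D t) <= Q" "abs (D t) <= Q" "p t <= Q" "Q >= 0"
    using p mu by (auto simp: Q_def algebra_simps intro!: add_nonneg_nonneg)
   have dd: "de <= ep"
   proof -
    have "1*1 <= B*(4 + abs A + 2*mu)" using mu by (intro mult_mono) (auto simp: B_def)
    then have "de*1 <= de*(B*(4 + abs A + 2*mu))" using dl(1) by (intro mult_left_mono) auto
    then show ?thesis using dl(2) by simp
   qed
   have eps1: "ep <= 1"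
   proof -
    have "ep*(5 + 2*mu) <= 5 + 2*mu" using eps(2) mu by linarith
    then show ?thesis using mu mult_le_cancel_right_pos[of "5 + 2*mu" ep 1] by simp
   qed
   have Zb: "abs (z t - 2) <= Q + abs A*Q"
   proof -
    have "z t - 2 = E t - mu*D t + A*p1 t" by (simp add: E_def)
    moreover have "abs (A*p1 t) <= abs A*Q"
    proof -
     have "abs (p1 t) <= 1*p t" 
      by (rule order_trans[OF _ mult_right_mono[of de 1 "p t"]]) (use tt dd eps1 p in auto)
     then show ?thesis unfolding abs_mult using Q by (intro mult_left_mono) auto
    qed
    moreover have "abs (mu*D t) = mu*abs (D t)" using mu by (simp add: abs_mult)
    ultimately show ?thesis using Q(1) by linarith
   qed
   have r1: "abs (a*(z t - 2)^2) <= abs a*(de*(Q + abs A*Q))"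
    
    unfolding abs_mult power2_eq_square using tt Zb Q dl(1) by (intro mult_left_mono mult_mono) auto
   have r2: "abs (h t*(z t)^2 - mu^2*A*p t) <= 2*(de*Q)"
   proof -
    have "h t*(z t)^2 - mu^2*A*p t = h t*((z t)^2 - 4) + (4*h t - mu^2*A*p t)" by (simp add: algebra_simps)
    moreover have "de*p t <= de*Q" using Q dl by (intro mult_left_mono) auto
    ultimately show ?thesis using tt by linarith
   qed
   have r3: "abs (y t - mu^2 + mu^2*X t) <= mu^2*(2*de*(Q + abs A*Q))"
   proof -
    have yp: "y t > 0" using emden_orbitD(1)[OF orb t0(2)] .
    have "exp (- X t) = exp (ln (y t))/exp (ln (mu^2))" by (simp add: X_def exp_diff)
    then have "y t = mu^2*exp (- X t)" using yp mu2 by simp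
    then have "y t - mu^2 + mu^2*X t = mu^2*(exp (- X t) - 1 + X t)" by (simp add: algebra_simps)
    moreover have "abs (exp (- X t) - 1 + X t) <= 2*abs (X t)*abs (X t)" using tt by (intro abs_exp_minus_taylor_le) auto
    moreover have "2*abs (X t)*abs (X t) <= 2*de*(Q + abs A*Q)"
    proof -
     have "X t = D t + A*p t" by (simp add: D_def)
     then have "abs (X t) <= abs (D t) + abs A*p t" using abs_triangle_ineq[of "D t" "A*p t"] p by (simp add: abs_mult)
     also have "... <= Q + abs A*Q" using Q by (intro add_mono mult_left_mono) auto
     finally show ?thesis using tt Q dl by (intro mult_mono) auto
    qed
    ultimately show ?thesis using mu2 by (simp add: abs_mult)
   qed
   have r4: "abs (A*(p2 t + 2*mu*p1 t)) <= abs A*((1 + 2*mu)*(de*Q))"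
   proof -
    have dQ: "de*p t <= de*Q" using Q dl by (intro mult_left_mono) auto
    have "abs (p2 t + 2*mu*p1 t) <= abs (p2 t) + 2*mu*abs (p1 t)"
     using abs_triangle_ineq[of "p2 t" "2*mu*p1 t"] mu by (simp add: abs_mult)
    also have "... <= de*Q + 2*mu*(de*Q)" using tt dQ mu by (intro add_mono mult_left_mono) auto
    finally show ?thesis unfolding abs_mult by (intro mult_left_mono) (auto simp: algebra_simps)
   qed
   have "R t = a*(z t - 2)^2 + (h t*(z t)^2 - mu^2*A*p t) + (y t - mu^2 + mu^2*X t) - A*(p2 t + 2*mu*p1 t)"
    by (simp add: R_def algebra_simps)
   then have "abs (R t) <= abs (a*(z t - 2)^2) + abs (h t*(z t)^2 - mu^2*A*p t) + abs (y t - mu^2 + mu^2*X t) + abs (A*(p2 t + 2*mu*p1 t))"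
    by linarith
   also have "... <= abs a*(de*(Q + abs A*Q)) + 2*(de*Q) + mu^2*(2*de*(Q + abs A*Q)) + abs A*((1 + 2*mu)*(de*Q))"
    by (intro add_mono r1 r2 r3 r4)
   also have "... = de*Q*(abs a*(1 + abs A) + 2 + 2*mu^2*(1 + abs A) + abs A*(1 + 2*mu))" by (simp add: algebra_simps)
   also have "... <= de*Q*(B*(4 + abs A + 2*mu))"
   proof (rule mult_left_mono)
    have n: "abs a*(3 + 2*mu) >= 0" "2*mu^2*(3 + 2*mu) >= 0" "abs A*(3 + abs A) >= 0" using mu by auto
    have "B*(4 + abs A + 2*mu) - (abs a*(1 + abs A) + 2 + 2*mu^2*(1 + abs A) + abs A*(1 + 2*mu)) =
     2 + abs A + 2*mu + abs a*(3 + 2*mu) + 2*mu^2*(3 + 2*mu) + abs A*(3 + abs A)"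
     by (simp add: B_def algebra_simps)
    then show "abs a*(1 + abs A) + 2 + 2*mu^2*(1 + abs A) + abs A*(1 + 2*mu) <= B*(4 + abs A + 2*mu)"
     using n mu by linarith
   qed (use Q dl in auto)
   also have "... = ep*Q" using dl(2) by (simp add: mult_ac)
   finally show ?thesis by (simp add: Q_def)
  qed
  define V where "V t = (D t)^2 + (E t)^2 - ep*(p t)^2" for t
  define V' where "V' t = 2*D t*(E t - mu*D t) + 2*E t*(- mu*E t + R t) - ep*(2*p t*p1 t)" for t
  have "V t <= 0" if t: "t < T'" for t
  proof (rule DERIV_decay_imp_nonpos[of 1 T' V V' 2, OF _ _ _ _ t])
   fix t assume t: "t < T'"
   then have t0: "t < T" "t < 0" using T'[of t] by auto
   show "(V hasD V' t) (at t)" unfolding V_def[abs_def] V'_def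
    by (rule derivative_eq_intros dD[OF t0] dE[OF t0] dp(1)[OF t0(2)] refl | simp)+
   have "2*D t*(E t - mu*D t) + 2*E t*(- mu*E t + R t) <= - ((D t)^2 + (E t)^2) + ep*(p t)^2"
    by (rule emden_comparison_step[OF mu _ eps(2) Rb]) (use eps t ppos(1)[OF t0(2)] in auto)
   \<comment> \<open>p is increasing, so the derivative of - ep*p^2 has the right sign.\<close>
   moreover have "ep*(2*p t*p1 t) >= 0" using eps ppos(1)[OF t0(2)] k by (auto simp: p1_def)
   ultimately have "V' t <= - V t" unfolding V'_def V_def by linarith
   then show "V' t <= - 1*V t" by simp
   have "(D t)^2 <= 1" "(E t)^2 <= 1"
    using T'[of t] t abs_square_le_1[of "D t"] abs_square_le_1[of "E t"] by (auto simp: abs_le_iff)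
   moreover have "ep*(p t)^2 >= 0" using eps by simp
   ultimately show "V t <= 2" unfolding V_def by linarith
  qed simp
  moreover have "\<forall>\<^sub>F t in at_bot. t < T'" by (rule eventually_gt_at_bot)
  ultimately show ?thesis
  proof (elim eventually_mono)
   fix t assume "!!t. t < T' ==> V t <= 0" "t < T'"
   then have "V t <= 0" by blast
   moreover have "0 <= (E t)^2" by simp
   ultimately show "(D t)^2 <= ep*(p t)^2" unfolding V_def by linarith
  qed
 qed
 have "((%t. D t*(- t) powr k) ---> 0) at_bot"
  unfolding tendsto_iff dist_real_def
 proof (intro allI impI)
  fix e :: real assume e: "e > 0"
  define ep where "ep = min (e^2/4) ((2*mu - 2)/(5 + 2*mu))"
  have eps: "0 < ep" "ep <= e^2/4" using e mu by (auto simp: ep_def)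
  have "ep <= (2*mu - 2)/(5 + 2*mu)" by (simp add: ep_def)
  then have "ep*(5 + 2*mu) <= 2*mu - 2" using mu by (simp add: pos_le_divide_eq)
  from V_small[OF eps(1) this] eventually_gt_at_bot[of "0::real"]
  show "\<forall>\<^sub>F t in at_bot. abs (D t*(- t) powr k - 0) < e"
  proof eventually_elim
   case (elim t)
   have "(D t*(- t) powr k)^2 <= ep*(p t*(- t) powr k)^2"
    using elim(1) by (simp add: power_mult_distrib mult_right_mono mult.assoc[symmetric])
   also have "... <= e^2/4" using ppos(2)[OF elim(2)] eps by simp
   also have "... < e^2" using e by simp
   finally show ?case using power2_less_imp_less[of "abs (D t*(- t) powr k)" e] e by simp
  qed
 qed
 then have "((%t. D t*(- t) powr k + A) ---> 0 + A) at_bot" by (intro tendsto_intros)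
 moreover have "\<forall>\<^sub>F t in at_bot. D t*(- t) powr k + A = X t*(- t) powr k"
  using eventually_gt_at_bot[of "0::real"]
 proof eventually_elim
  case (elim t) then show ?case using ppos(2)[OF elim] by (simp add: D_def left_diff_distrib mult.assoc)
 qed
 ultimately show ?thesis by (simp add: tendsto_cong X_def A_def)
qed

context jl_nonlinearity begin

text \<open>Since s^2 = y*F(U), one has s^2*f'(U) = y*(q + h) with y = mu^2*exp (- X). To first
  order the correction is mu^2*(h - q*X); inserting X ~ 4*h/mu^2 leaves mu^2 - 4*q = mu^2 - (mu -
  2)^2 = 4*(mu - 1) times h. The factor 2 powr (- k) stems from - ln w ~ - 2*ln s.\<close>

lemma singular_asymptotics:
 assumes U: "singular_profile U U1 R"
 shows "((%s. (s^2*f1 (U s) - (mu - 2)^2/4*mu^2)*(- ln s) powr k) ---> 4*(mu - 1)*(\<gamma>*2 powr (- k))) (at_right 0)"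
proof -
 define y where "y = emden_y U"
 define h where "h t = H (2*t - ln (y t))" for t
 define q where "q = (mu - 2)^2/4"
 define c where "c = \<gamma>*2 powr (- k)"
 define X where "X t = ln (mu^2) - ln (y t)" for t
 have mu2: "mu^2 > 0" using mu by simp
 obtain T where orb: "emden_orbit mu h T y (emden_z U U1)" and TR: "T <= ln R"
  using singular_orbit(1)[OF U] unfolding h_def[abs_def] y_def by blast
 have at_bot: "filterlim (%t. 2*t - ln (y t)) at_bot at_bot" and yl: "(y ---> mu^2) at_bot"
  and zl: "(emden_z U U1 ---> 2) at_bot"
  using singular_orbit(2-)[OF U] by (auto simp: y_def)
 have lny: "((%t. ln (y t)) ---> ln (mu^2)) at_bot" using mu2 by (intro tendsto_intros yl) simp
 have hl: "((%t. h t*(- t) powr k) ---> c) at_bot"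
 proof -
  have "((%t::real. 1/(- t)) ---> 0) at_bot" by real_asymp
  then have "((%t. (2 + ln (y t)*(1/(- t))) powr (- k)) ---> (2 + ln (mu^2)*0) powr (- k)) at_bot"
   by (intro tendsto_intros lny) auto
  then have "((%t. h t*(- (2*t - ln (y t))) powr k*(2 + ln (y t)*(1/(- t))) powr (- k)) ---> \<gamma>*(2 + ln (mu^2)*0) powr (- k)) at_bot"
   unfolding h_def by (intro tendsto_mult filterlim_compose[OF H_gamma at_bot])
  then have "((%t. h t*(- (2*t - ln (y t))) powr k*(2 + ln (y t)*(1/(- t))) powr (- k)) ---> c) at_bot"
   by (simp add: c_def)
  then show ?thesis
  proof (rule Lim_transform_eventually)
   have "\<forall>\<^sub>F t in at_bot. 2*t - ln (y t) < 0"
    using at_bot unfolding filterlim_at_bot_dense by blast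
   then show "\<forall>\<^sub>F t in at_bot. h t*(- (2*t - ln (y t))) powr k*(2 + ln (y t)*(1/(- t))) powr (- k) = h t*(- t) powr k"
    using eventually_gt_at_bot[of "0::real"]
   proof eventually_elim
    case (elim t)
    have eq: "2 + ln (y t)*(1/(- t)) = - (2*t - ln (y t))/(- t)" using elim by (simp add: field_simps)
    have "(- (2*t - ln (y t))) powr k*(2 + ln (y t)*(1/(- t))) powr (- k) = (- t) powr k"
     unfolding eq using elim by (subst powr_divide) (auto simp: powr_minus field_simps)
    then show ?case by (simp add: mult.assoc)
   qed
  qed
 qed
 have Xk: "((%t. X t*(- t) powr k) ---> 4*c/mu^2) at_bot"
  unfolding X_def by (rule emden_asymptotics[OF mu orb k(1) hl yl zl])
 have X0: "(X ---> 0) at_bot"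
  using tendsto_diff[OF tendsto_const[of "ln (mu^2)"] lny] by (simp add: X_def[abs_def])
 have eX: "((%t. (exp (- X t) - 1 + X t)*(- t) powr k) ---> 0) at_bot"
 proof (rule Lim_null_comparison)
  have "((%t. 2*abs (X t)*abs (X t*(- t) powr k)) ---> 2*abs 0*abs (4*c/mu^2)) at_bot" by (intro tendsto_intros X0 Xk)
  then show "((%t. 2*abs (X t)*abs (X t*(- t) powr k)) ---> 0) at_bot" by simp
  have "\<forall>\<^sub>F t in at_bot. abs (X t) < 1/2" using tendstoD[OF X0, of "1/2"] by simp
  then show "\<forall>\<^sub>F t in at_bot. norm ((exp (- X t) - 1 + X t)*(- t) powr k) <= 2*abs (X t)*abs (X t*(- t) powr k)"
  proof eventually_elim
   case (elim t)
   then have "abs (exp (- X t) - 1 + X t)*(- t) powr k <= 2*abs (X t)*abs (X t)*(- t) powr k"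
    by (intro mult_right_mono abs_exp_minus_taylor_le) auto
   then show ?case by (simp add: abs_mult mult.assoc)
  qed
 qed
 have "((%t. q*mu^2*((exp (- X t) - 1 + X t)*(- t) powr k - X t*(- t) powr k) + h t*(- t) powr k*y t)
   ---> q*mu^2*(0 - 4*c/mu^2) + c*mu^2) at_bot"
  by (intro tendsto_intros eX Xk hl yl)
 moreover have "q*mu^2*(0 - 4*c/mu^2) + c*mu^2 = 4*(mu - 1)*c"
  using mu by (simp add: q_def power2_eq_square field_simps)
 ultimately have "((%t. q*mu^2*((exp (- X t) - 1 + X t)*(- t) powr k - X t*(- t) powr k) + h t*(- t) powr k*y t)
   ---> 4*(mu - 1)*c) at_bot" by simp
 from filterlim_compose[OF this ln_at_0]
 show ?thesis unfolding c_def[symmetric] q_def[symmetric]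
 proof (rule Lim_transform_eventually)
  have R: "R > 0" using U by (simp add: singular_profile_def)
  have "\<forall>\<^sub>F t in at_bot. t < T" by (rule eventually_gt_at_bot)
  then have "\<forall>\<^sub>F s in at_right 0. ln s < T" using filterlim_iff[THEN iffD1, OF ln_at_0] by blast
  moreover have "\<forall>\<^sub>F s in at_right (0::real). s > 0" by (simp add: eventually_at_right_less)
  ultimately show "\<forall>\<^sub>F s in at_right 0.
   q*mu^2*((exp (- X (ln s)) - 1 + X (ln s))*(- ln s) powr k - X (ln s)*(- ln s) powr k) + h (ln s)*(- ln s) powr k*y (ln s)
   = (s^2*f1 (U s) - q*mu^2)*(- ln s) powr k"
  proof eventually_elim
   case (elim s)
   have "ln s < ln R" using elim TR by linarith
   then have sR: "s < R" using elim R by simp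
   have Us: "U s > 0" using U elim sR by (auto simp: singular_profile_def)
   have yp: "y (ln s) > 0" using emden_orbitD(1)[OF orb elim(1)] .
   have "exp (- X (ln s)) = exp (ln (y (ln s)))/exp (ln (mu^2))" by (simp add: X_def exp_diff)
   then have y1: "mu^2*exp (- X (ln s)) = y (ln s)" using yp mu2 by simp
   have hh: "h (ln s) = F (U s)*f1 (U s) - q"
    using emden_ln_w[of U "ln s"] Us elim F_pos[of "U s"] u_of_F[of "U s"] by (simp add: h_def y_def H_def q_def)
   have yF: "y (ln s)*F (U s) = s^2" using F_pos[of "U s"] Us elim by (simp add: y_def emden_y_def)
   have "q*mu^2*((exp (- X (ln s)) - 1 + X (ln s)) - X (ln s)) + h (ln s)*y (ln s)
    = q*(mu^2*exp (- X (ln s))) - q*mu^2 + (F (U s)*f1 (U s) - q)*y (ln s)" by (simp add: hh algebra_simps)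
   also have "... = (y (ln s)*F (U s))*f1 (U s) - q*mu^2" unfolding y1 by (simp add: algebra_simps)
   finally have "q*mu^2*((exp (- X (ln s)) - 1 + X (ln s)) - X (ln s)) + h (ln s)*y (ln s) = s^2*f1 (U s) - q*mu^2"
    unfolding yF .
   from this[symmetric] show ?case by (simp add: algebra_simps)
  qed
 qed
qed

text \<open>s*(ln f(U))' = - F*f'*z tends to - 2*q, so f(U) grows at most like s^(- ka - 2), and U'
  = - z*f(U)*F(U)/s with F(U) <= s^2 follows. A square integrable gradient demands ka < (N - 2)/2;
  such an exponent exists because 2*q < (N - 2)/2 + 1.\<close>

lemma singular_growth:
 assumes U: "singular_profile U U1 R"
 shows "EX ka>0. 2*ka + 2 < dimN & (EX C r0. 0 < r0 & r0 < R & (ALL s. 0 < s & s <= r0 --> U s <= C * s powr (- ka) & abs (U1 s) <= C * s powr (- ka - 1)))"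
proof -
 define a where "a = mu*(mu - 2)/2"
 define ka where "ka = max (a - 1) (a/2)"
 define q where "q = (mu - 2)^2/4"
 have a: "a > 0" using mu by (simp add: a_def)
 then have kap: "ka > 0" "ka < a" "a - 1 <= ka" by (auto simp: ka_def)
 have dim: "2*ka + 2 < dimN" using kap by (simp add: a_def dimN_def power2_eq_square algebra_simps)
 have q2: "q*2 < ka + 2"
 proof -
  have "a + 1 - q*2 = mu - 1" by (simp add: a_def q_def power2_eq_square field_simps)
  then show ?thesis using kap mu by linarith
 qed
 have R: "R > 0" and ode: "radial_ode f dimN 1 U U1 0 R" and Up: "!!s. 0 < s ==> s < R ==> U s > 0"
  and sing: "filterlim U at_top (at_right 0)" using U by (auto simp: singular_profile_def)
 define z where "z s = emden_z U U1 (ln s)" for s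
 define y where "y s = emden_y U (ln s)" for s
 have zl: "(z ---> 2) (at_right 0)" unfolding z_def[abs_def]
  by (rule filterlim_compose[OF singular_orbit(4)[OF U] ln_at_0])
 have yl: "(y ---> mu^2) (at_right 0)" unfolding y_def[abs_def]
  by (rule filterlim_compose[OF singular_orbit(3)[OF U] ln_at_0])
 have ql: "((%s. F (U s)*f1 (U s)) ---> q) (at_right 0)" unfolding q_def
  by (rule filterlim_compose[OF F_u_of_lim sing])
 have "((%s. (F (U s)*f1 (U s))*z s) ---> q*2) (at_right 0)" by (intro tendsto_mult ql zl)
 then have "\<forall>\<^sub>F s in at_right 0. (F (U s)*f1 (U s))*z s < ka + 2" using q2 by (rule order_tendstoD)
 moreover have "\<forall>\<^sub>F s in at_right 0. z s < 3" using zl by (rule order_tendstoD) simp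
 moreover have "\<forall>\<^sub>F s in at_right 0. y s > 1" using yl by (rule order_tendstoD) (use mu in "simp add: one_less_power")
 ultimately have "\<forall>\<^sub>F s in at_right 0. (F (U s)*f1 (U s))*z s < ka + 2 & z s < 3 & y s > 1" by eventually_elim auto
 then obtain b where b: "b > 0" "!!s. 0 < s ==> s < b ==> (F (U s)*f1 (U s))*z s < ka + 2 & z s < 3 & y s > 1"
  by (auto simp: eventually_at_right_field)
 define r0 where "r0 = min b R/2"
 have r0: "0 < r0" "r0 < b" "r0 < R" using b R by (auto simp: r0_def)
 have zeq: "s*U1 s = - z s*(f (U s)*F (U s))" and yeq: "y s*F (U s) = s^2" if s: "0 < s" "s < R" for s
  using Up[OF s] s f_pos[of "U s"] F_pos[of "U s"] by (auto simp: z_def emden_z_def y_def emden_y_def)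
 define g where "g s = ln (f (U s)) + (ka + 2)*ln s" for s
 have g_le: "g s <= g r0" if s: "0 < s" "s <= r0" for s
 proof (rule DERIV_nonneg_imp_nondecreasing[where f = g, OF s(2)], intro exI conjI)
  fix x assume x: "s <= x" "x <= r0"
  then have x0: "0 < x" "x < R" "x < b" using s r0 by auto
  have Ux: "U x > 0" "f (U x) > 0" using Up[OF x0(1,2)] f_pos by auto
  have dU: "(U hasD U1 x) (at x)" using ode x0 by (auto simp: radial_ode_def)
  have df: "(f hasD f1 (U x)) (at (U x))" using f_deriv[of "U x"] Ux by (simp add: at_within_pos)
  show "(g hasD f1 (U x)*U1 x*(1/f (U x)) + (ka + 2)*(1/x)) (at x)"
   unfolding g_def[abs_def] using x0 Ux
   by (auto intro!: derivative_eq_intros DERIV_chain2[OF df dU])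
  have "x*(f1 (U x)*U1 x*(1/f (U x)) + (ka + 2)*(1/x)) = f1 (U x)*(x*U1 x)/f (U x) + (ka + 2)"
   using x0 by (simp add: field_simps)
  also have "... = (ka + 2) - (F (U x)*f1 (U x))*z x" unfolding zeq[OF x0(1,2)] using Ux by simp
  also have "... > 0" using b(2)[OF x0(1,3)] by simp
  finally show "0 <= f1 (U x)*U1 x*(1/f (U x)) + (ka + 2)*(1/x)" using x0 by (simp add: zero_less_mult_iff)
 qed
 define C1 where "C1 = 3*exp (g r0)"
 have C1: "C1 > 0" by (simp add: C1_def)
 have U1b: "abs (U1 s) <= C1 * s powr (- ka - 1)" if s: "0 < s" "s <= r0" for s
 proof -
  have sR: "s < R" "s < b" using s r0 by auto
  have Us: "U s > 0" "f (U s) > 0" using Up[OF s(1) sR(1)] f_pos by auto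
  have "f (U s) = exp (g s) * s powr (- ka - 2)" 
  proof -
   have "exp (g s) * s powr (- ka - 2) = exp (g s + (- ka - 2)*ln s)" using s by (simp add: powr_def exp_add)
   also have "g s + (- ka - 2)*ln s = ln (f (U s))" by (simp add: g_def algebra_simps)
   finally show ?thesis using Us by simp
  qed
  also have "... <= exp (g r0) * s powr (- ka - 2)" using g_le[OF s] by (intro mult_right_mono) auto
  finally have fb: "f (U s) <= exp (g r0) * s powr (- ka - 2)" .
  have U1n: "U1 s < 0" by (rule singular_profile_decreasing[OF U s(1) sR(1)])
  have Fs: "F (U s) <= s^2"
  proof -
   have "1*F (U s) <= y s*F (U s)" using b(2)[OF s(1) sR(2)] F_pos[of "U s"] Us by (intro mult_right_mono) auto
   then show ?thesis using yeq[OF s(1) sR(1)] by simp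
  qed
  have "s*abs (U1 s) = z s*(f (U s)*F (U s))" using zeq[OF s(1) sR(1)] U1n by simp
  also have "... <= 3*(f (U s)*F (U s))" using b(2)[OF s(1) sR(2)] Us F_pos[of "U s"] by (intro mult_right_mono) auto
  also have "... <= 3*((exp (g r0) * s powr (- ka - 2)) * s^2)"
   using fb Fs Us F_pos[of "U s"] by (intro mult_left_mono mult_mono) auto
  also have "... = s*(C1 * s powr (- ka - 1))"
  proof -
   have "s powr (- ka - 2) * s^2 = s powr (- ka - 2) * s powr 2" using s by (simp add: powr_numeral)
   also have "... = s powr (- ka)" by (simp add: powr_add[symmetric])
   also have "... = s powr (- ka - 1) * s powr 1" by (subst powr_add[symmetric]) simp
   finally have "s powr (- ka - 2) * s^2 = s powr (- ka - 1) * s" using s by simp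
   then show ?thesis by (simp add: C1_def mult_ac)
  qed
  finally show ?thesis using s by (simp add: mult_le_cancel_left)
 qed
 define C where "C = max C1 (C1/ka + U r0*r0 powr ka)"
 have Ub: "U s <= C * s powr (- ka)" if s: "0 < s" "s <= r0" for s
 proof -
  have "U s - C1/ka * s powr (- ka) <= U r0 - C1/ka*r0 powr (- ka)"
  proof (rule DERIV_nonneg_imp_nondecreasing[where f = "%s. U s - C1/ka * s powr (- ka)", OF s(2)], intro exI conjI)
   fix x assume x: "s <= x" "x <= r0"
   then have x0: "0 < x" "x < R" using s r0 by auto
   have dU: "(U hasD U1 x) (at x)" using ode x0 by (auto simp: radial_ode_def)
   show "((%s. U s - C1/ka * s powr (- ka)) hasD U1 x + C1*x powr (- ka - 1)) (at x)"
    using x0 kap by (auto intro!: derivative_eq_intros dU)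
   show "0 <= U1 x + C1*x powr (- ka - 1)" using U1b[of x] x0 x by linarith
  qed
  moreover have "C1/ka*r0 powr (- ka) >= 0" using C1 kap by simp
  moreover have "U r0*1 <= U r0*(r0 powr ka * s powr (- ka))"
  proof (rule mult_left_mono)
   have "r0 powr ka * s powr (- ka) = (r0/s) powr ka" using s r0 by (simp add: powr_divide powr_minus_divide)
   also have "... >= 1" using s kap by (intro ge_one_powr_ge_zero) auto
   finally show "1 <= r0 powr ka * s powr (- ka)" .
   show "0 <= U r0" using Up[of r0] r0 by simp
  qed
  ultimately have "U s <= (C1/ka + U r0*r0 powr ka) * s powr (- ka)" by (simp add: algebra_simps)
  also have "... <= C * s powr (- ka)" by (intro mult_right_mono) (auto simp: C_def)
  finally show ?thesis .
 qed
 have "abs (U1 s) <= C * s powr (- ka - 1)" if s: "0 < s" "s <= r0" for s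
  by (rule order_trans[OF U1b[OF s]], intro mult_right_mono) (auto simp: C_def)
 with Ub kap dim r0 show ?thesis by blast
qed

end

section \<open>Divergence theorem for functions with compact support\<close>

text \<open>The gradient is carried as an argument, so that sums, products and radial factors can be
  differentiated by composing rules.\<close>

definition C1_grad :: "('a::euclidean_space => real) => ('a => 'a) => bool" where
 "C1_grad u G \<longleftrightarrow> (ALL x. (u has_derivative (%h. G x \<bullet> h)) (at x)) & continuous_on UNIV G"

lemma C1_grad_cont: "C1_grad u G ==> continuous_on S u" "C1_grad u G ==> continuous_on S G"
 unfolding C1_grad_def
 by (meson continuous_at_imp_continuous_on has_derivative_continuous) (blast intro: continuous_on_subset)

lemma C1_grad_pderiv: "C1_grad u G ==> pderiv_dir i u x = G x \<bullet> i"
 unfolding C1_grad_def using pderiv_dir_eq[of u "%h. G x \<bullet> h" x i] by blast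

lemma C1_gradD: "C1_grad u G ==> Ck_on 1 UNIV u" "C1_grad u G ==> grad u = G"
proof -
 assume u: "C1_grad u G"
 have "pderiv_dir i u = (%x. G x \<bullet> i)" for i using C1_grad_pderiv[OF u] by auto
 then show "Ck_on 1 UNIV u" "grad u = G"
  using u by (auto simp: C1_grad_def differentiable_def grad_def[abs_def] euclidean_representation intro!: continuous_intros)
qed

lemma C1_grad_grad: "Ck_on 1 UNIV u ==> C1_grad u (grad u)"
proof -
 assume u: "Ck_on 1 UNIV u"
 have "(%h. grad u x \<bullet> h) = frechet_derivative u (at x)" for x
 proof
  fix h
  have D: "(u has_derivative frechet_derivative u (at x)) (at x)" using u frechet_derivative_works by auto
  have "frechet_derivative u (at x) h = frechet_derivative u (at x) (\<Sum>i\<in>Basis. (h \<bullet> i) *\<^sub>R i)"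
   by (simp add: euclidean_representation)
  also have "... = (\<Sum>i\<in>Basis. (h \<bullet> i)*frechet_derivative u (at x) i)"
   using has_derivative_linear[OF D] by (simp add: linear_sum linear_scale)
  also have "... = grad u x \<bullet> h" 
   unfolding grad_def pderiv_dir_def inner_sum_left by (simp add: inner_commute mult.commute)
  finally show "grad u x \<bullet> h = frechet_derivative u (at x) h" by simp
 qed
 moreover have "(u has_derivative frechet_derivative u (at x)) (at x)" for x using u frechet_derivative_works by auto
 moreover have "continuous_on UNIV (grad u)" using u unfolding grad_def[abs_def] by (auto intro!: continuous_intros)
 ultimately show ?thesis by (simp add: C1_grad_def)
qed

lemma C1_grad_mult:
 "C1_grad u G ==> C1_grad v K ==> C1_grad (%x. u x * v x) (%x. u x *\<^sub>R K x + v x *\<^sub>R G x)"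
 using C1_grad_cont[of u G UNIV] C1_grad_cont[of v K UNIV]
 unfolding C1_grad_def by (auto intro!: derivative_eq_intros continuous_intros simp: inner_add_left algebra_simps fun_eq_iff)

lemma C1_grad_add: "C1_grad u G ==> C1_grad v K ==> C1_grad (%x. u x + v x) (%x. G x + K x)"
 unfolding C1_grad_def by (auto intro!: derivative_eq_intros continuous_intros simp: inner_add_left fun_eq_iff)

lemma C1_grad_const: "C1_grad (%x. c) (%x. 0)"
 unfolding C1_grad_def by (auto intro!: derivative_eq_intros)

lemma C1_grad_inner: "C1_grad (%x. x \<bullet> i) (%x. i)"
 unfolding C1_grad_def by (auto intro!: derivative_eq_intros simp: inner_commute fun_eq_iff)

lemma C1_grad_scale: "C1_grad u G ==> C1_grad (%x. c*u x) (%x. c *\<^sub>R G x)"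
 using C1_grad_mult[OF C1_grad_const, of u G c] by simp

lemma C1_grad_sum: "finite A ==> (!!i. i \<in> A ==> C1_grad (u i) (G i)) ==> C1_grad (%x. \<Sum>i\<in>A. u i x) (%x. \<Sum>i\<in>A. G i x)"
 by (induction A rule: finite_induct) (auto intro: C1_grad_const C1_grad_add)

lemma C1_grad_eq_0:
 assumes "C1_grad u G" "open S" "x \<in> S" "!!y. y \<in> S ==> u y = 0"
 shows "G x = 0"
proof -
 have "((%_. 0) has_derivative (%_. 0)) (at x)" by simp
 then have "(u has_derivative (%_. 0)) (at x)"
  by (rule has_derivative_transform_within_open[OF _ assms(2,3)]) (simp add: assms(4))
 moreover have "(u has_derivative (%h. G x \<bullet> h)) (at x)" using assms(1) by (simp add: C1_grad_def)
 ultimately have "(%h. G x \<bullet> h) = (%_. 0)" using has_derivative_unique by blast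
 then have "G x \<bullet> G x = 0" by metis
 then show ?thesis by simp
qed

text \<open>Formulas in |x| can be differentiated away from 0 only; constancy near 0 repairs the
  origin.\<close>

lemma C1_grad_off_origin:
 assumes u: "!!x. x ~= 0 ==> (u has_derivative (%h. G x \<bullet> h)) (at x)" and G: "continuous_on (- {0}) G"
  and z: "de > 0" "!!x. norm x < de ==> u x = c" "!!x. norm x < de ==> G x = 0"
 shows "C1_grad u (G :: 'a::euclidean_space => 'a)"
 unfolding C1_grad_def
proof (intro conjI allI)
 fix x :: 'a
 show "(u has_derivative (%h. G x \<bullet> h)) (at x)"
 proof (cases "x = 0")
  case True
  have "((%_. c) has_derivative (%_. 0)) (at x)" by simp
  then have "(u has_derivative (%_. 0)) (at x)"
   by (rule has_derivative_transform_within_open[of _ _ _ _ "ball 0 de"]) (use z True in auto)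
  then show ?thesis using True z by simp
 qed (rule u)
next
 have "continuous_on (ball 0 de) G" by (rule continuous_on_eq[of _ "%_. 0"]) (use z in auto)
 then have "continuous_on (ball 0 de \<union> - {0}) G" using G by (intro continuous_on_open_Un) auto
 moreover have "ball 0 de \<union> - {0} = (UNIV :: 'a set)" using z by auto
 ultimately show "continuous_on UNIV G" by simp
qed

lemma C1_grad_radial:
 assumes c: "!!r. r > 0 ==> (c hasD c1 r) (at r)" "continuous_on {0<..} c1"
  and z: "de > 0" "!!r. 0 <= r ==> r < de ==> c r = c0"
 shows "C1_grad (%x::'a::euclidean_space. c (norm x)) (%x. (c1 (norm x)/norm x) *\<^sub>R x)"
proof (rule C1_grad_off_origin[OF _ _ z(1)])
 fix x :: 'a assume x: "x ~= 0"
 show "((%x. c (norm x)) has_derivative (%h. ((c1 (norm x)/norm x) *\<^sub>R x) \<bullet> h)) (at x)"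
  using radial_has_derivative[OF c(1) x] x by (simp add: radial_def[abs_def])
next
 show "continuous_on (- {0::'a}) (%x. (c1 (norm x)/norm x) *\<^sub>R x)"
  by (intro continuous_intros continuous_on_compose2[OF c(2)]) auto
next
 fix x :: 'a assume x: "norm x < de"
 then show "c (norm x) = c0" using z by simp
 show "(c1 (norm x)/norm x) *\<^sub>R x = 0"
 proof (cases "x = 0")
  case False
  have "((%_. c0) hasD 0) (at (norm x))" by simp
  then have "(c hasD 0) (at (norm x))"
   by (rule has_field_derivative_transform_within_open[of _ _ _ "{0<..<de}"]) (use z x False in auto)
  then have "c1 (norm x) = 0" using c(1)[of "norm x"] False DERIV_unique by force
  then show ?thesis by simp
 qed simp
qed

lemma C1_grad_annulus:
 assumes u: "!!x. 0 < norm x ==> norm x < rh ==> (u has_derivative (%h. G x \<bullet> h)) (at x)"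
  and G: "continuous_on {x. 0 < norm x & norm x < rh} G"
  and z: "de > 0" "!!x. norm x < de ==> u x = 0 & G x = 0"
  and R: "R < rh" "!!x. R <= norm x ==> u x = 0" "!!x. R < norm x ==> G x = 0"
 shows "C1_grad u (G :: 'a::euclidean_space => 'a)"
proof (rule C1_grad_off_origin[OF _ _ z(1), where c = 0])
 have o: "open {x::'a. R < norm x}" "open {x::'a. 0 < norm x & norm x < rh}"
  by (intro open_Collect_conj open_Collect_less continuous_intros)+
 have "continuous_on {x. R < norm x} G" by (rule continuous_on_eq[of _ "%_. 0"]) (use R in auto)
 then have "continuous_on ({x. 0 < norm x & norm x < rh} \<union> {x. R < norm x}) G" by (intro continuous_on_open_Un G o)
 moreover have "- {0} \<subseteq> {x. 0 < norm x & norm x < rh} \<union> {x. R < norm x}" using R(1) by auto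
 ultimately show "continuous_on (- {0}) G" by (rule continuous_on_subset)
 fix x :: 'a assume x: "x ~= 0"
 show "(u has_derivative (%h. G x \<bullet> h)) (at x)"
 proof (cases "norm x < rh")
  case False
  have "((%_. 0) has_derivative (%_. 0)) (at x)" by simp
  then have "(u has_derivative (%_. 0)) (at x)"
   by (rule has_derivative_transform_within_open[OF _ o(1)]) (use R False in auto)
  then show ?thesis using R False by simp
 qed (use u x in auto)
qed (use z in auto)

lemma C1_grad_radial_compact:
 assumes c: "!!r. 0 < r ==> r < rh ==> (c hasD c1 r) (at r)" "continuous_on {0<..<rh} c1"
  and z: "de > 0" "!!r. 0 <= r ==> r < de ==> c r = 0 & c1 r = 0" and R: "R < rh" "!!r. R <= r ==> c r = 0 & c1 r = 0"
 shows "C1_grad (%x::'a::euclidean_space. c (norm x)) (%x. (c1 (norm x)/norm x) *\<^sub>R x)"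
proof (rule C1_grad_annulus[OF _ _ z(1) _ R(1)])
 fix x :: 'a assume x: "0 < norm x" "norm x < rh"
 show "((%x. c (norm x)) has_derivative (%h. ((c1 (norm x)/norm x) *\<^sub>R x) \<bullet> h)) (at x)"
  using radial_has_derivative[OF c(1)[OF x]] x by (simp add: radial_def[abs_def])
qed (use z R in "auto intro!: continuous_intros continuous_on_compose2[OF c(2)]")

lemma C1_grad_radial_mult:
 assumes u: "C1_grad u G" and z: "de > 0" "!!x. norm x < de ==> u x = 0" and R: "R < rh" "!!x. R <= norm x ==> u x = 0"
  and c: "!!r. 0 < r ==> r < rh ==> (c hasD c1 r) (at r)" "continuous_on {0<..<rh} c1"
 shows "C1_grad (%x::'a::euclidean_space. u x*c (norm x)) (%x. c (norm x) *\<^sub>R G x + (u x*c1 (norm x)/norm x) *\<^sub>R x)"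
proof (rule C1_grad_annulus[OF _ _ z(1) _ R(1)])
 have c': "continuous_on {0<..<rh} c" using c(1) by (intro DERIV_continuous_on) (auto intro: has_field_derivative_at_within)
 show "continuous_on {x::'a. 0 < norm x & norm x < rh} (%x. c (norm x) *\<^sub>R G x + (u x*c1 (norm x)/norm x) *\<^sub>R x)"
  by (intro continuous_intros continuous_on_compose2[OF c(2)] continuous_on_compose2[OF c'] C1_grad_cont[OF u]) auto
 fix x :: 'a assume x: "0 < norm x" "norm x < rh"
 then have x0: "x ~= 0" by auto
 have "(u has_derivative (%h. G x \<bullet> h)) (at x)" using u by (simp add: C1_grad_def)
 from has_derivative_mult[OF this radial_has_derivative[OF c(1)[OF x] x0]] x
 show "((%x. u x*c (norm x)) has_derivative (%h. (c (norm x) *\<^sub>R G x + (u x*c1 (norm x)/norm x) *\<^sub>R x) \<bullet> h)) (at x)"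
  by (simp add: radial_def[abs_def] inner_add_left algebra_simps)
next
 fix x :: 'a assume x: "norm x < de"
 have "G x = 0" by (rule C1_grad_eq_0[OF u, of "ball 0 de"]) (use x z in auto)
 then show "u x*c (norm x) = 0 & c (norm x) *\<^sub>R G x + (u x*c1 (norm x)/norm x) *\<^sub>R x = 0" using x z by simp
next
 fix x :: 'a
 show "R <= norm x ==> u x*c (norm x) = 0" using R by simp
 assume x: "R < norm x"
 have "G x = 0" by (rule C1_grad_eq_0[OF u, of "{x. R < norm x}"]) (use x R in "auto intro!: open_Collect_less continuous_intros")
 then show "c (norm x) *\<^sub>R G x + (u x*c1 (norm x)/norm x) *\<^sub>R x = 0" using x R by simp
qed

lemma C1c_iff: "xi \<in> C1c (ball (0::'a::euclidean_space) 1) \<longleftrightarrow> (EX G. C1_grad xi G) & (EX rh<1. ALL x. rh <= norm x --> xi x = 0)"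
proof safe
 assume xi: "xi \<in> C1c (ball 0 1)"
 then show "EX G. C1_grad xi G" using C1_grad_grad by (auto simp: C1c_def)
 let ?K = "closure {x. xi x ~= 0}"
 have K: "compact ?K" "?K \<subseteq> ball 0 1" using xi by (auto simp: C1c_def)
 have "EX rh<1. \<forall>x\<in>?K. norm x < rh"
 proof (cases "?K = {}")
  case False
  obtain x where x: "x \<in> ?K" "\<forall>y\<in>?K. norm y <= norm x"
   using continuous_attains_sup[OF K(1) False, of norm] by (auto intro: continuous_intros)
  then have "norm x < 1" using K(2) by auto
  then show ?thesis using x by (intro exI[of _ "(norm x + 1)/2"]) force
 qed (auto intro!: exI[of _ 0])
 then obtain rh where "rh < 1" "!!x. x \<in> ?K ==> norm x < rh" by blast
 moreover have "{x. xi x ~= 0} \<subseteq> ?K" by (rule closure_subset)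
 ultimately show "EX rh<1. ALL x. rh <= norm x --> xi x = 0" by (intro exI[of _ rh]) force
next
 fix G rh assume G: "C1_grad xi G" and r: "rh < 1" "ALL x. rh <= norm x --> xi x = 0"
 have "{x. xi x ~= 0} \<subseteq> cball 0 rh" using r by force
 then have sub: "closure {x. xi x ~= 0} \<subseteq> cball 0 rh" by (simp add: closure_minimal)
 moreover have "compact (closure {x. xi x ~= 0})"
  using compact_closure bounded_subset[OF bounded_cball \<open>{x. xi x ~= 0} \<subseteq> cball 0 rh\<close>] by blast
 ultimately show "xi \<in> C1c (ball 0 1)" using C1_gradD(1)[OF G] r by (auto simp: C1c_def)
qed

lemma compact_support_integrable:
 fixes g :: "'a::euclidean_space => 'b::euclidean_space"
 assumes g: "continuous_on UNIV g" and R: "!!x. R <= norm x ==> g x = 0"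
 shows "integrable lborel g"
proof -
 have "integrable lborel (%x. indicator (cball 0 R) x *\<^sub>R g x)"
  by (intro borel_integrable_compact continuous_on_subset[OF g]) auto
 moreover have "(%x. indicator (cball 0 R) x *\<^sub>R g x) = g" using R by (auto simp: fun_eq_iff indicator_def)
 ultimately show ?thesis by simp
qed

lemma C1_grad_zero_outside:
 assumes "C1_grad u G" "!!x. R <= norm x ==> u x = 0" "R < norm x"
 shows "G x = 0"
proof (rule C1_grad_eq_0[OF assms(1), of "{x. R < norm x}"])
 show "open {x::'a. R < norm x}" by (intro open_Collect_less continuous_intros)
qed (use assms in auto)

lemma C1_grad_lipschitz:
 assumes u: "C1_grad u G" and R: "!!x. R <= norm x ==> u x = 0"
 shows "EX K>=0. (ALL x. norm (G x) <= K) & (ALL x y. abs (u x - u y) <= K*norm (x - y))"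
proof -
 have "compact (G ` cball 0 \<bar>R\<bar>)" by (intro compact_continuous_image C1_grad_cont[OF u]) auto
 then obtain K where K: "!!x. norm x <= abs R ==> norm (G x) <= K" by (meson compact_imp_bounded bounded_iff imageI mem_cball_0)
 have K': "norm (G x) <= abs K" for x
  using K[of x] C1_grad_zero_outside[of u G "abs R" x] u R by (cases "norm x <= abs R") auto
 have "norm (u x - u y) <= abs K*norm (x - y)" for x y
 proof (rule differentiable_bound[of UNIV u "%x h. G x \<bullet> h"])
  fix x show "(u has_derivative (%h. G x \<bullet> h)) (at x within UNIV)" using u by (simp add: C1_grad_def)
  show "onorm (%h. G x \<bullet> h) <= abs K"
   by (rule onorm_bound) (use K'[of x] in "auto intro!: order_trans[OF Cauchy_Schwarz_ineq2] mult_right_mono")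
 qed auto
 then show ?thesis using K' by (intro exI[of _ "abs K"]) auto
qed

lemma integral_translate:
 "(LINT x|lborel. g (x + c)) = (LINT x|lborel. (g x :: real))" if "g \<in> borel_measurable borel" for c :: "'a::euclidean_space"
proof -
 have "(LINT x|lborel. g x) = (LINT x|distr lborel borel ((+) c). g x)" by (simp add: lborel_distr_plus)
 also have "... = (LINT x|lborel. g (c + x))" using that by (intro integral_distr) auto
 finally show ?thesis by (simp add: add.commute)
qed

text \<open>The shifts have length at most |w|, so all quotients live in one ball, and the Lipschitz
  constant bounds them uniformly: the input for dominated convergence.\<close>

lemma difference_quotient:
 fixes u :: "'a::euclidean_space => real" and w :: 'a
 assumes u: "C1_grad u G" and R: "!!x. R <= norm x ==> u x = 0"
 defines "q \<equiv> %n x. (u (x + (1/real (Suc n)) *\<^sub>R w) - u x)*real (Suc n)"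
 shows "(%n. q n x) \<longlonglongrightarrow> G x \<bullet> w" "EX C. ALL n x. abs (q n x) <= indicator (cball 0 (abs R + norm w)) x *\<^sub>R C"
  "continuous_on UNIV (q n)"
proof -
 obtain K where K: "K >= 0" "!!x. norm (G x) <= K" "!!x y. abs (u x - u y) <= K*norm (x - y)" using C1_grad_lipschitz[OF u R] by blast
 have d: "((%t. u (x + t *\<^sub>R w)) hasD G x \<bullet> w) (at 0)"
 proof -
  have "(u has_derivative (%h. G x \<bullet> h)) (at (x + 0 *\<^sub>R w))" using u by (simp add: C1_grad_def)
  moreover have "((%t. x + t *\<^sub>R w) has_derivative (%h. h *\<^sub>R w)) (at 0)" by (auto intro!: derivative_eq_intros)
  ultimately show ?thesis
   using has_derivative_compose[of "%t. x + t *\<^sub>R w" "%h. h *\<^sub>R w" 0 UNIV u "%h. G x \<bullet> h"] by (simp add: has_field_derivative_def mult_commute_abs)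
 qed
 have "filterlim (%n. 1/real (Suc n)) (at 0) sequentially"
  using LIMSEQ_inverse_real_of_nat by (auto simp: filterlim_at inverse_eq_divide)
 from filterlim_compose[OF d[unfolded has_field_derivative_iff] this]
 show "(%n. q n x) \<longlonglongrightarrow> G x \<bullet> w" by (simp add: q_def)
 have cu: "continuous_on UNIV u" by (rule C1_grad_cont[OF u])
 show "continuous_on UNIV (q n)" unfolding q_def by (intro continuous_intros cu continuous_on_compose2[OF cu]) auto
 show "EX C. ALL n x. abs (q n x) <= indicator (cball 0 (abs R + norm w)) x *\<^sub>R C"
 proof (intro exI allI)
  fix n x
  define c where "c = (1/real (Suc n)) *\<^sub>R w"
  have nc: "norm c*real (Suc n) = norm w" by (simp add: c_def)
  have "norm c <= norm c*real (Suc n)" by (simp add: mult_le_cancel_left1)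
  then have c: "norm c <= norm w" unfolding nc .
  show "abs (q n x) <= indicator (cball 0 (abs R + norm w)) x *\<^sub>R (K*norm w)"
  proof (cases "norm x <= abs R + norm w")
   case True
   have "abs (q n x) = abs (u (x + c) - u x)*real (Suc n)" by (simp add: q_def c_def abs_mult)
   also have "... <= (K*norm c)*real (Suc n)" using K(3)[of "x + c" x] by (intro mult_right_mono) auto
   finally show ?thesis using True nc by (simp add: mult.assoc)
  next
   case False
   then have "R <= norm x" "R <= norm (x + c)" using c norm_diff_ineq[of x c] norm_ge_zero[of w] by linarith+
   then have "q n x = 0" using R by (simp add: q_def c_def)
   then show ?thesis using False by simp
  qed
 qed
qed

lemma compact_support_translate:
 fixes u :: "'a::euclidean_space => real"
 assumes "continuous_on UNIV u" "!!x. R <= norm x ==> u x = 0"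
 shows "integrable lborel (%x. u (x + c))"
proof (rule compact_support_integrable)
 show "continuous_on UNIV (%x. u (x + c))" by (intro continuous_on_compose2[OF assms(1)] continuous_intros) auto
 fix x :: 'a assume "abs R + norm c <= norm x"
 then show "u (x + c) = 0" using norm_diff_ineq[of x c] by (intro assms(2)) linarith
qed

text \<open>By translation invariance the integrals of the difference quotients vanish.\<close>

lemma integral_partial_zero:
 fixes u :: "'a::euclidean_space => real"
 assumes u: "C1_grad u G" and R: "!!x. R <= norm x ==> u x = 0"
 shows "(LINT x|lborel. G x \<bullet> w) = 0"
proof -
 have cu: "continuous_on UNIV u" by (rule C1_grad_cont[OF u])
 let ?q = "%n x. (u (x + (1/real (Suc n)) *\<^sub>R w) - u x)*real (Suc n)"
 note Q = difference_quotient[OF u R, where w = w]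
 obtain C where C: "!!n x. abs (?q n x) <= indicator (cball 0 (abs R + norm w)) x *\<^sub>R C" using Q(2) by blast
 have "(%n. LINT x|lborel. ?q n x) \<longlonglongrightarrow> (LINT x|lborel. G x \<bullet> w)"
 proof (rule integral_dominated_convergence)
  show "integrable lborel (%x::'a. indicator (cball 0 (abs R + norm w)) x *\<^sub>R C)" by (intro borel_integrable_compact continuous_intros) auto
  show "AE x in lborel. norm (?q n x) <= indicator (cball 0 (abs R + norm w)) x *\<^sub>R C" for n
   using C[of _ n] by (intro AE_I2) simp
 qed (use Q(1) Q(3)[THEN borel_measurable_continuous_onI] C1_grad_cont[OF u]
   in "auto intro!: borel_measurable_continuous_onI continuous_intros simp del: of_nat_Suc")
 moreover have "(LINT x|lborel. ?q n x) = 0" for n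
  using compact_support_translate[OF cu R, where c = "(1/real (Suc n)) *\<^sub>R w"] compact_support_integrable[OF cu R]
   integral_translate[OF borel_measurable_continuous_onI[OF cu]] by simp
 ultimately show ?thesis by (simp add: LIMSEQ_const_iff)
qed

text \<open>The integrand is the divergence of u*b(|x|)*x/|x|. As u vanishes near 0 and from R < rh
  on, this field is C^1 with compact support.\<close>

lemma radial_divergence:
 fixes u :: "'a::euclidean_space => real"
 assumes u: "C1_grad u G" and z: "de > 0" "!!x. norm x < de ==> u x = 0" and R: "R < rh" "!!x. R <= norm x ==> u x = 0"
  and b: "!!r. 0 < r ==> r < rh ==> (b hasD b1 r) (at r)" "continuous_on {0<..<rh} b1"
 shows "integrable lborel (%x. b (norm x)/norm x*(G x \<bullet> x) + u x*(b1 (norm x) + (real DIM('a) - 1)*b (norm x)/norm x))"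
  "(LINT x|lborel. b (norm x)/norm x*(G x \<bullet> x) + u x*(b1 (norm x) + (real DIM('a) - 1)*b (norm x)/norm x)) = 0"
proof -
 define c where "c r = b r/r" for r
 define c1 where "c1 r = b1 r/r - b r/r^2" for r
 have bc: "continuous_on {0<..<rh} b" using b(1) by (intro DERIV_continuous_on) (auto intro: has_field_derivative_at_within)
 have dc: "(c hasD c1 r) (at r)" if "0 < r" "r < rh" for r unfolding c_def[abs_def] c1_def using that
  by (auto intro!: derivative_eq_intros b(1) simp: field_simps power2_eq_square)
 have cc: "continuous_on {0<..<rh} c1" unfolding c1_def[abs_def] by (intro continuous_intros b(2) bc) auto
 define v where "v x = u x*c (norm x)" for x
 define K where "K x = c (norm x) *\<^sub>R G x + (u x*c1 (norm x)/norm x) *\<^sub>R x" for x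
 have v: "C1_grad v K" unfolding v_def[abs_def] K_def[abs_def] by (rule C1_grad_radial_mult[OF u z R dc cc])
 have vi: "C1_grad (%x. v x*(x \<bullet> i)) (%x. v x *\<^sub>R i + (x \<bullet> i) *\<^sub>R K x)" for i by (rule C1_grad_mult[OF v C1_grad_inner])
 have vR: "v x = 0" if "R <= norm x" for x using R(2)[OF that] by (simp add: v_def)
 have KR: "K x = 0" if "R < norm x" for x using C1_grad_zero_outside[OF v vR that] .
 have int: "integrable lborel (%x. (v x *\<^sub>R i + (x \<bullet> i) *\<^sub>R K x) \<bullet> i)" for i
  by (rule compact_support_integrable[of _ "abs R + 1"])
   (auto intro!: continuous_intros C1_grad_cont[OF v] simp: vR KR)
 have eq: "(\<Sum>i\<in>Basis. (v x *\<^sub>R i + (x \<bullet> i) *\<^sub>R K x) \<bullet> i) =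
   b (norm x)/norm x*(G x \<bullet> x) + u x*(b1 (norm x) + (real DIM('a) - 1)*b (norm x)/norm x)" for x :: 'a
 proof -
  have "(\<Sum>i\<in>Basis. (v x *\<^sub>R i + (x \<bullet> i) *\<^sub>R K x) \<bullet> i) = (\<Sum>i\<in>Basis. v x + (x \<bullet> i)*(K x \<bullet> i))"
   by (rule sum.cong) (auto simp: inner_add_left inner_same_Basis)
  also have "... = real DIM('a) * v x + x \<bullet> K x" by (simp add: sum.distrib euclidean_inner[of x "K x"])
  also have "... = b (norm x)/norm x*(G x \<bullet> x) + u x*(b1 (norm x) + (real DIM('a) - 1)*b (norm x)/norm x)"
  proof (cases "x = 0")
   case True then show ?thesis using z by (simp add: v_def)
  next
   case False
   then show ?thesis
    by (simp add: v_def K_def inner_add_right c_def c1_def inner_commute[of x] dot_square_norm field_simps power2_eq_square)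
  qed
  finally show ?thesis .
 qed
 show "integrable lborel (%x. b (norm x)/norm x*(G x \<bullet> x) + u x*(b1 (norm x) + (real DIM('a) - 1)*b (norm x)/norm x))"
  unfolding eq[symmetric] by (intro Bochner_Integration.integrable_sum int)
 show "(LINT x|lborel. b (norm x)/norm x*(G x \<bullet> x) + u x*(b1 (norm x) + (real DIM('a) - 1)*b (norm x)/norm x)) = 0"
  unfolding eq[symmetric] using int integral_partial_zero[OF vi, of R] vR by (simp add: Bochner_Integration.integral_sum)
qed

section \<open>Cutoffs and the space H10\<close>

text \<open>Piecewise quadratic transition from 0 at 1 to 1 at 2. The derivative is a tent of height
  2, so the function is C^1, which is the smoothness asked of test functions.\<close>

definition smooth_step :: "real => real" where
 "smooth_step t = 2*((max (t - 1) 0)^2 - 2*(max (t - 3/2) 0)^2 + (max (t - 2) 0)^2)"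

definition smooth_step1 :: "real => real" where
 "smooth_step1 t = 4*(max (t - 1) 0 - 2*max (t - 3/2) 0 + max (t - 2) 0)"

lemma smooth_step_DERIV: "(smooth_step hasD smooth_step1 t) (at t)"
proof -
 have d: "((%t. (max (t - c) 0)^2) hasD 2*max (t - c) 0) (at t)" for c
  using DERIV_chain2[where f = "%x. (max x 0)^2" and g = "%t. t - c", OF DERIV_max_zero_square DERIV_diff[OF DERIV_ident DERIV_const]] by simp
 have "(smooth_step hasD 2*(2*max (t - 1) 0 - 2*(2*max (t - 3/2) 0) + 2*max (t - 2) 0)) (at t)"
  unfolding smooth_step_def[abs_def] by (intro DERIV_cmult DERIV_add DERIV_diff d)
 then show ?thesis by (simp add: smooth_step1_def)
qed

lemma smooth_step1_cont: "continuous_on S smooth_step1"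
 unfolding smooth_step1_def[abs_def] by (intro continuous_intros)

lemma smooth_step_cont: "continuous_on S smooth_step"
 unfolding smooth_step_def[abs_def] by (intro continuous_intros)

lemma smooth_step1_bounds: "0 <= smooth_step1 t" "smooth_step1 t <= 2"
 by (auto simp: smooth_step1_def max_def)

lemma smooth_step_eq: "t <= 1 ==> smooth_step t = 0" "2 <= t ==> smooth_step t = 1"
 "t <= 1 ==> smooth_step1 t = 0" "2 <= t ==> smooth_step1 t = 0"
 by (auto simp: smooth_step_def smooth_step1_def max_def power2_eq_square field_simps)

lemma smooth_step_mono: "s <= t ==> smooth_step s <= smooth_step t"
 by (rule DERIV_nonneg_imp_nondecreasing[where f = smooth_step]) (use smooth_step_DERIV smooth_step1_bounds in blast)+

lemma smooth_step_bounds: "0 <= smooth_step t" "smooth_step t <= 1"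
 using smooth_step_mono[of "min t 1" t] smooth_step_eq(1)[of "min t 1"] smooth_step_mono[of t "max t 2"] smooth_step_eq(2)[of "max t 2"]
 by simp_all

text \<open>On the support of the derivative one has \<open>c <= 2 / r\<close>; this makes the bound independent of \<open>c\<close>.\<close>

lemma smooth_step_scaled_bound: "c > 0 ==> r > 0 ==> c * smooth_step1 (c*r) <= 4/r"
proof -
 assume c: "c > 0" and r: "r > 0"
 show "c * smooth_step1 (c*r) <= 4/r"
 proof (cases "c*r <= 2")
  case True
  have "(c*r) * smooth_step1 (c*r) <= 2*2"
   by (rule mult_mono) (use True smooth_step1_bounds c r in auto)
  then show ?thesis using r by (simp add: field_simps)
 next
  case False then show ?thesis using r smooth_step_eq(4)[of "c*r"] by simp
 qed
qed

lemma C1_grad_cutoff: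
 "c > 0 ==> C1_grad (%x::'a::euclidean_space. smooth_step (c*norm x)) (%x. (c * smooth_step1 (c*norm x)/norm x) *\<^sub>R x)"
proof -
 assume c: "c > 0"
 show ?thesis
 proof (rule C1_grad_radial[of "%r. smooth_step (c*r)" "%r. c * smooth_step1 (c*r)" "1/c" 0])
  fix r :: real
  show "((%r. smooth_step (c*r)) hasD c * smooth_step1 (c*r)) (at r)"
   using DERIV_chain2[where f = smooth_step and g = "%r. c*r", OF smooth_step_DERIV DERIV_cmult_Id]
   by (simp only: mult.commute[of _ c])
  show "smooth_step (c*r) = 0" if "r < 1/c" using that c by (intro smooth_step_eq) (simp add: field_simps)
 qed (use c in "auto intro!: continuous_intros continuous_on_compose2[OF smooth_step1_cont]")
qed

text \<open>The divergence theorem for \<open>|x|\<^sup>-\<^sup>p x\<close> with cutoffs gives bounds uniform in the inner cutoff.\<close>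

lemma powr_norm_integrable:
 fixes p :: real
 assumes p: "p < real DIM('a::euclidean_space)" "p >= 0"
 shows "integrable lborel (%x::'a. indicator (ball 0 1) x *\<^sub>R norm x powr (- p))"
proof -
 define w where "w x = 1 - smooth_step (norm x)" for x :: 'a
 define w1 where "w1 x = (- smooth_step1 (norm x)/norm x) *\<^sub>R x" for x :: 'a
 define g where "g n x = smooth_step (real (Suc n)*norm x)" for n and x :: 'a
 define g1 where "g1 n x = (real (Suc n) * smooth_step1 (real (Suc n)*norm x)/norm x) *\<^sub>R x" for n and x :: 'a
 have w: "C1_grad w w1"
  using C1_grad_add[OF C1_grad_const[of 1] C1_grad_scale[OF C1_grad_cutoff[of 1], of "-1"]] by (simp add: w_def[abs_def] w1_def[abs_def])
 have g: "C1_grad (g n) (g1 n)" for n unfolding g_def[abs_def] g1_def[abs_def] by (rule C1_grad_cutoff) simp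
 define u where "u n x = g n x*w x" for n x
 have u: "C1_grad (u n) (%x. g n x *\<^sub>R w1 x + w x *\<^sub>R g1 n x)" for n
  using C1_grad_mult[OF g w] unfolding u_def[abs_def] .
 have u0: "u n x = 0" if "norm x < 1/real (Suc n)" for n x
 proof -
  have "real (Suc n)*norm x <= 1" using that by (simp add: field_simps)
  then show ?thesis by (simp add: u_def g_def smooth_step_eq)
 qed
 have u2: "u n x = 0" if "2 <= norm x" for n x using that by (simp add: u_def w_def smooth_step_eq)
 have un: "u n x >= 0" for n x using smooth_step_bounds by (simp add: u_def g_def w_def)
 define h where "h n x = (real DIM('a) - p)*(u n x*norm x powr (- p))" for n and x :: 'a
 define C where "C = (LINT x|lborel. indicator (cball 0 2) (x::'a) *\<^sub>R (4::real))"
 have i4: "integrable lborel (%x. indicator (cball 0 2) (x::'a) *\<^sub>R (4::real))" by (intro borel_integrable_compact) auto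
 have bnd: "integrable lborel (h n)" "(LINT x|lborel. h n x) <= C" for n
 proof -
  let ?e = "%x. norm x powr (1 - p)/norm x*((g n x *\<^sub>R w1 x + w x *\<^sub>R g1 n x) \<bullet> x) +
   u n x*((1 - p)*norm x powr (- p) + (real DIM('a) - 1)*norm x powr (1 - p)/norm x)"
  have b: "((%r. r powr (1 - p)) hasD (1 - p)*r powr (- p)) (at r)" if "0 < r" for r
   using that by (auto intro!: derivative_eq_intros)
  have bc: "continuous_on {0<..<3} (%r::real. (1 - p)*r powr (- p))" by (intro continuous_intros) auto
  have np: "1/real (Suc n) > 0" by simp
  have int: "integrable lborel ?e" "(LINT x|lborel. ?e x) = 0"
   using radial_divergence[OF u[of n] np u0 _ u2 b bc, where R = 2] by auto
  have e: "?e x = h n x + norm x powr (1 - p)*(real (Suc n) * smooth_step1 (real (Suc n)*norm x)*w x - g n x * smooth_step1 (norm x))" for x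
  proof (cases "x = 0")
   case True then show ?thesis using p by (simp add: h_def u_def g_def smooth_step_eq)
  next
   case False
   have P: "norm x powr (1 - p) = norm x powr (- p)*norm x" using False powr_add[of "norm x" 1 "- p"] by simp
   have i: "w1 x \<bullet> x = - smooth_step1 (norm x)*norm x" "g1 n x \<bullet> x = real (Suc n) * smooth_step1 (real (Suc n)*norm x)*norm x"
    using False by (simp_all add: w1_def g1_def dot_square_norm power2_eq_square del: of_nat_Suc)
   show ?thesis unfolding h_def P u_def inner_add_left inner_scaleR_left i using False
    by (simp add: field_simps del: of_nat_Suc)
  qed
  have gb: "g n x <= 1" "0 <= g n x" for x by (simp_all add: g_def smooth_step_bounds)
  have wb: "0 <= w x" for x by (simp add: w_def smooth_step_bounds)
  \<comment> \<open>The inner cutoff contributes a nonnegative term, which is dropped; the outer one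
    acts on 1 <= |x| <= 2 and costs at most 4.\<close>
  have le: "h n x <= ?e x + indicator (cball 0 2) x *\<^sub>R 4" for x :: 'a
  proof -
   have "norm x powr (1 - p)*(g n x * smooth_step1 (norm x)) <= indicator (cball 0 2) x *\<^sub>R 4"
   proof (cases "1 <= norm x & norm x <= 2")
    case True
    have "norm x powr (1 - p) <= norm x powr 1" using True p by (intro powr_mono) auto
    also have "... <= 2" using True by simp
    finally have "norm x powr (1 - p)*(g n x * smooth_step1 (norm x)) <= 2*(1*2)"
     using gb[of x] smooth_step1_bounds[of "norm x"] by (intro mult_mono) auto
    then show ?thesis using True by simp
   next
    case False
    then have "smooth_step1 (norm x) = 0" using smooth_step_eq(3,4)[of "norm x"] by linarith
    then show ?thesis by simp
   qed
   moreover have "0 <= norm x powr (1 - p)*(real (Suc n) * smooth_step1 (real (Suc n)*norm x)*w x)"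
    using wb[of x] smooth_step1_bounds by (intro mult_nonneg_nonneg) auto
   ultimately show ?thesis unfolding e right_diff_distrib by linarith
  qed
  have "continuous_on {0<..<3} (%r::real. - p*r powr (- p - 1))" by (intro continuous_intros) auto
  then have "C1_grad (%x. u n x*norm x powr (- p)) (%x. norm x powr (- p) *\<^sub>R (g n x *\<^sub>R w1 x + w x *\<^sub>R g1 n x) + (u n x*(- p*norm x powr (- p - 1))/norm x) *\<^sub>R x)"
   by (intro C1_grad_radial_mult[OF u[of n] np u0, where R = 2 and rh = 3 and c = "%r. r powr (- p)" and ?c1.0 = "%r. - p*r powr (- p - 1)"]) (auto intro!: derivative_eq_intros simp: u2)
  then have "integrable lborel (%x. u n x*norm x powr (- p))"
   by (intro compact_support_integrable[of _ 2]) (auto simp: u2 intro: C1_grad_cont)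
  then show ih: "integrable lborel (h n)" unfolding h_def[abs_def] by simp
  have "(LINT x|lborel. h n x) <= (LINT x|lborel. ?e x + indicator (cball 0 2) x *\<^sub>R 4)"
   by (rule integral_mono[OF ih _ le]) (intro Bochner_Integration.integrable_add int i4)
  also have "... = C" unfolding C_def by (subst Bochner_Integration.integral_add[OF int(1) i4]) (simp only: int(2) add_0)
  finally show "(LINT x|lborel. h n x) <= C" .
 qed
 have mp: "(%x::'a. norm x powr (- p)) \<in> borel_measurable lborel" by measurable
 have mono: "mono (%n. h n x)" for x
 proof (intro monoI)
  fix m n :: nat assume "m <= n"
  then have "real (Suc m)*norm x <= real (Suc n)*norm x" by (intro mult_right_mono) auto
  then have "g m x <= g n x" unfolding g_def by (rule smooth_step_mono)
  then show "h m x <= h n x" unfolding h_def u_def using p smooth_step_bounds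
   by (intro mult_left_mono mult_right_mono) (auto simp: w_def)
 qed
 let ?l = "%x::'a. (real DIM('a) - p)*(w x*norm x powr (- p))"
 have int: "integrable lborel ?l"
 proof (rule integrable_monotone_convergence[OF bnd(1)])
  have "incseq (%n. LINT x|lborel. h n x)" by (intro incseq_SucI integral_mono bnd(1)) (use mono in "auto simp: mono_def")
  then show "(%n. LINT x|lborel. h n x) \<longlonglongrightarrow> lim (%n. LINT x|lborel. h n x)"
   using incseq_convergent[of "%n. LINT x|lborel. h n x" C] bnd(2) convergent_LIMSEQ_iff by (metis convergentI)
  show "AE x in lborel. (%n. h n x) \<longlonglongrightarrow> ?l x"
  proof (rule AE_I2, rule tendsto_eventually)
   fix x :: 'a
   show "\<forall>\<^sub>F n in sequentially. h n x = ?l x"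
   proof (cases "x = 0")
    case False
    have "\<forall>\<^sub>F n in sequentially. 2/norm x <= real n" using filterlim_real_sequentially by (auto simp: filterlim_at_top)
    then show ?thesis
    proof eventually_elim
     case (elim n)
     then have "2 <= real (Suc n)*norm x" using False by (simp add: field_simps) (metis add_increasing norm_ge_zero)
     then show ?case by (simp add: h_def u_def g_def smooth_step_eq)
    qed
   qed (simp add: h_def)
  qed
  show "?l \<in> borel_measurable lborel" unfolding w_def
   by (intro borel_measurable_times borel_measurable_const borel_measurable_diff mp)
    (auto intro!: borel_measurable_continuous_onI continuous_on_compose2[OF smooth_step_cont] continuous_intros)
 qed (use mono in auto)
 have pos: "real DIM('a) - p > 0" using p by simp
 have "integrable lborel (%x::'a. 1/(real DIM('a) - p)*?l x)" using int by (rule integrable_mult_right)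
 then show ?thesis
 proof (rule Bochner_Integration.integrable_bound)
  show "(%x::'a. indicator (ball 0 1) x *\<^sub>R norm x powr (- p)) \<in> borel_measurable lborel"
   by (intro borel_measurable_scaleR borel_measurable_indicator mp) auto
  show "AE x in lborel. norm (indicator (ball 0 1) (x::'a) *\<^sub>R norm x powr (- p)) <= norm (1/(real DIM('a) - p)*?l x)"
  proof (rule AE_I2)
   fix x :: 'a
   have "1/(real DIM('a) - p)*?l x = w x*norm x powr (- p)" using pos by simp
   then show "norm (indicator (ball 0 1) x *\<^sub>R norm x powr (- p)) <= norm (1/(real DIM('a) - p)*?l x)"
    by (simp add: indicator_def w_def smooth_step_eq)
  qed
 qed
qed

section \<open>Dominated convergence in the ball and membership in H10\<close>

lemma set_lebesgue_borel:
 fixes g :: "'a::euclidean_space => 'b::euclidean_space"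
 assumes "(%x. indicator A x *\<^sub>R g x) \<in> borel_measurable lborel"
 shows "set_integrable lebesgue A g \<longleftrightarrow> integrable lborel (%x. indicator A x *\<^sub>R g x)"
  "(LINT x:A|lebesgue. g x) = (LINT x|lborel. indicator A x *\<^sub>R g x)"
 unfolding set_integrable_def set_lebesgue_integral_def using assms
 by (auto simp: integrable_completion integral_completion)

lemma ball_limit_measurable:
 fixes g :: "'a::euclidean_space => 'b::euclidean_space"
 assumes m: "!!n. (%x. indicator (ball 0 1) x *\<^sub>R h n x) \<in> borel_measurable lborel"
  and l: "!!x. 0 < norm x ==> norm x < 1 ==> (%n. h n x) \<longlonglongrightarrow> g x"
 shows "(%x. indicator (ball 0 1) x *\<^sub>R g x) \<in> borel_measurable lborel"
proof -
 have "(%x. indicator (- {0}) x *\<^sub>R indicator (ball 0 1) x *\<^sub>R g x) \<in> borel_measurable lborel"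
 proof (rule borel_measurable_LIMSEQ_metric)
  show "(%x. indicator (- {0}) x *\<^sub>R indicator (ball 0 1) x *\<^sub>R h n x) \<in> borel_measurable lborel" for n
   by (intro borel_measurable_scaleR borel_measurable_indicator m) auto
  fix x :: 'a
  show "(%n. indicator (- {0}) x *\<^sub>R indicator (ball 0 1) x *\<^sub>R h n x) \<longlonglongrightarrow> indicator (- {0}) x *\<^sub>R indicator (ball 0 1) x *\<^sub>R g x"
   using l[of x] by (cases "x ~= 0 & x \<in> ball 0 1") (auto simp: indicator_def intro!: tendsto_intros)
 qed
 then have "(%x. indicator (- {0}) x *\<^sub>R indicator (ball 0 1) x *\<^sub>R g x + indicator {0} x *\<^sub>R g 0) \<in> borel_measurable lborel"
  by (rule borel_measurable_add) (intro borel_measurable_scaleR borel_measurable_indicator borel_measurable_const, simp)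
 moreover have "(%x. indicator (- {0}) x *\<^sub>R indicator (ball 0 1) x *\<^sub>R g x + indicator {0} x *\<^sub>R g 0) = (%x. indicator (ball 0 1) x *\<^sub>R g x)"
  by (auto simp: fun_eq_iff indicator_def)
 ultimately show ?thesis by simp
qed

lemma ball_dominated_convergence:
 fixes g :: "'a::euclidean_space => real"
 assumes m: "!!n. (%x. indicator (ball 0 1) x *\<^sub>R h n x) \<in> borel_measurable lborel"
  and l: "!!x. 0 < norm x ==> norm x < 1 ==> (%n. h n x) \<longlonglongrightarrow> g x"
  and b: "!!n x. 0 < norm x ==> norm x < 1 ==> abs (h n x) <= C*norm x powr (- p)" and p: "0 <= p" "p < real DIM('a)"
 shows "set_integrable lebesgue (ball 0 1) g" "!!n. set_integrable lebesgue (ball 0 1) (h n)"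
  "(%n. LINT x:ball 0 1|lebesgue. h n x) \<longlonglongrightarrow> (LINT x:ball 0 1|lebesgue. g x)"
proof -
 have mg: "(%x. indicator (ball 0 1) x *\<^sub>R g x) \<in> borel_measurable lborel" by (rule ball_limit_measurable[OF m l])
 have C: "integrable lborel (%x::'a. C*(indicator (ball 0 1) x *\<^sub>R norm x powr (- p)))"
  by (intro integrable_mult_right powr_norm_integrable p)
 have ae: "AE x in lborel. x ~= (0::'a)" by (rule AE_lborel_singleton)
 have lim: "AE x in lborel. (%n. indicator (ball 0 1) x *\<^sub>R h n x) \<longlonglongrightarrow> indicator (ball 0 1) x *\<^sub>R g x"
  using ae
 proof eventually_elim
  case (elim x) then show ?case using l[of x] by (cases "x \<in> ball 0 1") auto
 qed
 have bd: "AE x in lborel. norm (indicator (ball 0 1) x *\<^sub>R h n x) <= C*(indicator (ball 0 1) x *\<^sub>R norm x powr (- p))" for n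
  using ae
 proof eventually_elim
  case (elim x) then show ?case using b[of x n] by (cases "x \<in> ball 0 1") auto
 qed
 note D = integrable_dominated_convergence[OF mg m C lim bd] integrable_dominated_convergence2[OF mg m C lim bd]
  integral_dominated_convergence[OF mg m C lim bd]
 show "set_integrable lebesgue (ball 0 1) g" "!!n. set_integrable lebesgue (ball 0 1) (h n)"
  "(%n. LINT x:ball 0 1|lebesgue. h n x) \<longlonglongrightarrow> (LINT x:ball 0 1|lebesgue. g x)"
  using D by (simp_all add: set_lebesgue_borel[OF m] set_lebesgue_borel[OF mg])
qed

text \<open>At each point other than 0 the approximants and their gradients equal the limits from
  some n on, and the common majorant |x|^(- p) is square integrable as 2*p < N. Integrability, the
  weak gradient and the approximation all follow by dominated convergence.\<close>

lemma H10_intro: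
 fixes u :: "'a::euclidean_space => real"
 assumes phi: "!!n::nat. C1_grad (ph n) (Ph n)" "!!n. EX rh<1. ALL x. rh <= norm x --> ph n x = 0"
  and lim: "!!x. 0 < norm x ==> norm x < 1 ==> \<forall>\<^sub>F n in sequentially. ph n x = u x & Ph n x = G x"
  and bnd: "!!n x. 0 < norm x ==> norm x < 1 ==> abs (ph n x) <= C*norm x powr (- p)"
   "!!n x. 0 < norm x ==> norm x < 1 ==> norm (Ph n x) <= C*norm x powr (- p)"
  and p: "0 <= p" "2*p < real DIM('a)"
 shows "u \<in> H10 (ball 0 1)"
proof -
 have l: "(%n. ph n x) \<longlonglongrightarrow> u x" "(%n. Ph n x) \<longlonglongrightarrow> G x" if "0 < norm x" "norm x < 1" for x
  using lim[OF that] by (auto intro!: tendsto_eventually elim: eventually_mono)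
 have c: "continuous_on UNIV (ph n)" "continuous_on UNIV (Ph n)" for n using C1_grad_cont[OF phi(1)] by auto
 have ind: "(%x. indicator (ball 0 1) x *\<^sub>R w x) \<in> borel_measurable lborel" if "continuous_on UNIV w" for w :: "'a => 'c::euclidean_space"
  using borel_measurable_continuous_onI[OF that] by (intro borel_measurable_scaleR borel_measurable_indicator) auto
 have mu: "(%x. indicator (ball 0 1) x *\<^sub>R u x) \<in> borel_measurable lborel"
  by (rule ball_limit_measurable[OF ind[OF c(1)] l(1)])
 have mG: "(%x. indicator (ball 0 1) x *\<^sub>R G x) \<in> borel_measurable lborel"
  by (rule ball_limit_measurable[OF ind[OF c(2)] l(2)])
 have bl: "abs (u x) <= C*norm x powr (- p)" "norm (G x) <= C*norm x powr (- p)" if "0 < norm x" "norm x < 1" for x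
 proof -
  have "EX n. ph n x = u x & Ph n x = G x" by (rule eventually_happens'[OF sequentially_bot lim]) (use that in auto)
  then obtain n where "ph n x = u x & Ph n x = G x" by blast
  then show "abs (u x) <= C*norm x powr (- p)" "norm (G x) <= C*norm x powr (- p)" using bnd[OF that, of n] by auto
 qed
 have sq: "t^2 <= c^2*r powr (- (2*p))" if "abs t <= c*r powr (- p)" "r > 0" for t c r :: real
 proof -
  have "t^2 <= (c*r powr (- p))^2" using that(1) by (meson abs_le_square_iff abs_ge_self order_trans)
  then show ?thesis using that(2) by (simp add: power_mult_distrib powr_power)
 qed
 have L2u: "L2_on (ball 0 1) u" "L2_on (ball 0 1) G" unfolding L2_on_def set_borel_measurable_def
 proof safe
  show "set_integrable lebesgue (ball 0 1) (%x. (norm (u x))^2)"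
   by (rule ball_dominated_convergence(1)[OF ind tendsto_power[OF tendsto_norm[OF l(1)]], where C = "C^2" and p = "2*p"])
    (use p sq bnd in "auto intro!: continuous_intros c")
  show "set_integrable lebesgue (ball 0 1) (%x. (norm (G x))^2)"
   by (rule ball_dominated_convergence(1)[OF ind tendsto_power[OF tendsto_norm[OF l(2)]], where C = "C^2" and p = "2*p"])
    (use p sq bnd in "auto intro!: continuous_intros c")
 qed (use mu mG in "auto intro: measurable_completion")
 have conv1: "(%n. LINT x:ball 0 1|lebesgue. (ph n x - u x)^2) \<longlonglongrightarrow> (LINT x:ball (0::'a) 1|lebesgue. (0::real))"
 proof (rule ball_dominated_convergence(3)[where C = "(2*C)^2" and p = "2*p"])
  show "(%x. indicator (ball 0 1) x *\<^sub>R (ph n x - u x)^2) \<in> borel_measurable lborel" for n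
  proof -
   have "(%x. (indicator (ball 0 1) x *\<^sub>R ph n x - indicator (ball 0 1) x *\<^sub>R u x)^2) \<in> borel_measurable lborel"
    by (intro borel_measurable_power borel_measurable_diff mu ind[OF c(1)])
   moreover have "(%x. (indicator (ball 0 1) x *\<^sub>R ph n x - indicator (ball 0 1) x *\<^sub>R u x)^2) = (%x. indicator (ball 0 1) x *\<^sub>R (ph n x - u x)^2)"
    by (auto simp: fun_eq_iff indicator_def)
   ultimately show ?thesis by simp
  qed
  fix n and x :: 'a assume x: "0 < norm x" "norm x < 1"
  show "(%n. (ph n x - u x)^2) \<longlonglongrightarrow> 0" using tendsto_power[OF tendsto_diff[OF l(1)[OF x] tendsto_const[of "u x"]], of 2] by simp
  have "abs (ph n x - u x) <= (2*C)*norm x powr (- p)" using bnd(1)[OF x, of n] bl(1)[OF x] by linarith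
  from sq[OF this x(1)] show "abs ((ph n x - u x)^2) <= (2*C)^2*norm x powr - (2*p)" by simp
 qed (use p in auto)
 have conv2: "(%n. LINT x:ball 0 1|lebesgue. (norm (Ph n x - G x))^2) \<longlonglongrightarrow> (LINT x:ball (0::'a) 1|lebesgue. (0::real))"
 proof (rule ball_dominated_convergence(3)[where C = "(2*C)^2" and p = "2*p"])
  show "(%x. indicator (ball 0 1) x *\<^sub>R (norm (Ph n x - G x))^2) \<in> borel_measurable lborel" for n
  proof -
   have "(%x. (norm (indicator (ball 0 1) x *\<^sub>R Ph n x - indicator (ball 0 1) x *\<^sub>R G x))^2) \<in> borel_measurable lborel"
    using borel_measurable_diff[OF ind[OF c(2)] mG] by measurable
   moreover have "(%x. (norm (indicator (ball 0 1) x *\<^sub>R Ph n x - indicator (ball 0 1) x *\<^sub>R G x))^2) = (%x. indicator (ball 0 1) x *\<^sub>R (norm (Ph n x - G x))^2)"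
    by (auto simp: fun_eq_iff indicator_def)
   ultimately show ?thesis by simp
  qed
  fix n and x :: 'a assume x: "0 < norm x" "norm x < 1"
  show "(%n. (norm (Ph n x - G x))^2) \<longlonglongrightarrow> 0" using tendsto_power[OF tendsto_norm[OF tendsto_diff[OF l(2)[OF x] tendsto_const[of "G x"]]], of 2] by simp
  have "abs (norm (Ph n x - G x)) <= (2*C)*norm x powr (- p)" using bnd(2)[OF x, of n] bl(2)[OF x] norm_triangle_ineq4[of "Ph n x" "G x"] by simp
  from sq[OF this x(1)] show "abs ((norm (Ph n x - G x))^2) <= (2*C)^2*norm x powr - (2*p)" by simp
 qed (use p in auto)
 have weak: "weak_gradient (ball 0 1) u G" unfolding weak_gradient_def
 proof (intro ballI)
  fix ps :: "'a => real" and i :: 'a assume ps: "ps \<in> C1c (ball 0 1)" and i: "i \<in> Basis"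
  obtain Ps rh where Ps: "C1_grad ps Ps" and r: "rh < 1" "!!x. rh <= norm x ==> ps x = 0" using ps by (auto simp: C1c_iff)
  obtain K where K: "K >= 0" "!!x. norm (Ps x) <= K" "!!x y. abs (ps x - ps y) <= K*norm (x - y)"
   using C1_grad_lipschitz[OF Ps r(2)] by blast
  have cp: "continuous_on UNIV ps" "continuous_on UNIV Ps" using C1_grad_cont[OF Ps] by auto
  obtain K' where K': "!!x. norm x <= 1 ==> norm (ps x) <= K'"
  proof -
   have "compact (ps ` cball 0 1)" by (intro compact_continuous_image continuous_on_subset[OF cp(1)]) auto
   then show ?thesis using that by (meson compact_imp_bounded bounded_iff imageI mem_cball_0)
  qed
  have Ki: "abs (v \<bullet> i) <= norm v" for v using Basis_le_norm[OF i] .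
  have C0: "C >= 0" if "0 < norm x" "norm x < 1" for x :: 'a
  proof -
   have "0 <= C*norm x powr (- p)" using bnd(1)[OF that, of 0] by linarith
   then show ?thesis using that by (simp add: zero_le_mult_iff)
  qed
  have A: "(%n. LINT x:ball 0 1|lebesgue. ph n x*(Ps x \<bullet> i)) \<longlonglongrightarrow> (LINT x:ball 0 1|lebesgue. u x*(Ps x \<bullet> i))"
   and Ai: "set_integrable lebesgue (ball 0 1) (%x. ph n x*(Ps x \<bullet> i))" for n
  proof -
   have cc: "continuous_on UNIV (%x. ph n x*(Ps x \<bullet> i))" for n by (intro continuous_intros c cp)
   have b: "abs (ph n x*(Ps x \<bullet> i)) <= C*K*norm x powr (- p)" if "0 < norm x" "norm x < 1" for n x
   proof -
    have "abs (ph n x)*abs (Ps x \<bullet> i) <= (C*norm x powr (- p))*K"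
     using bnd(1)[OF that] C0[OF that] order_trans[OF Ki K(2)] by (intro mult_mono) auto
    then show ?thesis by (simp add: abs_mult mult_ac)
   qed
   show "(%n. LINT x:ball 0 1|lebesgue. ph n x*(Ps x \<bullet> i)) \<longlonglongrightarrow> (LINT x:ball 0 1|lebesgue. u x*(Ps x \<bullet> i))"
    "set_integrable lebesgue (ball 0 1) (%x. ph n x*(Ps x \<bullet> i))"
    by (rule ball_dominated_convergence(3)[OF ind[OF cc] tendsto_mult[OF l(1) tendsto_const] b] ball_dominated_convergence(2)[OF ind[OF cc] tendsto_mult[OF l(1) tendsto_const] b]; use p in simp)+
  qed
  have B: "(%n. LINT x:ball 0 1|lebesgue. (Ph n x \<bullet> i)*ps x) \<longlonglongrightarrow> (LINT x:ball 0 1|lebesgue. (G x \<bullet> i)*ps x)"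
   and Bi: "set_integrable lebesgue (ball 0 1) (%x. (Ph n x \<bullet> i)*ps x)" for n
  proof -
   have cc: "continuous_on UNIV (%x. (Ph n x \<bullet> i)*ps x)" for n by (intro continuous_intros c cp)
   have b: "abs ((Ph n x \<bullet> i)*ps x) <= C*K'*norm x powr (- p)" if "0 < norm x" "norm x < 1" for n x
   proof -
    have "abs (Ph n x \<bullet> i)*abs (ps x) <= (C*norm x powr (- p))*K'"
     using order_trans[OF Ki bnd(2)[OF that]] C0[OF that] K'[of x] that by (intro mult_mono) auto
    then show ?thesis by (simp add: abs_mult mult_ac)
   qed
   show "(%n. LINT x:ball 0 1|lebesgue. (Ph n x \<bullet> i)*ps x) \<longlonglongrightarrow> (LINT x:ball 0 1|lebesgue. (G x \<bullet> i)*ps x)"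
    "set_integrable lebesgue (ball 0 1) (%x. (Ph n x \<bullet> i)*ps x)"
    by (rule ball_dominated_convergence(3)[OF ind[OF cc] tendsto_mult[OF tendsto_inner[OF l(2) tendsto_const] tendsto_const] b] ball_dominated_convergence(2)[OF ind[OF cc] tendsto_mult[OF tendsto_inner[OF l(2) tendsto_const] tendsto_const] b]; use p in simp)+
  qed
  have "(LINT x:ball 0 1|lebesgue. ph n x*(Ps x \<bullet> i)) + (LINT x:ball 0 1|lebesgue. (Ph n x \<bullet> i)*ps x) = 0" for n
  proof -
   have "(LINT x:ball 0 1|lebesgue. ph n x*(Ps x \<bullet> i)) + (LINT x:ball 0 1|lebesgue. (Ph n x \<bullet> i)*ps x)
    = (LINT x:ball 0 1|lebesgue. (ph n x *\<^sub>R Ps x + ps x *\<^sub>R Ph n x) \<bullet> i)"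
    by (subst set_integral_add(2)[OF Ai Bi, symmetric]) (simp add: inner_add_left mult.commute)
   also have "... = (LINT x|lborel. indicator (ball 0 1) x *\<^sub>R ((ph n x *\<^sub>R Ps x + ps x *\<^sub>R Ph n x) \<bullet> i))"
    by (rule set_lebesgue_borel(2)[OF ind]) (auto intro!: continuous_intros c cp)
   also have "... = (LINT x|lborel. (ph n x *\<^sub>R Ps x + ps x *\<^sub>R Ph n x) \<bullet> i)"
   proof (rule Bochner_Integration.integral_cong)
    fix x :: 'a
    show "indicator (ball 0 1) x *\<^sub>R ((ph n x *\<^sub>R Ps x + ps x *\<^sub>R Ph n x) \<bullet> i) = (ph n x *\<^sub>R Ps x + ps x *\<^sub>R Ph n x) \<bullet> i"
    proof (cases "norm x < 1")
     case False
     then have "ps x = 0" "Ps x = 0" using r C1_grad_zero_outside[OF Ps r(2)] by auto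
     then show ?thesis by simp
    qed simp
   qed simp
   also have "... = 0"
    by (rule integral_partial_zero[OF C1_grad_mult[OF phi(1) Ps], of 1]) (use r in auto)
   finally show ?thesis .
  qed
  then have "(%n. 0) \<longlonglongrightarrow> (LINT x:ball 0 1|lebesgue. u x*(Ps x \<bullet> i)) + (LINT x:ball 0 1|lebesgue. (G x \<bullet> i)*ps x)"
   using tendsto_add[OF A B] by simp
  then show "(LINT x:ball 0 1|lebesgue. u x*pderiv_dir i ps x) = - (LINT x:ball 0 1|lebesgue. (G x \<bullet> i)*ps x)"
   by (simp add: LIMSEQ_const_iff C1_grad_pderiv[OF Ps])
 qed
 have "ph n \<in> C1c (ball 0 1)" for n using C1c_iff phi by blast
 then show ?thesis unfolding H10_def
  using L2u weak conv1 conv2 by (auto simp: C1_gradD(2)[OF phi(1)] intro!: exI[of _ G] exI[of _ ph])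
qed

text \<open>The cutoff \<open>w n\<close> removes both ends of (0, 1), and its derivative is at most
  4/r + 4/(1 - r). The factor 1 - r in the bound on U pays for the end 1, the spare power of r for
  the end 0; 9 = 8 + 1 also counts \<open>U1\<close>.\<close>

lemma radial_H10:
 assumes dU: "!!r. 0 < r ==> r < 1 ==> (U hasD U1 r) (at r)" and cU1: "continuous_on {0<..<1} U1"
  and b: "!!r. 0 < r ==> r < 1 ==> abs (U r) <= C*(1 - r)*r powr (- ka)"
   "!!r. 0 < r ==> r < 1 ==> abs (U1 r) <= C*r powr (- ka - 1)"
  and ka: "0 <= ka" "2*ka + 2 < real DIM('a::euclidean_space)"
 shows "(radial U :: 'a => real) \<in> H10 (ball 0 1)"
proof -
 define c where "c n = real n + 3" for n :: nat
 define w where "w n r = smooth_step (c n*r) * smooth_step (c n*(1 - r))" for n r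
 define w1 where "w1 n r = c n * smooth_step1 (c n*r) * smooth_step (c n*(1 - r)) - smooth_step (c n*r)*(c n * smooth_step1 (c n*(1 - r)))" for n r
 define v where "v n r = w n r*U r" for n r
 define v1 where "v1 n r = w1 n r*U r + w n r*U1 r" for n r
 have c: "c n > 0" for n by (simp add: c_def)
 have cU: "continuous_on {0<..<1} U" using dU by (intro DERIV_continuous_on) (auto intro: has_field_derivative_at_within)
 have z: "v n r = 0" "v1 n r = 0" if "1 - 1/c n <= r" for n r
 proof -
  have "c n*(1 - r) <= 1" using that c[of n] by (simp add: field_simps)
  then show "v n r = 0" "v1 n r = 0" by (simp_all add: v_def v1_def w_def w1_def smooth_step_eq)
 qed
 have dw: "(w n hasD w1 n r) (at r)" for n r
 proof -
  have "((%r. smooth_step (c n*r)) hasD c n * smooth_step1 (c n*r)) (at r)"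
   using DERIV_chain2[where f = smooth_step and g = "%r. c n*r", OF smooth_step_DERIV DERIV_cmult_Id] by (simp only: mult.commute[of _ "c n"])
  moreover have "((%r. smooth_step (c n*(1 - r))) hasD smooth_step1 (c n*(1 - r))*(c n*(0 - 1))) (at r)"
   by (rule DERIV_chain2[where f = smooth_step and g = "%r. c n*(1 - r)", OF smooth_step_DERIV DERIV_cmult[OF DERIV_diff[OF DERIV_const DERIV_ident]]])
  ultimately show ?thesis unfolding w_def[abs_def] w1_def by (rule DERIV_mult[THEN DERIV_cong]) (simp add: algebra_simps)
 qed
 have dv: "(v n hasD v1 n r) (at r)" if "0 < r" "r < 1" for n r
  unfolding v_def[abs_def] v1_def using DERIV_mult[OF dw[of n r] dU[OF that]] by (simp add: algebra_simps)
 have cv1: "continuous_on {0<..<1} (v1 n)" for n unfolding v1_def[abs_def] w_def w1_def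
  by (intro continuous_intros continuous_on_compose2[OF smooth_step_cont] continuous_on_compose2[OF smooth_step1_cont] cU cU1) auto
 have C: "C >= 0" using b(2)[of "1/2"] by (simp add: zero_le_mult_iff[of C] order_trans[OF abs_ge_zero])
  (metis abs_ge_zero order_trans powr_gt_zero zero_le_mult_iff half_gt_zero_iff zero_less_one less_le not_le)
 have ev: "\<forall>\<^sub>F n in sequentially. 2 <= c n*r" if "r > 0" for r
 proof -
  have "\<forall>\<^sub>F n in sequentially. 2/r <= real n" using filterlim_real_sequentially by (auto simp: filterlim_at_top)
  then show ?thesis
  proof eventually_elim
   case (elim n)
   then have "2 <= real n*r" using that by (simp add: field_simps)
   then show ?case using that by (simp add: c_def distrib_right)
  qed
 qed
 show ?thesis
 proof (rule H10_intro[where ph = "%n x. v n (norm x)" and Ph = "%n x. (v1 n (norm x)/norm x) *\<^sub>R x" and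
    G = "%x. (U1 (norm x)/norm x) *\<^sub>R x" and C = "9*C" and p = "ka + 1"])
  fix n
  show "C1_grad (%x::'a. v n (norm x)) (%x. (v1 n (norm x)/norm x) *\<^sub>R x)"
  proof (rule C1_grad_radial_compact[OF dv cv1, where de = "1/c n" and R = "1 - 1/c n"])
   show "v n r = 0 & v1 n r = 0" if "r < 1/c n" for r
   proof -
    have "c n*r <= 1" using that c[of n] by (simp add: field_simps)
    then show ?thesis by (simp add: v_def w_def v1_def w1_def smooth_step_eq)
   qed
  qed (use c z in auto)
  show "EX rh<1. \<forall>x::'a. rh <= norm x --> v n (norm x) = 0" using z[of n] c[of n] by (intro exI[of _ "1 - 1/c n"]) auto
  fix x :: 'a assume x: "0 < norm x" "norm x < 1"
  define r where "r = norm x"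
  have r: "0 < r" "r < 1" using x by (simp_all add: r_def)
  note S = smooth_step_bounds smooth_step1_bounds
  have w01: "0 <= w n r" "w n r <= 1" unfolding w_def using S by (auto intro: mult_le_one)
  have P: "r powr (- ka) <= r powr (- ka - 1)" using r by (intro powr_mono') auto
  have Pr: "1/r*r powr (- ka) = r powr (- ka - 1)" using r by (simp add: powr_diff)
  have e: "- (ka + 1) = - ka - 1" by simp
  have U: "abs (U r) <= C*r powr (- ka - 1)"
  proof -
   have "C*(1 - r)*r powr (- ka) <= C*1*r powr (- ka - 1)" using P C r by (intro mult_mono) auto
   then show ?thesis using b(1)[OF r] by simp
  qed
  have Cp: "0 <= C*r powr (- ka - 1)" using C by simp
  have "abs (v n r) <= 1*abs (U r)" unfolding v_def abs_mult using w01 by (intro mult_right_mono) auto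
  then show "abs (v n (norm x)) <= 9*C*norm x powr - (ka + 1)" unfolding r_def[symmetric] e using U Cp by linarith
  have "abs (w1 n r) <= 4/r + 4/(1 - r)"
  proof -
   have A: "0 <= c n * smooth_step1 (c n * s)" "c n * smooth_step1 (c n * s) <= 4/s" if "s > 0" for s
    using smooth_step_scaled_bound[OF c that] S(3) c[of n] by auto
   have "c n * smooth_step1 (c n*r) * smooth_step (c n*(1 - r)) <= 4/r*1" using A[of r] r S by (intro mult_mono) auto
   moreover have "smooth_step (c n*r)*(c n * smooth_step1 (c n*(1 - r))) <= 1*(4/(1 - r))" using A[of "1 - r"] r S by (intro mult_mono) auto
   moreover have "0 <= c n * smooth_step1 (c n*r) * smooth_step (c n*(1 - r))" using c[of n] S by (intro mult_nonneg_nonneg) auto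
   moreover have "0 <= smooth_step (c n*r)*(c n * smooth_step1 (c n*(1 - r)))" using c[of n] S by (intro mult_nonneg_nonneg) auto
   ultimately show ?thesis unfolding w1_def by linarith
  qed
  then have "abs (w1 n r)*abs (U r) <= (4/r + 4/(1 - r))*(C*(1 - r)*r powr (- ka))" using b(1)[OF r] r C by (intro mult_mono) auto
  also have "... = 4*C*(1 - r)*(1/r*r powr (- ka)) + 4*C*r powr (- ka)" using r by (simp add: field_simps)
  also have "... <= 4*C*1*(1/r*r powr (- ka)) + 4*C*r powr (- ka - 1)" using P r C
   by (intro add_mono mult_left_mono mult_right_mono) auto
  finally have "abs (w1 n r)*abs (U r) <= 8*(C*r powr (- ka - 1))" unfolding Pr by simp
  moreover have "w n r*abs (U1 r) <= 1*abs (U1 r)" using w01 by (intro mult_right_mono) auto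
  moreover have "abs (v1 n r) <= abs (w1 n r)*abs (U r) + w n r*abs (U1 r)"
   unfolding v1_def using abs_triangle_ineq[of "w1 n r*U r" "w n r*U1 r"] w01 by (simp add: abs_mult)
  ultimately have "abs (v1 n r) <= 9*C*r powr - (ka + 1)" unfolding e using b(2)[OF r] by linarith
  then show "norm ((v1 n (norm x)/norm x) *\<^sub>R x) <= 9*C*norm x powr - (ka + 1)" using x by (simp add: r_def)
 next
  fix x :: 'a assume x: "0 < norm x" "norm x < 1"
  show "\<forall>\<^sub>F n in sequentially. v n (norm x) = radial U x & (v1 n (norm x)/norm x) *\<^sub>R x = (U1 (norm x)/norm x) *\<^sub>R x"
   using ev[OF x(1)] ev[of "1 - norm x", unfolded diff_gt_0_iff_gt, OF x(2)]
  proof eventually_elim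
   case (elim n)
   then show ?case
    by (simp add: v_def v1_def w_def w1_def smooth_step_eq radial_def)
  qed
 qed (use ka in auto)
qed

section \<open>Morse index and Poincare inequality\<close>

text \<open>Gaussian elimination: an equation with a nonzero coefficient eliminates one unknown, an
  equation without one is satisfied anyway.\<close>

lemma linear_system_nontrivial:
 fixes a :: "'j => 'b => real"
 assumes "finite J"
 shows "finite B ==> card J < card B ==> EX c. (\<exists>b\<in>B. c b ~= 0) & (\<forall>j\<in>J. (\<Sum>b\<in>B. c b*a j b) = 0)"
 using assms
proof (induction J arbitrary: a B rule: finite_induct)
 case empty
 then have "B ~= {}" by auto
 then show ?case by (intro exI[of _ "%_. 1"]) auto
next
 case (insert j J)
 show ?case
 proof (cases "\<exists>b0\<in>B. a j b0 ~= 0")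
  case False
  obtain c where "\<exists>b\<in>B. c b ~= 0" "\<forall>j\<in>J. (\<Sum>b\<in>B. c b*a j b) = 0"
   using insert.IH[of B a] insert.prems insert.hyps by auto
  then show ?thesis using False by (intro exI[of _ c]) auto
 next
  case True
  then obtain b0 where b0: "b0 \<in> B" "a j b0 ~= 0" by blast
  define B' where "B' = B - {b0}"
  have B': "finite B'" "B = insert b0 B'" "b0 \<notin> B'" using b0 insert.prems by (auto simp: B'_def)
  then have "card J < card B'" using insert.prems insert.hyps by simp
  then obtain c where c: "\<exists>b\<in>B'. c b ~= 0" "!!i. i \<in> J ==> (\<Sum>b\<in>B'. c b*(a i b - a j b/a j b0*a i b0)) = 0"
   using insert.IH[of B' "%i b. a i b - a j b/a j b0*a i b0"] B'(1) by blast
  define s where "s = (\<Sum>b\<in>B'. c b*a j b)"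
  have sum: "(\<Sum>b\<in>B. (c(b0 := - s/a j b0)) b*a i b) = - s/a j b0*a i b0 + (\<Sum>b\<in>B'. c b*a i b)" for i
   using B' by (auto intro!: sum.cong)
  have "(\<Sum>b\<in>B'. c b*a i b) = s/a j b0*a i b0" if "i \<in> J" for i
  proof -
   have "(\<Sum>b\<in>B'. c b*a i b) - (\<Sum>b\<in>B'. c b*a j b)*(a i b0/a j b0) = 0"
    using c(2)[OF that] unfolding sum_distrib_right sum_subtractf[symmetric] by (simp add: algebra_simps)
   then show ?thesis by (simp add: s_def)
  qed
  then have "\<forall>i\<in>insert j J. (\<Sum>b\<in>B. (c(b0 := - s/a j b0)) b*a i b) = 0"
   unfolding sum using b0 by (auto simp: s_def)
  moreover have "\<exists>b\<in>B. (c(b0 := - s/a j b0)) b ~= 0" using c(1) B' by auto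
  ultimately show ?thesis by blast
 qed
qed

lemma sum_fun_eq: "(\<Sum>v\<in>B. (%x. c v * v x)) = (%x. \<Sum>v\<in>B. c v * v x :: real)"
 by (induction B rule: infinite_finite_induct) (auto simp: zero_fun_def plus_fun_def)

text \<open>A negative subspace of dimension above card J would contain a nonzero common zero of the
  functionals \<open>L j\<close>, where the form is nonnegative.\<close>

lemma morse_index_finite:
 assumes J: "finite J"
  and lin: "!!j B c. j \<in> J ==> finite B ==> B \<subseteq> C1c (ball 0 1) ==> L j (%x. \<Sum>b\<in>B. c b*b x) = (\<Sum>b\<in>B. c b*L j b)"
  and Q: "!!xi. xi \<in> C1c (ball 0 1) ==> (!!j. j \<in> J ==> L j xi = (0::real)) ==> Q_form f l u xi >= 0"
 shows "morse_index f l (u :: 'a::euclidean_space => real) < \<infinity>"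
proof -
 have "morse_index f l u <= enat (card J)"
  unfolding morse_index_def
 proof (rule Sup_least, safe)
  fix B :: "('a => real) set"
  assume B: "fun_space.span B \<subseteq> C1c (ball 0 1)" "finite B" "fun_space.independent B" "\<forall>xi\<in>fun_space.span B - {0}. Q_form f l u xi < 0"
  have "card B <= card J"
  proof (rule ccontr)
   assume "~ card B <= card J"
   then obtain c where c: "\<exists>b\<in>B. c b ~= 0" "!!j. j \<in> J ==> (\<Sum>b\<in>B. c b*L j b) = 0"
    using linear_system_nontrivial[OF J B(2), of L] by auto
   define xi where "xi = (%x. \<Sum>b\<in>B. c b*b x)"
   have xi: "xi \<in> fun_space.span B" unfolding xi_def sum_fun_eq[symmetric] fun_space.span_finite[OF B(2)] by blast
   have "xi ~= 0" using B(3) c(1) unfolding xi_def sum_fun_eq[symmetric] fun_space.dependent_finite[OF B(2)] by blast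
   then have "Q_form f l u xi < 0" using B(4) xi by blast
   moreover have "B \<subseteq> C1c (ball 0 1)" using B(1) fun_space.span_superset by blast
   ultimately show False using Q[of xi] lin[OF _ B(2)] xi B(1) c(2) by (force simp: xi_def)
  qed
  then show "enat (card B) <= enat (card J)" by simp
 qed
 then show ?thesis using le_less_trans by fastforce
qed

text \<open>Disjoint supports diagonalize the quadratic form on the span, so negativity on each
  function gives negativity on every nonzero combination.\<close>

lemma morse_index_infinite:
 fixes xi :: "nat => 'a::euclidean_space => real"
 assumes xi: "!!n. C1_grad (xi n) (Ph n)" "!!n. EX rh<1. ALL x. rh <= norm x --> xi n x = 0"
  and disj: "!!i j x. i ~= j ==> xi i x = 0 | xi j x = 0" "!!i j x. i ~= j ==> Ph i x = 0 | Ph j x = 0"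
  and int: "!!n. set_integrable lebesgue (ball 0 1) (%x. (norm (Ph n x))^2 - l*deriv_on {0..} f (u x)*(xi n x)^2)"
  and Q: "!!n. (LINT x:ball 0 1|lebesgue. (norm (Ph n x))^2 - l*deriv_on {0..} f (u x)*(xi n x)^2) < 0"
  and nz: "!!n. EX x. xi n x ~= 0"
 shows "morse_index f l u = \<infinity>"
proof -
 let ?E = "%n x. (norm (Ph n x))^2 - l*deriv_on {0..} f (u x)*(xi n x)^2"
 have inj: "inj xi"
 proof (rule injI)
  fix i j assume "xi i = xi j"
  then show "i = j" using nz[of i] disj(1)[of i j] by metis
 qed
 have diag: "(\<Sum>i\<in>I. g i)^2 = (\<Sum>i\<in>I. (g i)^2)" if fin: "finite I" and g: "!!i j. i ~= j ==> g i = 0 | g j = 0" for g :: "nat => real" and I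
  using fin
 proof (induction I rule: finite_induct)
  case (insert i I)
  have "g i*(\<Sum>j\<in>I. g j) = 0"
  proof (cases "g i = 0")
   case False
   have "g j = 0" if "j \<in> I" for j
   proof -
    have "i ~= j" using insert.hyps that by auto
    then show ?thesis using g[of i j] False by simp
   qed
   then show ?thesis by simp
  qed simp
  then show ?case using insert by (simp add: power2_sum)
 qed simp
 have Qsum: "Q_form f l u (%x. \<Sum>i\<in>I. c i*xi i x) = (\<Sum>i\<in>I. (c i)^2*(LINT x:ball 0 1|lebesgue. ?E i x))" if I: "finite I" for I c
 proof -
  have g: "grad (%x. \<Sum>i\<in>I. c i*xi i x) = (%x. \<Sum>i\<in>I. c i *\<^sub>R Ph i x)"
   by (intro C1_gradD(2) C1_grad_sum I C1_grad_scale xi)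
  have n: "(norm (\<Sum>i\<in>I. c i *\<^sub>R Ph i x))^2 = (\<Sum>i\<in>I. (c i)^2*(norm (Ph i x))^2)" for x
  proof -
   have "norm (\<Sum>i\<in>I. c i *\<^sub>R Ph i x) = (\<Sum>i\<in>I. norm (c i *\<^sub>R Ph i x))"
    using I
   proof (induction I rule: finite_induct)
    case (insert i I)
    show ?case
    proof (cases "Ph i x = 0")
     case False
     have "Ph j x = 0" if "j \<in> I" for j
     proof -
      have "i ~= j" using insert.hyps that by auto
      then show ?thesis using disj(2)[of i j x] False by simp
     qed
     then show ?thesis using insert by simp
    qed (use insert in simp)
   qed simp
   then show ?thesis using diag[OF I, of "%i. norm (c i *\<^sub>R Ph i x)"] disj(2) by (auto simp: power_mult_distrib)
  qed
  have s: "(\<Sum>i\<in>I. c i*xi i x)^2 = (\<Sum>i\<in>I. (c i)^2*(xi i x)^2)" for x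
   using diag[OF I, of "%i. c i*xi i x"] disj(1) by (auto simp: power_mult_distrib)
  have "(norm (\<Sum>i\<in>I. c i *\<^sub>R Ph i x))^2 - l*deriv_on {0..} f (u x)*(\<Sum>i\<in>I. c i*xi i x)^2 = (\<Sum>i\<in>I. (c i)^2*?E i x)" for x
   unfolding n s by (simp add: sum_distrib_left sum_subtractf algebra_simps)
  then have "Q_form f l u (%x. \<Sum>i\<in>I. c i*xi i x) = (LINT x:ball 0 1|lebesgue. (\<Sum>i\<in>I. (c i)^2*?E i x))"
   unfolding Q_form_def g by simp
  also have "... = (\<Sum>i\<in>I. (LINT x:ball 0 1|lebesgue. (c i)^2*?E i x))"
   using int unfolding set_lebesgue_integral_def set_integrable_def scaleR_sum_right
   by (intro Bochner_Integration.integral_sum) (auto simp: mult.left_commute[of "indicat_real _ _"] simp del: mult_minus_right)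
  finally show ?thesis by simp
 qed
 have "enat n <= morse_index f l u" for n
  unfolding morse_index_def
 proof (rule Sup_upper, clarify, intro exI conjI)
  let ?B = "xi ` {..<n}"
  have reidx: "(\<Sum>v\<in>?B. (%x. c v * v x)) = (%x. \<Sum>i<n. c (xi i)*xi i x)" for c
   unfolding sum_fun_eq by (subst sum.reindex) (auto intro: inj_on_subset[OF inj])
  have coeff: "(\<Sum>i<n. c i*xi i x) = c j*xi j x" if "j < n" "xi j x ~= 0" for c j x
  proof -
   have "(\<Sum>i<n. c i*xi i x) = (\<Sum>i\<in>{j}. c i*xi i x)"
    using that disj(1)[of _ j x] by (intro sum.mono_neutral_right) auto
   then show ?thesis by simp
  qed
  show "fun_space.subspace (fun_space.span ?B)" by (rule fun_space.subspace_span)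
  show "finite ?B" by simp
  show "card ?B = n" by (simp add: card_image inj_on_subset[OF inj])
  have zero: "c (xi j) = 0" if "(%x. \<Sum>i<n. c (xi i)*xi i x) = 0" "j < n" for c j
  proof -
   obtain x where x: "xi j x ~= 0" using nz by blast
   then show ?thesis using coeff[OF that(2) x, of "%i. c (xi i)"] fun_cong[OF that(1), of x] by simp
  qed
  show "fun_space.independent ?B"
   unfolding fun_space.dependent_finite[OF finite_imageI[OF finite_lessThan]] reidx using zero by auto
  show "fun_space.span ?B \<subseteq> C1c (ball 0 1)"
  proof
   fix v assume "v \<in> fun_space.span ?B"
   then obtain c where v: "v = (%x. \<Sum>i<n. c (xi i)*xi i x)" by (auto simp: fun_space.span_finite reidx)
   obtain rh where rh: "!!i. rh i < 1" "!!i x. rh i <= norm x ==> xi i x = 0" using xi(2) by metis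
   define R where "R = Max (insert 0 (rh ` {..<n}))"
   have "R < 1" using rh(1) by (auto simp: R_def)
   moreover have "v x = 0" if "R <= norm x" for x
   proof -
    have "rh i <= norm x" if "i < n" for i using that \<open>R <= norm x\<close> by (auto simp: R_def)
    then show ?thesis using rh(2) by (auto simp: v)
   qed
   moreover have "C1_grad v (%x. \<Sum>i<n. c (xi i) *\<^sub>R Ph i x)" unfolding v by (intro C1_grad_sum C1_grad_scale xi) auto
   ultimately show "v \<in> C1c (ball 0 1)" by (auto simp: C1c_iff)
  qed
  show "\<forall>v\<in>fun_space.span ?B - {0}. Q_form f l u v < 0"
  proof
   fix v assume v: "v \<in> fun_space.span ?B - {0}"
   then obtain c where vc: "v = (%x. \<Sum>i<n. c (xi i)*xi i x)" by (auto simp: fun_space.span_finite reidx)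
   have "EX j<n. c (xi j) ~= 0" 
   proof (rule ccontr)
    assume "~ (EX j<n. c (xi j) ~= 0)"
    then have "v = 0" unfolding vc by (simp add: zero_fun_def)
    then show False using v by simp
   qed
   then obtain j where j: "j < n" "c (xi j) ~= 0" by blast
   have "(\<Sum>i<n. (c (xi i))^2*(LINT x:ball 0 1|lebesgue. ?E i x)) < (\<Sum>i<n. 0)"
    using Q j by (intro sum_strict_mono_ex1) (auto simp: mult_nonneg_nonpos less_imp_le mult_pos_neg intro!: bexI[of _ j])
   then show "Q_form f l u v < 0" unfolding vc Qsum[OF finite_lessThan, of "%i. c (xi i)"] by simp
  qed
 qed (rule refl)+
 then have e: "enat (Suc n) <= morse_index f l u" for n by blast
 show ?thesis
 proof (cases "morse_index f l u")
  case (enat m)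
  then show ?thesis using e[of m] by simp
 qed
qed

text \<open>Cut the shift by w into n + 1 equal steps: Cauchy-Schwarz and translation invariance
  bound the left side by the squared L^2 norm of a difference quotient, and in the limit the
  directional derivative along w appears.\<close>

lemma translation_L2_bound:
 fixes u :: "'a::euclidean_space => real"
 assumes u: "C1_grad u G" and R: "!!x. R <= norm x ==> u x = 0"
 shows "(LINT x|lborel. (u (x + w) - u x)^2) <= (norm w)^2*(LINT x|lborel. (norm (G x))^2)"
proof -
 have cu: "continuous_on UNIV u" and cG: "continuous_on UNIV G" using C1_grad_cont[OF u] by auto
 let ?q = "%n x. (u (x + (1/real (Suc n)) *\<^sub>R w) - u x)*real (Suc n)"
 note D = difference_quotient[where u = u and R = R and w = w, OF u R]
 obtain C where C: "!!n x. abs (?q n x) <= indicator (cball 0 (abs R + norm w)) x *\<^sub>R C" using D(2) by blast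
 have sqi: "continuous_on UNIV (%x. (u (x + d) - u x)^2)" "!!x. abs R + norm d <= norm x ==> (u (x + d) - u x)^2 = 0" for d :: 'a
 proof -
  show "continuous_on UNIV (%x. (u (x + d) - u x)^2)" by (intro continuous_intros cu continuous_on_compose2[OF cu]) auto
  fix x :: 'a assume "abs R + norm d <= norm x"
  then have "R <= norm x" "R <= norm (x + d)" using norm_diff_ineq[of x d] norm_ge_zero[of d] by linarith+
  then show "(u (x + d) - u x)^2 = 0" using R by simp
 qed
 have le: "(LINT x|lborel. (u (x + w) - u x)^2) <= (LINT x|lborel. (?q n x)^2)" for n
 proof -
  define d where "d = (1/real (Suc n)) *\<^sub>R w"
  define g where "g x = (u (x + d) - u x)^2" for x
  have gi: "integrable lborel (%x. g (x + c))" for c unfolding g_def by (rule compact_support_translate[OF sqi])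
  have nd: "real (Suc n) *\<^sub>R d = w" by (simp add: d_def del: of_nat_Suc)
  have "(u (x + w) - u x)^2 <= (\<Sum>j<Suc n. g (x + real j *\<^sub>R d))*real (Suc n)" for x
  proof -
   have "u (x + w) - u x = (\<Sum>j<Suc n. u (x + real (Suc j) *\<^sub>R d) - u (x + real j *\<^sub>R d))"
    unfolding sum_lessThan_telescope[of "%j. u (x + real j *\<^sub>R d)"] using nd by simp
   also have "...^2 <= (\<Sum>j<Suc n. (u (x + real (Suc j) *\<^sub>R d) - u (x + real j *\<^sub>R d))^2)*real (card {..<Suc n})"
    by (rule sum_squared_le_sum_of_squares)
   also have "(\<Sum>j<Suc n. (u (x + real (Suc j) *\<^sub>R d) - u (x + real j *\<^sub>R d))^2) = (\<Sum>j<Suc n. g (x + real j *\<^sub>R d))"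
    unfolding g_def by (intro sum.cong) (auto simp: algebra_simps)
   finally show ?thesis by simp
  qed
  then have "(LINT x|lborel. (u (x + w) - u x)^2) <= (LINT x|lborel. (\<Sum>j<Suc n. g (x + real j *\<^sub>R d))*real (Suc n))"
   by (intro integral_mono compact_support_integrable[OF sqi] integrable_mult_left Bochner_Integration.integrable_sum gi) auto
  also have "... = (\<Sum>j<Suc n. LINT x|lborel. g (x + real j *\<^sub>R d))*real (Suc n)"
   by (simp only: integral_mult_left_zero Bochner_Integration.integral_sum[OF gi])
  also have "... = real (Suc n)*(LINT x|lborel. g x)*real (Suc n)"
  proof -
   have "g \<in> borel_measurable borel" unfolding g_def[abs_def] by (rule borel_measurable_continuous_onI[OF sqi(1)])
   then show ?thesis by (simp add: integral_translate del: of_nat_Suc)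
  qed
  also have "... = (LINT x|lborel. g x*(real (Suc n))^2)"
   by (simp only: integral_mult_left_zero power2_eq_square mult_ac)
  also have "... = (LINT x|lborel. (?q n x)^2)" by (simp only: g_def d_def power_mult_distrib)
  finally show ?thesis .
 qed
 have "(%n. LINT x|lborel. (?q n x)^2) \<longlonglongrightarrow> (LINT x|lborel. (G x \<bullet> w)^2)"
 proof (rule integral_dominated_convergence)
  show "integrable lborel (%x::'a. indicator (cball 0 (abs R + norm w)) x *\<^sub>R C^2)" by (intro borel_integrable_compact continuous_intros) auto
  show "AE x in lborel. norm ((?q n x)^2) <= indicator (cball 0 (abs R + norm w)) x *\<^sub>R C^2" for n
  proof (rule AE_I2)
   fix x
   have "abs (?q n x)^2 <= (indicator (cball 0 (abs R + norm w)) x *\<^sub>R C)^2" by (rule power_mono[OF C]) simp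
   then show "norm ((?q n x)^2) <= indicator (cball 0 (abs R + norm w)) x *\<^sub>R C^2" by (cases "x \<in> cball 0 (abs R + norm w)") (simp_all del: of_nat_Suc)
  qed
  show "AE x in lborel. (%n. (?q n x)^2) \<longlonglongrightarrow> (G x \<bullet> w)^2" by (intro AE_I2 tendsto_power D(1))
  show "(%x. (G x \<bullet> w)^2) \<in> borel_measurable lborel" using cG by (auto intro!: borel_measurable_continuous_onI continuous_intros)
  show "(%x. (?q n x)^2) \<in> borel_measurable lborel" for n
   using borel_measurable_power[OF borel_measurable_continuous_onI[OF D(3)[of n]], of 2] by (simp del: of_nat_Suc)
 qed
 then have "(LINT x|lborel. (u (x + w) - u x)^2) <= (LINT x|lborel. (G x \<bullet> w)^2)" by (rule LIMSEQ_le_const) (use le in auto)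
 also have "... <= (LINT x|lborel. (norm w)^2*(norm (G x))^2)"
 proof (rule integral_mono)
  have z: "G x = 0" if "abs R + 1 <= norm x" for x using C1_grad_zero_outside[OF u, of "abs R" x] R that by auto
  show "integrable lborel (%x. (G x \<bullet> w)^2)" "integrable lborel (%x. (norm w)^2*(norm (G x))^2)"
   by (rule compact_support_integrable[of _ "abs R + 1"]; use z cG in "auto intro!: continuous_intros")+
  show "(G x \<bullet> w)^2 <= (norm w)^2*(norm (G x))^2" for x
   using Cauchy_Schwarz_ineq[of "G x" w] by (simp add: power2_norm_eq_inner mult.commute)
 qed
 finally show ?thesis by simp
qed

text \<open>If the mean of \<open>u\<close> over a cube of side \<open>h\<close> vanishes, then \<open>h\<^sup>N u(x)^2 <= \<integral> (u(x) - u(y))^2 dy\<close> over this cube.\<close>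

lemma poincare_cubes:
 assumes e: "e > 0"
 shows "\<exists>C::'a::euclidean_space set set. finite C & (\<forall>S\<in>C. compact S) &
  (ALL u G. C1_grad u G --> (ALL x. 1 <= norm x --> u x = 0) --> (\<forall>S\<in>C. (LINT x|lborel. indicator S x *\<^sub>R u x) = 0) -->
   (LINT x|lborel. (u x)^2) <= e*(LINT x|lborel. (norm (G x))^2))"
proof -
 define N where "N = DIM('a)"
 obtain M :: nat where M: "real M > (2^N*real N)/e + 1" using reals_Archimedean2 by blast
 have "(2^N*real N)/e >= 0" using e by simp
 then have M1: "real M >= 1" "(2^N*real N)/e <= real M" using M by linarith+
 define h where "h = 1/real M"
 have h: "h > 0" "h*real M = 1" using M1 by (auto simp: h_def)
 have he: "2^N*real N*h^2 <= e"
 proof -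
  have "2^N*real N <= e*real M" using M1 e by (simp add: field_simps)
  then have "2^N*real N*h^2 <= e*real M*h^2" by (intro mult_right_mono) auto
  also have "... = e*h" using h(2) by (simp add: power2_eq_square mult_ac)
  also have "... <= e*1" using e M1 by (intro mult_left_mono) (auto simp: h_def)
  finally show ?thesis by simp
 qed
 define a where "a k = (\<Sum>i\<in>Basis. (h*real_of_int (k i)) *\<^sub>R i)" for k :: "'a => int"
 define Q where "Q k = cbox (a k) (a k + h *\<^sub>R One)" for k
 define J where "J = (Basis :: 'a set) \<rightarrow>\<^sub>E {- int M..<int M}"
 \<comment> \<open>Contains the difference of any two points of one cube. Its volume is 2^N*h^N and
   |w|^2 <= N*h^2 on it, whence the factor 2^N*N*h^2 that \<open>he\<close> makes small.\<close>
 define D where "D = cbox (- h *\<^sub>R One) (h *\<^sub>R One :: 'a)"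
 have [measurable]: "D \<in> sets borel" by (simp add: D_def)
 have mQ: "measure lborel (Q k) = h^N" for k
  using h(1) by (simp add: Q_def content_cbox_if box_eq_empty inner_add_left N_def)
 have main: "(LINT x|lborel. (u x)^2) <= e*(LINT x|lborel. (norm (G x))^2)"
  if u: "C1_grad u G" and R: "!!x. 1 <= norm x ==> u x = 0" and mean: "!!k. k \<in> J ==> (LINT x|lborel. indicator (Q k) x *\<^sub>R u x) = 0"
  for u and G :: "'a => 'a"
 proof -
  have cu: "continuous_on UNIV u" by (rule C1_grad_cont[OF u])
  have cu': "continuous_on S (%y. u (c + y))" for S c by (intro continuous_on_compose2[OF cu] continuous_intros) auto
  have [measurable]: "u \<in> borel_measurable borel" by (rule borel_measurable_continuous_onI[OF cu])
  have iD: "integrable lborel (%w. indicator D w *\<^sub>R (u (x + w) - u x)^2)" for x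
   unfolding D_def by (intro borel_integrable_compact continuous_intros cu') auto
  have pt: "(u x)^2*h^N <= (LINT w|lborel. indicator D w *\<^sub>R (u (x + w) - u x)^2)" for x
  proof (cases "norm x < 1")
   case False
   then show ?thesis using R[of x] h by (simp add: Bochner_Integration.integral_nonneg)
  next
   case True
   define k where "k = (\<lambda>i\<in>Basis. \<lfloor>real M*(x \<bullet> i)\<rfloor>)"
   have kJ: "k \<in> J" unfolding J_def k_def
   proof (rule restrict_PiE_iff[THEN iffD2], rule ballI)
    fix i :: 'a assume i: "i \<in> Basis"
    have "abs (x \<bullet> i) < 1" using Basis_le_norm[OF i, of x] True by linarith
    then have "abs (real M*(x \<bullet> i)) < real M*1" unfolding abs_mult abs_of_nat using M1 by (intro mult_strict_left_mono) auto
    then have "- real M <= real M*(x \<bullet> i)" "real M*(x \<bullet> i) < real M" by linarith+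
    then show "\<lfloor>real M*(x \<bullet> i)\<rfloor> \<in> {- int M..<int M}" by (simp add: floor_less_iff le_floor_iff)
   qed
   have xQ: "a k \<bullet> i <= x \<bullet> i" "x \<bullet> i <= a k \<bullet> i + h" if i: "i \<in> Basis" for i
   proof -
    have ak: "a k \<bullet> i = h*real_of_int \<lfloor>real M*(x \<bullet> i)\<rfloor>" using i by (simp add: a_def k_def inner_sum_left inner_Basis if_distrib cong: if_cong)
    have x: "x \<bullet> i = h*(real M*(x \<bullet> i))" using h(2) by (simp add: mult.assoc[symmetric])
    show "a k \<bullet> i <= x \<bullet> i" unfolding ak by (subst (2) x) (intro mult_left_mono, use h in auto)
    have "h*(real M*(x \<bullet> i)) <= h*(real_of_int \<lfloor>real M*(x \<bullet> i)\<rfloor> + 1)" using h(1) by (intro mult_left_mono) linarith+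
    then show "x \<bullet> i <= a k \<bullet> i + h" unfolding ak x[symmetric] by (simp add: distrib_left)
   qed
   have iQ: "integrable lborel (%y. indicator (Q k) y *\<^sub>R g y)" if "continuous_on UNIV g" for g :: "'a => real"
    unfolding Q_def by (intro borel_integrable_compact continuous_on_subset[OF that]) auto
   have "(u x)^2*h^N <= (LINT y|lborel. indicator (Q k) y *\<^sub>R (u x)^2) - 2*u x*(LINT y|lborel. indicator (Q k) y *\<^sub>R u y) + (LINT y|lborel. indicator (Q k) y *\<^sub>R (u y)^2)"
    unfolding mean[OF kJ] using mQ[of k] by (simp add: Q_def mult.commute Bochner_Integration.integral_nonneg)
   also have "... = (LINT y|lborel. indicator (Q k) y *\<^sub>R (u x)^2 - 2*u x*(indicator (Q k) y *\<^sub>R u y) + indicator (Q k) y *\<^sub>R (u y)^2)"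
    by (simp only: Bochner_Integration.integral_add[OF Bochner_Integration.integrable_diff[OF iQ[OF continuous_on_const] integrable_mult_right[OF iQ[OF cu]]] iQ[OF continuous_on_power[OF cu]]]
     Bochner_Integration.integral_diff[OF iQ[OF continuous_on_const] integrable_mult_right[OF iQ[OF cu]]] integral_mult_right_zero)
   also have "... = (LINT y|lborel. indicator (Q k) y *\<^sub>R (u y - u x)^2)"
    by (intro Bochner_Integration.integral_cong) (auto simp: indicator_def power2_eq_square algebra_simps)
   also have "... = (LINT w|lborel. indicator (Q k) (w + x) *\<^sub>R (u (w + x) - u x)^2)"
    by (rule integral_translate[symmetric]) (simp add: Q_def)
   also have "... <= (LINT w|lborel. indicator D w *\<^sub>R (u (x + w) - u x)^2)"
   proof (rule integral_mono_AE'[OF iD])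
    have "w \<in> D" if "w + x \<in> Q k" for w
     unfolding D_def mem_box
    proof (intro ballI conjI)
     fix i :: 'a assume i: "i \<in> Basis"
     have "a k \<bullet> i <= w \<bullet> i + x \<bullet> i" "w \<bullet> i + x \<bullet> i <= a k \<bullet> i + h" using that i by (auto simp: Q_def mem_box inner_add_left)
     then show "(- h *\<^sub>R One) \<bullet> i <= w \<bullet> i" "w \<bullet> i <= (h *\<^sub>R One) \<bullet> i" using xQ[OF i] i by simp_all
    qed
    then show "AE w in lborel. indicator (Q k) (w + x) *\<^sub>R (u (w + x) - u x)^2 <= indicator D w *\<^sub>R (u (x + w) - u x)^2"
     by (intro AE_I2) (auto simp: indicator_def add.commute)
   qed simp
   finally show ?thesis .
  qed
  define E where "E = (LINT x|lborel. (norm (G x))^2)"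
  have E: "E >= 0" by (simp add: E_def)
  have nD: "(norm w)^2 <= real N*h^2" if "w \<in> D" for w
  proof -
   have "(norm w)^2 = (\<Sum>i\<in>Basis. (w \<bullet> i)^2)" unfolding power2_norm_eq_inner by (subst euclidean_inner) (simp add: power2_eq_square)
   also have "... <= (\<Sum>i\<in>(Basis::'a set). h^2)"
   proof (rule sum_mono)
    fix i :: 'a assume "i \<in> Basis"
    then have "abs (w \<bullet> i) <= h" using that by (auto simp: D_def mem_box abs_le_iff)
    then show "(w \<bullet> i)^2 <= h^2" using h(1) by (simp add: abs_le_square_iff[symmetric])
   qed
   finally show ?thesis by (simp add: N_def)
  qed
  \<comment> \<open>The pointwise bound is integrated in x and the order of integration exchanged,
    so that \<open>translation_L2_bound\<close> applies for each fixed shift w.\<close>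
  have "ennreal ((LINT x|lborel. (u x)^2)*h^N) = (\<integral>\<^sup>+x. ennreal ((u x)^2*h^N) \<partial>lborel)"
   using h(1) by (subst nn_integral_eq_integral)
    (auto intro!: integrable_mult_left compact_support_integrable[of _ 1] continuous_intros cu simp: R)
  also have "... <= (\<integral>\<^sup>+x. \<integral>\<^sup>+w. ennreal (indicator D w *\<^sub>R (u (x + w) - u x)^2) \<partial>lborel \<partial>lborel)"
  proof (rule nn_integral_mono)
   fix x
   have "(\<integral>\<^sup>+w. ennreal (indicator D w *\<^sub>R (u (x + w) - u x)^2) \<partial>lborel) = ennreal (LINT w|lborel. indicator D w *\<^sub>R (u (x + w) - u x)^2)"
    by (rule nn_integral_eq_integral[OF iD]) simp
   then show "ennreal ((u x)^2*h^N) <= (\<integral>\<^sup>+w. ennreal (indicator D w *\<^sub>R (u (x + w) - u x)^2) \<partial>lborel)"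
    using pt[of x] by (simp add: ennreal_leI del: real_scaleR_def)
  qed
  also have "... = (\<integral>\<^sup>+w. \<integral>\<^sup>+x. ennreal (indicator D w *\<^sub>R (u (x + w) - u x)^2) \<partial>lborel \<partial>lborel)"
   by (rule lborel_pair.Fubini'[symmetric]) measurable
  also have "... <= (\<integral>\<^sup>+w. ennreal (real N*h^2*E)*indicator D w \<partial>lborel)"
  proof (rule nn_integral_mono)
   fix w :: 'a
   show "(\<integral>\<^sup>+x. ennreal (indicator D w *\<^sub>R (u (x + w) - u x)^2) \<partial>lborel) <= ennreal (real N*h^2*E)*indicator D w"
   proof (cases "w \<in> D")
    case True
    have c: "continuous_on UNIV (%x. (u (x + w) - u x)^2)" using cu'[of UNIV w] by (auto simp: add.commute intro!: continuous_intros cu)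
    have z: "(u (x + w) - u x)^2 = 0" if "1 + norm w <= norm x" for x
     using R[of x] R[of "x + w"] that norm_diff_ineq[of x w] norm_ge_zero[of w] by simp
    have "(\<integral>\<^sup>+x. ennreal ((u (x + w) - u x)^2) \<partial>lborel) = ennreal (LINT x|lborel. (u (x + w) - u x)^2)"
     by (rule nn_integral_eq_integral[OF compact_support_integrable[OF c z]]) auto
    also have "... <= ennreal (real N*h^2*E)"
     using order_trans[OF translation_L2_bound[OF u R, where w = w] mult_right_mono[OF nD[OF True] E[unfolded E_def]]]
     by (intro ennreal_leI) (simp add: E_def)
    finally show ?thesis using True by simp
   qed simp
  qed
  also have "... = ennreal (real N*h^2*E)*ennreal ((2*h)^N)"
  proof -
   have "emeasure lborel D = ennreal ((2*h)^N)"
   proof -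
    have "(\<Prod>i\<in>(Basis::'a set). (h *\<^sub>R One - - h *\<^sub>R One) \<bullet> i) = (\<Prod>i\<in>(Basis::'a set). 2*h)"
     by (intro prod.cong) (auto simp: inner_diff_left inner_add_left)
    then show ?thesis using h(1) by (simp add: D_def emeasure_lborel_cbox_eq N_def)
   qed
   then show ?thesis by (subst nn_integral_cmult_indicator) (simp_all add: D_def)
  qed
  finally have "(LINT x|lborel. (u x)^2)*h^N <= real N*h^2*E*(2*h)^N"
   using E h(1) by (simp add: ennreal_mult[symmetric])
  then have "(LINT x|lborel. (u x)^2) <= 2^N*real N*h^2*E" using h(1) by (simp add: power_mult_distrib field_simps)
  also have "... <= e*E" using he E by (intro mult_right_mono) auto
  finally show ?thesis by (simp add: E_def)
 qed
 show ?thesis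
  by (rule exI[of _ "Q ` J"]) (use main in "auto simp: J_def Q_def intro!: finite_PiE")
qed

section \<open>Hardy inequality with logarithmic remainder\<close>

text \<open>Truncating sin at zeros leaves corners; squaring smooths them, since near A and B the
  square is at most h^2 and its difference quotient tends to 0.\<close>

lemma sin_clamp_square_DERIV:
 assumes A: "A < B" "sin A = 0" "sin B = 0"
 shows "((%t. (sin (max A (min B t)))^2) hasD 2 * sin (max A (min B t))*cos (max A (min B t))) (at t)"
proof -
 let ?c = "%t. max A (min B t)"
 consider "t < A" | "B < t" | "A < t" "t < B" | "t = A | t = B" by linarith
 then show ?thesis
 proof cases
  case 1
  have "((%_. 0) hasD 0) (at t)" by simp
  then have "((%t. (sin (?c t))^2) hasD 0) (at t)"
   by (rule has_field_derivative_transform_within_open[of _ _ _ "{..<A}"]) (use A 1 in auto)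
  then show ?thesis using A 1 by simp
 next
  case 2
  have "((%_. 0) hasD 0) (at t)" by simp
  then have "((%t. (sin (?c t))^2) hasD 0) (at t)"
   by (rule has_field_derivative_transform_within_open[of _ _ _ "{B<..}"]) (use A 2 in auto)
  then show ?thesis using A 2 by simp
 next
  case 3
  have "((%t. (sin t)^2) hasD 2 * sin t*cos t) (at t)" by (auto intro!: derivative_eq_intros)
  then have "((%t. (sin (?c t))^2) hasD 2 * sin t*cos t) (at t)"
   by (rule has_field_derivative_transform_within_open[of _ _ _ "{A<..<B}"]) (use 3 in auto)
  then show ?thesis using 3 by simp
 next
  case 4
  then have ct: "?c t = t" "sin t = 0" using A by auto
  have b: "(sin (?c (t + h)))^2 <= h^2" for h
  proof -
   define d where "d = ?c (t + h) - t"
   have "abs d <= abs h" using 4 A unfolding d_def by (auto simp: max_def min_def)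
   moreover have "sin (?c (t + h)) = cos t * sin d" using ct(2) sin_add[of t d] by (simp add: d_def)
   moreover have "abs (cos t * sin d) <= 1*abs d" unfolding abs_mult by (intro mult_mono abs_sin_x_le_abs_x) auto
   ultimately show ?thesis by (simp add: abs_le_square_iff[symmetric])
  qed
  have "((%h. ((sin (?c (t + h)))^2 - (sin (?c t))^2)/h) ---> 0) (at 0)"
  proof (rule Lim_null_comparison)
   show "((%h::real. abs h) ---> 0) (at 0)" by (auto intro!: tendsto_eq_intros)
   have "norm (((sin (?c (t + h)))^2 - (sin (?c t))^2)/h) <= abs h" if "h ~= 0" for h
    using b[of h] that ct by (simp add: field_simps power2_eq_square)
   then show "\<forall>\<^sub>F h in at 0. norm (((sin (?c (t + h)))^2 - (sin (?c t))^2)/h) <= abs h"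
    by (auto simp: eventually_at intro!: exI[of _ 1])
  qed
  then show ?thesis using ct by (simp add: DERIV_def)
 qed
qed

lemma continuous_positive_integral:
 fixes g :: "'a::euclidean_space => real"
 assumes g: "continuous_on UNIV g" "integrable lborel g" "!!x. g x >= 0" "g x0 > 0"
 shows "(LINT x|lborel. g x) > 0"
proof -
 have "isCont g x0" using g(1) by (simp add: continuous_on_eq_continuous_at)
 then obtain d where d: "d > 0" "!!x. dist x0 x < d ==> dist (g x0) (g x) < g x0/2"
  using g(4) by (metis continuous_at_eps_delta dist_commute half_gt_zero)
 have "0 < measure lborel (ball x0 d)*(g x0/2)" using g(4) content_ball_pos[OF d(1), of x0] by simp
 also have "... = (LINT x|lborel. indicator (ball x0 d) x*(g x0/2))" by simp
 also have "... <= (LINT x|lborel. g x)"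
 proof (rule integral_mono[OF _ g(2)])
  show "integrable lborel (%x. indicator (ball x0 d) x*(g x0/2))"
   using emeasure_bounded_finite[OF bounded_ball, of x0 d] by (intro integrable_mult_left integrable_real_indicator) auto
  show "indicator (ball x0 d) x*(g x0/2) <= g x" for x
  proof (cases "dist x0 x < d")
   case True
   have "g x0 - g x < g x0/2" using d(2)[OF True] abs_ge_self[of "g x0 - g x"] unfolding dist_real_def by linarith
   then show ?thesis using True by simp
  qed (use g(3) in simp)
 qed
 finally show ?thesis .
qed

text \<open>A test function vanishing near 0 and near the sphere hides the singularity of the
  potential, so the energy density extends continuously by zero; this settles measurability and
  integrability.\<close>

lemma quadratic_form_annulus:
 fixes xi :: "'a::euclidean_space => real"
 assumes xi: "C1_grad xi Ph" and z: "de > 0" "!!x. norm x < de ==> xi x = 0" and R: "R < 1" "!!x. R <= norm x ==> xi x = 0"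
  and V: "!!x. 0 < norm x ==> norm x < 1 ==> v x = V (norm x)" and cV: "continuous_on {0<..<1} V"
 shows "integrable lborel (%x. (norm (Ph x))^2 - V (norm x)*(xi x)^2)"
  "(%x. indicator (ball 0 1) x *\<^sub>R ((norm (Ph x))^2 - v x*(xi x)^2)) \<in> borel_measurable lborel"
  "set_integrable lebesgue (ball 0 1) (%x. (norm (Ph x))^2 - v x*(xi x)^2)"
  "(LINT x:ball 0 1|lebesgue. (norm (Ph x))^2 - v x*(xi x)^2) = (LINT x|lborel. (norm (Ph x))^2 - V (norm x)*(xi x)^2)"
proof -
 let ?E = "%x. (norm (Ph x))^2 - V (norm x)*(xi x)^2"
 have cxi: "continuous_on S xi" "continuous_on S Ph" for S using C1_grad_cont[OF xi] by auto
 have z0: "Ph x = 0" if "norm x < de" for x by (rule C1_grad_eq_0[OF xi, of "ball 0 de"]) (use that z in auto)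
 have z1: "Ph x = 0" if "R < norm x" for x by (rule C1_grad_zero_outside[OF xi R(2) that])
 have o: "open {x::'a. R < norm x}" "open {x::'a. 0 < norm x & norm x < 1}" by (intro open_Collect_conj open_Collect_less continuous_intros)+
 have "continuous_on {x. 0 < norm x & norm x < 1} ?E"
  by (intro continuous_intros cxi continuous_on_compose2[OF cV]) auto
 moreover have "continuous_on (ball 0 de) ?E" "continuous_on {x. R < norm x} ?E"
  by (rule continuous_on_eq[of _ "%_. 0"]; use z R z0 z1 in auto)+
 ultimately have "continuous_on ((ball 0 de \<union> {x. 0 < norm x & norm x < 1}) \<union> {x. R < norm x}) ?E"
  by (intro continuous_on_open_Un open_Un o open_ball)
 moreover have "(ball 0 de \<union> {x. 0 < norm x & norm x < 1}) \<union> {x. R < norm x} = (UNIV :: 'a set)" using R(1) z(1) by auto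
 ultimately have cE: "continuous_on UNIV ?E" by simp
 then show int: "integrable lborel ?E" using z1 R by (intro compact_support_integrable[of _ 1]) auto
 have eq: "(%x. indicator (ball 0 1) x *\<^sub>R ((norm (Ph x))^2 - v x*(xi x)^2)) = ?E"
 proof
  fix x
  show "indicator (ball 0 1) x *\<^sub>R ((norm (Ph x))^2 - v x*(xi x)^2) = ?E x"
   using V[of x] z(1) z(2)[of x] R z1[of x] by (cases "x = 0"; cases "norm x < 1") auto
 qed
 show m: "(%x. indicator (ball 0 1) x *\<^sub>R ((norm (Ph x))^2 - v x*(xi x)^2)) \<in> borel_measurable lborel"
  unfolding eq using int by (rule borel_measurable_integrable)
 show "set_integrable lebesgue (ball 0 1) (%x. (norm (Ph x))^2 - v x*(xi x)^2)"
  "(LINT x:ball 0 1|lebesgue. (norm (Ph x))^2 - v x*(xi x)^2) = (LINT x|lborel. ?E x)"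
  using set_lebesgue_borel[OF m] int unfolding eq by auto
qed

text \<open>Test functions \<open>r\<^sup>-\<^sup>a sqrt \<ell> sin^2 th\<close> with \<open>a = (N - 2) / 2\<close>, \<open>\<ell> = 1 - ln r\<close> and
 \<open>th = ep ln \<ell>\<close> running over one interval between zeros of the sine. Squaring the sine makes them \<open>C\<^sup>1\<close>; the
 loss is compensated by the exact derivative \<open>m'\<close> in the identity for the energy density.\<close>

lemma morse_index_infinite_radial:
 fixes u :: "'a::euclidean_space => real"
 assumes V: "!!x::'a. 0 < norm x ==> norm x < 1 ==> l*deriv_on {0..} f (u x) = V (norm x)"
  and cV: "continuous_on {0<..<1} V" and de: "de > 0"
  and low: "\<forall>\<^sub>F r in at_right 0. ((real DIM('a) - 2)^2/4 + (1/4 + de)/(1 - ln r)^2)/r^2 <= V r"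
 shows "morse_index f l u = \<infinity>"
proof -
 define N where "N = real DIM('a)"
 define a where "a = (N - 2)/2"
 \<comment> \<open>The Rayleigh quotient of sin^2 is 4/3, against 1 for sin, so the frequency
   \<open>ep\<close> costs 4/3*ep^2 = de/3 and leaves 2*de/3 for strict negativity.\<close>
 define ep where "ep = sqrt de/2"
 have e: "ep > 0" "4/3*ep^2 = de/3" using de by (auto simp: ep_def power_divide)
 have a2: "(N - 2)^2/4 = a^2" by (simp add: a_def power_divide)
 obtain r1 where r1: "r1 > 0" "!!r. 0 < r ==> r < r1 ==> (a^2 + (1/4 + de)/(1 - ln r)^2)/r^2 <= V r"
  using low unfolding a2[symmetric] N_def[symmetric] by (auto simp: eventually_at_right_field)
 define r0 where "r0 = min r1 (1/2)"
 have r0: "0 < r0" "r0 < 1" "r0 <= r1" using r1 by (auto simp: r0_def)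
 define L where "L r = 1 - ln r" for r :: real
 define th where "th r = ep*ln (L r)" for r
 have L1: "L r > 1" if "0 < r" "r < 1" for r using that by (simp add: L_def)
 have thmono: "th r <= th r'" if "0 < r'" "r' <= r" "r < 1" for r r'
 proof -
  have "ln r' <= ln r" using that by (subst ln_le_cancel_iff) auto
  then have "L r <= L r'" by (simp add: L_def)
  moreover have "0 < r" "r' < 1" using that by linarith+
  ultimately have "L r <= L r'" "0 < L r" "0 < L r'" using that L1[of r] L1[of r'] by linarith+
  then have "ln (L r) <= ln (L r')" by simp
  then show ?thesis unfolding th_def using e by (intro mult_left_mono) auto
 qed
 \<comment> \<open>Only intervals beyond th r0 are used, which keeps the supports inside r <
   r0.\<close>
 obtain j0 :: nat where j0: "th r0 < pi*real j0" using reals_Archimedean3[OF pi_gt_zero] by (metis mult.commute)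
 define A where "A j = pi*real (j0 + j)" for j
 define B where "B j = pi*real (Suc (j0 + j))" for j
 have AB: "A j < B j" "sin (A j) = 0" "sin (B j) = 0" "B j = A j + pi" for j
  using sin_npi[of "j0 + j"] sin_npi[of "Suc (j0 + j)"] by (simp_all add: A_def B_def mult.commute algebra_simps del: sin_npi)
 have A0: "th r0 < A j" for j
 proof -
  have "pi*real j0 <= A j" unfolding A_def by (intro mult_left_mono) auto
  then show ?thesis using j0 by linarith
 qed
 define c where "c j r = max (A j) (min (B j) (th r))" for j r
 define s where "s j r = (if r < r0 then (sin (c j r))^2 else 0)" for j r
 define s1 where "s1 j r = (if r < r0 then 2 * sin (c j r)*cos (c j r) else 0)" for j r
 have c0: "c j r = A j" if "r0 <= r" "r < 1" for j r
  using thmono[of r0 r] A0[of j] AB(1)[of j] that r0 by (auto simp: c_def)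
 have sc: "s j r = (sin (c j r))^2" "s1 j r = 2 * sin (c j r)*cos (c j r)" if "r < 1" for j r
  using c0[of r j] that AB by (auto simp: s_def s1_def)
 have act: "A j < th r" "th r < B j" "r < r0" if "s j r ~= 0 | s1 j r ~= 0" for j r
 proof -
  have "sin (c j r) ~= 0" "r < r0" using that by (auto simp: s_def s1_def split: if_splits)
  then have "c j r ~= A j" "c j r ~= B j" "r < r0" using AB(2,3)[of j] by auto
  then show "A j < th r" "th r < B j" "r < r0" using AB(1)[of j] by (auto simp: c_def max_def min_def split: if_splits)
 qed
 have cases: "s j r = 0 & s1 j r = 0 | s j r = (sin (th r))^2 & s1 j r = 2 * sin (th r)*cos (th r)" for j r
 proof (cases "s j r = 0 & s1 j r = 0")
  case False
  then have "A j < th r" "th r < B j" "r < r0" using act[of j r] by auto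
  then show ?thesis by (simp add: s_def s1_def c_def)
 qed simp
 have dL: "(L hasD - 1/r) (at r)" if "0 < r" for r
  unfolding L_def[abs_def] using that by (auto intro!: derivative_eq_intros)
 have dth: "(th hasD - ep/(r*L r)) (at r)" if "0 < r" "r < 1" for r
  unfolding th_def[abs_def] using that L1[OF that] by (auto intro!: derivative_eq_intros dL simp: field_simps)
 have ds: "(s j hasD s1 j r*(- ep/(r*L r))) (at r)" if r: "0 < r" "r < 1" for j r
 proof -
  have "((%r. (sin (c j r))^2) hasD s1 j r*(- ep/(r*L r))) (at r)"
   unfolding sc(2)[OF r(2)] unfolding c_def
   by (rule DERIV_chain2[where f = "%t. (sin (max (A j) (min (B j) t)))^2" and g = th, OF sin_clamp_square_DERIV[OF AB(1-3)] dth[OF r]])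
  then show ?thesis by (rule has_field_derivative_transform_within_open[of _ _ _ "{..<1}"]) (use r sc in auto)
 qed
 have cL: "continuous_on {0<..<1} L" unfolding L_def[abs_def] by (intro continuous_intros) auto
 have cth: "continuous_on {0<..<1} th" unfolding th_def[abs_def] using L1 by (intro continuous_intros cL) force
 have cs: "continuous_on {0<..<1} (s j)" "continuous_on {0<..<1} (s1 j)" for j
 proof -
  have "continuous_on {0<..<1} (%r. (sin (c j r))^2)" "continuous_on {0<..<1} (%r. 2 * sin (c j r)*cos (c j r))"
   unfolding c_def by (intro continuous_intros cth)+
  then show "continuous_on {0<..<1} (s j)" "continuous_on {0<..<1} (s1 j)" using sc
   by (simp_all cong: continuous_on_cong_simp)
 qed
 \<comment> \<open>For 0 < r < d j the phase \<open>th r\<close> is beyond \<open>B j\<close>, so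
   the support stays away from the origin.\<close>
 define d where "d j = exp (1 - exp (B j/ep))" for j
 have near0: "s j r = 0 & s1 j r = 0" if "0 <= r" "r < d j" for j r
 proof (rule ccontr)
  assume "~ (s j r = 0 & s1 j r = 0)"
  then have t: "A j < th r" "th r < B j" "r < r0" using act[of j r] by auto
  \<comment> \<open>As ln 0 = 0, the phase at r = 0 is 0 and does not exceed A j >= 0.\<close>
  have "r ~= 0"
  proof
   assume "r = 0"
   then have "th r = 0" by (simp add: th_def L_def)
   moreover have "A j >= 0" unfolding A_def by (intro mult_nonneg_nonneg) auto
   ultimately show False using t(1) by simp
  qed
  then have "ln r < ln (d j)" using that by (subst ln_less_cancel_iff) (auto simp: d_def)
  then have "exp (B j/ep) < L r" by (simp add: d_def L_def)
  then have "ln (exp (B j/ep)) < ln (L r)" using less_trans[OF exp_gt_zero] by (subst ln_less_cancel_iff) auto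
  then show False using t(2) e by (simp add: th_def field_simps)
 qed
 have far: "s j r = 0" "s1 j r = 0" if "r0 <= r" for j r using that by (auto simp: s_def s1_def)
 define g where "g j r = r powr (- a) * sqrt (L r) * s j r" for j r
 define g1 where "g1 j r = r powr (- a - 1)*(- (a * sqrt (L r) + 1/(2 * sqrt (L r))) * s j r - ep/sqrt (L r) * s1 j r)" for j r
 \<comment> \<open>r powr (1 - N)*m1 is the divergence by which g1^2 differs from the Hardy
   potential times g^2. The term with sin*cos accounts for the identity that replaces the squared
   derivative of sin^2 by 4/3*sin^4 up to a derivative.\<close>
 define m where "m j r = - (a*L r + 1/2)*(s j r)^2 - 4/3*ep*(s j r*(sin (th r)*cos (th r)))" for j r
 define m1 where "m1 j r = 1/r*(a*(s j r)^2 + (a*L r + 1/2)*2 * s j r * s1 j r*ep/L r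
   + 4/3*(ep^2/L r)*(s1 j r * sin (th r)*cos (th r) + s j r*((cos (th r))^2 - (sin (th r))^2)))" for j r
 have dg: "(g j hasD g1 j r) (at r)" if r: "0 < r" "r < 1" for j r
 proof -
  have P: "r powr (- a) = r powr (- a - 1)*r" using r powr_add[of r "- a - 1" 1] by simp
  define X where "X = sqrt (L r)"
  have X: "X > 0" "L r = X^2" using L1[OF r] by (auto simp: X_def)
  define p where "p = r powr (- a - 1)"
  have "((%r. sqrt (L r)) hasD inverse (sqrt (L r))/2*(- 1/r)) (at r)"
   using L1[OF r] by (intro DERIV_chain2[OF DERIV_real_sqrt dL[OF r(1)]]) auto
  moreover have "((%r. r powr (- a)) hasD - a*r powr (- a - 1)) (at r)" using r by (auto intro!: derivative_eq_intros)
  ultimately have "(g j hasD (- a*r powr (- a - 1) * sqrt (L r) + inverse (sqrt (L r))/2*(- 1/r)*r powr (- a)) * s j r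
    + s1 j r*(- ep/(r*L r))*(r powr (- a) * sqrt (L r))) (at r)"
   unfolding g_def[abs_def] by (intro DERIV_mult ds r)
  moreover have "(- a*p*X + inverse X/2*(- 1/r)*(p*r)) * s j r + s1 j r*(- ep/(r*X^2))*(p*r*X)
    = p*(- (a*X + 1/(2*X)) * s j r - ep/X * s1 j r)" using X(1) r by (simp add: field_simps power2_eq_square)
  ultimately show ?thesis unfolding g1_def P X_def[symmetric] p_def[symmetric] X(2)[symmetric] by simp
 qed
 have dm: "(m j hasD m1 j r) (at r)" if r: "0 < r" "r < 1" for j r
  unfolding m_def[abs_def] m1_def
  by (rule derivative_eq_intros dL[OF r(1)] ds[OF r] dth[OF r] refl | use L1[OF r] r in "simp add: field_simps power2_eq_square")+
 have cg: "continuous_on {0<..<1} (g1 j)" "continuous_on {0<..<1} (m1 j)" for j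
  unfolding g1_def[abs_def] m1_def[abs_def] using L1 by (intro continuous_intros cs cL cth; force)+
 define xi where "xi j x = g j (norm x)" for j and x :: 'a
 define Ph where "Ph j x = (g1 j (norm x)/norm x) *\<^sub>R x" for j and x :: 'a
 have dpos: "d j > 0" for j by (simp add: d_def)
 have C: "C1_grad (xi j) (Ph j)" for j unfolding xi_def[abs_def] Ph_def[abs_def]
  by (rule C1_grad_radial_compact[OF dg cg(1) dpos[of j] _ r0(2)]) (use near0 far in "auto simp: g_def g1_def")
 have M: "C1_grad (%x::'a. m j (norm x)) (%x. (m1 j (norm x)/norm x) *\<^sub>R x)" for j
  by (rule C1_grad_radial_compact[OF dm cg(2) dpos[of j] _ r0(2)]) (use near0 far in "auto simp: m_def m1_def")
 have xi0: "xi j x = 0" if "norm x < d j" for j x using near0[of "norm x" j] that by (simp add: xi_def g_def)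
 have xi1: "xi j x = 0" if "r0 <= norm x" for j x using far that by (simp add: xi_def g_def)
 have ident: "(g1 j r)^2 = r powr (1 - N)*m1 j r + (g j r)^2/r^2*(a^2 + (1/4 + de/3)/(L r)^2)" if r: "0 < r" "r < 1" for j r
 proof -
  define X where "X = sqrt (L r)"
  have X: "X > 0" "L r = X^2" using L1[OF r] by (auto simp: X_def)
  define p where "p = r powr (- a - 1)"
  have N2: "1 - N = (- a - 1) + (- a - 1) + 1" by (simp add: a_def)
  have p: "r powr (- a) = p*r" "r powr (1 - N) = p^2*r"
  proof -
   show "r powr (- a) = p*r" using r powr_add[of r "- a - 1" 1] by (simp add: p_def)
   show "r powr (1 - N) = p^2*r" unfolding N2 powr_add p_def using r by (simp add: power2_eq_square)
  qed
  have "((a*X + 1/(2*X))*S + ep/X*S1)^2 = a*S^2 + (a*X^2 + 1/2)*2*S*S1*ep/X^2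
   + 4/3*(ep^2/X^2)*(S1 * sg*ta + S*(ta^2 - sg^2)) + (X*S)^2*(a^2 + (1/4 + 4/3*ep^2)/(X^2)^2)"
   if "S = 0 & S1 = 0 | S = sg^2 & S1 = 2 * sg*ta" for S S1 sg ta
  proof -
   have key: "3*S1^2 = 4*(S1 * sg*ta + S*(ta^2 - sg^2)) + 4*S^2" using that by (auto simp: power2_eq_square algebra_simps)
   define T where "T = S1 * sg*ta + S*(ta^2 - sg^2)"
   have "3*S1^2 = 4*T + 4*S^2" using key by (simp only: T_def)
   then have T: "S1 * sg*ta + S*(ta^2 - sg^2) = 3/4*S1^2 - S^2" unfolding T_def[symmetric] by linarith
   show ?thesis unfolding T using X(1) by (simp add: field_simps power2_eq_square)
  qed
  from this[OF cases[of j r]] have I: "((a*X + 1/(2*X)) * s j r + ep/X * s1 j r)^2 = r*m1 j r + (X * s j r)^2*(a^2 + (1/4 + de/3)/(L r)^2)"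
   unfolding e(2) m1_def X(2) using r by simp
  have "(g1 j r)^2 = p^2*((a*X + 1/(2*X)) * s j r + ep/X * s1 j r)^2"
  proof -
   have "g1 j r = - (p*((a*X + 1/(2*X)) * s j r + ep/X * s1 j r))"
    unfolding g1_def X_def[symmetric] p_def[symmetric] by (simp add: algebra_simps)
   then show ?thesis by (simp add: power_mult_distrib)
  qed
  also have "... = p^2*r*m1 j r + (p*r*X * s j r)^2/r^2*(a^2 + (1/4 + de/3)/(L r)^2)"
   unfolding I using r by (simp add: algebra_simps power_mult_distrib)
  finally show ?thesis unfolding g_def p X_def[symmetric] by simp
 qed
 \<comment> \<open>On the support L r <= exp (B j/ep), so the spare 2*de/3/(L r)^2 is at least this
   constant.\<close>
 define ka where "ka j = 2*de/3/(exp (B j/ep))^2" for j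
 let ?m = "%j (x::'a). norm x powr (1 - N)/norm x*(((m1 j (norm x)/norm x) *\<^sub>R x) \<bullet> x) + m j (norm x)*((1 - N)*norm x powr (- N) + (real DIM('a) - 1)*norm x powr (1 - N)/norm x)"
 have div: "integrable lborel (?m j)" "(LINT x|lborel. ?m j x) = 0" for j
 proof -
  have bc: "continuous_on {0<..<1} (%r. (1 - N)*r powr (- N))" by (intro continuous_intros) auto
  have b: "((%r. r powr (1 - N)) hasD (1 - N)*r powr (- N)) (at r)" if "0 < r" for r
   using that by (auto intro!: derivative_eq_intros)
  have m0: "m j (norm x) = 0" if "norm x < d j" for x :: 'a using near0[of "norm x" j] that by (simp add: m_def)
  have m2: "m j (norm x) = 0" if "r0 <= norm x" for x :: 'a using far that by (simp add: m_def)
  show "integrable lborel (?m j)" "(LINT x|lborel. ?m j x) = 0"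
   using radial_divergence[OF M[of j] dpos[of j] m0 r0(2) m2 b bc] by auto
 qed
 have pt: "(norm (Ph j x))^2 - V (norm x)*(xi j x)^2 <= ?m j x - ka j*(xi j x)^2" for j x
 proof (cases "x = 0 | r0 <= norm x")
  case True
  then have "s j (norm x) = 0" "s1 j (norm x) = 0" using near0[of "norm x" j] far[of "norm x" j] dpos[of j] by auto
  then show ?thesis by (simp add: Ph_def xi_def g_def g1_def m_def m1_def)
 next
  case False
  define r where "r = norm x"
  have r: "0 < r" "r < r0" "r < 1" using False r0 by (auto simp: r_def)
  have xx: "x \<bullet> x = r*r" by (simp add: r_def dot_square_norm power2_eq_square)
  have m: "?m j x = r powr (1 - N)*m1 j r"
  proof -
   have "r powr (- N) = r powr (1 - N)/r" using r powr_add[of r "- N" 1] by (simp add: field_simps)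
   then show ?thesis using r unfolding r_def[symmetric] inner_scaleR_left xx by (simp add: N_def field_simps)
  qed
  have "ka j*(g j r)^2 <= (g j r)^2/r^2*(2*de/3/(L r)^2)"
  proof (cases "s j r = 0")
   case False
   have "L r <= exp (B j/ep)"
   proof -
    have "ln (L r) < B j/ep" using act(2)[of j r] False e by (simp add: th_def field_simps)
    then have "exp (ln (L r)) < exp (B j/ep)" by simp
    then show ?thesis using L1[OF r(1,3)] by simp
   qed
   then have "ka j <= 2*de/3/(L r)^2" unfolding ka_def using de L1[OF r(1,3)]
    by (intro divide_left_mono power_mono mult_pos_pos) auto
   also have "... <= 1/r^2*(2*de/3/(L r)^2)"
    using mult_right_mono[of 1 "1/r^2" "2*de/3/(L r)^2"] r de by (simp add: power_le_one)
   finally have "(g j r)^2*ka j <= (g j r)^2*(1/r^2*(2*de/3/(L r)^2))" by (intro mult_left_mono) auto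
   then show ?thesis by (simp add: mult.commute)
  qed (simp add: g_def)
  moreover have "(g j r)^2*((a^2 + (1/4 + de)/(L r)^2)/r^2) <= (g j r)^2*V r"
   using r1(2)[of r] r r0 by (intro mult_left_mono) (auto simp: L_def)
  moreover have "(g j r)^2*((a^2 + (1/4 + de)/(L r)^2)/r^2) = (g j r)^2/r^2*(a^2 + (1/4 + de/3)/(L r)^2) + (g j r)^2/r^2*(2*de/3/(L r)^2)"
  proof -
   have gen: "G*((A + P)/R) = G/R*(A + P1) + G/R*Q" if "P = P1 + Q" for G A P P1 Q R :: real
    using that by (simp add: add_divide_distrib algebra_simps)
   have "(1/4 + de)/(L r)^2 = (1/4 + de/3)/(L r)^2 + 2*de/3/(L r)^2" by (subst add_divide_distrib[symmetric]) simp
   then show ?thesis by (rule gen)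
  qed
  ultimately have "(g1 j r)^2 - V r*(g j r)^2 <= r powr (1 - N)*m1 j r - ka j*(g j r)^2"
   using ident[OF r(1,3), of j] by (simp add: mult.commute[of "V r"])
  moreover have "(norm (Ph j x))^2 = (g1 j r)^2" using False by (simp add: Ph_def r_def power_divide power_mult_distrib)
  ultimately show ?thesis unfolding m by (simp add: xi_def r_def)
 qed
 have nz: "EX x. xi j x ~= 0" for j
 proof -
  define t where "t = A j + pi/2"
  define r where "r = exp (1 - exp (t/ep))"
  have t: "A j < t" "t < B j" "t > 0" using AB(4)[of j] pi_gt_zero by (auto simp: t_def A_def intro!: add_nonneg_pos)
  have rt: "th r = t" using e by (simp add: th_def L_def r_def)
  have r: "0 < r" "r < 1" using t e by (auto simp: r_def)
  then have "r < r0" using thmono[of r0 r] A0[of j] t rt r0 by linarith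
  moreover have "sin t ~= 0"
  proof -
   have "sin t = cos (A j)" by (simp add: t_def sin_add AB(2))
   moreover have "(cos (A j))^2 = 1" using sin_cos_squared_add[of "A j"] AB(2)[of j] by simp
   ultimately show ?thesis by auto
  qed
  ultimately have "g j r ~= 0" using r L1[OF r] t rt by (auto simp: g_def s_def c_def)
  moreover obtain b :: 'a where "b \<in> Basis" using nonempty_Basis by blast
  ultimately show ?thesis using r by (intro exI[of _ "r *\<^sub>R b"]) (simp add: xi_def)
 qed
 have same: "i = j" if "A i < t" "t < B i" "A j < t" "t < B j" for i j t
 proof -
  have "pi*real (j0 + i) < pi*real (Suc (j0 + j))" "pi*real (j0 + j) < pi*real (Suc (j0 + i))"
   using that unfolding A_def B_def by linarith+
  then show ?thesis by (simp add: mult_less_cancel_left_pos)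
 qed
 show ?thesis
 proof (rule morse_index_infinite[OF C _ _ _ _ _ nz])
  show "EX rh<1. ALL x. rh <= norm x --> xi n x = 0" for n using xi1 r0 by blast
  show "xi i x = 0 | xi j x = 0" "Ph i x = 0 | Ph j x = 0" if "i ~= j" for i j x
  proof -
   have "(s i (norm x) = 0 & s1 i (norm x) = 0) | (s j (norm x) = 0 & s1 j (norm x) = 0)"
    using same[of i "th (norm x)" j] act[of i "norm x"] act[of j "norm x"] that by blast
   then show "xi i x = 0 | xi j x = 0" "Ph i x = 0 | Ph j x = 0" by (auto simp: xi_def Ph_def g_def g1_def)
  qed
  fix j
  note Q = quadratic_form_annulus[where v = "%x. l*deriv_on {0..} f (u x)", OF C[of j] dpos[of j] xi0 r0(2) xi1 _ cV, OF _ _ V, simplified]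
  show "set_integrable lebesgue (ball 0 1) (%x. (norm (Ph j x))^2 - l*deriv_on {0..} f (u x)*(xi j x)^2)" using Q(3) by simp
  have ixi: "integrable lborel (%x. (xi j x)^2)" and cxi: "continuous_on UNIV (%x. (xi j x)^2)"
   using xi1[of _ j] by (auto intro!: compact_support_integrable[of _ r0] continuous_intros C1_grad_cont[OF C])
  obtain x0 where "xi j x0 ~= 0" using nz by blast
  then have pos: "(LINT x|lborel. (xi j x)^2) > 0" by (intro continuous_positive_integral[OF cxi ixi]) auto
  have "(LINT x|lborel. (norm (Ph j x))^2 - V (norm x)*(xi j x)^2) <= (LINT x|lborel. ?m j x - ka j*(xi j x)^2)"
   by (rule integral_mono[OF Q(1) _ pt]) (intro Bochner_Integration.integrable_diff div integrable_mult_right ixi)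
  also have "... = - (ka j*(LINT x|lborel. (xi j x)^2))"
   by (subst Bochner_Integration.integral_diff[OF div(1) integrable_mult_right[OF ixi]]) (simp only: div(2) integral_mult_right_zero diff_0)
  also have "... < 0" using pos de by (simp add: ka_def)
  finally show "(LINT x:ball 0 1|lebesgue. (norm (Ph j x))^2 - l*deriv_on {0..} f (u x)*(xi j x)^2) < 0" using Q(4) by simp
 qed
qed

lemma norm_diff_scaleR_square: "(norm (p - c *\<^sub>R x))^2 = (norm p)^2 - 2*c*(p \<bullet> x) + c^2*(x \<bullet> (x::'a::real_inner))"
 unfolding power2_norm_eq_inner by (simp add: inner_diff_left inner_diff_right inner_commute[of x p] power2_eq_square) (simp add: algebra_simps)

lemma norm_add_square_le: "(norm (p + q))^2 <= 2*(norm p)^2 + 2*(norm (q::'a::real_inner))^2"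
proof -
 have "(norm (p + q))^2 + (norm (p - q))^2 = 2*(norm p)^2 + 2*(norm q)^2"
  by (simp add: power2_norm_eq_inner inner_add_left inner_add_right inner_diff_left inner_diff_right)
 then show ?thesis using zero_le_power2[of "norm (p - q)"] by linarith
qed

text \<open>With \<open>b = - (a + 1 / (2 \<ell>)) / r\<close> and \<open>B = b(r) x / r\<close> one has \<open>- (div B + |B|^2) = (a^2 + 1 / (4 \<ell>^2)) / r^2\<close>, so
 \<open>|\<nabla>xi|^2 - V xi^2\<close> is \<open>|\<nabla>xi - xi B|^2\<close> plus a term that is nonnegative near the origin, up to a divergence.
 Away from the origin the Poincare inequality on small cubes absorbs the remaining terms.\<close>

lemma morse_index_finite_radial:
 fixes u :: "'a::euclidean_space => real"
 assumes N3: "DIM('a) >= 3" and V: "!!x::'a. 0 < norm x ==> norm x < 1 ==> l*deriv_on {0..} f (u x) = V (norm x)"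
  and cV: "continuous_on {0<..<1} V" and VK: "!!r. 0 < r ==> r < 1 ==> abs (V r) <= K/r^2" and be: "be < 1/4"
  and up: "\<forall>\<^sub>F r in at_right 0. V r <= ((real DIM('a) - 2)^2/4 + be/(1 - ln r)^2)/r^2"
 shows "morse_index f l u < \<infinity>"
proof -
 define N where "N = real DIM('a)"
 define a where "a = (N - 2)/2"
 have a: "a > 0" "N - 1 = 2*a + 1" "(N - 2)^2/4 = a^2"
  using N3 by (simp add: a_def N_def, simp add: a_def field_simps, simp add: a_def power_divide)
 obtain r1 where r1: "r1 > 0" "!!r. 0 < r ==> r < r1 ==> V r <= (a^2 + be/(1 - ln r)^2)/r^2"
  using up unfolding a(3)[symmetric] N_def[symmetric] by (auto simp: eventually_at_right_field)
 define r0 where "r0 = min r1 (1/2)"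
 have r0: "0 < r0" "r0 < 1" "r0 <= r1" using r1 by (auto simp: r0_def)
 have "0 <= K/r0^2" using VK[of r0] r0 abs_ge_zero[of "V r0"] by linarith
 then have K: "K >= 0" using r0 by (simp add: zero_le_divide_iff)
 define L where "L r = 1 - ln r" for r :: real
 have L1: "L r > 1" if "0 < r" "r < 1" for r using that by (simp add: L_def)
 have dL: "(L hasD - 1/r) (at r)" if "0 < r" for r
  unfolding L_def[abs_def] using that by (auto intro!: derivative_eq_intros)
 have cL: "continuous_on {0<..<1} L" unfolding L_def[abs_def] by (intro continuous_intros) auto
 \<comment> \<open>Logarithmic derivative of r powr (- a)*sqrt (L r), the function for which the
   Hardy inequality with logarithmic remainder is sharp.\<close>
 define b where "b r = - (a + 1/(2*L r))/r" for r
 define b1 where "b1 r = (a + 1/(2*L r) - 1/(2*(L r)^2))/r^2" for r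
 have db: "(b hasD b1 r) (at r)" if r: "0 < r" "r < 1" for r
  unfolding b_def[abs_def] b1_def
  by (rule derivative_eq_intros dL[OF r(1)] refl | use L1[OF r] r in "simp add: field_simps power2_eq_square")+
 have cb: "continuous_on {0<..<1} b1" unfolding b1_def[abs_def] using L1 by (intro continuous_intros cL) force+
 define P where "P r = (a^2 + 1/(4*(L r)^2))/r^2" for r
 have P: "b1 r + (N - 1)*b r/r = - P r - (b r)^2" if r: "0 < r" "r < 1" for r
  unfolding P_def b_def b1_def a(2) using L1[OF r] r by (simp add: field_simps power2_eq_square)
 \<comment> \<open>Near the origin P - V >= 0 is enough. The cutoff confines the Poincare argument
   to |x| >= r0/2, where \<open>b\<close> is bounded.\<close>
 define ze where "ze x = smooth_step (2/r0*norm x)" for x :: 'a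
 define ze1 where "ze1 x = (2/r0 * smooth_step1 (2/r0*norm x)/norm x) *\<^sub>R x" for x :: 'a
 have ze: "C1_grad ze ze1" unfolding ze_def[abs_def] ze1_def[abs_def] by (rule C1_grad_cutoff) (use r0 in simp)
 have ze0: "ze x = 0" "ze1 x = 0" if "norm x <= r0/2" for x using that r0 by (simp_all add: ze_def ze1_def smooth_step_eq field_simps)
 have ze2: "ze x = 1" "ze1 x = 0" if "r0 <= norm x" for x using that r0 by (simp_all add: ze_def ze1_def smooth_step_eq field_simps)
 have zeb: "0 <= ze x" "ze x <= 1" "norm (ze1 x) <= 4/r0" for x
 proof -
  show "0 <= ze x" "ze x <= 1" by (auto simp: ze_def smooth_step_bounds)
  have "2/r0 * smooth_step1 (2/r0*norm x) <= 2/r0*2" using r0 smooth_step1_bounds by (intro mult_left_mono) auto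
  then show "norm (ze1 x) <= 4/r0" using smooth_step1_bounds r0 by (simp add: ze1_def)
 qed
 define k1 where "k1 = (2*a + 1)/r0 + 4/r0"
 have k1: "k1 > 0" using a r0 by (auto simp: k1_def intro!: add_pos_pos divide_pos_pos)
 define c0 where "c0 = (1/4 - be)/(L (r0/2))^2"
 have Lr: "L (r0/2) > 1" using L1[of "r0/2"] r0 by simp
 have c0: "c0 > 0" using be Lr by (simp add: c0_def)
 \<comment> \<open>A fraction \<open>th\<close> of the completed square is converted into the
   gradient of ze*xi; the by-product th*k1^2*t^2 must be covered by P - V >= c0 on r0/2 <= r <
   r0.\<close>
 define th where "th = min 1 (c0/k1^2)"
 have th: "th > 0" "th <= 1" "th*k1^2 <= c0"
 proof -
  show "th > 0" "th <= 1" using c0 k1 by (auto simp: th_def)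
  have "th <= c0/k1^2" by (simp add: th_def)
  then show "th*k1^2 <= c0" using k1 by (simp add: pos_le_divide_eq)
 qed
 \<comment> \<open>For r >= r0 the difference P - V has no sign, and \<open>C\<close> pays for both
   it and the by-product; the Poincare constant th/(2*C) is chosen to return this debt.\<close>
 define C where "C = th*k1^2 + K/r0^2"
 have C: "C > 0" using th k1 K by (simp add: C_def add_pos_nonneg)
 have W: "P r - V r >= 0" "r0/2 <= r ==> P r - V r >= c0" if r: "0 < r" "r < r0" for r
 proof -
  have rr: "r < 1" using r r0 by simp
  have w: "(1/4 - be)/(L r)^2/r^2 <= P r - V r"
  proof -
   have "P r - (a^2 + be/(L r)^2)/r^2 = (1/4 - be)/(L r)^2/r^2" 
   proof -
    have "1/(4*Y) - be/Y = (1/4 - be)/Y" for Y :: real by (simp add: diff_divide_distrib)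
    then show ?thesis unfolding P_def by (simp add: diff_divide_distrib[symmetric])
   qed
   then show ?thesis using r1(2)[of r] r r0 by (simp add: L_def)
  qed
  moreover have nn: "(1/4 - be)/(L r)^2 >= 0" using be by simp
  moreover have "(1/4 - be)/(L r)^2/r^2 >= 0" by (rule divide_nonneg_nonneg[OF nn]) simp
  ultimately show "P r - V r >= 0" by linarith
  assume r2: "r0/2 <= r"
  have "L r <= L (r0/2)" using r2 r0 by (simp add: L_def)
  then have "c0 <= (1/4 - be)/(L r)^2" unfolding c0_def using be L1[OF r(1) rr] by (intro divide_left_mono power_mono mult_pos_pos) auto
  also have "... <= 1/r^2*((1/4 - be)/(L r)^2)" using mult_right_mono[OF _ nn, of 1 "1/r^2"] r rr by (simp add: power_le_one)
  finally show "P r - V r >= c0" using w by (simp add: mult.commute)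
 qed
 have pt: "th/2*(norm (ze x *\<^sub>R Xi + t *\<^sub>R ze1 x))^2 - C*(ze x*t)^2 <= (norm (Xi - (t*b (norm x)/norm x) *\<^sub>R x))^2 + (P (norm x) - V (norm x))*t^2"
  if x: "0 < norm x" "norm x < 1" for x Xi and t :: real
 proof (cases "norm x < r0/2")
  case True
  then show ?thesis using ze0[of x] W(1)[of "norm x"] x r0 by simp
 next
  case False
  define r where "r = norm x"
  define Z where "Z = Xi - (t*b r/r) *\<^sub>R x"
  define Y where "Y = (ze x*b r/r) *\<^sub>R x + ze1 x"
  have r: "r0/2 <= r" "0 < r" "r < 1" using False x by (auto simp: r_def)
  have "norm Y <= k1"
  proof -
   have "a + 1/(2*L r) <= a + 1/2" "0 <= a + 1/(2*L r)" using L1[OF r(2,3)] a(1) by (simp_all add: field_simps)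
   then have "abs (b r) <= (a + 1/2)/r" unfolding b_def using r by (simp add: divide_right_mono)
   also have "... <= (a + 1/2)/(r0/2)" using r r0 a by (intro divide_left_mono) auto
   finally have "abs (b r) <= (2*a + 1)/r0" using r0 by (simp add: field_simps)
   then have "ze x*abs (b r) <= 1*((2*a + 1)/r0)" using zeb[of x] by (intro mult_mono) auto
   moreover have "norm ((ze x*b r/r) *\<^sub>R x) = ze x*abs (b r)" using r zeb[of x] by (simp add: r_def abs_mult)
   ultimately show ?thesis unfolding Y_def k1_def using norm_triangle_ineq[of "(ze x*b r/r) *\<^sub>R x" "ze1 x"] zeb(3)[of x] by linarith
  qed
  then have Y: "(norm Y)^2 <= k1^2" by (intro power_mono) auto
  have "(ze x)^2*(norm Z)^2 <= 1*(norm Z)^2" using zeb[of x] by (intro mult_right_mono) (auto simp: power_le_one)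
  moreover have "t^2*(norm Y)^2 <= t^2*k1^2" using Y by (intro mult_left_mono) auto
  moreover have "(norm (ze x *\<^sub>R Z + t *\<^sub>R Y))^2 <= 2*((ze x)^2*(norm Z)^2) + 2*(t^2*(norm Y)^2)"
   using norm_add_square_le[of "ze x *\<^sub>R Z" "t *\<^sub>R Y"] by (simp add: power_mult_distrib)
  ultimately have "(norm (ze x *\<^sub>R Z + t *\<^sub>R Y))^2 <= 2*(norm Z)^2 + 2*(t^2*k1^2)" by linarith
  then have "th/2*(norm (ze x *\<^sub>R Z + t *\<^sub>R Y))^2 <= th/2*(2*(norm Z)^2 + 2*(t^2*k1^2))" using th by (intro mult_left_mono) auto
  also have "... = th*(norm Z)^2 + (th*k1^2)*t^2" by (simp add: algebra_simps)
  also have "th*(norm Z)^2 <= 1*(norm Z)^2" using th by (intro mult_right_mono) auto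
  finally have main: "th/2*(norm (ze x *\<^sub>R Z + t *\<^sub>R Y))^2 <= (norm Z)^2 + (th*k1^2)*t^2" by simp
  have eq: "ze x *\<^sub>R Xi + t *\<^sub>R ze1 x = ze x *\<^sub>R Z + t *\<^sub>R Y" by (simp add: Z_def Y_def algebra_simps)
  have "(th*k1^2)*t^2 - C*(ze x*t)^2 <= (P r - V r)*t^2"
  proof (cases "r < r0")
   case True
   have "(th*k1^2)*t^2 <= (P r - V r)*t^2" using W(2)[OF r(2) True r(1)] th(3) by (intro mult_right_mono) auto
   moreover have "0 <= C*(ze x*t)^2" using C by simp
   ultimately show ?thesis by linarith
  next
   case False
   have "P r >= 0" unfolding P_def by (intro divide_nonneg_nonneg add_nonneg_nonneg) auto
   moreover have "V r <= K/r0^2"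
   proof -
    have "K/r^2 <= K/r0^2" using K False r0 r by (intro divide_left_mono power_mono mult_pos_pos) auto
    then show ?thesis using VK[OF r(2,3)] by linarith
   qed
   ultimately have "(th*k1^2 - C)*t^2 <= (P r - V r)*t^2" by (intro mult_right_mono) (auto simp: C_def)
   then show ?thesis using ze2(1)[of x] False by (simp add: r_def left_diff_distrib)
  qed
  then show ?thesis using main unfolding eq r_def[symmetric] Z_def[symmetric] by linarith
 qed
 obtain \<S> :: "'a set set" where \<S>: "finite \<S>" "!!S. S \<in> \<S> ==> compact S"
  and poin: "!!u G. C1_grad u G ==> (!!x. 1 <= norm x ==> u x = 0) ==> (!!S. S \<in> \<S> ==> (LINT x|lborel. indicator S x *\<^sub>R u x) = 0) ==>
   (LINT x|lborel. (u x)^2) <= th/(2*C)*(LINT x|lborel. (norm (G x))^2)"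
  using poincare_cubes[where 'a = 'a, of "th/(2*C)"] th C by (auto simp del: real_scaleR_def)
 define M where "M S xi = (LINT x|lborel. indicator S x *\<^sub>R (ze x*xi x))" for S xi
 let ?v = "%x. l*deriv_on {0..} f (u x)"
 \<comment> \<open>First for functions vanishing near 0, to which the divergence theorem applies;
   the general case is reached by cutting off.\<close>
 have hardy: "0 <= (LINT x:ball 0 1|lebesgue. (norm (Xi x))^2 - ?v x*(xi x)^2)"
  if xi: "C1_grad xi Xi" and z: "de > 0" "!!x. norm x < de ==> xi x = 0" and R: "R < 1" "!!x. R <= norm x ==> xi x = 0"
   and mean: "!!S. S \<in> \<S> ==> M S xi = 0" for xi Xi de R
 proof -
  let ?E = "%x. (norm (Xi x))^2 - V (norm x)*(xi x)^2"
  have QE: "integrable lborel ?E" "(LINT x:ball 0 1|lebesgue. (norm (Xi x))^2 - ?v x*(xi x)^2) = (LINT x|lborel. ?E x)"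
   using quadratic_form_annulus(1,4)[where v = ?v, OF xi z R V cV] by auto
  have w: "C1_grad (%x. ze x*xi x) (%x. ze x *\<^sub>R Xi x + xi x *\<^sub>R ze1 x)" by (rule C1_grad_mult[OF ze xi])
  have w1: "ze x*xi x = 0" if "1 <= norm x" for x using that R by simp
  have Xi0: "Xi x = 0" if "R < norm x" for x by (rule C1_grad_zero_outside[OF xi R(2) that])
  let ?G = "%x. ze x *\<^sub>R Xi x + xi x *\<^sub>R ze1 x"
  have iw: "integrable lborel (%x. (norm (?G x))^2)" "integrable lborel (%x. (ze x*xi x)^2)"
   by (rule compact_support_integrable[of _ 1]; use R Xi0 in "auto intro!: continuous_intros C1_grad_cont[OF ze] C1_grad_cont[OF xi]")+
  have sq: "C1_grad (%x. xi x*xi x) (%x. xi x *\<^sub>R Xi x + xi x *\<^sub>R Xi x)" by (rule C1_grad_mult[OF xi xi])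
  let ?H = "%x. b (norm x)/norm x*((xi x *\<^sub>R Xi x + xi x *\<^sub>R Xi x) \<bullet> x) + xi x*xi x*(b1 (norm x) + (real DIM('a) - 1)*b (norm x)/norm x)"
  have H: "integrable lborel ?H" "(LINT x|lborel. ?H x) = 0"
   using radial_divergence[OF sq z(1) _ R(1) _ db cb] z R by auto
  have "th/2*(norm (?G x))^2 - C*(ze x*xi x)^2 + ?H x <= ?E x" for x
  proof (cases "x = 0 | 1 <= norm x")
   case True
   moreover have "Xi 0 = 0" by (rule C1_grad_eq_0[OF xi, of "ball 0 de"]) (use z in auto)
   ultimately have "xi x = 0" "Xi x = 0" using z R Xi0[of x] by auto
   then show ?thesis by simp
  next
   case False
   define r where "r = norm x"
   have r: "0 < r" "r < 1" using False by (auto simp: r_def)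
   have "(norm (Xi x - (xi x*b r/r) *\<^sub>R x))^2 = (norm (Xi x))^2 - 2*(xi x*b r/r)*(Xi x \<bullet> x) + (xi x*b r/r)^2*(x \<bullet> x)"
    by (rule norm_diff_scaleR_square)
   also have "x \<bullet> x = r^2" by (simp add: r_def dot_square_norm)
   also have "(xi x*b r/r)^2*r^2 = (xi x)^2*(b r)^2" using r by (simp add: power_divide power_mult_distrib)
   finally have Z: "(norm (Xi x - (xi x*b r/r) *\<^sub>R x))^2 = (norm (Xi x))^2 - 2*(xi x*b r/r)*(Xi x \<bullet> x) + (xi x)^2*(b r)^2" .
   have "?H x = 2*(xi x*b r/r)*(Xi x \<bullet> x) + (xi x)^2*(- P r - (b r)^2)"
    unfolding r_def[symmetric] N_def[symmetric] P[OF r] by (simp add: inner_add_left power2_eq_square)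
   then have "?E x = ?H x + ((norm (Xi x - (xi x*b r/r) *\<^sub>R x))^2 + (P r - V r)*(xi x)^2)"
    unfolding Z r_def[symmetric] by (simp add: algebra_simps)
   then show ?thesis using pt[of x "Xi x" "xi x"] r unfolding r_def by linarith
  qed
  then have "(LINT x|lborel. th/2*(norm (?G x))^2 - C*(ze x*xi x)^2 + ?H x) <= (LINT x|lborel. ?E x)"
   by (intro integral_mono Bochner_Integration.integrable_add Bochner_Integration.integrable_diff integrable_mult_right iw H QE)
  also have "(LINT x|lborel. th/2*(norm (?G x))^2 - C*(ze x*xi x)^2 + ?H x) = th/2*(LINT x|lborel. (norm (?G x))^2) - C*(LINT x|lborel. (ze x*xi x)^2)"
   by (simp only: Bochner_Integration.integral_add[OF Bochner_Integration.integrable_diff[OF integrable_mult_right[OF iw(1)] integrable_mult_right[OF iw(2)]] H(1)]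
    Bochner_Integration.integral_diff[OF integrable_mult_right[OF iw(1)] integrable_mult_right[OF iw(2)]] integral_mult_right_zero H(2) add_0_right)
  finally have "th/2*(LINT x|lborel. (norm (?G x))^2) - C*(LINT x|lborel. (ze x*xi x)^2) <= (LINT x|lborel. ?E x)" .
  moreover have "C*(LINT x|lborel. (ze x*xi x)^2) <= C*(th/(2*C)*(LINT x|lborel. (norm (?G x))^2))"
   using C mean by (intro mult_left_mono poin[OF w w1]) (auto simp: M_def)
  moreover have "C*(th/(2*C)*(LINT x|lborel. (norm (?G x))^2)) = th/2*(LINT x|lborel. (norm (?G x))^2)" using C by simp
  ultimately show ?thesis unfolding QE(2) by linarith
 qed
 show ?thesis
 proof (rule morse_index_finite[OF \<S>(1), of M])
  fix S B and c :: "('a => real) => real" assume S: "S \<in> \<S>" and B: "finite B" "B \<subseteq> C1c (ball (0::'a) 1)"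
  have i: "integrable lborel (%x. indicator S x *\<^sub>R (ze x*w x))" if "w \<in> B" for w
  proof -
   have "w \<in> C1c (ball 0 1)" using that B by blast
   then obtain G where "C1_grad w G" unfolding C1c_iff by blast
   then show ?thesis by (intro borel_integrable_compact \<S> S continuous_intros C1_grad_cont[OF ze]) (rule C1_grad_cont)
  qed
  have "M S (%x. \<Sum>w\<in>B. c w*w x) = (LINT x|lborel. (\<Sum>w\<in>B. c w*(indicator S x *\<^sub>R (ze x*w x))))"
   unfolding M_def by (intro Bochner_Integration.integral_cong) (auto simp: sum_distrib_left mult_ac)
  also have "... = (\<Sum>w\<in>B. c w*M S w)"
   unfolding M_def
   by (subst Bochner_Integration.integral_sum, rule integrable_mult_right[OF i], assumption) (simp only: integral_mult_right_zero)
  finally show "M S (%x. \<Sum>w\<in>B. c w*w x) = (\<Sum>w\<in>B. c w*M S w)" .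
 next
  fix xi :: "'a => real" assume "xi \<in> C1c (ball 0 1)" and mean: "!!S. S \<in> \<S> ==> M S xi = 0"
  then obtain Xi R where xi: "C1_grad xi Xi" and R: "R < 1" "!!x. R <= norm x ==> xi x = 0" by (auto simp: C1c_iff)
  obtain K2 where K2: "K2 >= 0" "!!x. norm (Xi x) <= K2" "!!x y. abs (xi x - xi y) <= K2*norm (x - y)" using C1_grad_lipschitz[OF xi R(2)] by blast
  have K3: "abs (xi x) <= K2*2" if "norm x < 1" for x
  proof -
   obtain e :: 'a where "e \<in> Basis" using nonempty_Basis by blast
   then have e: "norm e = 1" by simp
   have "abs (xi x - xi e) <= K2*norm (x - e)" by (rule K2(3))
   also have "... <= K2*2" using K2(1) norm_triangle_ineq4[of x e] that e by (intro mult_left_mono) auto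
   finally show ?thesis using R e by simp
  qed
  define k where "k n = 1 + real n" for n
  define g where "g n x = smooth_step (k n*norm x)" for n and x :: 'a
  define g1 where "g1 n x = (k n * smooth_step1 (k n*norm x)/norm x) *\<^sub>R x" for n and x :: 'a
  have kp: "k n > 0" for n by (simp add: k_def)
  have g: "C1_grad (g n) (g1 n)" for n unfolding g_def[abs_def] g1_def[abs_def] by (rule C1_grad_cutoff[OF kp])
  define et where "et n x = g n x*xi x" for n x
  define H where "H n x = g n x *\<^sub>R Xi x + xi x *\<^sub>R g1 n x" for n x
  have et: "C1_grad (et n) (H n)" for n unfolding et_def[abs_def] H_def[abs_def] by (rule C1_grad_mult[OF g xi])
  have z: "et n x = 0" if "norm x < 1/k n" for n x
  proof -
   have "k n*norm x <= 1" using that kp[of n] by (simp add: field_simps)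
   then show ?thesis by (simp add: et_def g_def smooth_step_eq)
  qed
  have R': "et n x = 0" if "R <= norm x" for n x using R that by (simp add: et_def)
  have kd: "1/k n > 0" for n using kp by simp
  have large: "\<forall>\<^sub>F n in sequentially. 2 <= k n * s" if "s > 0" for s
  proof -
   have "\<forall>\<^sub>F n in sequentially. 2/s <= real n" using filterlim_real_sequentially by (auto simp: filterlim_at_top)
   then show ?thesis
   proof eventually_elim
    case (elim n)
    then have "2 <= real n * s" using that by (simp add: field_simps)
    then show ?case using that by (simp add: k_def distrib_right)
   qed
  qed
  have one: "g n x = 1" "g1 n x = 0" if "2 <= k n * s" "s <= norm x" for n s x
  proof -
   have "k n * s <= k n*norm x" using that kp[of n] by (intro mult_left_mono) auto
   then show "g n x = 1" "g1 n x = 0" using that by (simp_all add: g_def g1_def smooth_step_eq)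
  qed
  \<comment> \<open>Cutting off at scale 1/k n costs a gradient of order 1/|x|; the majorant |x|^(-
    2) is integrable because N >= 3.\<close>
  have "(%n. LINT x:ball 0 1|lebesgue. (norm (H n x))^2 - ?v x*(et n x)^2) \<longlonglongrightarrow> (LINT x:ball 0 1|lebesgue. (norm (Xi x))^2 - ?v x*(xi x)^2)"
  proof (rule ball_dominated_convergence(3)[where p = 2 and C = "(9*K2)^2 + K*(K2*2)^2"])
   show "(%x. indicator (ball 0 1) x *\<^sub>R ((norm (H n x))^2 - ?v x*(et n x)^2)) \<in> borel_measurable lborel" for n
    using quadratic_form_annulus(2)[where v = ?v, OF et[of n] kd[of n] z R(1) R' V cV] by blast
   fix x :: 'a assume x: "0 < norm x" "norm x < 1"
   show "(%n. (norm (H n x))^2 - ?v x*(et n x)^2) \<longlonglongrightarrow> (norm (Xi x))^2 - ?v x*(xi x)^2"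
    using large[OF x(1)] by (intro tendsto_eventually, elim eventually_mono) (simp add: H_def et_def one)
   fix n
   have P2: "norm x powr - 2 = 1/(norm x)^2" using x by (simp add: powr_minus_divide powr_numeral)
   have gb: "0 <= g n x" "g n x <= 1" by (auto simp: g_def smooth_step_bounds)
   have "norm (g1 n x) <= 4/norm x" using smooth_step_scaled_bound[OF kp x(1), of n] smooth_step1_bounds kp[of n] x by (simp add: g1_def abs_mult)
   then have "abs (xi x)*norm (g1 n x) <= (K2*2)*(4/norm x)" using K3[OF x(2)] K2(1) by (intro mult_mono) auto
   moreover have "g n x*norm (Xi x) <= 1*(K2/norm x)"
   proof -
    have "K2 <= K2/norm x" using K2(1) x by (simp add: pos_le_divide_eq mult_left_le)
    then show ?thesis using gb K2(2)[of x] by (intro mult_mono order_trans[OF K2(2)[of x]]) auto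
   qed
   moreover have "norm (H n x) <= g n x*norm (Xi x) + abs (xi x)*norm (g1 n x)"
    unfolding H_def using norm_triangle_ineq[of "g n x *\<^sub>R Xi x" "xi x *\<^sub>R g1 n x"] gb by simp
   ultimately have "norm (H n x) <= 9*K2/norm x" by (simp add: add_divide_distrib[symmetric])
   then have h: "(norm (H n x))^2 <= (9*K2)^2/(norm x)^2" using power_mono[of "norm (H n x)" "9*K2/norm x" 2] by (simp add: power_divide)
   have "abs (et n x) <= 1*(K2*2)" unfolding et_def abs_mult using gb K3[OF x(2)] by (intro mult_mono) auto
   then have "abs (et n x)^2 <= (1*(K2*2))^2" by (rule power_mono) simp
   then have "(et n x)^2 <= (K2*2)^2" by (simp only: power2_abs mult_1)
   then have "abs (V (norm x))*(et n x)^2 <= K/(norm x)^2*(K2*2)^2" using VK[OF x] K x by (intro mult_mono) auto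
   then have "abs (V (norm x)*(et n x)^2) <= K*(K2*2)^2/(norm x)^2" by (simp add: abs_mult)
   then have "abs ((norm (H n x))^2 - V (norm x)*(et n x)^2) <= (9*K2)^2/(norm x)^2 + K*(K2*2)^2/(norm x)^2"
    using h zero_le_power2[of "norm (H n x)"] by linarith
   then show "abs ((norm (H n x))^2 - ?v x*(et n x)^2) <= ((9*K2)^2 + K*(K2*2)^2)*norm x powr - 2"
    unfolding V[OF x] P2 by (simp add: add_divide_distrib)
  qed (use N3 in auto)
  moreover have "\<forall>\<^sub>F n in sequentially. 0 <= (LINT x:ball 0 1|lebesgue. (norm (H n x))^2 - ?v x*(et n x)^2)"
   using large[of "r0/2"] r0
  proof (simp, elim eventually_mono)
   fix n assume n: "4 <= k n*r0"
   \<comment> \<open>For large n the inner cutoff acts only where \<open>ze\<close> vanishes, so the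
     cut-off function inherits the vanishing means.\<close>
   have eq: "ze x*et n x = ze x*xi x" for x
    using one(1)[of n "r0/2" x] ze0(1)[of x] n by (cases "norm x <= r0/2") (auto simp: et_def)
   show "0 <= (LINT x:ball 0 1|lebesgue. (norm (H n x))^2 - ?v x*(et n x)^2)"
    by (rule hardy[OF et kd[of n] z R(1) R']) (use mean in "auto simp: M_def eq")
  qed
  ultimately have "0 <= (LINT x:ball 0 1|lebesgue. (norm (Xi x))^2 - ?v x*(xi x)^2)"
   by (rule tendsto_lowerbound) simp
  then show "0 <= Q_form f l u xi" by (simp add: Q_form_def C1_gradD(2)[OF xi])
 qed
qed

section \<open>The singular solution in the unit ball\<close>

lemma DERIV_at_imp_continuous_on: "(!!x. x \<in> S ==> (f hasD g x) (at x)) ==> continuous_on S f"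
 by (meson DERIV_isCont continuous_at_imp_continuous_on)

context jl_nonlinearity
begin

lemma deriv_on_f: "u >= 0 ==> deriv_on {0..} f u = f1 u"
 by (rule deriv_on_eq[OF f_deriv]) (simp_all add: at_within_atLeast_bot)

lemma filterlim_scale_right_0: "R > 0 ==> filterlim (%r. R*r) (at_right 0) (at_right (0::real))"
 by real_asymp

lemma extended_profile_scaled:
 assumes U: "extended_profile U U1 R S"
 shows "0 < r ==> r <= 1 ==> ((%r. U (R*r)) hasD R*U1 (R*r)) (at r)"
  "0 < r ==> r < 1 ==> ((%r. R*U1 (R*r)) hasD - (dimN - 1)/r*(R*U1 (R*r)) - R^2*f (U (R*r))) (at r)"
  "0 < r ==> r < 1 ==> U (R*r) > 0"
proof -
 have RS: "0 < R" "R < S" and ode: "radial_ode fp dimN 1 U U1 0 S" using U by (auto simp: extended_profile_def)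
 have in_S: "0 < R*r" "R*r < S" if "0 < r" "r <= 1"
 proof -
  have "R*r <= R*1" using that RS by (intro mult_left_mono) auto
  then show "0 < R*r" "R*r < S" using that RS by (simp, linarith)
 qed
 have dR: "((*) R hasD R) (at r)" by (rule DERIV_cmult_Id)
 show "((%r. U (R*r)) hasD R*U1 (R*r)) (at r)" if r: "0 < r" "r <= 1"
 proof -
  have "(U hasD U1 (R*r)) (at (R*r))" using ode in_S[OF r] by (auto simp: radial_ode_def)
  from DERIV_chain2[OF this dR] show ?thesis by (simp add: mult.commute)
 qed
 show pos: "U (R*r) > 0" if "0 < r" "r < 1" using extended_profile_bounds(2)[OF U, of "R*r"] that RS by simp
 show "((%r. R*U1 (R*r)) hasD - (dimN - 1)/r*(R*U1 (R*r)) - R^2*f (U (R*r))) (at r)" if r: "0 < r" "r < 1"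
 proof -
  have "(U1 hasD - (dimN - 1)/(R*r)*U1 (R*r) - 1*fp (U (R*r))) (at (R*r))"
   using ode in_S r by (auto simp: radial_ode_def)
  from DERIV_cmult[OF DERIV_chain2[OF this dR], of R] show ?thesis
   by (rule DERIV_cong) (use r RS fp_eq[of "U (R*r)"] pos[OF r] in "simp add: field_simps power2_eq_square")
 qed
qed

lemma extended_profile_solution:
 assumes U: "extended_profile U U1 R S" and dim: "real DIM('a::euclidean_space) = dimN"
 shows "radial_singular_solution TYPE('a) f (R^2) (%r. U (R*r))"
 unfolding radial_singular_solution_def
proof (intro conjI allI impI)
 have RS: "0 < R" "R < S" and ode: "radial_ode fp dimN 1 U U1 0 S" and sing: "filterlim U at_top (at_right 0)"
  using U by (auto simp: extended_profile_def singular_profile_def)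
 show "R^2 > 0" using RS by simp
 show "C2_on {0<..1} (%r. U (R*r))" by (rule ode_imp_C2_on(1)[OF ode RS]) simp
 show "U (R*1) = 0" using U by (simp add: extended_profile_def)
 show "filterlim (%r. U (R*r)) at_top (at_right 0)" by (rule filterlim_compose[OF sing filterlim_scale_right_0[OF RS(1)]])
 fix r :: real assume "0 < r & r < 1" then show "U (R*r) > 0" using extended_profile_scaled(3)[OF U] by blast
next
 fix x :: 'a assume x: "0 < norm x & norm x < 1"
 have "laplacian (radial (%r. U (R*r))) x = (- (dimN - 1)/norm x*(R*U1 (R*norm x)) - R^2*f (U (R*norm x))) + (real DIM('a) - 1)/norm x*(R*U1 (R*norm x))"
  by (rule radial_laplacian[where a = 0 and b = 1]) (use extended_profile_scaled(1,2)[OF U] x in auto)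
 moreover have "- (dimN - 1)/norm x*Y = - ((dimN - 1)/norm x*Y)" for Y by (simp only: minus_divide_left[symmetric] mult_minus_left)
 ultimately show "- laplacian (radial (%r. U (R*r))) x = R^2*f (radial (%r. U (R*r)) x)"
  unfolding dim radial_def by simp
qed

text \<open>Rescaled, V is a singular profile on (0, sqrt l) and therefore a part of U. V vanishes
  at 1 by continuity, so sqrt l is a zero of U, which can only be R.\<close>

lemma singular_solution_unique:
 assumes U: "extended_profile U U1 R S" and dim: "real DIM('a::euclidean_space) = dimN"
  and V: "radial_singular_solution TYPE('a) f l V"
 shows "l = R^2 & (\<forall>r\<in>{0<..1}. V r = U (R*r))"
proof -
 have RS: "0 < R" "R < S" and ode: "radial_ode fp dimN 1 U U1 0 S" and UR: "U R = 0" using U by (auto simp: extended_profile_def)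
 have l: "l > 0" and V1: "V 1 = 0" and Vp: "!!r. 0 < r ==> r < 1 ==> V r > 0" and sing: "filterlim V at_top (at_right 0)"
  using V by (auto simp: radial_singular_solution_def)
 note SP = singular_solution_profile[OF V]
 define rh where "rh = sqrt l"
 have rh: "rh > 0" "rh^2 = l" using l by (auto simp: rh_def)
 have "radial_ode f dimN 1 (%s. V (s/rh)) (%s. deriv_on {0<..1} V (s/rh)/rh) 0 (1*rh)"
  by (rule radial_ode_scale[OF SP(1)[unfolded dim] l rh_def])
 moreover have "filterlim (%s. V (s/rh)) at_top (at_right 0)"
  using filterlim_compose[OF sing filterlim_scale_right_0[of "1/rh"]] rh by simp
 ultimately have "singular_profile (%s. V (s/rh)) (%s. deriv_on {0<..1} V (s/rh)/rh) rh"
  using rh Vp by (simp add: singular_profile_def)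
 note un = singular_profile_unique[OF U this]
 have eq: "V r = U (rh*r)" if "0 < r" "r < 1" for r using un(2)[of "rh*r"] that rh by simp
 have "U rh = 0"
 proof (rule tendsto_unique[OF at_within_Ioc_bot])
  have "continuous (at 1 within {0<..1}) V" using SP(2)[of 1] DERIV_continuous by force
  then show "(V ---> 0) (at 1 within {0<..1})" by (simp add: continuous_within V1)
  have "isCont U (rh*1)" using ode un(1) RS rh by (intro DERIV_isCont[of U "U1 (rh*1)"]) (auto simp: radial_ode_def)
  then have "isCont (%r. U (rh*r)) 1" 
   by (rule isCont_o2[where g = U and f = "%r. rh*r", rotated]) simp
  then have "continuous (at 1 within {0<..1}) (%r. U (rh*r))" by (rule continuous_at_imp_continuous_at_within)
  then have "((%r. U (rh*r)) ---> U rh) (at 1 within {0<..1})" by (simp add: continuous_within)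
  moreover have "\<forall>\<^sub>F r in at 1 within {0<..1}. U (rh*r) = V r"
   unfolding eventually_at_filter by (rule always_eventually) (use eq in auto)
  ultimately show "(V ---> U rh) (at 1 within {0<..1})" by (rule Lim_transform_eventually)
 qed simp
 then have "rh = R" using extended_profile_bounds(2)[OF U, of rh] un(1) rh by force
 moreover have "V r = U (rh*r)" if "r \<in> {0<..1}" for r
  using eq[of r] that V1 UR \<open>rh = R\<close> by (cases "r = 1") auto
 ultimately show ?thesis using rh by blast
qed

lemma solution_curve_limit:
 assumes U: "extended_profile U U1 R S" and dim: "real DIM('a::euclidean_space) = dimN"
  and u: "solution_curve TYPE('a) f lam u"
 shows "(lam ---> R^2) at_top" "C2_loc_convergent {0<..1} u (%r. U (R*r)) at_top"
proof -
 define P where "P al v \<longleftrightarrow> radial_ode f dimN (lam al) (u al) v 0 1 & continuous_on {0..1} (u al) & u al 1 = 0 &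
  (ALL r. 0 <= r & r < 1 --> u al r > 0) & (EX M. ALL r. 0 < r & r < 1/2 --> abs (v r) <= M) & lam al > 0" for al v
 have "EX v. P al v" if "al > 0" for al
  unfolding P_def by (rule regular_solution_profile[where 'a = 'a, unfolded dim]) (use u that in "simp add: solution_curve_def")
 then obtain u1 where "!!al. al > 0 ==> P al (u1 al)" by metis
 note u1 = this[unfolded P_def]
 define rh where "rh al = sqrt (lam al)" for al
 have rp: "regular_profile (%s. u al (s/rh al)) (%s. u1 al (s/rh al)/rh al) (rh al) al" if al: "al > 0" for al
 proof -
  note v = u1[OF al]
  have r: "rh al > 0" using v by (simp add: rh_def)
  obtain M where M: "!!r. 0 < r ==> r < 1/2 ==> abs (u1 al r) <= M" using v by blast
  have "radial_ode f dimN 1 (%s. u al (s/rh al)) (%s. u1 al (s/rh al)/rh al) 0 (1*rh al)"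
   by (rule radial_ode_scale[of _ _ "lam al"]) (use v in "auto simp: rh_def")
  moreover have "continuous_on {0..rh al} (%s. u al (s/rh al))"
   by (rule continuous_on_compose2[of "{0..1}" "u al"]) (use v r in "auto intro!: continuous_intros")
  moreover have "abs (u1 al (s/rh al)/rh al) <= M/rh al" if "0 < s" "s < rh al/2" for s
   using M[of "s/rh al"] that r by (simp add: divide_right_mono field_simps)
  ultimately show ?thesis using v r u al unfolding regular_profile_def solution_curve_def
   by (intro conjI exI[of _ "M/rh al"] exI[of _ "rh al/2"]) auto
 qed
 have eq: "u al r = u al (rh al*r/rh al)" if "al > 0" for al r using u1[OF that] by (simp add: rh_def)
 note lim = rescaled_profiles_converge[where V = "%al s. u al (s/rh al)" and u = u and rh = rh, OF U rp eq]
 show "C2_loc_convergent {0<..1} u (%r. U (R*r)) at_top" by (rule lim(2))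
 have "(rh ---> R) at_top" by (rule lim(1))
 then have "((%al. (rh al)^2) ---> R^2) at_top" by (intro tendsto_intros)
 moreover have "\<forall>\<^sub>F al in at_top. (rh al)^2 = lam al"
  using eventually_gt_at_top[of "0::real"] by eventually_elim (use u1 in "simp add: rh_def less_imp_le")
 ultimately show "(lam ---> R^2) at_top" by (rule Lim_transform_eventually)
qed

text \<open>For R*r <= r0 the power bounds of \<open>singular_growth\<close> apply, and 1 - r >= t
  explains the division by \<open>t\<close> in \<open>C1\<close>. On the rest the mean value theorem
  at the zero R supplies the factor 1 - r, and 1 <= r powr (- ka) restores the required
  form.\<close>

lemma singular_solution_H10:
 assumes U: "extended_profile U U1 R S" and dim: "real DIM('a::euclidean_space) = dimN"
 shows "(radial (%r. U (R*r)) :: 'a => real) \<in> H10 (ball 0 1)"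
proof -
 have RS: "0 < R" "R < S" and ode: "radial_ode fp dimN 1 U U1 0 S" and UR: "U R = 0" and sp: "singular_profile U U1 R"
  using U by (auto simp: extended_profile_def)
 note sc = extended_profile_scaled[OF U]
 have cU1: "continuous_on {0<..<S} U1" using ode by (intro DERIV_at_imp_continuous_on) (auto simp: radial_ode_def)
 obtain ka C r0 where ka: "ka > 0" "2*ka + 2 < dimN" and r0: "0 < r0" "r0 < R"
  and b: "!!s. 0 < s ==> s <= r0 ==> U s <= C * s powr (- ka) & abs (U1 s) <= C * s powr (- ka - 1)"
  using singular_growth[OF sp] by blast
 have C: "C >= 0"
 proof -
  have "0 <= C*r0 powr (- ka - 1)" using b[of r0] r0 by linarith
  then show ?thesis using r0 by (simp add: zero_le_mult_iff)
 qed
 have "compact (U1 ` {r0..R})" 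
  by (intro compact_continuous_image continuous_on_subset[OF cU1]) (use RS r0 in auto)
 then obtain M where M: "!!s. r0 <= s ==> s <= R ==> abs (U1 s) <= M"
  by (metis (no_types) atLeastAtMost_iff bounded_real compact_imp_bounded imageI)
 have M0: "M >= 0" using M[of r0] r0 by linarith
 define t where "t = 1 - r0/R"
 have t: "t > 0" using r0 RS by (simp add: t_def)
 define C2 where "C2 = C*R powr (- ka)"
 define C1 where "C1 = C2/t"
 define D where "D = C1 + C2 + R*M"
 have D: "C1 >= 0" "C2 >= 0" "R*M >= 0" using C t RS M0 by (auto simp: C1_def C2_def)
 have rk: "1 <= r powr (- p)" if "0 < r" "r < 1" "p >= 0" for r p :: real
  using powr_mono'[of "- p" 0 r] that by simp
 show ?thesis
 proof (rule radial_H10[of _ "%r. R*U1 (R*r)" D ka])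
  show "continuous_on {0<..<1} (%r. R*U1 (R*r))"
  proof (intro continuous_intros continuous_on_compose2[OF cU1])
   have "R*r < S" if "r < 1" for r using mult_strict_left_mono[OF that RS(1)] RS(2) by simp
   then show "(*) R ` {0<..<1} \<subseteq> {0<..<S}" using RS by auto
  qed
  fix r :: real assume r: "0 < r" "r < 1"
  show "((%r. U (R*r)) hasD R*U1 (R*r)) (at r)" using sc(1) r by simp
  have Up: "U (R*r) > 0" using sc(3) r by simp
  have "abs (U (R*r)) <= D*(1 - r)*r powr (- ka) & abs (R*U1 (R*r)) <= D*r powr (- ka - 1)"
  proof (cases "R*r <= r0")
   case True
   have bb: "U (R*r) <= C2*r powr (- ka)" "abs (U1 (R*r)) <= C*(R*r) powr (- ka - 1)"
    using b[of "R*r"] True r RS by (auto simp: C2_def powr_mult mult.assoc)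
   have "t <= 1 - r" using True RS r0 by (auto simp: t_def field_simps)
   then have "C1*t <= C1*(1 - r)" using D by (intro mult_left_mono) auto
   moreover have "C1*t = C2" using t by (simp add: C1_def)
   moreover have "C1*(1 - r) <= D*(1 - r)" using D r by (intro mult_right_mono) (auto simp: D_def)
   ultimately have "C2*r powr (- ka) <= D*(1 - r)*r powr (- ka)" by (intro mult_right_mono) auto
   moreover have "abs (R*U1 (R*r)) <= D*r powr (- ka - 1)"
   proof -
    have "abs (R*U1 (R*r)) <= R*(C*(R*r) powr (- ka - 1))" using bb(2) RS by (simp add: abs_mult)
    also have "... = C2*r powr (- ka - 1)" using r RS powr_add[of R "- ka - 1" 1] by (simp add: C2_def powr_mult)
    also have "... <= D*r powr (- ka - 1)" using D by (intro mult_right_mono) (auto simp: D_def)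
    finally show ?thesis .
   qed
   ultimately show ?thesis using bb(1) Up by linarith
  next
   case False
   have Rr: "R*r < R" using r RS by simp
   obtain z where z: "r < z" "z < 1" "U (R*1) - U (R*r) = (1 - r)*(R*U1 (R*z))"
    using MVT2[OF r(2), of "%r. U (R*r)" "%r. R*U1 (R*r)"] sc(1) r by auto
   have Rz: "R*r <= R*z" "R*z <= R*1" using z RS by (auto intro!: mult_left_mono)
   have "R*abs (U1 (R*z)) <= R*M" using M[of "R*z"] Rz False RS by (intro mult_left_mono) auto
   then have "(1 - r)*(R*abs (U1 (R*z))) <= (1 - r)*D" using r D by (intro mult_left_mono) (auto simp: D_def)
   moreover have "U (R*r) <= (1 - r)*(R*abs (U1 (R*z)))"
   proof -
    have "U (R*r) = (1 - r)*(R*(- U1 (R*z)))" using z(3) UR by simp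
    also have "... <= (1 - r)*(R*abs (U1 (R*z)))" using r RS by (intro mult_left_mono) auto
    finally show ?thesis .
   qed
   moreover have "(1 - r)*D*1 <= (1 - r)*D*r powr (- ka)" using r D ka rk[of r ka] by (intro mult_left_mono mult_nonneg_nonneg) (auto simp: D_def)
   moreover have "R*abs (U1 (R*r)) <= D*r powr (- ka - 1)"
   proof -
    have "R*abs (U1 (R*r)) <= R*M" using M[of "R*r"] False Rr RS by (intro mult_left_mono) auto
    also have "... <= D*1" using D by (simp add: D_def)
    also have "... <= D*r powr (- ka - 1)" using D rk[of r "ka + 1"] r ka by (intro mult_left_mono) (auto simp: D_def)
    finally show ?thesis .
   qed
   ultimately show ?thesis using Up RS by (simp add: abs_mult mult.commute)
  qed
  then show "abs (U (R*r)) <= D*(1 - r)*r powr (- ka)" "abs (R*U1 (R*r)) <= D*r powr (- ka - 1)" by auto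
 qed (use ka dim in auto)
qed

text \<open>\<open>singular_asymptotics\<close> rescaled by R. Replacing - ln (R*r) by - ln r is
  harmless as their ratio tends to 1, and 2 powr (k - 2) cancels 4*2 powr (- k).\<close>

lemma singular_potential_limit:
 assumes U: "extended_profile U U1 R S"
 shows "((%r. (r^2*(R^2*f1 (U (R*r))) - (dimN - 2)^2/4)*(2 powr (k - 2)*(- ln r) powr k)) ---> \<gamma>*(mu - 1)) (at_right 0)"
proof -
 have R: "R > 0" and sp: "singular_profile U U1 R" using U by (auto simp: extended_profile_def)
 have l1: "((%r. (((R*r)^2*f1 (U (R*r)) - (mu - 2)^2/4*mu^2)*(- ln (R*r)) powr k)) ---> 4*(mu - 1)*(\<gamma>*2 powr (- k))) (at_right 0)"
  by (rule filterlim_compose[OF singular_asymptotics[OF sp] filterlim_scale_right_0[OF R]])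
 have "((%r. (- ln r)/(- ln (R*r))) ---> 1) (at_right 0)" using R by real_asymp
 then have l2: "((%r. ((- ln r)/(- ln (R*r))) powr k) ---> 1 powr k) (at_right 0)" by (intro tendsto_intros) auto
 have "((%r. 2 powr (k - 2)*((((R*r)^2*f1 (U (R*r)) - (mu - 2)^2/4*mu^2)*(- ln (R*r)) powr k)*((- ln r)/(- ln (R*r))) powr k))
  ---> 2 powr (k - 2)*(4*(mu - 1)*(\<gamma>*2 powr (- k))*1 powr k)) (at_right 0)"
  by (intro tendsto_mult tendsto_const l1 l2)
 moreover have "2 powr (k - 2)*(4*(mu - 1)*(\<gamma>*2 powr (- k))*1 powr k) = \<gamma>*(mu - 1)"
 proof -
  have "2 powr (k - 2)*2 powr (- k) = 2 powr (- 2 :: real)" by (simp add: powr_add[symmetric])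
  also have "... = 1/4" by (simp add: powr_minus_divide)
  finally have "2 powr (k - 2)*2 powr (- k) = 1/4" .
  moreover have "2 powr (k - 2)*(4*(mu - 1)*(\<gamma>*2 powr (- k))*1 powr k) = 4*(mu - 1)*\<gamma>*(2 powr (k - 2)*2 powr (- k))"
   by (simp add: mult_ac)
  ultimately show ?thesis by (simp only: mult_ac)
 qed
 ultimately have lim: "((%r. 2 powr (k - 2)*((((R*r)^2*f1 (U (R*r)) - (mu - 2)^2/4*mu^2)*(- ln (R*r)) powr k)*((- ln r)/(- ln (R*r))) powr k))
  ---> \<gamma>*(mu - 1)) (at_right 0)" by (simp only:)
 have dN: "(dimN - 2)^2/4 = (mu - 2)^2/4*mu^2" by (simp add: dimN_def power2_eq_square algebra_simps)
 show ?thesis unfolding dN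
 proof (rule Lim_transform_eventually[OF lim])
  have "\<forall>\<^sub>F r in at_right 0. - ln (R*r) > 0" "\<forall>\<^sub>F r in at_right 0. - ln (r::real) > 0" using R by real_asymp+
  then show "\<forall>\<^sub>F r in at_right 0. 2 powr (k - 2)*((((R*r)^2*f1 (U (R*r)) - (mu - 2)^2/4*mu^2)*(- ln (R*r)) powr k)*((- ln r)/(- ln (R*r))) powr k)
   = (r^2*(R^2*f1 (U (R*r))) - (mu - 2)^2/4*mu^2)*(2 powr (k - 2)*(- ln r) powr k)"
  proof eventually_elim
   case (elim r)
   have p: "(- ln (R*r)) powr k*((- ln r)/(- ln (R*r))) powr k = (- ln r) powr k"
    using elim by (subst powr_divide) auto
   have "(R*r)^2*f1 (U (R*r)) = r^2*(R^2*f1 (U (R*r)))" by (simp add: power_mult_distrib)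
   then show ?case using p by (simp only: mult.assoc mult.left_commute)
  qed
 qed
qed

text \<open>The Hardy remainder has weight (1 - ln r)^(- 2), so the potential is measured on that
  scale. For k = 2 the limit is to be compared with 1/4; for k < 2 the quotient (1 - ln r)^2/(- ln
  r)^k is unbounded and the sign of \<open>\<gamma>\<close> decides.\<close>

lemma singular_potential_log_square:
 assumes U: "extended_profile U U1 R S"
 defines "A \<equiv> %r. (r^2*(R^2*f1 (U (R*r))) - (dimN - 2)^2/4)*(1 - ln r)^2"
 shows "k = 2 ==> (A ---> \<gamma>*(mu - 1)) (at_right 0)" "k < 2 ==> \<gamma> > 0 ==> filterlim A at_top (at_right 0)"
  "k < 2 ==> \<gamma> < 0 ==> filterlim A at_bot (at_right 0)"
proof -
 define B where "B r = (1 - ln r)^2/(2 powr (k - 2)*(- ln r) powr k)" for r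
 define L where "L r = (r^2*(R^2*f1 (U (R*r))) - (dimN - 2)^2/4)*(2 powr (k - 2)*(- ln r) powr k)" for r
 have L: "(L ---> \<gamma>*(mu - 1)) (at_right 0)" unfolding L_def by (rule singular_potential_limit[OF U])
 have AB: "\<forall>\<^sub>F r in at_right 0. L r*B r = A r"
 proof -
  have "\<forall>\<^sub>F r in at_right (0::real). - ln r > 0" by real_asymp
  then show ?thesis
  proof eventually_elim
   case (elim r)
   then have "2 powr (k - 2)*(- ln r) powr k ~= 0" by simp
   then show ?case unfolding L_def B_def A_def by (simp only: times_divide_eq_right nonzero_mult_div_cancel_right mult.assoc mult.commute[of "(1 - ln r)^2"] nonzero_mult_div_cancel_left) simp
  qed
 qed
 have B2: "k = 2 ==> (B ---> 1) (at_right 0)"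
 proof -
  assume k2: "k = 2"
  have "((%r::real. (1 - ln r)^2/(- ln r)^2) ---> 1) (at_right 0)" by real_asymp
  moreover have "\<forall>\<^sub>F r in at_right (0::real). - ln r > 0" by real_asymp
  then have "\<forall>\<^sub>F r in at_right 0. (1 - ln r)^2/(- ln r)^2 = B r" by eventually_elim (simp add: B_def k2 powr_numeral)
  ultimately show ?thesis by (rule Lim_transform_eventually)
 qed
 have B1: "filterlim B at_top (at_right 0)" if "k < 2"
 proof -
  have "filterlim (%r::real. (1 - ln r)^2/(- ln r) powr k) at_top (at_right 0)" using that by real_asymp
  then have "filterlim (%r::real. 1/2 powr (k - 2)*((1 - ln r)^2/(- ln r) powr k)) at_top (at_right 0)"
   by (intro filterlim_tendsto_pos_mult_at_top[OF tendsto_const]) auto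
  then show ?thesis by (simp add: B_def[abs_def])
 qed
 have m1: "mu - 1 > 0" using mu by simp
 show "k = 2 ==> (A ---> \<gamma>*(mu - 1)) (at_right 0)"
  using Lim_transform_eventually[OF tendsto_mult[OF L B2] AB] by simp
 show "filterlim A at_top (at_right 0)" if "k < 2" "\<gamma> > 0"
  using filterlim_tendsto_pos_mult_at_top[OF L _ B1[OF that(1)]] that m1 filterlim_cong[OF refl refl AB] by simp
 show "filterlim A at_bot (at_right 0)" if "k < 2" "\<gamma> < 0"
  using filterlim_tendsto_neg_mult_at_bot[OF L _ B1[OF that(1)]] that m1 filterlim_cong[OF refl refl AB] by (simp add: mult_neg_pos)
qed

lemma singular_potential:
 assumes U: "extended_profile U U1 R S"
 defines "V \<equiv> %r. R^2*f1 (U (R*r))"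
 shows "continuous_on {0<..<1} V" "EX K. ALL r. 0 < r & r < 1 --> abs (V r) <= K/r^2"
proof -
 have RS: "0 < R" "R < S" and UR: "U R = 0" using U by (auto simp: extended_profile_def)
 have Un: "U (R*r) >= 0" if "0 < r" "r <= 1" for r
  using extended_profile_scaled(3)[OF U, of r] UR that by (cases "r = 1") auto
 have cU: "continuous_on {0<..1} (%r. U (R*r))"
  by (rule DERIV_at_imp_continuous_on) (use extended_profile_scaled(1)[OF U] in auto)
 have cV: "continuous_on {0<..1} V" unfolding V_def
  by (intro continuous_intros continuous_on_compose2[OF f1_cont cU]) (use Un in auto)
 then show "continuous_on {0<..<1} V" by (rule continuous_on_subset) auto
 define A where "A r = r^2*V r - (dimN - 2)^2/4" for r
 have inf: "((%r::real. 1/(2 powr (k - 2)*(- ln r) powr k)) ---> 0) (at_right 0)" using k(1) by real_asymp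
 have l: "((%r. (r^2*V r - (dimN - 2)^2/4)*(2 powr (k - 2)*(- ln r) powr k)*(1/(2 powr (k - 2)*(- ln r) powr k))) ---> \<gamma>*(mu - 1)*0) (at_right 0)"
  unfolding V_def by (rule tendsto_mult[OF singular_potential_limit[OF U] inf])
 have "(A ---> \<gamma>*(mu - 1)*0) (at_right 0)"
 proof (rule Lim_transform_eventually[OF l])
  have "\<forall>\<^sub>F r in at_right (0::real). - ln r > 0" by real_asymp
  then show "\<forall>\<^sub>F r in at_right 0. (r^2*V r - (dimN - 2)^2/4)*(2 powr (k - 2)*(- ln r) powr k)*(1/(2 powr (k - 2)*(- ln r) powr k)) = A r"
   by eventually_elim (simp add: A_def)
 qed
 then have "\<forall>\<^sub>F r in at_right 0. abs (A r) < 1" using tendstoD[of A 0 "at_right 0" 1] by simp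
 then obtain d where d: "d > 0" "!!r. 0 < r ==> r < d ==> abs (A r) < 1" by (auto simp: eventually_at_right_field)
 have "compact ((%r. r^2*V r) ` {d..1})"
  by (intro compact_continuous_image continuous_intros continuous_on_subset[OF cV]) (use d in auto)
 then obtain M where M: "!!r. d <= r ==> r <= 1 ==> abs (r^2*V r) <= M"
  by (metis (no_types, lifting) atLeastAtMost_iff bounded_real compact_imp_bounded imageI)
 define K where "K = max M ((dimN - 2)^2/4 + 1)"
 have "abs (V r) <= K/r^2" if r: "0 < r" "r < 1" for r
 proof -
  have "abs (r^2*V r) <= K"
  proof (cases "r < d")
   case True
   have "0 <= (dimN - 2)^2/4" by simp
   then have "abs (r^2*V r) <= (dimN - 2)^2/4 + 1" using d(2)[OF r(1) True] unfolding A_def by linarith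
   then show ?thesis by (simp add: K_def)
  next
   case False
   then have "abs (r^2*V r) <= M" using M r by simp
   then show ?thesis by (simp add: K_def)
  qed
  then show ?thesis using r by (simp add: abs_mult pos_le_divide_eq mult.commute)
 qed
 then show "EX K. ALL r. 0 < r & r < 1 --> abs (V r) <= K/r^2" by blast
qed

lemma singular_morse_index:
 assumes U: "extended_profile U U1 R S" and dim: "real DIM('a::euclidean_space) = dimN"
 shows "0 < k & k < 2 & \<gamma> > 0 | k = 2 & \<gamma>*(mu - 1) > 1/4 ==> morse_index f (R^2) (radial (%r. U (R*r)) :: 'a => real) = \<infinity>"
  "0 < k & k < 2 & \<gamma> < 0 | k = 2 & \<gamma>*(mu - 1) < 1/4 ==> morse_index f (R^2) (radial (%r. U (R*r)) :: 'a => real) < \<infinity>"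
proof -
 define V where "V r = R^2*f1 (U (R*r))" for r
 have V: "R^2*deriv_on {0..} f (radial (%r. U (R*r)) x) = V (norm x)" if "0 < norm x" "norm x < 1" for x :: 'a
  using extended_profile_scaled(3)[OF U that] by (simp add: V_def radial_def deriv_on_f)
 have cV: "continuous_on {0<..<1} V" and "EX K. ALL r. 0 < r & r < 1 --> abs (V r) <= K/r^2"
  using singular_potential[OF U] unfolding V_def by auto
 then obtain K where K: "!!r. 0 < r ==> r < 1 ==> abs (V r) <= K/r^2" by blast
 define A where "A r = (r^2*V r - (dimN - 2)^2/4)*(1 - ln r)^2" for r
 note lim = singular_potential_log_square[OF U, folded V_def, folded A_def]
 have "\<forall>\<^sub>F r in at_right 0. 0 < 1 - ln (r::real)" by real_asymp
 then have ev: "\<forall>\<^sub>F r in at_right 0. 0 < r & 0 < 1 - ln (r::real)"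
  using eventually_at_right_less by (rule eventually_elim2) auto
 have VA: "V r = ((dimN - 2)^2/4 + A r/(1 - ln r)^2)/r^2" if "0 < r" "0 < 1 - ln r" for r
  using that by (simp add: A_def)
 show "morse_index f (R^2) (radial (%r. U (R*r)) :: 'a => real) = \<infinity>"
  if h: "0 < k & k < 2 & \<gamma> > 0 | k = 2 & \<gamma>*(mu - 1) > 1/4"
 proof -
  obtain de where de: "de > 0" "\<forall>\<^sub>F r in at_right 0. 1/4 + de <= A r"
  proof (cases "k = 2")
   case True
   define de where "de = (\<gamma>*(mu - 1) - 1/4)/2"
   have "de > 0" "1/4 + de < \<gamma>*(mu - 1)" using h True by (auto simp: de_def field_simps)
   moreover have "\<forall>\<^sub>F r in at_right 0. 1/4 + de < A r" using order_tendstoD(1)[OF lim(1)[OF True]] calculation(2) by blast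
   ultimately show ?thesis by (intro that[of de]) (auto elim: eventually_mono)
  next
   case False
   then have "\<forall>\<^sub>F r in at_right 0. 1/4 + 1 <= A r" using lim(2) h unfolding filterlim_at_top by blast
   then show ?thesis by (intro that[of 1]) auto
  qed
  show ?thesis
  proof (rule morse_index_infinite_radial[OF V cV de(1)])
   show "\<forall>\<^sub>F r in at_right 0. ((real DIM('a) - 2)^2/4 + (1/4 + de)/(1 - ln r)^2)/r^2 <= V r"
    using ev de(2)
   proof eventually_elim
    case (elim r)
    then show ?case unfolding VA[OF conjunct1[OF elim(1)] conjunct2[OF elim(1)]] dim by (intro divide_right_mono add_left_mono) auto
   qed
  qed
 qed
 show "morse_index f (R^2) (radial (%r. U (R*r)) :: 'a => real) < \<infinity>"
  if h: "0 < k & k < 2 & \<gamma> < 0 | k = 2 & \<gamma>*(mu - 1) < 1/4"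
 proof -
  obtain be where be: "be < 1/4" "\<forall>\<^sub>F r in at_right 0. A r <= be"
  proof (cases "k = 2")
   case True
   define be where "be = (\<gamma>*(mu - 1) + 1/4)/2"
   have "be < 1/4" "\<gamma>*(mu - 1) < be" using h True by (auto simp: be_def field_simps)
   moreover have "\<forall>\<^sub>F r in at_right 0. A r < be" using order_tendstoD(2)[OF lim(1)[OF True]] calculation(2) by blast
   ultimately show ?thesis by (intro that[of be]) (auto elim: eventually_mono)
  next
   case False
   then have "\<forall>\<^sub>F r in at_right 0. A r <= 0" using lim(3) h unfolding filterlim_at_bot by blast
   then show ?thesis by (intro that[of 0]) auto
  qed
  show ?thesis
  proof (rule morse_index_finite_radial[OF _ V cV K be(1)])
   show "3 <= DIM('a)" using dim dimN_gt(1) by linarith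
   show "\<forall>\<^sub>F r in at_right 0. V r <= ((real DIM('a) - 2)^2/4 + be/(1 - ln r)^2)/r^2"
    using ev be(2)
   proof eventually_elim
    case (elim r)
    then show ?case unfolding VA[OF conjunct1[OF elim(1)] conjunct2[OF elim(1)]] dim by (intro divide_right_mono add_left_mono) auto
   qed
  qed
 qed
qed

end

theorem theorem1p5:
  fixes f :: "real \<Rightarrow> real" and q k \<gamma> :: real
  assumes N: "DIM('a::euclidean_space) \<ge> 3"
    and f_C2: "C2_on {0..} f"
    and f_pos: "\<forall>u\<ge>0. f u > 0"
    and F_finite: "\<forall>u\<ge>0. set_integrable lebesgue {u..} (\<lambda>s. 1 / f s)"
    and q_defined: "\<forall>\<^sub>F u in at_top. deriv_on {0..} (deriv_on {0..} f) u \<noteq> 0"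
    and q_lim: "((\<lambda>u. (deriv_on {0..} f u)\<^sup>2 / (f u * deriv_on {0..} (deriv_on {0..} f) u)) \<longlongrightarrow> q) at_top"
    and q_less: "q < (real DIM('a) + 2) / 4"
    and k: "0 < k" "k \<le> 2"
    and \<gamma>_lim: "((\<lambda>u. (F_tail f u * deriv_on {0..} f u - q_JL DIM('a)) * (- ln (F_tail f u)) powr k) \<longlongrightarrow> \<gamma>) at_top"
  shows "\<exists>lam_s U.
      radial_singular_solution TYPE('a) f lam_s U \<and>
      (\<forall>l V. radial_singular_solution TYPE('a) f l V \<longrightarrow> l = lam_s \<and> (\<forall>r\<in>{0<..1}. V r = U r)) \<and>
      (radial U :: 'a \<Rightarrow> real) \<in> H10 (ball 0 1) \<and>
      (\<forall>lam u. solution_curve TYPE('a) f lam u \<longrightarrow>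
         (lam \<longlongrightarrow> lam_s) at_top \<and> C2_loc_convergent {0<..1} u U at_top) \<and>
      (\<exists>\<epsilon>. (\<epsilon> \<longlongrightarrow> 0) (at_right 0) \<and>
         (\<forall>\<^sub>F r in at_right 0. lam_s * deriv_on {0..} f (U r) =
            (real DIM('a) - 2)\<^sup>2 / (4 * r\<^sup>2) +
            (\<gamma> * sqrt (real DIM('a) - 1) + \<epsilon> r) / (2 powr (k - 2) * r\<^sup>2 * (- ln r) powr k))) \<and>
      (((0 < k \<and> k < 2 \<and> \<gamma> > 0) \<or> (k = 2 \<and> \<gamma> > 1 / (4 * sqrt (real DIM('a) - 1)))) \<longrightarrow>
         morse_index f lam_s (radial U :: 'a \<Rightarrow> real) = \<infinity>) \<and>
      (((0 < k \<and> k < 2 \<and> \<gamma> < 0) \<or> (k = 2 \<and> \<gamma> < 1 / (4 * sqrt (real DIM('a) - 1)))) \<longrightarrow>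
         morse_index f lam_s (radial U :: 'a \<Rightarrow> real) < \<infinity>)"
proof -
 \<comment> \<open>The root of N = mu^2 - 2*mu + 2 above 1; with it q_JL = (mu - 2)^2/4 and N - 2 =
   mu*(mu - 2).\<close>
 define mu where "mu = 1 + sqrt (real DIM('a) - 1)"
 have sq: "sqrt (real DIM('a) - 1) > 1" "(sqrt (real DIM('a) - 1))^2 = real DIM('a) - 1" using N by auto
 have q_JL: "q_JL DIM('a) = (mu - 2)^2/4"
  using sq(2) unfolding q_JL_def mu_def by (simp add: power2_eq_square algebra_simps)
 interpret jl_nonlinearity f "deriv_on {0..} f" "deriv_on {0..} (deriv_on {0..} f)" mu k \<gamma> q
 proof
  show "mu > 2" using sq by (simp add: mu_def)
  show "set_integrable lebesgue {0..} (%s. 1/f s)" using F_finite by simp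
  show "((%u. (F_tail f u*deriv_on {0..} f u - (mu - 2)^2/4)*(- ln (F_tail f u)) powr k) ---> \<gamma>) at_top"
   using \<gamma>_lim unfolding q_JL .
 qed (use f_C2 f_pos q_defined q_lim k deriv_on_works in "auto simp: C2_on_def")
 have "real DIM('a) = mu^2 - 2*mu + 2" using sq(2) by (simp add: mu_def power2_eq_square algebra_simps)
 then have dim: "real DIM('a) = dimN" by (simp add: dimN_def)
 obtain U U1 R S where U: "extended_profile U U1 R S" using extended_profile_exists by blast
 have mu1: "sqrt (real DIM('a) - 1) = mu - 1" by (simp add: mu_def)
 have g: "\<gamma> > 1/(4*(mu - 1)) \<longleftrightarrow> \<gamma>*(mu - 1) > 1/4" "\<gamma> < 1/(4*(mu - 1)) \<longleftrightarrow> \<gamma>*(mu - 1) < 1/4"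
  using mu by (auto simp: field_simps)
 define L where "L r = (r^2*(R^2*deriv_on {0..} f (U (R*r))) - (dimN - 2)^2/4)*(2 powr (k - 2)*(- ln r) powr k)" for r
 \<comment> \<open>The error is obtained by solving the claimed expansion for it, so its limit
   carries the whole content.\<close>
 define ep where "ep r = L r - \<gamma>*(mu - 1)" for r
 have "(ep ---> 0) (at_right 0)"
  using tendsto_diff[OF singular_potential_limit[OF U] tendsto_const[of "\<gamma>*(mu - 1)"]] by (simp add: ep_def[abs_def] L_def)
 moreover have "\<forall>\<^sub>F r in at_right 0. R^2*deriv_on {0..} f (U (R*r)) = (real DIM('a) - 2)^2/(4*r^2) +
   (\<gamma> * sqrt (real DIM('a) - 1) + ep r)/(2 powr (k - 2)*r^2*(- ln r) powr k)"
 proof -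
  have "\<forall>\<^sub>F r in at_right (0::real). - ln r > 0" by real_asymp
  then show ?thesis using eventually_at_right_less[of "0::real"]
  proof eventually_elim
   case (elim r)
   define w where "w = 2 powr (k - 2)*(- ln r) powr k"
   have w: "w > 0" using elim by (auto simp: w_def intro!: mult_pos_pos)
   have num: "\<gamma> * sqrt (real DIM('a) - 1) + ep r = (r^2*(R^2*deriv_on {0..} f (U (R*r))) - (dimN - 2)^2/4)*w"
    by (simp add: ep_def L_def w_def mu1)
   have den: "2 powr (k - 2)*r^2*(- ln r) powr k = r^2*w" by (simp add: w_def)
   have "X = D/(4 * s) + (s*X - D/4)*w/(s*w)" if "s > 0" for X D s using that w by (simp add: field_simps)
   then show ?case unfolding num den unfolding dim using elim by simp
  qed
 qed
 ultimately have asym: "EX ep. (ep ---> 0) (at_right 0) & (\<forall>\<^sub>F r in at_right 0. R^2*deriv_on {0..} f (U (R*r)) = (real DIM('a) - 2)^2/(4*r^2) +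
   (\<gamma> * sqrt (real DIM('a) - 1) + ep r)/(2 powr (k - 2)*r^2*(- ln r) powr k))" by blast
 show ?thesis
 proof (rule exI[of _ "R^2"], rule exI[of _ "%r. U (R*r)"], intro conjI asym)
  show "radial_singular_solution TYPE('a) f (R^2) (%r. U (R*r))" by (rule extended_profile_solution[OF U dim])
  show "ALL l V. radial_singular_solution TYPE('a) f l V --> l = R^2 & (\<forall>r\<in>{0<..1}. V r = U (R*r))"
   using singular_solution_unique[OF U dim] by blast
  show "(radial (%r. U (R*r)) :: 'a => real) \<in> H10 (ball 0 1)" by (rule singular_solution_H10[OF U dim])
  show "ALL lam u. solution_curve TYPE('a) f lam u --> (lam ---> R^2) at_top & C2_loc_convergent {0<..1} u (%r. U (R*r)) at_top"
   using solution_curve_limit[OF U dim] by blast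
 qed (use singular_morse_index[OF U dim] in "unfold mu1 g, blast+")
qed

end
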